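(* Let $M$ be a (smooth, connected) Riemannian manifold. Then $$\lambda^{\ast}(M)\;\geq\;\sup_{X\in \mathcal{W}^{1,1}(M)}\Big\{\inf_{M}\big(\operatorname{Div} X-|X|^{2}\big)\Big\}.$$ If moreover $M$ is a compact Riemannian manifold with smooth boundary, then $$\lambda_{1}(M)\;=\;\sup_{X\in \mathcal{W}^{1,1}(M)}\Big\{\inf_{M}\big(\operatorname{Div} X-|X|^{2}\big)\Big\}.$$
   Context: All Riemannian manifolds are smooth and connected. Fundamental tone: $\lambda^{\ast}(M)=\inf\left\{\frac{\int_{M}|\operatorname{grad} f|^{2}}{\int_{M}f^{2}} : f\in L^{2}_{1,0}(M)\setminus\{0\}\right\}$, where $L^{2}_{1,0}(M)$ is the completion of $C_{0}^{\infty}(M)$ with respect to the norm $\|\varphi\|^{2}=\int_{M}\varphi^{2}+\int_{M}|\nabla\varphi|^{2}$. Here $C_0^\infty(M)$ is the space of smooth functions with compact support in (the interior of) $M$. When $M$ is compact with piecewise smooth (possibly empty) boundary, $\lambda_{1}(M)=\lambda^{\ast}(M)$ is the first eigenvalue of the Laplacian $-\triangle$ (with Dirichlet boundary condition if $\partial M\neq\emptyset$). Weak divergence: for a vector field $X$ with $|X|\in L^{1}_{loc}(M)$, a function $g\in L^{1}_{loc}(M)$ is a weak divergence of $X$ if $\int_{M}\phi\, g=-\int_{M}\langle\operatorname{grad}\phi,X\rangle$ for all $\phi\in C_{0}^{\infty}(M)$. It is unique (almost everywhere) if it exists and is written $g=\operatorname{Div} X$. For $C^1$ vector fields it coincides with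 the classical divergence. $\mathcal{W}^{1,1}(M)$ denotes the space of all vector fields $X\in L^{1}_{loc}(M)$ possessing a weak divergence. When $M$ has boundary, $L^1_{loc}(M)$ refers to the interior of $M$. Since $\operatorname{Div}X-|X|^2$ is defined only almost everywhere, $\inf_M$ is the infimum up to sets of measure zero (essential infimum). *)

theory Defs
  imports "HOL-Analysis.Analysis" "HOL-Probability.Essential_Supremum"
begin

primrec ck_on :: "nat \<Rightarrow> 'a::real_normed_vector set \<Rightarrow> ('a \<Rightarrow> 'b::real_normed_vector) \<Rightarrow> bool" where
  "ck_on 0 S f \<longleftrightarrow> continuous_on S f"
| "ck_on (Suc k) S f \<longleftrightarrow> (\<forall>x\<in>S. f differentiable (at x)) \<and>
     (\<forall>v. ck_on k S (\<lambda>x. frechet_derivative f (at x) v))"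

text \<open>For a set \<open>S\<close> that need not be open (a relatively open subset of a half space), smooth means:
  locally the restriction of a smooth function defined on an open set.\<close>

definition smooth_on :: "'a::real_normed_vector set \<Rightarrow> ('a \<Rightarrow> 'b::real_normed_vector) \<Rightarrow> bool" where
  "smooth_on S f \<longleftrightarrow>
     (\<forall>x\<in>S. \<exists>V F. open V \<and> x \<in> V \<and> (\<forall>k. ck_on k V F) \<and> (\<forall>y\<in>S \<inter> V. F y = f y))"

text \<open>The points of the manifold are all the points of a topological space \<open>'p\<close> (Hausdorff and
  second countable by its type class); the dimension is \<open>CARD('n)\<close>.  A chart is a pair of its
  domain and its coordinate map.  The Riemannian metric is given by its coefficient matrices
  \<open>g\<^sub>i\<^sub>j\<close>: \<open>gmat M c p\<close> is the matrix at the point \<open>p\<close> in the chart \<open>c\<close>.\<close>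

type_synonym ('p, 'n) chart = "'p set \<times> ('p \<Rightarrow> real^'n)"

record ('p, 'n) riem =
  atlas :: "('p, 'n::finite) chart set"
  gmat :: "('p, 'n::finite) chart \<Rightarrow> 'p \<Rightarrow> real^'n^'n"

definition half_space :: "(real^'n::{finite,wellorder}) set" where
  "half_space = {x. 0 \<le> x $ (LEAST i. True)}"

definition cimage :: "('p, 'n::finite) chart \<Rightarrow> (real^'n) set" where
  "cimage c = snd c ` fst c"

definition cinv :: "('p, 'n::finite) chart \<Rightarrow> real^'n \<Rightarrow> 'p" where
  "cinv c = inv_into (fst c) (snd c)"

text \<open>A chart may, but need not, touch the boundary of the half space; thus boundaryless
  manifolds are included.\<close>

definition is_chart :: "('p::topological_space, 'n::{finite,wellorder}) chart \<Rightarrow> bool" where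
  "is_chart c \<longleftrightarrow> open (fst c) \<and> openin (top_of_set half_space) (cimage c) \<and>
     homeomorphism (fst c) (cimage c) (snd c) (cinv c)"

definition transition_domain :: "('p, 'n::finite) chart \<Rightarrow> ('p, 'n) chart \<Rightarrow> (real^'n) set" where
  "transition_domain c c' = snd c ` (fst c \<inter> fst c')"

definition transition :: "('p, 'n::finite) chart \<Rightarrow> ('p, 'n) chart \<Rightarrow> real^'n \<Rightarrow> real^'n" where
  "transition c c' = snd c' \<circ> cinv c"

text \<open>Derivatives are taken within the chart image, so that they also make sense (and are
  uniquely determined) at boundary points.\<close>

definition jacobian :: "('p, 'n::finite) chart \<Rightarrow> ('p, 'n) chart \<Rightarrow> 'p \<Rightarrow> real^'n^'n" where
  "jacobian c c' p =
     matrix (frechet_derivative (transition c c') (at (snd c p) within transition_domain c c'))"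

definition smooth_atlas :: "('p::topological_space, 'n::{finite,wellorder}) chart set \<Rightarrow> bool" where
  "smooth_atlas A \<longleftrightarrow> (\<forall>c\<in>A. is_chart c) \<and> (\<Union>c\<in>A. fst c) = UNIV \<and>
     (\<forall>c\<in>A. \<forall>c'\<in>A. smooth_on (transition_domain c c') (transition c c'))"

definition riemannian_metric :: "('p, 'n::finite) riem \<Rightarrow> bool" where
  "riemannian_metric M \<longleftrightarrow>
     (\<forall>c\<in>atlas M. smooth_on (cimage c) (gmat M c \<circ> cinv c) \<and>
        (\<forall>p\<in>fst c. transpose (gmat M c p) = gmat M c p \<and>
           (\<forall>v. v \<noteq> 0 \<longrightarrow> 0 < v \<bullet> (gmat M c p *v v)))) \<and>
     (\<forall>c\<in>atlas M. \<forall>c'\<in>atlas M. \<forall>p\<in>fst c \<inter> fst c'.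
        gmat M c p = transpose (jacobian c c' p) ** gmat M c' p ** jacobian c c' p)"

definition riemannian_manifold ::
    "('p::{t2_space,second_countable_topology}, 'n::{finite,wellorder}) riem \<Rightarrow> bool" where
  "riemannian_manifold M \<longleftrightarrow>
     smooth_atlas (atlas M) \<and> riemannian_metric M \<and> connected (UNIV :: 'p set)"

definition mfd_interior :: "('p, 'n::{finite,wellorder}) riem \<Rightarrow> 'p set" where
  "mfd_interior M = {p. \<exists>c\<in>atlas M. p \<in> fst c \<and> snd c p \<in> interior half_space}"

text \<open>The Riemannian volume is the unique Borel measure which in each chart is
  \<open>dV = sqrt (det g\<^sub>i\<^sub>j) dx\<close>.\<close>

definition riem_volume :: "('p::topological_space, 'n::finite) riem \<Rightarrow> 'p measure" where
  "riem_volume M = (THE \<mu>. sets \<mu> = sets borel \<and>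
     (\<forall>c\<in>atlas M. \<forall>B\<in>sets borel. B \<subseteq> fst c \<longrightarrow>
        emeasure \<mu> B = (\<integral>\<^sup>+x\<in>snd c ` B. ennreal (sqrt (det (gmat M c (cinv c x)))) \<partial>lborel)))"

text \<open>A vector field is given by its components in all the charts of the atlas.\<close>

type_synonym ('p, 'n) vfield = "('p, 'n) chart \<Rightarrow> 'p \<Rightarrow> real^'n"

definition vector_field :: "('p, 'n::finite) riem \<Rightarrow> ('p, 'n) vfield \<Rightarrow> bool" where
  "vector_field M X \<longleftrightarrow> (\<forall>c\<in>atlas M. \<forall>c'\<in>atlas M. \<forall>p\<in>fst c \<inter> fst c'.
     X c' p = jacobian c c' p *v X c p)"

definition measurable_vfield :: "('p::topological_space, 'n::finite) riem \<Rightarrow> ('p, 'n) vfield \<Rightarrow> bool" where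
  "measurable_vfield M X \<longleftrightarrow>
     vector_field M X \<and> (\<forall>c\<in>atlas M. set_borel_measurable borel (fst c) (X c))"

text \<open>The pointwise inner product of two vector fields does not depend on the chart used to
  compute it.\<close>

definition chart_at :: "('p, 'n::finite) riem \<Rightarrow> 'p \<Rightarrow> ('p, 'n) chart" where
  "chart_at M p = (SOME c. c \<in> atlas M \<and> p \<in> fst c)"

definition vinner :: "('p, 'n::finite) riem \<Rightarrow> ('p, 'n) vfield \<Rightarrow> ('p, 'n) vfield \<Rightarrow> 'p \<Rightarrow> real" where
  "vinner M X Y p = (let c = chart_at M p in X c p \<bullet> (gmat M c p *v Y c p))"

definition vnorm :: "('p, 'n::finite) riem \<Rightarrow> ('p, 'n) vfield \<Rightarrow> 'p \<Rightarrow> real" where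
  "vnorm M X p = sqrt (vinner M X X p)"

text \<open>In coordinates, \<open>(grad f)\<^sup>i = \<Sum>\<^sub>j g\<^sup>i\<^sup>j \<partial>\<^sub>j f\<close>.\<close>

definition grad :: "('p, 'n::finite) riem \<Rightarrow> ('p \<Rightarrow> real) \<Rightarrow> ('p, 'n) vfield" where
  "grad M f c p = matrix_inv (gmat M c p) *v
     (\<chi> j. frechet_derivative (f \<circ> cinv c) (at (snd c p) within cimage c) (axis j 1))"

definition test_functions :: "('p::topological_space, 'n::{finite,wellorder}) riem \<Rightarrow> ('p \<Rightarrow> real) set" where
  "test_functions M = {f. (\<forall>c\<in>atlas M. smooth_on (cimage c) (f \<circ> cinv c)) \<and>
     compact (closure {p. f p \<noteq> 0}) \<and> closure {p. f p \<noteq> 0} \<subseteq> mfd_interior M}"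

text \<open>Functions and vector fields defined almost everywhere are represented by everywhere defined
  Borel ones.  The boundary has measure zero; local integrability is only required in the
  interior.\<close>

definition L1_loc :: "('p::topological_space, 'n::{finite,wellorder}) riem \<Rightarrow> ('p \<Rightarrow> real) set" where
  "L1_loc M = {h \<in> borel_measurable borel.
     \<forall>K. compact K \<and> K \<subseteq> mfd_interior M \<longrightarrow> set_integrable (riem_volume M) K h}"

definition L1_loc_vfield :: "('p::topological_space, 'n::{finite,wellorder}) riem \<Rightarrow> ('p, 'n) vfield set" where
  "L1_loc_vfield M = {X. measurable_vfield M X \<and> vnorm M X \<in> L1_loc M}"

definition has_weak_div ::
    "('p::topological_space, 'n::{finite,wellorder}) riem \<Rightarrow> ('p, 'n) vfield \<Rightarrow> ('p \<Rightarrow> real) \<Rightarrow> bool" where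
  "has_weak_div M X h \<longleftrightarrow> X \<in> L1_loc_vfield M \<and> h \<in> L1_loc M \<and>
     (\<forall>\<phi>\<in>test_functions M.
        (\<integral>p. \<phi> p * h p \<partial>riem_volume M) = - (\<integral>p. vinner M (grad M \<phi>) X p \<partial>riem_volume M))"

definition Div :: "('p::topological_space, 'n::{finite,wellorder}) riem \<Rightarrow> ('p, 'n) vfield \<Rightarrow> 'p \<Rightarrow> real" where
  "Div M X = (SOME h. has_weak_div M X h)"

definition W11 :: "('p::topological_space, 'n::{finite,wellorder}) riem \<Rightarrow> ('p, 'n) vfield set" where
  "W11 M = {X \<in> L1_loc_vfield M. \<exists>h. has_weak_div M X h}"

definition essinf :: "'a measure \<Rightarrow> ('a \<Rightarrow> real) \<Rightarrow> ereal" where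
  "essinf \<mu> f = - esssup \<mu> (\<lambda>x. - ereal (f x))"

text \<open>The completion of the space of test functions is realised as its closure in
  \<open>L\<^sup>2(M) \<times> L\<^sup>2(TM)\<close> under \<open>\<phi> \<mapsto> (\<phi>, grad \<phi>)\<close>: \<open>sobolev0 M f V\<close> says that \<open>f\<close>
  belongs to the completion and has (weak) gradient \<open>V\<close>.\<close>

definition sobolev0 ::
    "('p::topological_space, 'n::{finite,wellorder}) riem \<Rightarrow> ('p \<Rightarrow> real) \<Rightarrow> ('p, 'n) vfield \<Rightarrow> bool" where
  "sobolev0 M f V \<longleftrightarrow>
     f \<in> borel_measurable borel \<and> integrable (riem_volume M) (\<lambda>p. (f p)\<^sup>2) \<and>
     measurable_vfield M V \<and> integrable (riem_volume M) (\<lambda>p. (vnorm M V p)\<^sup>2) \<and>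
     (\<exists>\<phi>::nat \<Rightarrow> 'p \<Rightarrow> real. (\<forall>k. \<phi> k \<in> test_functions M) \<and>
        (\<lambda>k. (\<integral>p. (f p - \<phi> k p)\<^sup>2 \<partial>riem_volume M) +
             (\<integral>p. (vnorm M (\<lambda>c q. V c q - grad M (\<phi> k) c q) p)\<^sup>2 \<partial>riem_volume M))
          \<longlonglongrightarrow> 0)"

definition fundamental_tone :: "('p::topological_space, 'n::{finite,wellorder}) riem \<Rightarrow> ereal" where
  "fundamental_tone M =
     Inf {ereal ((\<integral>p. (vnorm M V p)\<^sup>2 \<partial>riem_volume M) / (\<integral>p. (f p)\<^sup>2 \<partial>riem_volume M)) | f V.
       sobolev0 M f V \<and> \<not> (AE p in riem_volume M. f p = 0)}"

text \<open>Eigenvalues of \<open>-\<triangle> = - Div \<circ> grad\<close> as an operator in \<open>L\<^sup>2(M)\<close>; the Dirichlet condition is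
  membership of the eigenfunction in the completion of the test functions (no condition if the
  boundary is empty, in which case constants give the first eigenvalue 0).\<close>

definition laplace_eigenvalue ::
    "('p::topological_space, 'n::{finite,wellorder}) riem \<Rightarrow> real \<Rightarrow> bool" where
  "laplace_eigenvalue M l \<longleftrightarrow>
     (\<exists>f V. sobolev0 M f V \<and> \<not> (AE p in riem_volume M. f p = 0) \<and>
        has_weak_div M V (\<lambda>p. - l * f p))"

definition lambda1 :: "('p::topological_space, 'n::{finite,wellorder}) riem \<Rightarrow> real" where
  "lambda1 M = (LEAST l. laplace_eigenvalue M l)"

end

theory Submission
  imports Defs
begin

text \<open>If \<open>Div X - \<bar>X\<bar>\<^sup>2 \<ge> r\<close>, then testing the divergence with \<open>\<phi>\<^sup>2\<close> and completing the square,
  \<open>\<integral>\<bar>grad \<phi>\<bar>\<^sup>2 + 2 \<phi> \<langle>grad \<phi>, X\<rangle> + \<phi>\<^sup>2 \<bar>X\<bar>\<^sup>2 \<ge> 0\<close>, gives \<open>\<integral>\<bar>grad \<phi>\<bar>\<^sup>2 \<ge> r \<integral>\<phi>\<^sup>2\<close>.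

  For the converse on a compact manifold one would like to take \<open>X = - grad (ln u)\<close> for a first
  eigenfunction \<open>u\<close>, but this needs regularity and positivity of \<open>u\<close>.  Instead let
  \<open>0 < m' < m < \<lambda>\<^sup>*\<close> and let \<open>w \<ge> 0\<close> be the weak solution of \<open>- \<Delta> w - m w = 1\<close> with zero boundary
  values, obtained by minimization.  Then \<open>w + 1/m\<close> is a solution of \<open>\<Delta> v + m v = 0\<close> bounded away from zero,
  and \<open>X = - F(w) grad w\<close>, for a smooth \<open>F\<close> close to \<open>s \<mapsto> 1/(s + 1/m)\<close>, has
  \<open>Div X - \<bar>X\<bar>\<^sup>2 \<ge> m'\<close>.  That \<open>\<lambda>\<^sup>*\<close> is the least eigenvalue follows from the compactness of the
  embedding into \<open>L\<^sup>2\<close>, which is proved by applying the Poincare inequality on the cells of a fine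
  grid in charts.\<close>

section \<open>Square integrable fields\<close>

text \<open>Everything stays weak: nothing is integrated by parts on the manifold, and the field
  constructed for the converse is only square integrable. The chain rule is thus available for test
  functions alone and must be carried to \<open>w\<close> by limits, so the nonlinear function has
  to be smooth with bounded derivative on the whole line, not only for \<open>s > - 1/m\<close>.
  Smoothing its pole costs a constant factor, and the gap between m' and m pays for it. A second
  obstacle is that the tangent bundle has no global frame, while the volume and \<open>Div\<close>
  are given by description and choice. Components in a Borel selection of charts turn vector fields
  into functions with values in one Euclidean space, carrying an inner product that varies
  measurably with the point. The Hilbert space arguments take place there, for functions and fields
  alike. If a compact manifold has no boundary, the Rayleigh infimum is zero and the zero field is
  enough.\<close>

text \<open>Besides Cauchy-Schwarz, the case \<open>a = 0\<close> matters: it forces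
  \<open>b = 0\<close>, and this is how the weak equations are read off from the minimality of a
  function.\<close>

lemma quadratic_nonneg_discriminant:
  fixes a b c :: real
  assumes "\<And>t. 0 \<le> a + 2 * t * b + t\<^sup>2 * c"
  shows "b\<^sup>2 \<le> a * c"
proof (cases "c = 0")
  case True
  have "b = 0"
  proof (rule ccontr)
    assume "b \<noteq> 0"
    \<comment> \<open>At this \<open>t\<close> the expression, which is affine in \<open>t\<close>,
      takes the value -1.\<close>
    then show False using assms[of "- (a + 1) / (2 * b)"] True by (simp add: field_simps)
  qed
  then show ?thesis using True by simp
next
  case False
  have c: "c > 0"
  proof (rule ccontr)
    assume "\<not> c > 0"
    with False have "c < 0" by simp
    \<comment> \<open>Chosen so large that \<open>t * (- c)\<close> beats the other coefficients;
      the summand \<open>- c\<close> of the numerator makes \<open>t\<close> at least 1.\<close>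
    define t where "t = (\<bar>a\<bar> + 1 + 2 * \<bar>b\<bar> - c) / (- c)"
    have "t * (-c) = \<bar>a\<bar> + 1 + 2 * \<bar>b\<bar> - c" using \<open>c < 0\<close> by (simp add: t_def)
    moreover have "t \<ge> 1" using \<open>c < 0\<close> unfolding t_def by (subst le_divide_eq) auto
    ultimately have t: "t \<ge> 1" "t * (-c) \<ge> \<bar>a\<bar> + 1 + 2 * \<bar>b\<bar>"
      using \<open>c < 0\<close> by auto
    have "t * (t * (-c)) \<ge> t * (\<bar>a\<bar> + 1 + 2 * \<bar>b\<bar>)"
      using t by (intro mult_left_mono) auto
    moreover have "t * (\<bar>a\<bar> + 1) \<ge> 1 * (\<bar>a\<bar> + 1)" using t by (intro mult_right_mono) auto
    moreover have "2 * t * b \<le> 2 * t * \<bar>b\<bar>" using t by (intro mult_left_mono) auto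
    ultimately show False using assms[of t] by (simp add: algebra_simps power2_eq_square)
  qed
  have "0 \<le> a + 2 * (- b / c) * b + (- b / c)\<^sup>2 * c" by (rule assms)
  also have "\<dots> = a - b\<^sup>2 / c" using c by (simp add: field_simps power2_eq_square)
  finally show ?thesis using c by (simp add: field_simps)
qed

text \<open>A Riemannian metric read in a fixed space of components. Only measurability in
  \<open>p\<close> is asked, because the components jump where the selected chart changes.
  Multiplication of real numbers is a second instance, so completeness and limits are proved once
  for functions and for fields.\<close>

locale ip_field =
  fixes \<mu> :: "'p measure" and q :: "'p \<Rightarrow> 'v::euclidean_space \<Rightarrow> 'v \<Rightarrow> real"
  assumes bil: "\<And>p. bilinear (q p)"
    and sym: "\<And>p u v. q p u v = q p v u"
    and pos: "\<And>p u. u \<noteq> 0 \<Longrightarrow> 0 < q p u u"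
    and meas_q [measurable (raw)]: "\<And>U V. U \<in> borel_measurable \<mu> \<Longrightarrow> V \<in> borel_measurable \<mu> \<Longrightarrow>
      (\<lambda>p. q p (U p) (V p)) \<in> borel_measurable \<mu>"
begin

lemmas q_simps = bilinear_ladd[OF bil] bilinear_radd[OF bil] bilinear_lsub[OF bil] bilinear_rsub[OF bil]
  bilinear_lmul[OF bil] bilinear_rmul[OF bil] bilinear_lzero[OF bil] bilinear_rzero[OF bil]
  bilinear_lneg[OF bil] bilinear_rneg[OF bil]

lemma nonneg: "0 \<le> q p u u"
  using pos[of u p] by (cases "u = 0") (auto simp: q_simps)

lemma young: "2 * \<bar>q p u v\<bar> \<le> q p u u + q p v v"
  using nonneg[of p "u + v"] nonneg[of p "u - v"] sym[of p u v]
  by (simp add: q_simps)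

text \<open>Compactness of the unit sphere. The constant depends on \<open>p\<close>, which is
  enough to turn smallness in \<open>q p\<close> at one point into smallness in the Euclidean
  norm.\<close>

lemma coercive: "\<exists>a>0. \<forall>u. a * (norm u)\<^sup>2 \<le> q p u u"
proof -
  have bb: "bounded_bilinear (q p)" using bil by (simp add: bilinear_conv_bounded_bilinear)
  have "continuous_on (sphere 0 1) (\<lambda>u. q p u u)"
    by (intro bounded_bilinear.continuous_on[OF bb] continuous_intros)
  then obtain s where s: "s \<in> sphere 0 1" "\<And>u. u \<in> sphere 0 1 \<Longrightarrow> q p s s \<le> q p u u"
    using continuous_attains_inf[of "sphere (0::'v) 1" "\<lambda>u. q p u u"] by auto
  have "s \<noteq> 0" using s(1) by auto
  show ?thesis
  proof (intro exI[of _ "q p s s"] conjI allI pos \<open>s \<noteq> 0\<close>)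
    fix u :: 'v
    show "q p s s * (norm u)\<^sup>2 \<le> q p u u"
    proof (cases "u = 0")
      case False
      define v where "v = (1 / norm u) *\<^sub>R u"
      have "v \<in> sphere 0 1" using False by (simp add: v_def)
      then have "q p s s \<le> q p v v" by (rule s)
      also have "\<dots> = q p u u / (norm u)\<^sup>2" by (simp add: v_def q_simps power2_eq_square)
      finally show ?thesis using False by (simp add: field_simps)
    qed (simp add: q_simps)
  qed
qed

section \<open>The Hilbert space of square integrable fields\<close>

definition L2 :: "('p \<Rightarrow> 'v) set" where
  "L2 = {U. U \<in> borel_measurable \<mu> \<and> integrable \<mu> (\<lambda>p. q p (U p) (U p))}"

definition ip :: "('p \<Rightarrow> 'v) \<Rightarrow> ('p \<Rightarrow> 'v) \<Rightarrow> real" where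
  "ip U V = (\<integral>p. q p (U p) (V p) \<partial>\<mu>)"

abbreviation N2 :: "('p \<Rightarrow> 'v) \<Rightarrow> real" where "N2 U \<equiv> ip U U"

lemma L2_integrable: "U \<in> L2 \<Longrightarrow> V \<in> L2 \<Longrightarrow> integrable \<mu> (\<lambda>p. q p (U p) (V p))"
proof -
  assume UV: "U \<in> L2" "V \<in> L2"
  then have m: "U \<in> borel_measurable \<mu>" "V \<in> borel_measurable \<mu>" by (auto simp: L2_def)
  have i: "integrable \<mu> (\<lambda>p. q p (U p) (U p) + q p (V p) (V p))" using UV by (auto simp: L2_def)
  show ?thesis
  proof (rule Bochner_Integration.integrable_bound[OF i])
    show "(\<lambda>p. q p (U p) (V p)) \<in> borel_measurable \<mu>" using m by measurable
    have "norm (q p (U p) (V p)) \<le> norm (q p (U p) (U p) + q p (V p) (V p))" for p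
      using young[of p "U p" "V p"] nonneg[of p "U p"] nonneg[of p "V p"] by simp
    then show "AE p in \<mu>. norm (q p (U p) (V p)) \<le> norm (q p (U p) (U p) + q p (V p) (V p))" by simp
  qed
qed

lemma L2_add: assumes "U \<in> L2" "V \<in> L2" shows "(\<lambda>p. U p + V p) \<in> L2"
proof -
  have m: "U \<in> borel_measurable \<mu>" "V \<in> borel_measurable \<mu>" using assms by (auto simp: L2_def)
  show ?thesis using L2_integrable[OF assms(1,1)] L2_integrable[OF assms] L2_integrable[OF assms(2,2)]
      L2_integrable[OF assms(2,1)] m
    unfolding L2_def by (auto simp: q_simps)
qed

lemma L2_scaleR: assumes "U \<in> L2" shows "(\<lambda>p. c *\<^sub>R U p) \<in> L2"
  using assms unfolding L2_def by (auto simp: q_simps)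

lemma L2_diff: assumes "U \<in> L2" "V \<in> L2" shows "(\<lambda>p. U p - V p) \<in> L2"
  using L2_add[OF assms(1) L2_scaleR[OF assms(2), of "-1"]] by simp

lemma L2_bounded_mult:
  assumes U: "U \<in> L2" and g[measurable]: "g \<in> borel_measurable \<mu>" and b: "\<And>p. \<bar>g p\<bar> \<le> B"
  shows "(\<lambda>p. g p *\<^sub>R U p) \<in> L2" and "N2 (\<lambda>p. g p *\<^sub>R U p) \<le> B\<^sup>2 * N2 U"
proof -
  have [measurable]: "U \<in> borel_measurable \<mu>" using U by (auto simp: L2_def)
  have i: "integrable \<mu> (\<lambda>p. B\<^sup>2 * q p (U p) (U p))" using U by (auto simp: L2_def)
  have B: "(g p)\<^sup>2 \<le> B\<^sup>2" for p using power_mono[OF b[of p], of 2] by simp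
  have le: "q p (g p *\<^sub>R U p) (g p *\<^sub>R U p) \<le> B\<^sup>2 * q p (U p) (U p)" for p
    using mult_right_mono[OF B[of p] nonneg[of p "U p"]] by (simp add: q_simps power2_eq_square)
  show 1: "(\<lambda>p. g p *\<^sub>R U p) \<in> L2"
    unfolding L2_def
  proof (intro CollectI conjI)
    show "integrable \<mu> (\<lambda>p. q p (g p *\<^sub>R U p) (g p *\<^sub>R U p))"
      by (rule Bochner_Integration.integrable_bound[OF i]) (auto simp: nonneg intro!: AE_I2 order_trans[OF le])
  qed measurable
  show "N2 (\<lambda>p. g p *\<^sub>R U p) \<le> B\<^sup>2 * N2 U"
    using integral_mono[OF L2_integrable[OF 1 1] i] le by (simp add: ip_def)
qed

lemma ip_sym: "ip U V = ip V U" unfolding ip_def by (simp add: sym)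

lemma ip_diff: "U \<in> L2 \<Longrightarrow> V \<in> L2 \<Longrightarrow> W \<in> L2 \<Longrightarrow> ip (\<lambda>p. U p - V p) W = ip U W - ip V W"
  unfolding ip_def by (simp add: q_simps L2_integrable)

lemma ip_scaleR: "ip (\<lambda>p. c *\<^sub>R U p) W = c * ip U W"
  unfolding ip_def by (simp add: q_simps)

lemma ip_scaleR_right: "ip W (\<lambda>p. c *\<^sub>R U p) = c * ip W U"
  unfolding ip_def by (simp add: q_simps)

lemma N2_nonneg: "0 \<le> N2 U" unfolding ip_def by (simp add: nonneg)

lemma N2_line:
  assumes "U \<in> L2" "V \<in> L2"
  shows "N2 (\<lambda>p. U p + t *\<^sub>R V p) = N2 U + 2 * t * ip U V + t\<^sup>2 * N2 V"
proof -
  have "N2 (\<lambda>p. U p + t *\<^sub>R V p) = (\<integral>p. q p (U p) (U p) + 2 * t * q p (U p) (V p) + t\<^sup>2 * q p (V p) (V p) \<partial>\<mu>)"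
    unfolding ip_def using sym by (intro Bochner_Integration.integral_cong) (auto simp: q_simps algebra_simps power2_eq_square)
  also have "\<dots> = N2 U + 2 * t * ip U V + t\<^sup>2 * N2 V"
    unfolding ip_def using L2_integrable[OF assms] L2_integrable[OF assms(1,1)] L2_integrable[OF assms(2,2)]
    by simp
  finally show ?thesis .
qed

lemma parallelogram:
  assumes "U \<in> L2" "V \<in> L2"
  shows "N2 (\<lambda>p. U p - V p) = 2 * N2 U + 2 * N2 V - N2 (\<lambda>p. U p + V p)"
  using N2_line[OF assms, of 1] N2_line[OF assms, of "-1"] by simp

lemma Cauchy_Schwarz:
  assumes "U \<in> L2" "V \<in> L2"
  shows "(ip U V)\<^sup>2 \<le> N2 U * N2 V"
proof (rule quadratic_nonneg_discriminant)
  show "0 \<le> N2 U + 2 * t * ip U V + t\<^sup>2 * N2 V" for t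
    using N2_line[OF assms, of t] N2_nonneg by metis
qed

lemma Cauchy_Schwarz_abs:
  assumes "U \<in> L2" "V \<in> L2"
  shows "\<bar>ip U V\<bar> \<le> sqrt (N2 U) * sqrt (N2 V)"
  using real_le_rsqrt[of "\<bar>ip U V\<bar>" "N2 U * N2 V"] Cauchy_Schwarz[OF assms] by (simp add: real_sqrt_mult)

lemma ip_tendsto:
  assumes Uk: "\<And>k::nat. Uk k \<in> L2" "U \<in> L2" "(\<lambda>k. N2 (\<lambda>p. Uk k p - U p)) \<longlonglongrightarrow> 0"
    and Vk: "\<And>k::nat. Vk k \<in> L2" "V \<in> L2" "(\<lambda>k. N2 (\<lambda>p. Vk k p - V p)) \<longlonglongrightarrow> 0"
  shows "(\<lambda>k. ip (Uk k) (Vk k)) \<longlonglongrightarrow> ip U V"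
proof -
  define a where "a k = (\<lambda>p. Uk k p - U p)" for k
  define b where "b k = (\<lambda>p. Vk k p - V p)" for k
  have ab: "a k \<in> L2" "b k \<in> L2" for k unfolding a_def b_def using Uk Vk by (auto intro: L2_diff)
  have sa: "(\<lambda>k. sqrt (N2 (a k))) \<longlonglongrightarrow> 0" using tendsto_real_sqrt[OF Uk(3)] by (simp add: a_def)
  have sb: "(\<lambda>k. sqrt (N2 (b k))) \<longlonglongrightarrow> 0" using tendsto_real_sqrt[OF Vk(3)] by (simp add: b_def)
  have bd: "\<bar>ip (Uk k) (Vk k) - ip U V\<bar> \<le> sqrt (N2 (a k)) * sqrt (N2 (b k)) + sqrt (N2 (a k)) * sqrt (N2 V)
      + sqrt (N2 (b k)) * sqrt (N2 U)" for k
  proof -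
    have "ip (Uk k) (Vk k) - ip U V = ip (a k) (Vk k) + ip U (Vk k) - ip U V"
      unfolding a_def using Uk Vk by (simp add: ip_diff)
    also have "ip (a k) (Vk k) = ip (a k) (b k) + ip (a k) V"
      using ip_diff[OF Vk(1)[of k] Vk(2) ab(1)[of k]] by (simp add: b_def ip_sym[of "a k"])
    also have "ip U (Vk k) = ip U V + ip (b k) U"
      using ip_diff[OF Vk(1)[of k] Vk(2) Uk(2)] by (simp add: b_def ip_sym[of U])
    finally have "ip (Uk k) (Vk k) - ip U V = ip (a k) (b k) + ip (a k) V + ip (b k) U" by simp
    then show ?thesis
      using Cauchy_Schwarz_abs[OF ab, of k k] Cauchy_Schwarz_abs[OF ab(1) Vk(2), of k] Cauchy_Schwarz_abs[OF ab(2) Uk(2), of k]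
      by linarith
  qed
  have "(\<lambda>k. sqrt (N2 (a k)) * sqrt (N2 (b k)) + sqrt (N2 (a k)) * sqrt (N2 V)
      + sqrt (N2 (b k)) * sqrt (N2 U)) \<longlonglongrightarrow> 0 * 0 + 0 * sqrt (N2 V) + 0 * sqrt (N2 U)"
    by (intro tendsto_intros sa sb)
  then have "(\<lambda>k. sqrt (N2 (a k)) * sqrt (N2 (b k)) + sqrt (N2 (a k)) * sqrt (N2 V)
      + sqrt (N2 (b k)) * sqrt (N2 U)) \<longlonglongrightarrow> 0" by simp
  then have "(\<lambda>k. ip (Uk k) (Vk k) - ip U V) \<longlonglongrightarrow> 0"
    by (rule Lim_null_comparison[rotated]) (use bd in auto)
  then show ?thesis by (simp add: LIM_zero_iff)
qed

lemma N2_tendsto: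
  assumes "\<And>k::nat. Uk k \<in> L2" "U \<in> L2" "(\<lambda>k. N2 (\<lambda>p. Uk k p - U p)) \<longlonglongrightarrow> 0"
  shows "(\<lambda>k. N2 (Uk k)) \<longlonglongrightarrow> N2 U"
  by (rule ip_tendsto[OF assms assms])

lemma ip_tendsto_left:
  assumes "\<And>k::nat. Uk k \<in> L2" "U \<in> L2" "(\<lambda>k. N2 (\<lambda>p. Uk k p - U p)) \<longlonglongrightarrow> 0" "V \<in> L2"
  shows "(\<lambda>k. ip (Uk k) V) \<longlonglongrightarrow> ip U V"
  by (rule ip_tendsto[OF assms(1-3)]) (use assms(4) in \<open>auto simp: ip_def q_simps\<close>)

lemma nn_integral_N2: "U \<in> L2 \<Longrightarrow> (\<integral>\<^sup>+p. ennreal (q p (U p) (U p)) \<partial>\<mu>) = ennreal (N2 U)"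
  unfolding ip_def by (rule nn_integral_eq_integral) (auto simp: L2_def nonneg)

text \<open>With the weights \<open>2^k\<close> the squared increments still have a finite integral
  in total. So almost everywhere they are bounded by a multiple of \<open>2^-k\<close>, and the
  increments themselves by a geometric sequence.\<close>

lemma AE_convergent_fast:
  assumes Wk: "\<And>k::nat. W k \<in> L2" and fast: "\<And>k. N2 (\<lambda>p. W (Suc k) p - W k p) \<le> (1/4)^k"
  shows "AE p in \<mu>. convergent (\<lambda>k. W k p)"
proof -
  define d where "d k p = W (Suc k) p - W k p" for k p
  have d: "d k \<in> L2" for k unfolding d_def using Wk by (intro L2_diff)
  have dm[measurable]: "d k \<in> borel_measurable \<mu>" for k using d[of k] by (simp add: L2_def)
  have "(\<integral>\<^sup>+p. (\<Sum>k. ennreal (2^k * q p (d k p) (d k p))) \<partial>\<mu>)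
      = (\<Sum>k. \<integral>\<^sup>+p. ennreal (2^k * q p (d k p) (d k p)) \<partial>\<mu>)"
    by (rule nn_integral_suminf) measurable
  also have "\<dots> = (\<Sum>k. ennreal (2^k * N2 (d k)))"
    by (simp add: ennreal_mult nonneg N2_nonneg nn_integral_cmult nn_integral_N2[OF d])
  also have "\<dots> \<le> (\<Sum>k. ennreal ((1/2)^k))"
  proof (intro suminf_le summableI ennreal_leI)
    fix k :: nat
    have "2^k * N2 (d k) \<le> 2^k * (1/4)^k" using fast[of k] unfolding d_def by (intro mult_left_mono) auto
    also have "\<dots> = (1/2::real)^k" by (simp flip: power_mult_distrib)
    finally show "2^k * N2 (d k) \<le> (1/2::real)^k" .
  qed
  also have "\<dots> < \<infinity>" by (subst suminf_ennreal2) (auto intro: summable_geometric)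
  finally have fin: "(\<integral>\<^sup>+p. (\<Sum>k. ennreal (2^k * q p (d k p) (d k p))) \<partial>\<mu>) \<noteq> \<infinity>" by simp
  have "AE p in \<mu>. (\<Sum>k. ennreal (2^k * q p (d k p) (d k p))) \<noteq> \<infinity>"
    by (rule nn_integral_noteq_infinite[OF _ fin]) measurable
  then show ?thesis
  proof (rule AE_mp, intro AE_I2 impI)
    fix p assume "(\<Sum>k. ennreal (2^k * q p (d k p) (d k p))) \<noteq> \<infinity>"
    then have "summable (\<lambda>k. 2^k * q p (d k p) (d k p))"
      by (intro summable_suminf_not_top) (auto simp: nonneg)
    then have "Bseq (\<lambda>k. 2^k * q p (d k p) (d k p))"
      by (intro convergent_imp_Bseq convergentI[OF summable_LIMSEQ_zero])
    then obtain C where C: "C > 0" "\<And>k. norm (2^k * q p (d k p) (d k p)) \<le> C" by (auto simp: Bseq_def)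
    obtain a where a: "a > 0" "\<And>u. a * (norm u)\<^sup>2 \<le> q p u u" using coercive[of p] by auto
    have bd: "norm (d k p) \<le> sqrt (C / a) * (sqrt (1/2))^k" for k
    proof -
      have "2^k * (a * (norm (d k p))\<^sup>2) \<le> 2^k * q p (d k p) (d k p)" by (intro mult_left_mono a) auto
      also have "\<dots> \<le> C" using C(2)[of k] nonneg[of p "d k p"] by simp
      finally have "(norm (d k p))\<^sup>2 \<le> C / a * (1/2)^k" using a by (simp add: field_simps power_divide)
      then have "norm (d k p) \<le> sqrt (C / a * (1/2)^k)" by (rule real_le_rsqrt)
      then show ?thesis by (simp only: real_sqrt_mult real_sqrt_power)
    qed
    have "summable (\<lambda>k. d k p)"
      by (rule summable_comparison_test'[OF _ bd]) (intro summable_mult summable_geometric, simp add: real_sqrt_divide)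
    then have "convergent (\<lambda>n. (\<Sum>k<n. d k p) + W 0 p)"
      by (intro convergent_add convergent_const) (simp add: summable_iff_convergent)
    moreover have "(\<Sum>k<n. d k p) + W 0 p = W n p" for n
      unfolding d_def using sum_lessThan_telescope[of "\<lambda>k. W k p" n] by simp
    ultimately show "convergent (\<lambda>k. W k p)" by simp
  qed
qed

text \<open>The Riesz-Fischer argument: a rapidly convergent subsequence has a pointwise limit, and
  Fatou's lemma turns it into a limit in the norm of the whole sequence.\<close>

theorem L2_complete:
  assumes Uk: "\<And>k::nat. Uk k \<in> L2"
    and Cau: "\<And>e. e > 0 \<Longrightarrow> \<exists>n0. \<forall>m\<ge>n0. \<forall>n\<ge>n0. N2 (\<lambda>p. Uk m p - Uk n p) \<le> e"
  shows "\<exists>U\<in>L2. (\<lambda>k. N2 (\<lambda>p. Uk k p - U p)) \<longlonglongrightarrow> 0"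
proof -
  have "\<forall>k. \<exists>n0. \<forall>m\<ge>n0. \<forall>n\<ge>n0. N2 (\<lambda>p. Uk m p - Uk n p) \<le> (1/4)^k" by (intro allI Cau) simp
  then obtain n0 where n0: "\<And>k m n. m \<ge> n0 k \<Longrightarrow> n \<ge> n0 k \<Longrightarrow> N2 (\<lambda>p. Uk m p - Uk n p) \<le> (1/4)^k" by metis
  \<comment> \<open>Partial sums dominate all earlier thresholds, so \<open>r k\<close> and
    \<open>r (Suc k)\<close> both lie beyond \<open>n0 k\<close>; the summand \<open>k\<close> sends
    \<open>r\<close> to infinity.\<close>
  define r where "r k = (\<Sum>i\<le>k. n0 i) + k" for k
  have r1: "r k \<ge> n0 k" "r (Suc k) \<ge> n0 k" "k \<le> r k" for k
    using member_le_sum[of k "{..k}" n0] by (auto simp: r_def)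
  have conv: "AE p in \<mu>. convergent (\<lambda>k. Uk (r k) p)"
    by (rule AE_convergent_fast) (use Uk n0 r1 in auto)
  define U where "U p = lim (\<lambda>k. Uk (r k) p)" for p
  have [measurable]: "Uk k \<in> borel_measurable \<mu>" for k using Uk[of k] by (simp add: L2_def)
  have [measurable]: "U \<in> borel_measurable \<mu>" unfolding U_def by (rule borel_measurable_lim_metric) measurable
  have lim: "AE p in \<mu>. (\<lambda>k. Uk (r k) p) \<longlonglongrightarrow> U p"
    using conv by eventually_elim (simp add: U_def convergent_LIMSEQ_iff)
  \<comment> \<open>Fatou's lemma along the subsequence, with the index \<open>m\<close> held fixed;
    it yields integrability and the bound at once.\<close>
  have key: "integrable \<mu> (\<lambda>p. q p (Uk m p - U p) (Uk m p - U p)) \<and> N2 (\<lambda>p. Uk m p - U p) \<le> e"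
    if e: "e > 0" and n1: "\<forall>m\<ge>n1. \<forall>n\<ge>n1. N2 (\<lambda>p. Uk m p - Uk n p) \<le> e" and m: "m \<ge> n1" for e n1 m
  proof -
    have "(\<integral>\<^sup>+p. ennreal (q p (Uk m p - U p) (Uk m p - U p)) \<partial>\<mu>)
        = (\<integral>\<^sup>+p. liminf (\<lambda>k. ennreal (q p (Uk m p - Uk (r k) p) (Uk m p - Uk (r k) p))) \<partial>\<mu>)"
    proof (rule nn_integral_cong_AE, use lim in eventually_elim)
      fix p assume l: "(\<lambda>k. Uk (r k) p) \<longlonglongrightarrow> U p"
      have bb: "bounded_bilinear (q p)" using bil by (simp add: bilinear_conv_bounded_bilinear)
      have "(\<lambda>k. ennreal (q p (Uk m p - Uk (r k) p) (Uk m p - Uk (r k) p))) \<longlonglongrightarrow> ennreal (q p (Uk m p - U p) (Uk m p - U p))"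
        by (intro tendsto_ennrealI bounded_bilinear.tendsto[OF bb] tendsto_intros l)
      then show "ennreal (q p (Uk m p - U p) (Uk m p - U p)) = liminf (\<lambda>k. ennreal (q p (Uk m p - Uk (r k) p) (Uk m p - Uk (r k) p)))"
        using lim_imp_Liminf[OF sequentially_bot] by metis
    qed
    also have "\<dots> \<le> liminf (\<lambda>k. \<integral>\<^sup>+p. ennreal (q p (Uk m p - Uk (r k) p) (Uk m p - Uk (r k) p)) \<partial>\<mu>)"
      by (rule nn_integral_liminf) measurable
    also have "\<dots> = liminf (\<lambda>k. ennreal (N2 (\<lambda>p. Uk m p - Uk (r k) p)))"
      using nn_integral_N2[OF L2_diff[OF Uk Uk]] by simp
    also have "\<dots> \<le> limsup (\<lambda>k. ennreal (N2 (\<lambda>p. Uk m p - Uk (r k) p)))"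
      by (rule Liminf_le_Limsup) simp
    also have "\<dots> \<le> ennreal e"
    proof (rule Limsup_bounded)
      show "\<forall>\<^sub>F k in sequentially. ennreal (N2 (\<lambda>p. Uk m p - Uk (r k) p)) \<le> ennreal e"
        using eventually_ge_at_top[of n1]
      proof eventually_elim
        case (elim k)
        then have "n1 \<le> r k" using r1(3)[of k] by simp
        then show ?case using n1 m by (intro ennreal_leI) auto
      qed
    qed
    finally have le: "(\<integral>\<^sup>+p. ennreal (q p (Uk m p - U p) (Uk m p - U p)) \<partial>\<mu>) \<le> ennreal e" .
    have i: "integrable \<mu> (\<lambda>p. q p (Uk m p - U p) (Uk m p - U p))"
      by (rule integrableI_nonneg) (use le in \<open>auto simp: nonneg top_unique less_top[symmetric]\<close>)
    have "ennreal (N2 (\<lambda>p. Uk m p - U p)) \<le> ennreal e"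
      using le nn_integral_eq_integral[OF i] by (simp add: ip_def nonneg)
    then show ?thesis using i e by simp
  qed
  have diffL2: "(\<lambda>p. Uk m p - U p) \<in> L2" if "m \<ge> n0 0" for m
    unfolding L2_def using key[of 1 "n0 0" m] n0[of 0] that by auto
  have "(\<lambda>p. Uk (n0 0) p - (Uk (n0 0) p - U p)) \<in> L2" by (intro L2_diff Uk diffL2) simp
  then have UL: "U \<in> L2" by simp
  moreover have "(\<lambda>k. N2 (\<lambda>p. Uk k p - U p)) \<longlonglongrightarrow> 0"
  proof (rule LIMSEQ_I)
    fix e :: real assume "e > 0"
    then obtain n1 where n1: "\<forall>m\<ge>n1. \<forall>n\<ge>n1. N2 (\<lambda>p. Uk m p - Uk n p) \<le> e/2" using Cau[of "e/2"] by auto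
    show "\<exists>no. \<forall>n\<ge>no. norm (N2 (\<lambda>p. Uk n p - U p) - 0) < e"
      using key[of "e/2" n1] n1 \<open>e > 0\<close> N2_nonneg by (intro exI[of _ n1]) (fastforce simp: abs_of_nonneg)
  qed
  ultimately show ?thesis by blast
qed

end

section \<open>Dirichlet forms\<close>

text \<open>The chain rule is postulated only for \<open>F\<close> smooth on the whole line, since
  test functions take values of either sign. The condition \<open>F 0 = 0\<close> keeps the support
  of \<open>\<phi>\<close> compact; in a product \<open>\<phi> p * F (w p)\<close> the factor
  \<open>\<phi>\<close> takes care of the support.\<close>

locale dirichlet_form = ip_field \<mu> q
  for \<mu> :: "'p measure" and q :: "'p \<Rightarrow> 'v::euclidean_space \<Rightarrow> 'v \<Rightarrow> real" +
  fixes T :: "('p \<Rightarrow> real) set" and D :: "('p \<Rightarrow> real) \<Rightarrow> 'p \<Rightarrow> 'v"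
  assumes T_add: "\<And>\<phi> \<psi>. \<phi> \<in> T \<Longrightarrow> \<psi> \<in> T \<Longrightarrow> (\<lambda>p. \<phi> p + \<psi> p) \<in> T"
    and D_add: "\<And>\<phi> \<psi>. \<phi> \<in> T \<Longrightarrow> \<psi> \<in> T \<Longrightarrow> D (\<lambda>p. \<phi> p + \<psi> p) = (\<lambda>p. D \<phi> p + D \<psi> p)"
    and T_scale: "\<And>\<phi> a. \<phi> \<in> T \<Longrightarrow> (\<lambda>p. a * \<phi> p) \<in> T"
    and D_scale: "\<And>\<phi> a. \<phi> \<in> T \<Longrightarrow> D (\<lambda>p. a * \<phi> p) = (\<lambda>p. a *\<^sub>R D \<phi> p)"
    and T_comp: "\<And>\<phi> F F'. \<phi> \<in> T \<Longrightarrow> (\<And>k. ck_on k UNIV F) \<Longrightarrow> (\<And>s. (F has_real_derivative F' s) (at s)) \<Longrightarrow>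
        F 0 = 0 \<Longrightarrow> (\<lambda>p. F (\<phi> p)) \<in> T"
    and D_comp: "\<And>\<phi> F F'. \<phi> \<in> T \<Longrightarrow> (\<And>k. ck_on k UNIV F) \<Longrightarrow> (\<And>s. (F has_real_derivative F' s) (at s)) \<Longrightarrow>
        D (\<lambda>p. F (\<phi> p)) = (\<lambda>p. F' (\<phi> p) *\<^sub>R D \<phi> p)"
    and T_mult_comp: "\<And>\<phi> w F F'. \<phi> \<in> T \<Longrightarrow> w \<in> T \<Longrightarrow> (\<And>k. ck_on k UNIV F) \<Longrightarrow>
        (\<And>s. (F has_real_derivative F' s) (at s)) \<Longrightarrow> (\<lambda>p. \<phi> p * F (w p)) \<in> T"
    and D_mult_comp: "\<And>\<phi> w F F'. \<phi> \<in> T \<Longrightarrow> w \<in> T \<Longrightarrow> (\<And>k. ck_on k UNIV F) \<Longrightarrow>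
        (\<And>s. (F has_real_derivative F' s) (at s)) \<Longrightarrow>
        D (\<lambda>p. \<phi> p * F (w p)) = (\<lambda>p. F (w p) *\<^sub>R D \<phi> p + (\<phi> p * F' (w p)) *\<^sub>R D w p)"
    and T_meas: "\<And>\<phi>. \<phi> \<in> T \<Longrightarrow> \<phi> \<in> borel_measurable \<mu>"
    and T_sq: "\<And>\<phi>. \<phi> \<in> T \<Longrightarrow> integrable \<mu> (\<lambda>p. (\<phi> p)\<^sup>2)"
    and T_bdd: "\<And>\<phi>. \<phi> \<in> T \<Longrightarrow> \<exists>B. \<forall>p. \<bar>\<phi> p\<bar> \<le> B"
    and D_L2: "\<And>\<phi>. \<phi> \<in> T \<Longrightarrow> D \<phi> \<in> L2"
begin

sublocale S: ip_field \<mu> "\<lambda>_ (a::real) b. a * b"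
  by unfold_locales (auto simp: bilinear_def linear_iff algebra_simps zero_less_mult_iff)

lemma T_L2: "\<phi> \<in> T \<Longrightarrow> \<phi> \<in> S.L2"
  using T_meas T_sq by (auto simp: S.L2_def power2_eq_square)

lemma T_diff: "\<phi> \<in> T \<Longrightarrow> \<psi> \<in> T \<Longrightarrow> (\<lambda>p. \<phi> p - \<psi> p) \<in> T"
  using T_add[OF _ T_scale[of \<psi> "-1"]] by simp

lemma D_diff: "\<phi> \<in> T \<Longrightarrow> \<psi> \<in> T \<Longrightarrow> D (\<lambda>p. \<phi> p - \<psi> p) = (\<lambda>p. D \<phi> p - D \<psi> p)"
  using D_add[of \<phi>, OF _ T_scale[of \<psi> "-1"]] D_scale[of \<psi> "-1"] by simp

text \<open>The pair \<open>(f, U)\<close> lies in the closure of the graph of \<open>D\<close>. The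
  approximating sequence is part of the predicate because nonlinear functions are applied to it
  rather than to \<open>f\<close>.\<close>

definition hconv :: "(nat \<Rightarrow> 'p \<Rightarrow> real) \<Rightarrow> ('p \<Rightarrow> real) \<Rightarrow> ('p \<Rightarrow> 'v) \<Rightarrow> bool" where
  "hconv \<phi> f U \<longleftrightarrow> (\<forall>k. \<phi> k \<in> T) \<and> f \<in> S.L2 \<and> U \<in> L2 \<and> (\<lambda>k. S.N2 (\<lambda>p. \<phi> k p - f p)) \<longlonglongrightarrow> 0 \<and>
     (\<lambda>k. N2 (\<lambda>p. D (\<phi> k) p - U p)) \<longlonglongrightarrow> 0"

lemma hconvD:
  assumes "hconv \<phi> f U"
  shows "\<And>k. \<phi> k \<in> T" "f \<in> S.L2" "U \<in> L2" "\<And>k. \<phi> k \<in> S.L2" "\<And>k. D (\<phi> k) \<in> L2"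
    "(\<lambda>k. S.N2 (\<lambda>p. \<phi> k p - f p)) \<longlonglongrightarrow> 0" "(\<lambda>k. N2 (\<lambda>p. D (\<phi> k) p - U p)) \<longlonglongrightarrow> 0"
    "(\<lambda>k. S.N2 (\<phi> k)) \<longlonglongrightarrow> S.N2 f" "(\<lambda>k. N2 (D (\<phi> k))) \<longlonglongrightarrow> N2 U"
proof -
  show 1: "\<And>k. \<phi> k \<in> T" "f \<in> S.L2" "U \<in> L2"
    "(\<lambda>k. S.N2 (\<lambda>p. \<phi> k p - f p)) \<longlonglongrightarrow> 0" "(\<lambda>k. N2 (\<lambda>p. D (\<phi> k) p - U p)) \<longlonglongrightarrow> 0"
    using assms by (auto simp: hconv_def)
  show 2: "\<And>k. \<phi> k \<in> S.L2" "\<And>k. D (\<phi> k) \<in> L2" using 1(1) T_L2 D_L2 by auto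
  show "(\<lambda>k. S.N2 (\<phi> k)) \<longlonglongrightarrow> S.N2 f" by (rule S.N2_tendsto) (use 1 2 in auto)
  show "(\<lambda>k. N2 (D (\<phi> k))) \<longlonglongrightarrow> N2 U" by (rule N2_tendsto) (use 1 2 in auto)
qed

lemma hconv_line:
  assumes h: "hconv \<phi> f U" and \<psi>: "\<psi> \<in> T"
  shows "hconv (\<lambda>k p. \<phi> k p + t * \<psi> p) (\<lambda>p. f p + t * \<psi> p) (\<lambda>p. U p + t *\<^sub>R D \<psi> p)"
proof -
  note h' = hconvD[OF h]
  have "(\<lambda>p. f p + t * \<psi> p) \<in> S.L2" using S.L2_add[OF h'(2) S.L2_scaleR[OF T_L2[OF \<psi>], of t]] by simp
  moreover have "(\<lambda>p. U p + t *\<^sub>R D \<psi> p) \<in> L2" by (intro L2_add L2_scaleR h' D_L2 \<psi>)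
  ultimately show ?thesis unfolding hconv_def using h' \<psi>
    by (auto simp: T_add T_scale D_add D_scale)
qed

lemma hconv_exists:
  assumes \<phi>: "\<And>k. \<phi> k \<in> T"
    and c1: "\<And>e. e > 0 \<Longrightarrow> \<exists>n0. \<forall>m\<ge>n0. \<forall>n\<ge>n0. S.N2 (\<lambda>p. \<phi> m p - \<phi> n p) \<le> e"
    and c2: "\<And>e. e > 0 \<Longrightarrow> \<exists>n0. \<forall>m\<ge>n0. \<forall>n\<ge>n0. N2 (\<lambda>p. D (\<phi> m) p - D (\<phi> n) p) \<le> e"
  shows "\<exists>f U. hconv \<phi> f U"
proof -
  obtain f where "f \<in> S.L2" "(\<lambda>k. S.N2 (\<lambda>p. \<phi> k p - f p)) \<longlonglongrightarrow> 0"
    using S.L2_complete[OF T_L2[OF \<phi>] c1] by auto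
  moreover obtain U where "U \<in> L2" "(\<lambda>k. N2 (\<lambda>p. D (\<phi> k) p - U p)) \<longlonglongrightarrow> 0"
    using L2_complete[OF D_L2[OF \<phi>] c2] by auto
  ultimately show ?thesis using \<phi> unfolding hconv_def by blast
qed

section \<open>The Rayleigh infimum and its minimizer\<close>

text \<open>A real infimum over test functions, meaningful once some test function has nonzero norm.
  By continuity of both norms the inequality extends to the completion.\<close>

definition lam :: real where
  "lam = Inf {N2 (D \<phi>) / S.N2 \<phi> | \<phi>. \<phi> \<in> T \<and> S.N2 \<phi> \<noteq> 0}"

lemma lam_le:
  assumes "\<phi> \<in> T" shows "lam * S.N2 \<phi> \<le> N2 (D \<phi>)"
proof (cases "S.N2 \<phi> = 0")
  case True then show ?thesis using N2_nonneg by simp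
next
  case False
  have "lam \<le> N2 (D \<phi>) / S.N2 \<phi>" unfolding lam_def
    by (rule cInf_lower) (use False assms N2_nonneg S.N2_nonneg in \<open>auto intro!: bdd_belowI[of _ 0]\<close>)
  then show ?thesis using False S.N2_nonneg[of \<phi>] by (simp add: field_simps)
qed

lemma lam_le_hconv:
  assumes "hconv \<phi> f U" shows "lam * S.N2 f \<le> N2 U"
  by (rule LIMSEQ_le[OF tendsto_mult_left[OF hconvD(8)[OF assms]] hconvD(9)[OF assms]])
    (use lam_le hconvD(1)[OF assms] in auto)

lemma lam_nonneg:
  assumes "\<phi> \<in> T" "S.N2 \<phi> \<noteq> 0" shows "lam \<ge> 0"
  unfolding lam_def by (rule cInf_greatest) (use assms N2_nonneg S.N2_nonneg in auto)

lemma lam_approx: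
  assumes "\<phi> \<in> T" "S.N2 \<phi> \<noteq> 0" "e > 0"
  shows "\<exists>\<psi>\<in>T. S.N2 \<psi> = 1 \<and> N2 (D \<psi>) < lam + e"
proof -
  have "\<exists>y\<in>{N2 (D \<phi>) / S.N2 \<phi> | \<phi>. \<phi> \<in> T \<and> S.N2 \<phi> \<noteq> 0}. y < lam + e"
    unfolding lam_def by (rule cInf_lessD) (use assms in auto)
  then obtain \<psi> where \<psi>: "\<psi> \<in> T" "S.N2 \<psi> \<noteq> 0" "N2 (D \<psi>) / S.N2 \<psi> < lam + e" by auto
  define c where "c = 1 / sqrt (S.N2 \<psi>)"
  have c: "c * c = 1 / S.N2 \<psi>" using S.N2_nonneg[of \<psi>] by (simp add: c_def)
  have "S.N2 (\<lambda>p. c * \<psi> p) = 1"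
    using S.ip_scaleR[of c \<psi>] S.ip_scaleR_right[of _ c \<psi>] c \<psi>(2) by (simp add: mult.assoc[symmetric])
  moreover have "N2 (D (\<lambda>p. c * \<psi> p)) = N2 (D \<psi>) / S.N2 \<psi>"
    using c by (simp add: D_scale[OF \<psi>(1)] ip_scaleR ip_scaleR_right mult.assoc[symmetric])
  ultimately show ?thesis using \<psi> by (intro bexI[of _ "\<lambda>p. c * \<psi> p"] T_scale) auto
qed

text \<open>Compactness of the embedding into \<open>L2\<close>, phrased by the Cauchy property; the
  limit then comes from completeness.\<close>

definition rellich :: bool where
  "rellich \<longleftrightarrow> (\<forall>\<phi> B. (\<forall>k. \<phi> k \<in> T \<and> S.N2 (\<phi> k) + N2 (D (\<phi> k)) \<le> B) \<longrightarrow>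
     (\<exists>r::nat\<Rightarrow>nat. strict_mono r \<and>
       (\<forall>e>0. \<exists>n0. \<forall>m\<ge>n0. \<forall>n\<ge>n0. S.N2 (\<lambda>p. \<phi> (r m) p - \<phi> (r n) p) \<le> e)))"

text \<open>The direct method. Compactness gives convergence of a normalized minimizing sequence in
  \<open>L2\<close> only; the parallelogram identity, with \<open>lam\<close> bounding the energy of
  the sum from below, lifts it to convergence of the gradients. The weak equation is then the
  vanishing first variation of the energy minus \<open>lam\<close> times the squared norm.\<close>

theorem eigenfunction_exists:
  assumes "rellich" and T: "\<phi>0 \<in> T" "S.N2 \<phi>0 \<noteq> 0"
  shows "\<exists>\<phi> f U. hconv \<phi> f U \<and> S.N2 f = 1 \<and> N2 U = lam \<and> (\<forall>\<psi>\<in>T. ip U (D \<psi>) = lam * S.ip f \<psi>)"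
proof -
  have "\<forall>k. \<exists>\<psi>. \<psi> \<in> T \<and> S.N2 \<psi> = 1 \<and> N2 (D \<psi>) < lam + 1 / real (Suc k)"
    using lam_approx[OF T] by (auto simp: Bex_def)
  then obtain \<phi> where \<phi>: "\<And>k. \<phi> k \<in> T" "\<And>k. S.N2 (\<phi> k) = 1" "\<And>k. N2 (D (\<phi> k)) < lam + 1 / real (Suc k)"
    by metis
  have "S.N2 (\<phi> k) + N2 (D (\<phi> k)) \<le> lam + 2" for k
  proof -
    have "1 / real (Suc k) \<le> 1" by simp
    then show ?thesis using \<phi>(2,3)[of k] by linarith
  qed
  then obtain r :: "nat \<Rightarrow> nat" where r: "strict_mono r"
    and cau: "\<And>e. e > 0 \<Longrightarrow> \<exists>n0. \<forall>m\<ge>n0. \<forall>n\<ge>n0. S.N2 (\<lambda>p. \<phi> (r m) p - \<phi> (r n) p) \<le> e"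
    using \<open>rellich\<close>[unfolded rellich_def, rule_format, of \<phi> "lam + 2"] \<phi>(1) by auto
  have lam0: "lam \<ge> 0" using lam_nonneg[OF T] .
  have rs: "1 / real (Suc (r k)) \<le> 1 / real (Suc k)" for k
    using seq_suble[OF r, of k] by (intro divide_left_mono) auto
  have lin: "L \<le> P \<Longrightarrow> x < l + a \<Longrightarrow> y < l + b \<Longrightarrow> a \<le> a' \<Longrightarrow> b \<le> b' \<Longrightarrow>
        2 * x + 2 * y - P \<le> 2 * (l + a') + 2 * (l + b') - L" for L P x y l a b a' b' :: real
    by argo
  have bd: "N2 (\<lambda>p. D (\<phi> (r m)) p - D (\<phi> (r n)) p) \<le> 2 / real (Suc m) + 2 / real (Suc n)
      + lam * S.N2 (\<lambda>p. \<phi> (r m) p - \<phi> (r n) p)" for m n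
  proof -
    have "N2 (\<lambda>p. D (\<phi> (r m)) p - D (\<phi> (r n)) p)
       = 2 * N2 (D (\<phi> (r m))) + 2 * N2 (D (\<phi> (r n))) - N2 (D (\<lambda>p. \<phi> (r m) p + \<phi> (r n) p))"
      using parallelogram[OF D_L2[OF \<phi>(1)] D_L2[OF \<phi>(1)]] by (simp add: D_add \<phi>)
    also have "\<dots> \<le> 2 * (lam + 1 / real (Suc m)) + 2 * (lam + 1 / real (Suc n)) - lam * S.N2 (\<lambda>p. \<phi> (r m) p + \<phi> (r n) p)"
      using lin[OF lam_le[OF T_add[OF \<phi>(1) \<phi>(1), of "r m" "r n"]] \<phi>(3)[of "r m"] \<phi>(3)[of "r n"] rs[of m] rs[of n]] .
    also have "S.N2 (\<lambda>p. \<phi> (r m) p + \<phi> (r n) p) = 4 - S.N2 (\<lambda>p. \<phi> (r m) p - \<phi> (r n) p)"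
      using S.parallelogram[OF T_L2[OF \<phi>(1)] T_L2[OF \<phi>(1)], of "r m" "r n"] \<phi>(2) by simp
    finally show ?thesis by (simp add: algebra_simps)
  qed
  have "\<exists>f U. hconv (\<lambda>k. \<phi> (r k)) f U"
  proof (rule hconv_exists)
    fix e :: real assume e: "e > 0"
    \<comment> \<open>The summand 1 guards the division, because \<open>lam\<close> may be
      zero.\<close>
    obtain n0 where n0: "\<forall>m\<ge>n0. \<forall>n\<ge>n0. S.N2 (\<lambda>p. \<phi> (r m) p - \<phi> (r n) p) \<le> e / (3 * (lam + 1))"
      using cau[of "e / (3 * (lam + 1))"] e lam0 by auto
    obtain n1 where n1: "6 / e < real n1" using reals_Archimedean2 by blast
    show "\<exists>n0. \<forall>m\<ge>n0. \<forall>n\<ge>n0. N2 (\<lambda>p. D (\<phi> (r m)) p - D (\<phi> (r n)) p) \<le> e"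
    proof (intro exI[of _ "max n0 n1"] allI impI)
      fix m n assume mn: "m \<ge> max n0 n1" "n \<ge> max n0 n1"
      have s: "2 / real (Suc k) \<le> e / 3" if "k \<ge> n1" for k
      proof -
        have "6 / e \<le> real (Suc k)" using n1 that by linarith
        then show ?thesis using e by (simp add: field_simps)
      qed
      have "lam * S.N2 (\<lambda>p. \<phi> (r m) p - \<phi> (r n) p) \<le> (lam + 1) * (e / (3 * (lam + 1)))"
        using n0 mn lam0 S.N2_nonneg by (intro mult_mono) auto
      then have "lam * S.N2 (\<lambda>p. \<phi> (r m) p - \<phi> (r n) p) \<le> e / 3"
        using lam0 nonzero_mult_divide_mult_cancel_left[of "lam + 1" e 3] by (simp add: mult.commute)
      then show "N2 (\<lambda>p. D (\<phi> (r m)) p - D (\<phi> (r n)) p) \<le> e"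
        using bd[of m n] s[of m] s[of n] mn by simp
    qed
  qed (use \<phi> cau in auto)
  then obtain f U where h: "hconv (\<lambda>k. \<phi> (r k)) f U" by auto
  note h' = hconvD[OF h]
  have N1: "S.N2 f = 1" using h'(8) \<phi>(2) by (simp add: LIMSEQ_const_iff)
  have NU: "N2 U = lam"
  proof (rule antisym)
    have "(\<lambda>k. lam + 1 / real (Suc k)) \<longlonglongrightarrow> lam + 0"
      by (intro tendsto_intros LIMSEQ_Suc[OF lim_1_over_n])
    then have "(\<lambda>k. lam + 1 / real (Suc k)) \<longlonglongrightarrow> lam" by simp
    from LIMSEQ_le[OF h'(9) this] show "N2 U \<le> lam"
      using \<phi>(3) rs by (meson add_left_mono less_imp_le order_trans)
    show "lam \<le> N2 U" using lam_le_hconv[OF h] N1 by simp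
  qed
  have "ip U (D \<psi>) = lam * S.ip f \<psi>" if \<psi>: "\<psi> \<in> T" for \<psi>
  proof -
    \<comment> \<open>The quadratic polynomial in \<open>t\<close> has constant term zero, since the
      infimum is attained at \<open>f\<close>; hence its linear coefficient vanishes.\<close>
    have "(ip U (D \<psi>) - lam * S.ip f \<psi>)\<^sup>2 \<le> 0 * (N2 (D \<psi>) - lam * S.N2 \<psi>)"
    proof (rule quadratic_nonneg_discriminant)
      fix t
      have "lam * S.N2 (\<lambda>p. f p + t * \<psi> p) \<le> N2 (\<lambda>p. U p + t *\<^sub>R D \<psi> p)"
        by (rule lam_le_hconv[OF hconv_line[OF h \<psi>]])
      then show "0 \<le> 0 + 2 * t * (ip U (D \<psi>) - lam * S.ip f \<psi>) + t\<^sup>2 * (N2 (D \<psi>) - lam * S.N2 \<psi>)"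
        using N2_line[OF h'(3) D_L2[OF \<psi>], of t] S.N2_line[OF h'(2) T_L2[OF \<psi>], of t] N1 NU
        by (simp add: algebra_simps)
    qed
    then show ?thesis by simp
  qed
  then show ?thesis using h N1 NU by blast
qed

end

section \<open>Smooth functions\<close>

lemma has_derivative_imp_frechet: "(f has_derivative f') (at x) \<Longrightarrow> frechet_derivative f (at x) = f'"
  using frechet_derivative_at by metis

lemma ck_cong:
  assumes "open S" "\<And>x. x \<in> S \<Longrightarrow> f x = g x" "ck_on k S f"
  shows "ck_on k S g"
  using assms(2,3)
proof (induction k arbitrary: f g)
  case 0
  then show ?case using continuous_on_cong[of S S f g] by simp
next
  case (Suc k)
  have d: "(g has_derivative frechet_derivative f (at x)) (at x)" if "x \<in> S" for x
  proof -
    have "(f has_derivative frechet_derivative f (at x)) (at x)"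
      using Suc.prems(2) that by (auto simp: frechet_derivative_works)
    then show ?thesis
      using has_derivative_transform_within_open[OF _ \<open>open S\<close> that, of f _ UNIV g] Suc.prems(1) by simp
  qed
  have "ck_on k S (\<lambda>x. frechet_derivative g (at x) v)" for v
    by (rule Suc.IH[of "\<lambda>x. frechet_derivative f (at x) v"])
      (use Suc.prems has_derivative_imp_frechet[OF d] in auto)
  then show ?case using d by (auto simp: differentiable_def)
qed

lemma ck_subset: "ck_on k S f \<Longrightarrow> T \<subseteq> S \<Longrightarrow> ck_on k T f"
  by (induction k arbitrary: f) (auto intro: continuous_on_subset)

lemma ck_Suc: "ck_on (Suc k) S f \<Longrightarrow> ck_on k S f"
proof (induction k arbitrary: f)
  case 0
  then show ?case by (auto intro!: differentiable_imp_continuous_on differentiable_at_imp_differentiable_on)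
next
  case (Suc k)
  have "ck_on k S (\<lambda>x. frechet_derivative f (at x) v)" for v
    using Suc.prems by (intro Suc.IH) simp
  then show ?case using Suc.prems by simp
qed

lemma ck_SucI:
  assumes "open S" "\<And>x. x \<in> S \<Longrightarrow> (f has_derivative f' x) (at x)" "\<And>v. ck_on k S (\<lambda>x. f' x v)"
  shows "ck_on (Suc k) S f"
proof -
  have "ck_on k S (\<lambda>x. frechet_derivative f (at x) v)" for v
    by (rule ck_cong[OF assms(1) _ assms(3)[of v]]) (simp add: has_derivative_imp_frechet[OF assms(2)])
  then show ?thesis using assms(2) by (auto simp: differentiable_def)
qed

lemma ck_has_derivative:
  "ck_on (Suc k) S f \<Longrightarrow> x \<in> S \<Longrightarrow> (f has_derivative frechet_derivative f (at x)) (at x)"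
  by (auto simp: frechet_derivative_works)

lemma ck_const: "open S \<Longrightarrow> ck_on k S (\<lambda>x. c)"
proof (induction k arbitrary: c)
  case (Suc k) then show ?case by (intro ck_SucI[where f' = "\<lambda>x v. 0"]) auto
qed auto

lemma ck_bounded_linear:
  assumes "bounded_linear h" "open S" "ck_on k S f"
  shows "ck_on k S (\<lambda>x. h (f x))"
  using assms(3)
proof (induction k arbitrary: f)
  case 0
  then show ?case using assms(1) by (auto intro: bounded_linear.continuous_on)
next
  case (Suc k)
  show ?case
    by (rule ck_SucI[OF assms(2) bounded_linear.has_derivative[OF assms(1) ck_has_derivative[OF Suc.prems]]])
      (use Suc in auto)
qed

lemma ck_id: "open S \<Longrightarrow> ck_on k S (\<lambda>x. x)"
proof (cases k)
  case (Suc j) then show "open S \<Longrightarrow> ?thesis" by (auto intro!: ck_SucI[where f' = "\<lambda>x v. v"] ck_const)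
qed auto

lemma ck_add:
  assumes "open S" "ck_on k S f" "ck_on k S g"
  shows "ck_on k S (\<lambda>x. f x + g x)"
  using assms(2,3)
proof (induction k arbitrary: f g)
  case 0 then show ?case by (auto intro: continuous_intros)
next
  case (Suc k)
  show ?case
    by (rule ck_SucI[OF assms(1) has_derivative_add[OF ck_has_derivative[OF Suc.prems(1)] ck_has_derivative[OF Suc.prems(2)]]])
      (use Suc in auto)
qed

lemma ck_mult:
  fixes f g :: "'a::real_normed_vector \<Rightarrow> real"
  assumes "open S" "ck_on k S f" "ck_on k S g"
  shows "ck_on k S (\<lambda>x. f x * g x)"
  using assms(2,3)
proof (induction k arbitrary: f g)
  case 0 then show ?case by (auto intro: continuous_intros)
next
  case (Suc k)
  show ?case
    by (rule ck_SucI[OF assms(1) has_derivative_mult[OF ck_has_derivative[OF Suc.prems(1)] ck_has_derivative[OF Suc.prems(2)]]])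
      (use Suc ck_Suc[OF Suc.prems(1)] ck_Suc[OF Suc.prems(2)] in \<open>auto intro!: ck_add assms(1)\<close>)
qed

text \<open>The derivative of \<open>E m (u x)\<close> contains \<open>E (Suc m) (u x)\<close>, so
  the induction has to run over a whole sequence of successive derivatives. The set \<open>I\<close>
  admits functions, such as real powers, that are smooth on a part of the line only.\<close>

lemma ck_comp_seq:
  fixes u :: "'a::real_normed_vector \<Rightarrow> real"
  assumes "open S" and E: "\<And>m t. t \<in> I \<Longrightarrow> (E m has_real_derivative E (Suc m) t) (at t)"
    and uI: "\<And>x. x \<in> S \<Longrightarrow> u x \<in> I" and "ck_on k S u"
  shows "ck_on k S (\<lambda>x. E m (u x))"
  using assms(4)
proof (induction k arbitrary: m)
  case 0
  have "continuous_on I (E m)" using E DERIV_continuous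
    by (metis continuous_at_imp_continuous_on)
  then show ?case using 0 uI by (auto intro!: continuous_on_compose2[of I "E m" S u])
next
  case (Suc k)
  have "((\<lambda>x. E m (u x)) has_derivative (\<lambda>v. frechet_derivative u (at x) v * E (Suc m) (u x))) (at x)" if "x \<in> S" for x
    using DERIV_compose_FDERIV[OF E[OF uI[OF that]] ck_has_derivative[OF Suc.prems that]] by simp
  then show ?case
    by (rule ck_SucI[OF assms(1)]) (use Suc ck_Suc[OF Suc.prems] in \<open>auto intro!: ck_mult assms(1)\<close>)
qed

text \<open>Evaluating the Frechet derivative at 1 is an operation on functions of one variable that
  can be iterated; linearity recovers the derivative from this single value.\<close>

lemma ck_seq_exists:
  fixes F :: "real \<Rightarrow> real"
  assumes "\<And>k. ck_on k UNIV F"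
  shows "\<exists>E. E 0 = F \<and> (\<forall>m t. (E m has_real_derivative E (Suc m) t) (at t))"
proof -
  define dd where "dd = (\<lambda>(G::real\<Rightarrow>real) t. frechet_derivative G (at t) 1)"
  have ck: "ck_on k UNIV ((dd ^^ m) F)" for k m
  proof (induction m arbitrary: k)
    case (Suc m)
    have "ck_on (Suc k) UNIV ((dd ^^ m) F)" by (rule Suc)
    then show ?case by (auto simp: dd_def)
  qed (use assms in auto)
  have "((dd ^^ m) F has_real_derivative (dd ^^ Suc m) F t) (at t)" for m t
  proof -
    have d: "((dd ^^ m) F has_derivative frechet_derivative ((dd ^^ m) F) (at t)) (at t)"
      by (rule ck_has_derivative[OF ck]) simp
    have "frechet_derivative ((dd ^^ m) F) (at t) = (*) ((dd ^^ Suc m) F t)"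
    proof (rule ext)
      fix v :: real
      have "frechet_derivative ((dd ^^ m) F) (at t) (v *\<^sub>R 1) = v *\<^sub>R frechet_derivative ((dd ^^ m) F) (at t) 1"
        by (rule linear_cmul[OF has_derivative_linear[OF d]])
      then show "frechet_derivative ((dd ^^ m) F) (at t) v = (dd ^^ Suc m) F t * v"
        by (simp add: dd_def mult.commute)
    qed
    then show ?thesis using d unfolding has_field_derivative_def by simp
  qed
  then show ?thesis by (intro exI[of _ "\<lambda>m. (dd ^^ m) F"]) auto
qed

lemma ck_comp:
  fixes u :: "'a::real_normed_vector \<Rightarrow> real" and F :: "real \<Rightarrow> real"
  assumes "open S" "\<And>k. ck_on k UNIV F" "ck_on k S u"
  shows "ck_on k S (\<lambda>x. F (u x))"
  using ck_seq_exists[OF assms(2)] ck_comp_seq[OF assms(1) _ _ assms(3), of UNIV] by (metis UNIV_I)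

lemma ck_powr:
  fixes u :: "'a::real_normed_vector \<Rightarrow> real"
  assumes "open S" "\<And>x. x \<in> S \<Longrightarrow> u x > 0" "ck_on k S u"
  shows "ck_on k S (\<lambda>x. u x powr a)"
proof -
  define E where "E m t = (\<Prod>i<m. a - real i) * t powr (a - real m)" for m :: nat and t :: real
  have "(E m has_real_derivative E (Suc m) t) (at t)" if "t \<in> {0<..}" for m t
    unfolding E_def using DERIV_cmult[OF has_real_derivative_powr[of t "a - real m"], of "\<Prod>i<m. a - real i"] that
    by (simp add: algebra_simps)
  then have "ck_on k S (\<lambda>x. E 0 (u x))"
    by (rule ck_comp_seq[OF assms(1) _ _ assms(3), of "{0<..}"]) (use assms(2) in auto)
  then show ?thesis by (simp add: E_def)
qed

text \<open>Both nonlinear functions of the proof have this form up to constants: the smoothed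
  absolute value with exponent \<open>1/2\<close> and the smoothed reciprocal with exponent
  \<open>-1/2\<close>.\<close>

lemma ck_regularized_powr:
  assumes "e > 0" shows "ck_on k UNIV (\<lambda>s::real. ((s + b)\<^sup>2 + e) powr a)"
  unfolding power2_eq_square using assms
  by (intro ck_powr ck_add ck_mult ck_id ck_const) (auto simp: add_nonneg_pos)

text \<open>A family closed under differentiation, so that smoothness follows by induction.\<close>

definition flat :: "nat \<Rightarrow> real \<Rightarrow> real" where
  "flat j t = (if t > 0 then inverse t ^ j * exp (- inverse t) else 0)"

lemma flat_tendsto_0: "(flat j \<longlongrightarrow> 0) (at_right 0)"
proof -
  have "((\<lambda>x::real. x ^ j * exp (- x)) \<longlongrightarrow> 0) at_top"
    using tendsto_power_div_exp_0[of j] by (simp add: exp_minus field_simps)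
  then have "((\<lambda>t. inverse t ^ j * exp (- inverse t)) \<longlongrightarrow> (0::real)) (at_right 0)"
    by (rule filterlim_compose[OF _ filterlim_inverse_at_top_right])
  then show ?thesis
    by (rule Lim_transform_eventually)
      (auto simp: flat_def eventually_at_right_field intro!: exI[of _ 1])
qed

lemma flat_DERIV: "(flat j has_real_derivative flat (j + 2) t - real j * flat (j + 1) t) (at t)"
proof -
  consider "t < 0" | "t = 0" | "t > 0" by linarith
  then show ?thesis
  proof cases
    case 1
    have "((\<lambda>_. 0) has_real_derivative 0) (at t)" by simp
    then have "(flat j has_real_derivative 0) (at t)"
      by (rule DERIV_cong_ev[OF refl _ refl, THEN iffD1, rotated])
        (use 1 eventually_nhds_in_open[of "{..<0}" t] in \<open>auto simp: flat_def elim!: eventually_mono\<close>)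
    then show ?thesis using 1 by (simp add: flat_def)
  next
    case 3
    have "((\<lambda>t. inverse t ^ j * exp (- inverse t)) has_real_derivative flat (j + 2) t - real j * flat (j + 1) t) (at t)"
    proof -
      have p: "((\<lambda>t. inverse t ^ j) has_real_derivative - real j * inverse t ^ (j + 1)) (at t)"
      proof (cases j)
        case (Suc n)
        show ?thesis using DERIV_power_Suc[OF DERIV_inverse[of t UNIV], of n] 3 unfolding Suc
          by (simp add: algebra_simps)
      qed simp
      have e: "((\<lambda>t. exp (- inverse t)) has_real_derivative exp (- inverse t) * inverse t ^ 2) (at t)"
        using 3 by (auto intro!: derivative_eq_intros simp: power2_eq_square)
      show ?thesis using DERIV_mult[OF p e] 3 by (simp add: flat_def algebra_simps power2_eq_square)
    qed
    then show ?thesis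
      by (rule DERIV_cong_ev[OF refl _ refl, THEN iffD1, rotated])
        (use 3 eventually_nhds_in_open[of "{0<..}" t] in \<open>auto simp: flat_def elim!: eventually_mono\<close>)
  next
    case 2
    \<comment> \<open>To the right of zero the difference quotient is again a member of the family,
      namely \<open>flat (Suc j)\<close>.\<close>
    have r: "((\<lambda>h. flat j h / h) \<longlongrightarrow> 0) (at_right 0)"
      by (rule Lim_transform_eventually[OF flat_tendsto_0[of "Suc j"]])
        (auto simp: flat_def field_simps eventually_at_right_field intro!: exI[of _ 1])
    have l: "((\<lambda>h. flat j h / h) \<longlongrightarrow> 0) (at_left 0)"
      by (rule Lim_transform_eventually[OF tendsto_const])
        (auto simp: flat_def eventually_at_left_field intro!: exI[of _ "-1"])
    have "((\<lambda>h. flat j h / h) \<longlongrightarrow> 0) (at 0)" using r l by (simp add: filterlim_at_split)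
    then show ?thesis using 2 by (simp add: DERIV_def flat_def)
  qed
qed

lemma ck_flat: "ck_on k UNIV (flat j)"
proof (induction k arbitrary: j)
  case 0
  then show ?case using DERIV_isCont[OF flat_DERIV] by (auto intro!: continuous_at_imp_continuous_on)
next
  case (Suc k)
  have "ck_on k UNIV (\<lambda>x. (flat (j + 2) x + (- real j) * flat (j + 1) x) * v)" for v
    by (intro ck_mult ck_add ck_const Suc) auto
  then show ?case
    by (intro ck_SucI[where f' = "\<lambda>x v. (flat (j + 2) x - real j * flat (j + 1) x) * v"])
      (use flat_DERIV in \<open>auto simp: has_field_derivative_def\<close>)
qed

section \<open>Smoothness on sets that need not be open\<close>

lemma smooth_onE:
  assumes "smooth_on S f" "x \<in> S"
  obtains V F where "open V" "x \<in> V" "\<And>k. ck_on k V F" "\<And>y. y \<in> S \<Longrightarrow> y \<in> V \<Longrightarrow> F y = f y"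
proof -
  obtain V F where "open V \<and> x \<in> V \<and> (\<forall>k. ck_on k V F) \<and> (\<forall>y\<in>S \<inter> V. F y = f y)"
    using bspec[OF assms(1)[unfolded smooth_on_def] assms(2)] by (elim exE)
  then show ?thesis by (intro that[of V F]) simp_all
qed

lemma smooth_onI:
  assumes "\<And>x. x \<in> S \<Longrightarrow> \<exists>V F. open V \<and> x \<in> V \<and> (\<forall>k. ck_on k V F) \<and> (\<forall>y\<in>S \<inter> V. F y = f y)"
  shows "smooth_on S f"
  unfolding smooth_on_def using assms by (rule ballI)

lemma smooth_on_const: "smooth_on S (\<lambda>x. c)"
  by (rule smooth_onI) (auto intro!: exI[of _ UNIV] exI[of _ "\<lambda>x. c"] ck_const)

lemma smooth_on_cong: "(\<And>x. x \<in> S \<Longrightarrow> f x = g x) \<Longrightarrow> smooth_on S f \<Longrightarrow> smooth_on S g"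
  unfolding smooth_on_def by simp

lemma smooth_on_local:
  assumes "\<And>x. x \<in> S \<Longrightarrow> \<exists>U. open U \<and> x \<in> U \<and> smooth_on (S \<inter> U) f"
  shows "smooth_on S f"
proof (rule smooth_onI)
  fix x assume "x \<in> S"
  then obtain U where U: "open U" "x \<in> U" "smooth_on (S \<inter> U) f" using assms by blast
  obtain V F where V: "open V" "x \<in> V" "\<And>k. ck_on k V F" "\<And>y. y \<in> S \<inter> U \<Longrightarrow> y \<in> V \<Longrightarrow> F y = f y"
    using smooth_onE[OF U(3), of x] U \<open>x \<in> S\<close> by auto
  show "\<exists>V F. open V \<and> x \<in> V \<and> (\<forall>k. ck_on k V F) \<and> (\<forall>y\<in>S \<inter> V. F y = f y)"
    by (intro exI[of _ "V \<inter> U"] exI[of _ F]) (use U V ck_subset[OF V(3), of "V \<inter> U"] in auto)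
qed

lemma smooth_on_bounded_linear:
  assumes "bounded_linear h" "smooth_on S f" shows "smooth_on S (\<lambda>x. h (f x))"
proof (rule smooth_onI)
  fix x assume "x \<in> S"
  from smooth_onE[OF assms(2) this] obtain V F where V: "open V" "x \<in> V" "\<And>k. ck_on k V F" "\<And>y. y \<in> S \<Longrightarrow> y \<in> V \<Longrightarrow> F y = f y"
    by metis
  have "ck_on k V (\<lambda>x. h (F x))" for k by (rule ck_bounded_linear[OF assms(1) V(1) V(3)])
  then show "\<exists>V F. open V \<and> x \<in> V \<and> (\<forall>k. ck_on k V F) \<and> (\<forall>y\<in>S \<inter> V. F y = h (f y))"
    by (intro exI[of _ V] exI[of _ "\<lambda>x. h (F x)"]) (use V in auto)
qed

lemma smooth_on_combine:
  fixes S :: "'a::real_normed_vector set"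
  assumes "smooth_on S f" "smooth_on S g"
    and "\<And>(V :: 'a set) F G k. open V \<Longrightarrow> (\<And>k. ck_on k V F) \<Longrightarrow> (\<And>k. ck_on k V G) \<Longrightarrow> ck_on k V (\<lambda>x. H (F x) (G x))"
  shows "smooth_on S (\<lambda>x. H (f x) (g x))"
proof (rule smooth_onI)
  fix x assume x: "x \<in> S"
  from smooth_onE[OF assms(1) this] obtain V F where V: "open V" "x \<in> V" "\<And>k. ck_on k V F" "\<And>y. y \<in> S \<Longrightarrow> y \<in> V \<Longrightarrow> F y = f y"
    by metis
  from smooth_onE[OF assms(2) x] obtain W G where W: "open W" "x \<in> W" "\<And>k. ck_on k W G" "\<And>y. y \<in> S \<Longrightarrow> y \<in> W \<Longrightarrow> G y = g y"
    by metis
  have "ck_on k (V \<inter> W) (\<lambda>x. H (F x) (G x))" for k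
    by (rule assms(3)) (use V W in \<open>auto intro: ck_subset[OF V(3)] ck_subset[OF W(3)]\<close>)
  then show "\<exists>V F. open V \<and> x \<in> V \<and> (\<forall>k. ck_on k V F) \<and> (\<forall>y\<in>S \<inter> V. F y = H (f y) (g y))"
    by (intro exI[of _ "V \<inter> W"] exI[of _ "\<lambda>x. H (F x) (G x)"]) (use V W in auto)
qed

lemma smooth_on_add: "smooth_on S f \<Longrightarrow> smooth_on S g \<Longrightarrow> smooth_on S (\<lambda>x. f x + g x)"
  by (rule smooth_on_combine) (auto intro: ck_add)

lemma smooth_on_mult:
  fixes f g :: "'a::real_normed_vector \<Rightarrow> real"
  shows "smooth_on S f \<Longrightarrow> smooth_on S g \<Longrightarrow> smooth_on S (\<lambda>x. f x * g x)"
  by (rule smooth_on_combine) (auto intro: ck_mult)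

lemma smooth_on_comp:
  fixes f :: "'a::real_normed_vector \<Rightarrow> real" and F :: "real \<Rightarrow> real"
  assumes "\<And>k. ck_on k UNIV F"
  shows "smooth_on S f \<Longrightarrow> smooth_on S (\<lambda>x. F (f x))"
  using smooth_on_combine[of S f f "\<lambda>a b. F a"] ck_comp[OF _ assms] by blast

lemma smooth_on_prod:
  fixes f :: "'i \<Rightarrow> 'a::real_normed_vector \<Rightarrow> real"
  assumes "finite I" "\<And>i. i \<in> I \<Longrightarrow> smooth_on S (f i)"
  shows "smooth_on S (\<lambda>x. \<Prod>i\<in>I. f i x)"
  using assms by (induction I rule: finite_induct) (auto intro: smooth_on_const smooth_on_mult)

section \<open>Vector fields from the resolvent equation\<close>

text \<open>The shape in which dominated convergence occurs below: a fixed integrable factor such as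
  the squared length of \<open>U\<close>, multiplied by bounded nonlinear functions of
  approximations that converge almost everywhere.\<close>

lemma tendsto_L1_mult_bounded:
  fixes g :: "'a \<Rightarrow> real"
  assumes g: "integrable \<mu> g" and [measurable]: "\<And>k::nat. u k \<in> borel_measurable \<mu>"
    and c: "AE x in \<mu>. (\<lambda>k. u k x) \<longlonglongrightarrow> v x" and [measurable]: "v \<in> borel_measurable \<mu>"
    and b: "\<And>k x. \<bar>u k x\<bar> \<le> B"
  shows "(\<lambda>k. \<integral>x. u k x * g x \<partial>\<mu>) \<longlonglongrightarrow> (\<integral>x. v x * g x \<partial>\<mu>)"
proof (rule integral_dominated_convergence[where w = "\<lambda>x. B * \<bar>g x\<bar>"])
  have [measurable]: "g \<in> borel_measurable \<mu>" using g by (rule borel_measurable_integrable)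
  show "(\<lambda>x. v x * g x) \<in> borel_measurable \<mu>" "\<And>k. (\<lambda>x. u k x * g x) \<in> borel_measurable \<mu>" by measurable
  show "integrable \<mu> (\<lambda>x. B * \<bar>g x\<bar>)" using g by auto
  show "AE x in \<mu>. (\<lambda>k. u k x * g x) \<longlonglongrightarrow> v x * g x"
    using c by eventually_elim (intro tendsto_mult tendsto_const)
  show "AE x in \<mu>. norm (u k x * g x) \<le> B * \<bar>g x\<bar>" for k
    using b by (auto simp: abs_mult intro!: mult_right_mono)
qed

context dirichlet_form
begin

text \<open>The absolute value leaves the class of test functions; its substitute
  \<open>sqrt (s^2 + \<epsilon>^2) - \<epsilon>\<close> is smooth, vanishes at 0 and has slope at
  most 1, hence does not increase the energy.\<close>

lemma nonneg_replacement:
  assumes \<phi>: "\<phi> \<in> T" and \<epsilon>: "\<epsilon> > 0"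
  shows "\<exists>\<psi>\<in>T. (\<forall>p. 0 \<le> \<psi> p \<and> \<psi> p \<le> \<bar>\<phi> p\<bar> \<and> \<bar>\<phi> p\<bar> - \<epsilon> \<le> \<psi> p) \<and> N2 (D \<psi>) \<le> N2 (D \<phi>)"
proof -
  define F where "F s = sqrt (s\<^sup>2 + \<epsilon>\<^sup>2) - \<epsilon>" for s
  define F' where "F' s = s / sqrt (s\<^sup>2 + \<epsilon>\<^sup>2)" for s
  have pos: "s\<^sup>2 + \<epsilon>\<^sup>2 > 0" for s using \<epsilon> by (simp add: add_nonneg_pos)
  have ck: "ck_on k UNIV F" for k
  proof -
    have "ck_on k UNIV (\<lambda>s. ((s + 0)\<^sup>2 + \<epsilon>\<^sup>2) powr (1/2) + (- \<epsilon>))"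
      using \<epsilon> by (intro ck_add ck_regularized_powr ck_const) auto
    moreover have "(\<lambda>s. ((s + 0)\<^sup>2 + \<epsilon>\<^sup>2) powr (1/2) + (- \<epsilon>)) = F"
      using pos by (auto simp: F_def powr_half_sqrt less_imp_le)
    ultimately show ?thesis by simp
  qed
  have d: "(F has_real_derivative F' s) (at s)" for s
    unfolding F_def F'_def using pos[of s] by (auto intro!: derivative_eq_intros simp: field_simps)
  have F'1: "\<bar>F' s\<bar> \<le> 1" for s
  proof -
    have "\<bar>s\<bar> \<le> sqrt (s\<^sup>2 + \<epsilon>\<^sup>2)" by (rule real_le_rsqrt) simp
    then show ?thesis using pos[of s] by (simp add: F'_def)
  qed
  have F0: "F 0 = 0" using \<epsilon> by (simp add: F_def)
  show ?thesis
  proof (intro bexI[of _ "\<lambda>p. F (\<phi> p)"] conjI allI)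
    show "(\<lambda>p. F (\<phi> p)) \<in> T" by (rule T_comp[OF \<phi> ck d F0])
    fix p
    have "\<epsilon> \<le> sqrt ((\<phi> p)\<^sup>2 + \<epsilon>\<^sup>2)" by (rule real_le_rsqrt) simp
    then show "0 \<le> F (\<phi> p)" by (simp add: F_def)
    have "\<bar>\<phi> p\<bar> \<le> sqrt ((\<phi> p)\<^sup>2 + \<epsilon>\<^sup>2)" by (rule real_le_rsqrt) simp
    then show "\<bar>\<phi> p\<bar> - \<epsilon> \<le> F (\<phi> p)" by (simp add: F_def)
    have "sqrt ((\<phi> p)\<^sup>2 + \<epsilon>\<^sup>2) \<le> \<bar>\<phi> p\<bar> + \<epsilon>"
      using \<epsilon> by (intro real_le_lsqrt) (auto simp: power2_sum)
    then show "F (\<phi> p) \<le> \<bar>\<phi> p\<bar>" by (simp add: F_def)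
  next
    have m: "(\<lambda>p. F' (\<phi> p)) \<in> borel_measurable \<mu>"
      unfolding F'_def using T_meas[OF \<phi>] by measurable
    show "N2 (D (\<lambda>p. F (\<phi> p))) \<le> N2 (D \<phi>)"
      using L2_bounded_mult(2)[OF D_L2[OF \<phi>] m F'1] D_comp[OF \<phi> ck d] by simp
  qed
qed

text \<open>Minimizing \<open>\<integral>\<bar>D \<phi>\<bar>\<^sup>2 - m \<phi>\<^sup>2 - 2 \<phi>\<close> solves \<open>- \<Delta> w - m w = 1\<close>; restricting to a
  minimizing sequence of nonnegative functions replaces the minimum principle.\<close>

lemma resolvent_exists:
  assumes fin: "finite_measure \<mu>" and m: "0 < m" "m < lam"
    and T: "\<phi>0 \<in> T"
  shows "\<exists>\<phi> w U. hconv \<phi> w U \<and> (AE p in \<mu>. 0 \<le> w p) \<and>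
    (\<forall>\<psi>\<in>T. ip U (D \<psi>) = m * S.ip w \<psi> + (\<integral>p. \<psi> p \<partial>\<mu>))"
proof -
  interpret finite_measure \<mu> by fact
  define V where "V = measure \<mu> (space \<mu>)"
  have one: "(\<lambda>_. 1) \<in> S.L2" by (auto simp: S.L2_def)
  have L1: "integrable \<mu> f" if "f \<in> S.L2" for f using S.L2_integrable[OF that one] by simp
  define J where "J f U = N2 U - m * S.N2 f - 2 * (\<integral>p. f p \<partial>\<mu>)" for f U
  \<comment> \<open>The strict gap \<open>lam - m\<close> absorbs the linear term:
    \<open>2 a \<le> c a^2 + 1/c\<close> with \<open>c = lam - m\<close>, integrated over a space of
    finite measure.\<close>
  have Jlow: "J \<phi> (D \<phi>) \<ge> - V / (lam - m)" if \<phi>: "\<phi> \<in> T" for \<phi>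
  proof -
    define c where "c = lam - m"
    have c: "c > 0" using m by (simp add: c_def)
    have "2 * a \<le> c * (a * a) + 1 / c" for a
    proof -
      have "0 \<le> (c * a - 1)\<^sup>2 / c" using c by simp
      also have "\<dots> = c * (a * a) + 1 / c - 2 * a" using c by (simp add: field_simps power2_eq_square)
      finally show ?thesis by simp
    qed
    then have "(\<integral>p. 2 * \<phi> p \<partial>\<mu>) \<le> (\<integral>p. c * (\<phi> p * \<phi> p) + 1 / c \<partial>\<mu>)"
      using L1[OF T_L2[OF \<phi>]] S.L2_integrable[OF T_L2[OF \<phi>] T_L2[OF \<phi>]] by (intro integral_mono) auto
    also have "\<dots> = c * S.N2 \<phi> + V / c"
      using S.L2_integrable[OF T_L2[OF \<phi>] T_L2[OF \<phi>]] by (simp add: S.ip_def V_def)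
    finally have "2 * (\<integral>p. \<phi> p \<partial>\<mu>) \<le> c * S.N2 \<phi> + V / c" by simp
    then show ?thesis using lam_le[OF \<phi>] unfolding J_def c_def by (simp add: algebra_simps)
  qed
  define m0 where "m0 = Inf ((\<lambda>\<phi>. J \<phi> (D \<phi>)) ` T)"
  have bdd: "bdd_below ((\<lambda>\<phi>. J \<phi> (D \<phi>)) ` T)" by (rule bdd_belowI2[OF Jlow])
  have m0_le: "m0 \<le> J \<phi> (D \<phi>)" if "\<phi> \<in> T" for \<phi>
    unfolding m0_def using that bdd by (intro cInf_lower) auto
  have ex: "\<exists>\<psi>\<in>T. (\<forall>p. 0 \<le> \<psi> p) \<and> J \<psi> (D \<psi>) < m0 + e" if e: "e > 0" for e
  proof -
    have "\<exists>y\<in>(\<lambda>\<phi>. J \<phi> (D \<phi>)) ` T. y < m0 + e / 2"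
      unfolding m0_def by (rule cInf_lessD) (use T e in auto)
    then obtain \<phi> where \<phi>: "\<phi> \<in> T" "J \<phi> (D \<phi>) < m0 + e / 2" by auto
    note i1 = L1[OF T_L2[OF \<phi>(1)]] and i2 = S.L2_integrable[OF T_L2[OF \<phi>(1)] T_L2[OF \<phi>(1)]]
    \<comment> \<open>Replacing \<open>\<phi>\<close> by a nonnegative function within \<epsilon> of
      its absolute value raises \<open>J\<close> by at most \<open>K * \<epsilon>\<close>: the first
      summand is the loss in the mass term, the second the loss in the linear term.\<close>
    define K where "K = 2 * m * (\<integral>p. \<bar>\<phi> p\<bar> \<partial>\<mu>) + 2 * V"
    have K: "K \<ge> 0" unfolding K_def V_def using m by auto
    define \<epsilon> where "\<epsilon> = e / (2 * (K + 1))"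
    have \<epsilon>: "\<epsilon> > 0" "K * \<epsilon> < e / 2" using K e by (auto simp: \<epsilon>_def field_simps)
    obtain \<psi> where \<psi>: "\<psi> \<in> T" "\<And>p. 0 \<le> \<psi> p" "\<And>p. \<psi> p \<le> \<bar>\<phi> p\<bar>" "\<And>p. \<bar>\<phi> p\<bar> - \<epsilon> \<le> \<psi> p" "N2 (D \<psi>) \<le> N2 (D \<phi>)"
      using nonneg_replacement[OF \<phi>(1) \<epsilon>(1)] by blast
    note j1 = L1[OF T_L2[OF \<psi>(1)]] and j2 = S.L2_integrable[OF T_L2[OF \<psi>(1)] T_L2[OF \<psi>(1)]]
    have "(\<integral>p. \<phi> p * \<phi> p - 2 * \<epsilon> * \<bar>\<phi> p\<bar> \<partial>\<mu>) \<le> S.N2 \<psi>"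
      unfolding S.ip_def
    proof (rule integral_mono)
      fix p
      show "\<phi> p * \<phi> p - 2 * \<epsilon> * \<bar>\<phi> p\<bar> \<le> \<psi> p * \<psi> p"
      proof (cases "\<bar>\<phi> p\<bar> \<ge> \<epsilon>")
        case True
        then have "(\<bar>\<phi> p\<bar> - \<epsilon>) * (\<bar>\<phi> p\<bar> - \<epsilon>) \<le> \<psi> p * \<psi> p" using \<psi>(4)[of p] by (intro mult_mono) auto
        moreover have "\<phi> p * \<phi> p = \<bar>\<phi> p\<bar> * \<bar>\<phi> p\<bar>" by simp
        moreover have "(x - \<epsilon>) * (x - \<epsilon>) = x * x - 2 * \<epsilon> * x + \<epsilon> * \<epsilon>" for x by (simp add: algebra_simps)
        ultimately show ?thesis using zero_le_square[of \<epsilon>] by argo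
      next
        case False
        then have "\<bar>\<phi> p\<bar> * \<bar>\<phi> p\<bar> \<le> \<epsilon> * \<bar>\<phi> p\<bar>" by (intro mult_right_mono) auto
        moreover have "\<phi> p * \<phi> p = \<bar>\<phi> p\<bar> * \<bar>\<phi> p\<bar>" by simp
        moreover have "0 \<le> \<epsilon> * \<bar>\<phi> p\<bar>" using \<epsilon> by auto
        moreover have "0 \<le> \<psi> p * \<psi> p" by simp
        ultimately show ?thesis by linarith
      qed
    qed (use i1 i2 j2 in auto)
    then have a: "S.N2 \<phi> - 2 * \<epsilon> * (\<integral>p. \<bar>\<phi> p\<bar> \<partial>\<mu>) \<le> S.N2 \<psi>"
      using i1 i2 by (simp add: S.ip_def)
    have "(\<integral>p. \<phi> p - \<epsilon> \<partial>\<mu>) \<le> (\<integral>p. \<psi> p \<partial>\<mu>)"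
    proof (rule integral_mono)
      show "\<phi> p - \<epsilon> \<le> \<psi> p" for p using \<psi>(4)[of p] by linarith
    qed (use i1 j1 in auto)
    then have b: "(\<integral>p. \<phi> p \<partial>\<mu>) - \<epsilon> * V \<le> (\<integral>p. \<psi> p \<partial>\<mu>)" using i1 by (simp add: V_def mult.commute)
    have "J \<psi> (D \<psi>) \<le> J \<phi> (D \<phi>) + K * \<epsilon>"
      using mult_left_mono[OF a, of m] b \<psi>(5) m unfolding J_def K_def by (simp add: algebra_simps)
    then show ?thesis using \<psi> \<phi> \<epsilon> by (intro bexI[of _ \<psi>]) auto
  qed
  have "\<forall>k. \<exists>\<psi>. \<psi> \<in> T \<and> (\<forall>p. 0 \<le> \<psi> p) \<and> J \<psi> (D \<psi>) < m0 + 1 / real (Suc k)"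
    using ex by (auto simp: Bex_def)
  then obtain \<phi> where \<phi>: "\<And>k. \<phi> k \<in> T" "\<And>k p. 0 \<le> \<phi> k p" "\<And>k. J (\<phi> k) (D (\<phi> k)) < m0 + 1 / real (Suc k)"
    by metis
  define c where "c = lam - m"
  have c: "c > 0" using m by (simp add: c_def)
  \<comment> \<open>Uniform convexity of \<open>J\<close>: compared with the midpoint, which has
    value at least \<open>m0\<close>, the linear terms cancel and the parallelogram identity leaves
    the quadratic part of the difference.\<close>
  have B: "N2 (\<lambda>p. D (\<phi> k) p - D (\<phi> l) p) - m * S.N2 (\<lambda>p. \<phi> k p - \<phi> l p) \<le> 2 / real (Suc k) + 2 / real (Suc l)" for k l
  proof -
    define s where "s = (\<lambda>p. (1/2) * (\<phi> k p + \<phi> l p))"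
    have s: "s \<in> T" unfolding s_def by (intro T_scale T_add \<phi>)
    have Ds: "D s = (\<lambda>p. (1/2) *\<^sub>R (D (\<phi> k) p + D (\<phi> l) p))" unfolding s_def
      by (simp only: D_scale[OF T_add[OF \<phi>(1) \<phi>(1)]] D_add[OF \<phi>(1) \<phi>(1)])
    have 1: "N2 (D s) = N2 (\<lambda>p. D (\<phi> k) p + D (\<phi> l) p) / 4" unfolding Ds by (simp add: ip_scaleR ip_scaleR_right)
    have 2: "S.N2 s = S.N2 (\<lambda>p. \<phi> k p + \<phi> l p) / 4"
    proof -
      have "S.N2 (\<lambda>p. (1/2) *\<^sub>R (\<phi> k p + \<phi> l p)) = (1/2) * ((1/2) * S.N2 (\<lambda>p. \<phi> k p + \<phi> l p))"
        by (simp only: S.ip_scaleR S.ip_scaleR_right)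
      then show ?thesis unfolding s_def by simp
    qed
    have 3: "2 * (\<integral>p. s p \<partial>\<mu>) = (\<integral>p. \<phi> k p \<partial>\<mu>) + (\<integral>p. \<phi> l p \<partial>\<mu>)"
      unfolding s_def using L1[OF T_L2[OF \<phi>(1)]] by simp
    have 4: "N2 (\<lambda>p. D (\<phi> k) p - D (\<phi> l) p) = 2 * N2 (D (\<phi> k)) + 2 * N2 (D (\<phi> l)) - 4 * N2 (D s)"
      using parallelogram[OF D_L2[OF \<phi>(1)] D_L2[OF \<phi>(1)], of k l] 1 by simp
    have 5: "S.N2 (\<lambda>p. \<phi> k p - \<phi> l p) = 2 * S.N2 (\<phi> k) + 2 * S.N2 (\<phi> l) - 4 * S.N2 s"
      using S.parallelogram[OF T_L2[OF \<phi>(1)] T_L2[OF \<phi>(1)], of k l] 2 by simp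
    have "N2 (\<lambda>p. D (\<phi> k) p - D (\<phi> l) p) - m * S.N2 (\<lambda>p. \<phi> k p - \<phi> l p)
       = 2 * J (\<phi> k) (D (\<phi> k)) + 2 * J (\<phi> l) (D (\<phi> l)) - 4 * J s (D s)"
      unfolding J_def 4 5 using 3 by (simp add: algebra_simps)
    also have "\<dots> \<le> 2 / real (Suc k) + 2 / real (Suc l)"
      using m0_le[OF s] \<phi>(3)[of k] \<phi>(3)[of l] by argo
    finally show ?thesis .
  qed
  have cS: "c * S.N2 (\<lambda>p. \<phi> k p - \<phi> l p) \<le> 2 / real (Suc k) + 2 / real (Suc l)" for k l
    using B[of k l] lam_le[OF T_diff[OF \<phi>(1) \<phi>(1), of k l]] unfolding c_def D_diff[OF \<phi>(1) \<phi>(1)]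
    by (simp add: algebra_simps)
  \<comment> \<open>Adding \<open>c\<close> times the previous bound and \<open>m\<close> times the
    bound on the squared norms; the factor on the right is \<open>c + m = lam\<close>.\<close>
  have cN: "c * N2 (\<lambda>p. D (\<phi> k) p - D (\<phi> l) p) \<le> lam * (2 / real (Suc k) + 2 / real (Suc l))" for k l
  proof -
    define x where "x = N2 (\<lambda>p. D (\<phi> k) p - D (\<phi> l) p)"
    define y where "y = S.N2 (\<lambda>p. \<phi> k p - \<phi> l p)"
    define z where "z = 2 / real (Suc k) + 2 / real (Suc l)"
    have "c * (x - m * y) \<le> c * z" using B[of k l] c unfolding x_def y_def z_def by (intro mult_left_mono) auto
    moreover have "m * (c * y) \<le> m * z" using cS[of k l] m unfolding y_def z_def by (intro mult_left_mono) auto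
    ultimately show ?thesis unfolding x_def[symmetric] z_def[symmetric] by (simp add: c_def algebra_simps)
  qed
  have small: "\<exists>n0. \<forall>k\<ge>n0. \<forall>l\<ge>n0. f k l \<le> e"
    if "A > 0" "e > 0" "\<And>k l. c * f k l \<le> A * (2 / real (Suc k) + 2 / real (Suc l))" for f :: "nat \<Rightarrow> nat \<Rightarrow> real" and A e :: real
  proof -
    obtain n0 where n0: "4 * A / (c * e) < real n0" using reals_Archimedean2 by blast
    have "f k l \<le> e" if "k \<ge> n0" "l \<ge> n0" for k l
    proof -
      have s: "2 / real (Suc k) \<le> c * e / (2 * A)" if "k \<ge> n0" for k
      proof -
        have "4 * A / (c * e) \<le> real (Suc k)" using n0 that by linarith
        then show ?thesis using \<open>A > 0\<close> \<open>e > 0\<close> c by (simp add: field_simps)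
      qed
      have "c * f k l \<le> A * (c * e / (2 * A) + c * e / (2 * A))"
        using \<open>A > 0\<close> s[of k] s[of l] that
        by (intro order_trans[OF \<open>\<And>k l. c * f k l \<le> A * (2 / real (Suc k) + 2 / real (Suc l))\<close>] mult_left_mono add_mono) auto
      also have "\<dots> = c * e" using \<open>A > 0\<close> by simp
      finally show ?thesis using c by simp
    qed
    then show ?thesis by blast
  qed
  have "\<exists>w U. hconv \<phi> w U"
  proof (rule hconv_exists[OF \<phi>(1)])
    fix e :: real assume "e > 0"
    show "\<exists>n0. \<forall>k\<ge>n0. \<forall>n\<ge>n0. S.N2 (\<lambda>p. \<phi> k p - \<phi> n p) \<le> e"
      by (rule small[of 1]) (use cS \<open>e > 0\<close> in auto)
    show "\<exists>n0. \<forall>k\<ge>n0. \<forall>n\<ge>n0. N2 (\<lambda>p. D (\<phi> k) p - D (\<phi> n) p) \<le> e"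
      by (rule small[of lam]) (use cN \<open>e > 0\<close> m in auto)
  qed
  then obtain w U where h: "hconv \<phi> w U" by blast
  note h' = hconvD[OF h]
  have wm: "w \<in> borel_measurable \<mu>" using h'(2) by (simp add: S.L2_def)
  have w_nonneg: "AE p in \<mu>. 0 \<le> w p"
  proof -
    \<comment> \<open>Since the approximating functions are nonnegative, the negative part of
      \<open>w\<close> is pointwise at most their distance to \<open>w\<close>, which tends to zero
      in \<open>L2\<close>.\<close>
    define g where "g p = min (w p) 0" for p
    have gm[measurable]: "g \<in> borel_measurable \<mu>" unfolding g_def using wm by measurable
    have gi: "integrable \<mu> (\<lambda>p. g p * g p)"
    proof (rule Bochner_Integration.integrable_bound[OF S.L2_integrable[OF h'(2) h'(2)]])
      show "(\<lambda>p. g p * g p) \<in> borel_measurable \<mu>" by measurable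
    qed (auto simp: g_def abs_mult min_def)
    have "(\<integral>p. g p * g p \<partial>\<mu>) \<le> S.N2 (\<lambda>p. \<phi> k p - w p)" for k
      unfolding S.ip_def
    proof (rule integral_mono[OF gi])
      show "integrable \<mu> (\<lambda>p. (\<phi> k p - w p) * (\<phi> k p - w p))"
        using S.L2_diff[OF h'(4) h'(2)] S.L2_integrable by auto
      fix p
      show "g p * g p \<le> (\<phi> k p - w p) * (\<phi> k p - w p)"
      proof (cases "w p \<ge> 0")
        case False
        then have "(- w p) * (- w p) \<le> (\<phi> k p - w p) * (\<phi> k p - w p)" using \<phi>(2)[of k p] by (intro mult_mono) auto
        then show ?thesis using False by (simp add: g_def min_def)
      qed (simp add: g_def)
    qed
    then have "(\<integral>p. g p * g p \<partial>\<mu>) \<le> 0"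
      by (intro LIMSEQ_le_const[OF h'(6)]) auto
    then have "(\<integral>p. g p * g p \<partial>\<mu>) = 0" by (intro antisym) auto
    then have "AE p in \<mu>. g p * g p = 0" using integral_nonneg_eq_0_iff_AE[OF gi] by auto
    then show ?thesis by eventually_elim (auto simp: g_def min_def split: if_splits)
  qed
  have Jlim: "m0 \<le> J f W" if hc: "hconv \<xi> f W" for \<xi> f W
  proof (rule LIMSEQ_le_const)
    have "(\<lambda>k. S.ip (\<xi> k) (\<lambda>_. 1)) \<longlonglongrightarrow> S.ip f (\<lambda>_. 1)"
      by (rule S.ip_tendsto_left) (use hconvD[OF hc] one in auto)
    then show "(\<lambda>k. J (\<xi> k) (D (\<xi> k))) \<longlonglongrightarrow> J f W"
      unfolding J_def using hconvD(8,9)[OF hc] by (intro tendsto_intros) (auto simp: S.ip_def)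
    show "\<exists>N. \<forall>n\<ge>N. m0 \<le> J (\<xi> n) (D (\<xi> n))" using m0_le hconvD(1)[OF hc] by auto
  qed
  have Jw: "J w U = m0"
  proof (rule antisym[OF _ Jlim[OF h]])
    have "(\<lambda>k. S.ip (\<phi> k) (\<lambda>_. 1)) \<longlonglongrightarrow> S.ip w (\<lambda>_. 1)"
      by (rule S.ip_tendsto_left) (use h' one in auto)
    then have 1: "(\<lambda>k. J (\<phi> k) (D (\<phi> k))) \<longlonglongrightarrow> J w U"
      unfolding J_def using h'(8,9) by (intro tendsto_intros) (auto simp: S.ip_def)
    have "(\<lambda>k. m0 + 1 / real (Suc k)) \<longlonglongrightarrow> m0 + 0"
      by (intro tendsto_intros LIMSEQ_Suc[OF lim_1_over_n])
    then have 2: "(\<lambda>k. m0 + 1 / real (Suc k)) \<longlonglongrightarrow> m0" by simp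
    show "J w U \<le> m0" by (rule LIMSEQ_le[OF 1 2]) (use \<phi>(3) in \<open>auto intro: less_imp_le\<close>)
  qed
  have weak: "ip U (D \<psi>) = m * S.ip w \<psi> + (\<integral>p. \<psi> p \<partial>\<mu>)" if \<psi>: "\<psi> \<in> T" for \<psi>
  proof -
    \<comment> \<open>As before: \<open>J\<close> is minimal at \<open>w\<close>, so the polynomial
      in \<open>t\<close> has no constant term and its linear coefficient, the weak equation, must
      vanish.\<close>
    have "(ip U (D \<psi>) - m * S.ip w \<psi> - (\<integral>p. \<psi> p \<partial>\<mu>))\<^sup>2 \<le> 0 * (N2 (D \<psi>) - m * S.N2 \<psi>)"
    proof (rule quadratic_nonneg_discriminant)
      fix t
      have "m0 \<le> J (\<lambda>p. w p + t * \<psi> p) (\<lambda>p. U p + t *\<^sub>R D \<psi> p)" by (rule Jlim[OF hconv_line[OF h \<psi>]])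
      moreover have "(\<integral>p. w p + t * \<psi> p \<partial>\<mu>) = (\<integral>p. w p \<partial>\<mu>) + t * (\<integral>p. \<psi> p \<partial>\<mu>)"
        using L1[OF h'(2)] L1[OF T_L2[OF \<psi>]] by simp
      ultimately show "0 \<le> 0 + 2 * t * (ip U (D \<psi>) - m * S.ip w \<psi> - (\<integral>p. \<psi> p \<partial>\<mu>)) + t\<^sup>2 * (N2 (D \<psi>) - m * S.N2 \<psi>)"
        using N2_line[OF h'(3) D_L2[OF \<psi>], of t] S.N2_line[OF h'(2) T_L2[OF \<psi>], of t] Jw
        unfolding J_def by (simp add: algebra_simps)
    qed
    then show ?thesis by simp
  qed
  show ?thesis using h w_nonneg weak by blast
qed

text \<open>If \<open>- \<Delta> w = m w + 1\<close> then \<open>X = - F(w) D w\<close> has \<open>Div X = F(w) (m w + 1) - F'(w) \<bar>D w\<bar>\<^sup>2\<close>, hence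
  \<open>Div X - \<bar>X\<bar>\<^sup>2 \<ge> m'\<close> for the function \<open>F\<close> below.  Being smooth on the whole line, \<open>F\<close> may be
  applied to approximations of \<open>w\<close> that take negative values.\<close>

lemma logarithmic_profile:
  fixes m m' :: real
  assumes m: "0 < m'" "m' < m"
  shows "\<exists>F F' C. (\<forall>k. ck_on k UNIV F) \<and> (\<forall>s. (F has_real_derivative F' s) (at s)) \<and> continuous_on UNIV F' \<and>
     (\<forall>s. \<bar>F s\<bar> \<le> C \<and> \<bar>F' s\<bar> \<le> C) \<and> (\<forall>s\<ge>0. F' s + (F s)\<^sup>2 \<le> 0 \<and> m' \<le> F s * (m * s + 1))"
proof -
  \<comment> \<open>For \<rho> = 1 and e = 0 the function below would be \<open>1 / (s + b)\<close>,
    which satisfies both inequalities with equality and with \<open>m\<close> in place of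
    \<open>m'\<close>, but has a pole at \<open>- b\<close>.\<close>
  define b where "b = 1 / m"
  define \<rho> where "\<rho> = sqrt (m / m')"
  have \<rho>2: "\<rho>\<^sup>2 = m / m'" using m by (simp add: \<rho>_def)
  have \<rho>: "\<rho> > 1" using m by (simp add: \<rho>_def)
  \<comment> \<open>The largest value for which \<open>\<Theta> s \<le> \<rho> * (s + b)\<close> on
    all \<open>s \<ge> 0\<close>; the critical point is \<open>s = 0\<close>. Losing the factor
    \<rho> twice turns \<open>m\<close> into \<open>m / \<rho>^2 = m'\<close>.\<close>
  define e where "e = (\<rho>\<^sup>2 - 1) * b\<^sup>2"
  have b: "b > 0" using m by (simp add: b_def)
  have e: "e > 0" unfolding e_def using \<rho>2 m b by simp
  define \<Theta> where "\<Theta> s = sqrt ((s + b)\<^sup>2 + e)" for s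
  have pos: "(s + b)\<^sup>2 + e > 0" for s using e by (simp add: add_nonneg_pos)
  have \<Theta>: "\<Theta> s > 0" "(\<Theta> s)\<^sup>2 = (s + b)\<^sup>2 + e" "\<bar>s + b\<bar> \<le> \<Theta> s" "sqrt e \<le> \<Theta> s" for s
    using pos[of s] e by (auto simp: \<Theta>_def intro!: real_le_rsqrt)
  define F where "F s = 1 / (\<rho> * \<Theta> s)" for s
  define F' where "F' s = - ((s + b) / (\<rho> * (\<Theta> s)^3))" for s
  have ck: "ck_on k UNIV F" for k
  proof -
    have "ck_on k UNIV (\<lambda>s. (1 / \<rho>) * ((s + b)\<^sup>2 + e) powr (-1/2))"
      by (intro ck_mult ck_regularized_powr ck_const e) auto
    moreover have "(\<lambda>s. (1 / \<rho>) * ((s + b)\<^sup>2 + e) powr (-1/2)) = F"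
    proof (rule ext)
      fix s
      have "((s + b)\<^sup>2 + e) powr (- (1/2)) = 1 / \<Theta> s"
        unfolding powr_minus_divide \<Theta>_def using pos[of s] by (simp add: powr_half_sqrt)
      then show "(1 / \<rho>) * ((s + b)\<^sup>2 + e) powr (-1/2) = F s" by (simp add: F_def)
    qed
    ultimately show ?thesis by simp
  qed
  have D\<Theta>: "(\<Theta> has_real_derivative (s + b) / \<Theta> s) (at s)" for s
    unfolding \<Theta>_def using pos[of s] by (auto intro!: derivative_eq_intros simp: field_simps)
  have d: "(F has_real_derivative F' s) (at s)" for s
    unfolding F_def F'_def using \<Theta>(1)[of s] \<rho>
    by (auto intro!: derivative_eq_intros D\<Theta> simp: field_simps power2_eq_square power3_eq_cube)
  have cF': "continuous_on UNIV F'"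
    unfolding F'_def \<Theta>_def using pos \<rho> by (intro continuous_intros) (auto simp: less_imp_neq[symmetric])
  have 1: "\<bar>F s\<bar> \<le> 1 / (\<rho> * sqrt e)" for s
    unfolding F_def using \<Theta>(1,4)[of s] \<rho> e by (simp add: abs_mult frac_le)
  have 2: "\<bar>F' s\<bar> \<le> 1 / (\<rho> * e)" for s
  proof -
    have "\<bar>F' s\<bar> = \<bar>s + b\<bar> / (\<rho> * (\<Theta> s)^3)" unfolding F'_def using \<Theta>(1)[of s] \<rho> by (simp add: abs_mult abs_divide)
    also have "\<dots> \<le> \<Theta> s / (\<rho> * (\<Theta> s)^3)" using \<Theta>(1,3)[of s] \<rho> by (intro divide_right_mono) auto
    also have "\<dots> = 1 / (\<rho> * (\<Theta> s)\<^sup>2)" using \<Theta>(1)[of s] by (simp add: power2_eq_square power3_eq_cube)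
    also have "\<dots> \<le> 1 / (\<rho> * e)" using \<rho> e \<Theta>(2)[of s] by (intro frac_le mult_left_mono mult_pos_pos) auto
    finally show ?thesis .
  qed
  have 3: "F' s + (F s)\<^sup>2 \<le> 0 \<and> m' \<le> F s * (m * s + 1)" if s: "s \<ge> 0" for s
  proof -
    have "b\<^sup>2 \<le> (s + b)\<^sup>2" using s b by (intro power_mono) auto
    then have "(\<rho>\<^sup>2 - 1) * b\<^sup>2 \<le> (\<rho>\<^sup>2 - 1) * (s + b)\<^sup>2" using \<rho>2 m by (intro mult_left_mono) auto
    then have "(\<Theta> s)\<^sup>2 \<le> (\<rho> * (s + b))\<^sup>2" unfolding \<Theta>(2) e_def power_mult_distrib by (simp add: algebra_simps)
    then have le: "\<Theta> s \<le> \<rho> * (s + b)" using s b \<rho> by (intro power2_le_imp_le[of "\<Theta> s"]) auto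
    have "(F s)\<^sup>2 = \<Theta> s / (\<rho>\<^sup>2 * (\<Theta> s)^3)"
      unfolding F_def using \<Theta>(1)[of s] by (simp add: power2_eq_square power3_eq_cube)
    also have "\<dots> \<le> (\<rho> * (s + b)) / (\<rho>\<^sup>2 * (\<Theta> s)^3)"
      using le \<Theta>(1)[of s] by (intro divide_right_mono) auto
    also have "\<dots> = - F' s" unfolding F'_def using \<rho> by (simp add: power2_eq_square)
    finally have A: "F' s + (F s)\<^sup>2 \<le> 0" by simp
    have "m' * (\<rho> * \<Theta> s) \<le> m' * (\<rho> * (\<rho> * (s + b)))"
      using le m \<rho> by (intro mult_left_mono) auto
    also have "\<dots> = (m' * \<rho>\<^sup>2) * (s + b)" by (simp add: power2_eq_square)
    also have "\<dots> = m * s + 1" unfolding \<rho>2 using m by (simp add: b_def algebra_simps)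
    finally have "m' \<le> F s * (m * s + 1)" unfolding F_def using \<Theta>(1)[of s] \<rho> by (simp add: field_simps)
    with A show ?thesis by simp
  qed
  show ?thesis
  proof (intro exI conjI allI impI)
    fix s
    show "\<bar>F s\<bar> \<le> max (1 / (\<rho> * sqrt e)) (1 / (\<rho> * e))" "\<bar>F' s\<bar> \<le> max (1 / (\<rho> * sqrt e)) (1 / (\<rho> * e))"
      using 1[of s] 2[of s] by linarith+
  qed (use ck d cF' 3 in auto)
qed

text \<open>The divergence of \<open>- F(w) D w\<close> is computed by testing the equation of
  \<open>w\<close> with \<open>\<phi> F(w)\<close>. As this is not a test function, \<open>w\<close>
  is first replaced by its smooth approximations, and the limit is taken in every term of the
  product rule.\<close>

theorem divergence_field_exists:
  assumes fin: "finite_measure \<mu>" and m: "0 < m'" "m' < lam" and T: "\<phi>0 \<in> T"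
  shows "\<exists>X h. X \<in> L2 \<and> integrable \<mu> h \<and> (\<forall>\<phi>\<in>T. (\<integral>p. \<phi> p * h p \<partial>\<mu>) = - ip (D \<phi>) X) \<and>
     (AE p in \<mu>. m' \<le> h p - q p (X p) (X p))"
proof -
  interpret finite_measure \<mu> by fact
  have one: "(\<lambda>_. 1) \<in> S.L2" by (auto simp: S.L2_def)
  have L1: "integrable \<mu> f" if "f \<in> S.L2" for f using S.L2_integrable[OF that one] by simp
  \<comment> \<open>Room on both sides: above \<open>m'\<close> for smoothing the pole of the
    profile, below \<open>lam\<close> for solving the equation.\<close>
  obtain m1 where m1: "m' < m1" "m1 < lam" using dense[OF m(2)] by blast
  then have m10: "0 < m1" using m by simp
  obtain \<xi> w U where h0: "hconv \<xi> w U" and w0: "AE p in \<mu>. 0 \<le> w p"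
    and weak: "\<And>\<psi>. \<psi> \<in> T \<Longrightarrow> ip U (D \<psi>) = m1 * S.ip w \<psi> + (\<integral>p. \<psi> p \<partial>\<mu>)"
    using resolvent_exists[OF fin m10 m1(2) T] by blast
  obtain F F' C where F: "\<And>k. ck_on k UNIV F" "\<And>s. (F has_real_derivative F' s) (at s)"
      "continuous_on UNIV F'" "\<And>s. \<bar>F s\<bar> \<le> C" "\<And>s. \<bar>F' s\<bar> \<le> C"
      "\<And>s. s \<ge> 0 \<Longrightarrow> F' s + (F s)\<^sup>2 \<le> 0" "\<And>s. s \<ge> 0 \<Longrightarrow> m' \<le> F s * (m1 * s + 1)"
    using logarithmic_profile[OF m(1) m1(1)] by blast
  have cF: "continuous_on UNIV F" using F(1)[of 0] by simp
  note h0' = hconvD[OF h0]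
  \<comment> \<open>Convergence in the norm is not enough for the nonlinear terms; a subsequence
    converges almost everywhere.\<close>
  have "\<exists>r. strict_mono r \<and> (AE p in \<mu>. (\<lambda>k. (\<xi> (r k) p - w p)\<^sup>2) \<longlonglongrightarrow> 0)"
  proof (rule tendsto_L1_AE_subseq)
    have i: "integrable \<mu> (\<lambda>p. (\<xi> k p - w p) * (\<xi> k p - w p))" for k
      using S.L2_diff[OF h0'(4) h0'(2)] S.L2_integrable by auto
    then show "integrable \<mu> (\<lambda>p. (\<xi> k p - w p)\<^sup>2)" for k by (simp add: power2_eq_square)
    show "(\<lambda>k. \<integral>p. norm ((\<xi> k p - w p)\<^sup>2) \<partial>\<mu>) \<longlonglongrightarrow> 0"
      using h0'(6) by (simp add: S.ip_def power2_eq_square)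
  qed
  then obtain r where r: "strict_mono r" and ae: "AE p in \<mu>. (\<lambda>k. (\<xi> (r k) p - w p)\<^sup>2) \<longlonglongrightarrow> 0" by auto
  define wk where "wk k = \<xi> (r k)" for k
  have wk: "AE p in \<mu>. (\<lambda>k. wk k p) \<longlonglongrightarrow> w p"
    using ae
  proof eventually_elim
    case (elim p)
    then have "(\<lambda>k. sqrt ((wk k p - w p)\<^sup>2)) \<longlonglongrightarrow> sqrt 0" unfolding wk_def by (intro tendsto_intros)
    then show ?case by (simp add: tendsto_rabs_zero_iff LIM_zero_iff)
  qed
  have h: "hconv wk w U"
    using h0 LIMSEQ_subseq_LIMSEQ[OF h0'(6) r] LIMSEQ_subseq_LIMSEQ[OF h0'(7) r]
    unfolding hconv_def wk_def by (auto simp: o_def)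
  note h' = hconvD[OF h]
  have wm[measurable]: "w \<in> borel_measurable \<mu>" using h'(2) by (simp add: S.L2_def)
  have wkm[measurable]: "wk k \<in> borel_measurable \<mu>" for k using h'(4) by (simp add: S.L2_def)
  have Fm[measurable]: "F \<in> borel_measurable borel" "F' \<in> borel_measurable borel"
    using cF F(3) by (auto intro: borel_measurable_continuous_onI)
  have aeF: "AE p in \<mu>. (\<lambda>k. F (wk k p)) \<longlonglongrightarrow> F (w p)" "AE p in \<mu>. (\<lambda>k. F' (wk k p)) \<longlonglongrightarrow> F' (w p)"
    using wk continuous_on_tendsto_compose[OF cF] continuous_on_tendsto_compose[OF F(3)]
    by (auto elim!: eventually_mono)
  define X where "X p = (- F (w p)) *\<^sub>R U p" for p
  define g where "g p = F (w p) * (m1 * w p + 1) - F' (w p) * q p (U p) (U p)" for p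
  have XL: "X \<in> L2" unfolding X_def by (rule L2_bounded_mult(1)[OF h'(3)]) (use F(4) in auto)
  have bnd: "integrable \<mu> (\<lambda>p. u p * f p)" if f: "integrable \<mu> f" and [measurable]: "u \<in> borel_measurable \<mu>" and b: "\<And>p. \<bar>u p\<bar> \<le> B" for u f :: "'p \<Rightarrow> real" and B
  proof (rule Bochner_Integration.integrable_bound[where f = "\<lambda>p. B * \<bar>f p\<bar>"])
    show "integrable \<mu> (\<lambda>p. B * \<bar>f p\<bar>)" using f by auto
    have [measurable]: "f \<in> borel_measurable \<mu>" using f by (rule borel_measurable_integrable)
    show "(\<lambda>p. u p * f p) \<in> borel_measurable \<mu>" by measurable
    have "0 \<le> B" using b[of undefined] by simp
    then show "AE p in \<mu>. norm (u p * f p) \<le> norm (B * \<bar>f p\<bar>)"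
      using b by (auto simp: abs_mult intro!: mult_right_mono)
  qed
  have i1: "integrable \<mu> (\<lambda>p. m1 * w p + 1)" using L1[OF h'(2)] by auto
  have i2: "integrable \<mu> (\<lambda>p. q p (U p) (U p))" by (rule L2_integrable[OF h'(3) h'(3)])
  have j1: "integrable \<mu> (\<lambda>p. F (w p) * (m1 * w p + 1))" by (rule bnd[OF i1 _ F(4)]) measurable
  have j2: "integrable \<mu> (\<lambda>p. F' (w p) * q p (U p) (U p))" by (rule bnd[OF i2 _ F(5)]) measurable
  have gi: "integrable \<mu> g" unfolding g_def using j1 j2 by auto
  have "(\<integral>p. \<phi> p * g p \<partial>\<mu>) = - ip (D \<phi>) X" if \<phi>: "\<phi> \<in> T" for \<phi>
  proof -
    obtain B where B: "\<And>p. \<bar>\<phi> p\<bar> \<le> B" using T_bdd[OF \<phi>] by blast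
    have [measurable]: "\<phi> \<in> borel_measurable \<mu>" by (rule T_meas[OF \<phi>])
    define \<psi> where "\<psi> k p = \<phi> p * F (wk k p)" for k p
    have \<psi>: "\<psi> k \<in> T" for k unfolding \<psi>_def by (rule T_mult_comp[OF \<phi> h'(1) F(1,2)])
    define gk where "gk k p = \<phi> p * F' (wk k p)" for k p
    have D\<psi>: "D (\<psi> k) = (\<lambda>p. F (wk k p) *\<^sub>R D \<phi> p + gk k p *\<^sub>R D (wk k) p)" for k
      unfolding \<psi>_def gk_def by (rule D_mult_comp[OF \<phi> h'(1) F(1,2)])
    have gkb: "\<bar>gk k p\<bar> \<le> B * C" for k p
      unfolding gk_def abs_mult by (intro mult_mono B F) (use B[of p] in auto)
    have gkm[measurable]: "gk k \<in> borel_measurable \<mu>" for k unfolding gk_def by measurable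
    have gU: "(\<lambda>p. gk k p *\<^sub>R U p) \<in> L2" "N2 (\<lambda>p. gk k p *\<^sub>R U p) \<le> (B * C)\<^sup>2 * N2 U" for k
      by (rule L2_bounded_mult[OF h'(3) gkm gkb])+
    \<comment> \<open>The gradients of the approximations converge only in the norm, so
      \<open>U\<close> is split off from them: the remainder tends to zero by Cauchy-Schwarz, and
      the other two integrals have a fixed integrable factor.\<close>
    have split: "ip U (D (\<psi> k)) = (\<integral>p. F (wk k p) * q p (U p) (D \<phi> p) \<partial>\<mu>)
        + (ip (\<lambda>p. gk k p *\<^sub>R U p) (\<lambda>p. D (wk k) p - U p) + (\<integral>p. gk k p * q p (U p) (U p) \<partial>\<mu>))" for k
    proof -
      have a: "integrable \<mu> (\<lambda>p. F (wk k p) * q p (U p) (D \<phi> p))"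
        by (rule bnd[OF L2_integrable[OF h'(3) D_L2[OF \<phi>]] _ F(4)]) measurable
      have b: "integrable \<mu> (\<lambda>p. q p (gk k p *\<^sub>R U p) (D (wk k) p - U p))"
        by (rule L2_integrable[OF gU(1) L2_diff[OF h'(5) h'(3)]])
      have c: "integrable \<mu> (\<lambda>p. gk k p * q p (U p) (U p))"
        by (rule bnd[OF i2 gkm gkb])
      have "ip U (D (\<psi> k)) = (\<integral>p. F (wk k p) * q p (U p) (D \<phi> p) + (q p (gk k p *\<^sub>R U p) (D (wk k) p - U p) + gk k p * q p (U p) (U p)) \<partial>\<mu>)"
        unfolding ip_def D\<psi> by (intro Bochner_Integration.integral_cong) (auto simp: q_simps algebra_simps)
      also have "\<dots> = (\<integral>p. F (wk k p) * q p (U p) (D \<phi> p) \<partial>\<mu>)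
        + (ip (\<lambda>p. gk k p *\<^sub>R U p) (\<lambda>p. D (wk k) p - U p) + (\<integral>p. gk k p * q p (U p) (U p) \<partial>\<mu>))"
        unfolding ip_def using a b c by simp
      finally show ?thesis .
    qed
    have t1: "(\<lambda>k. \<integral>p. F (wk k p) * q p (U p) (D \<phi> p) \<partial>\<mu>) \<longlonglongrightarrow> (\<integral>p. F (w p) * q p (U p) (D \<phi> p) \<partial>\<mu>)"
      by (rule tendsto_L1_mult_bounded[OF L2_integrable[OF h'(3) D_L2[OF \<phi>]] _ aeF(1) _ F(4)]) measurable
    have t2: "(\<lambda>k. ip (\<lambda>p. gk k p *\<^sub>R U p) (\<lambda>p. D (wk k) p - U p)) \<longlonglongrightarrow> 0"
    proof (rule Lim_null_comparison)
      show "\<forall>\<^sub>F k in sequentially. norm (ip (\<lambda>p. gk k p *\<^sub>R U p) (\<lambda>p. D (wk k) p - U p))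
          \<le> sqrt ((B * C)\<^sup>2 * N2 U) * sqrt (N2 (\<lambda>p. D (wk k) p - U p))"
      proof (rule always_eventually, rule allI)
        fix k
        have "norm (ip (\<lambda>p. gk k p *\<^sub>R U p) (\<lambda>p. D (wk k) p - U p)) \<le> sqrt (N2 (\<lambda>p. gk k p *\<^sub>R U p)) * sqrt (N2 (\<lambda>p. D (wk k) p - U p))"
          using Cauchy_Schwarz_abs[OF gU(1) L2_diff[OF h'(5) h'(3)]] by simp
        also have "\<dots> \<le> sqrt ((B * C)\<^sup>2 * N2 U) * sqrt (N2 (\<lambda>p. D (wk k) p - U p))"
          using gU(2)[of k] N2_nonneg by (intro mult_right_mono real_sqrt_le_mono) auto
        finally show "norm (ip (\<lambda>p. gk k p *\<^sub>R U p) (\<lambda>p. D (wk k) p - U p))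
          \<le> sqrt ((B * C)\<^sup>2 * N2 U) * sqrt (N2 (\<lambda>p. D (wk k) p - U p))" .
      qed
      have "(\<lambda>k. sqrt ((B * C)\<^sup>2 * N2 U) * sqrt (N2 (\<lambda>p. D (wk k) p - U p))) \<longlonglongrightarrow> sqrt ((B * C)\<^sup>2 * N2 U) * sqrt 0"
        by (intro tendsto_intros h'(7))
      then show "(\<lambda>k. sqrt ((B * C)\<^sup>2 * N2 U) * sqrt (N2 (\<lambda>p. D (wk k) p - U p))) \<longlonglongrightarrow> 0" by simp
    qed
    have t3: "(\<lambda>k. \<integral>p. gk k p * q p (U p) (U p) \<partial>\<mu>) \<longlonglongrightarrow> (\<integral>p. (\<phi> p * F' (w p)) * q p (U p) (U p) \<partial>\<mu>)"
    proof (rule tendsto_L1_mult_bounded[OF i2 gkm _ _ gkb])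
      show "AE p in \<mu>. (\<lambda>k. gk k p) \<longlonglongrightarrow> \<phi> p * F' (w p)"
        using aeF(2) by eventually_elim (auto simp: gk_def intro!: tendsto_intros)
    qed measurable
    have p1: "integrable \<mu> (\<lambda>p. \<phi> p * (m1 * w p + 1))" by (rule bnd[OF i1 _ B]) measurable
    have t4: "(\<lambda>k. \<integral>p. F (wk k p) * (\<phi> p * (m1 * w p + 1)) \<partial>\<mu>) \<longlonglongrightarrow> (\<integral>p. F (w p) * (\<phi> p * (m1 * w p + 1)) \<partial>\<mu>)"
      by (rule tendsto_L1_mult_bounded[OF p1 _ aeF(1) _ F(4)]) measurable
    have "m1 * S.ip w (\<psi> k) + (\<integral>p. \<psi> k p \<partial>\<mu>) = (\<integral>p. F (wk k p) * (\<phi> p * (m1 * w p + 1)) \<partial>\<mu>)" for k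
    proof -
      have "m1 * S.ip w (\<psi> k) + (\<integral>p. \<psi> k p \<partial>\<mu>) = (\<integral>p. m1 * (w p * \<psi> k p) + \<psi> k p \<partial>\<mu>)"
        unfolding S.ip_def using S.L2_integrable[OF h'(2) T_L2[OF \<psi>]] L1[OF T_L2[OF \<psi>]] by simp
      also have "\<dots> = (\<integral>p. F (wk k p) * (\<phi> p * (m1 * w p + 1)) \<partial>\<mu>)"
        unfolding \<psi>_def by (intro Bochner_Integration.integral_cong) (auto simp: algebra_simps)
      finally show ?thesis .
    qed
    then have eq: "(\<lambda>k. \<integral>p. F (wk k p) * (\<phi> p * (m1 * w p + 1)) \<partial>\<mu>) = (\<lambda>k. ip U (D (\<psi> k)))"
      using weak[OF \<psi>] by simp
    have "(\<lambda>k. ip U (D (\<psi> k))) \<longlonglongrightarrow> (\<integral>p. F (w p) * q p (U p) (D \<phi> p) \<partial>\<mu>) + (0 + (\<integral>p. (\<phi> p * F' (w p)) * q p (U p) (U p) \<partial>\<mu>))"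
      unfolding split by (intro tendsto_add t1 t2 t3)
    then have E: "(\<integral>p. F (w p) * (\<phi> p * (m1 * w p + 1)) \<partial>\<mu>) = (\<integral>p. F (w p) * q p (U p) (D \<phi> p) \<partial>\<mu>) + (\<integral>p. (\<phi> p * F' (w p)) * q p (U p) (U p) \<partial>\<mu>)"
      using LIMSEQ_unique[OF t4[unfolded eq]] by simp
    have k1: "integrable \<mu> (\<lambda>p. F (w p) * (\<phi> p * (m1 * w p + 1)))" by (rule bnd[OF p1 _ F(4)]) measurable
    have k2: "integrable \<mu> (\<lambda>p. (\<phi> p * F' (w p)) * q p (U p) (U p))"
      using bnd[OF j2 _ B] by (simp add: mult.assoc)
    have "(\<integral>p. \<phi> p * g p \<partial>\<mu>) = (\<integral>p. F (w p) * (\<phi> p * (m1 * w p + 1)) - (\<phi> p * F' (w p)) * q p (U p) (U p) \<partial>\<mu>)"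
      unfolding g_def by (intro Bochner_Integration.integral_cong) (auto simp: algebra_simps)
    also have "\<dots> = (\<integral>p. F (w p) * q p (U p) (D \<phi> p) \<partial>\<mu>)" using k1 k2 E by simp
    also have "\<dots> = - ip (D \<phi>) X" unfolding ip_def X_def using sym by (simp add: q_simps)
    finally show ?thesis .
  qed
  moreover have "AE p in \<mu>. m' \<le> g p - q p (X p) (X p)"
    using w0
  proof eventually_elim
    case (elim p)
    have "(F' (w p) + (F (w p))\<^sup>2) * q p (U p) (U p) \<le> 0"
      using F(6)[OF elim] nonneg[of p "U p"] by (rule mult_nonpos_nonneg)
    moreover have "g p - q p (X p) (X p) = F (w p) * (m1 * w p + 1) - (F' (w p) + (F (w p))\<^sup>2) * q p (U p) (U p)"
      unfolding g_def X_def by (simp add: q_simps algebra_simps power2_eq_square)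
    ultimately show ?case using F(7)[OF elim] by simp
  qed
  ultimately show ?thesis using XL gi by blast
qed

end

section \<open>Charts and gradients\<close>

lemma half_space_closed: "closed (half_space :: (real^'n::{finite,wellorder}) set)"
  unfolding half_space_def by (intro closed_Collect_le continuous_intros)

lemma half_space_convex: "convex (half_space :: (real^'n::{finite,wellorder}) set)"
  unfolding half_space_def convex_def by auto

lemma interior_half_space: "interior half_space = {x :: real^'n::{finite,wellorder}. 0 < x $ (LEAST i. True)}"
  unfolding half_space_def by (rule interior_halfspace_component_ge)

abbreviation rel_open :: "(real^'n::{finite,wellorder}) set \<Rightarrow> bool" where
  "rel_open S \<equiv> openin (top_of_set half_space) S"

text \<open>Derivatives are taken within \<open>half_space\<close> from here on; being local, they
  do not depend on the relatively open set, chart image or transition domain, within which they were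
  first formed.\<close>

lemma rel_open_at:
  assumes "rel_open S" "x \<in> S" shows "at x within S = at x within half_space"
proof -
  obtain T where "open T" "S = half_space \<inter> T" using assms(1) by (auto simp: openin_open)
  then show ?thesis using assms(2) by (intro at_within_nhd[of x T]) auto
qed

text \<open>At each point of the half space, a boundary point included, small positive multiples of
  all coordinate vectors lead to points of the half space, and this determines a linear map.\<close>

lemma half_space_derivative_unique:
  fixes f :: "real^'n::{finite,wellorder} \<Rightarrow> 'b::real_normed_vector"
  assumes "x \<in> half_space" "(f has_derivative f') (at x within half_space)" "(f has_derivative f'') (at x within half_space)"
  shows "f' = f''"
proof (rule frechet_derivative_unique_within[OF assms(2,3)])
  fix i :: "real^'n::_" and e :: real assume "i \<in> Basis" "e > 0"
  then obtain j where "i = axis j 1" by (auto simp: Basis_vec_def)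
  then have "0 \<le> i $ (LEAST i. True)" by (simp add: axis_def)
  then have "x + (e/2) *\<^sub>R i \<in> half_space" using assms(1) \<open>e > 0\<close> by (auto simp: half_space_def)
  then show "\<exists>d. 0 < \<bar>d\<bar> \<and> \<bar>d\<bar> < e \<and> x + d *\<^sub>R i \<in> half_space"
    using \<open>e > 0\<close> by (intro exI[of _ "e/2"]) auto
qed

abbreviation hder :: "(real^'n::{finite,wellorder} \<Rightarrow> 'b::real_normed_vector) \<Rightarrow> real^'n::_ \<Rightarrow> real^'n::_ \<Rightarrow> 'b" where
  "hder f x \<equiv> frechet_derivative f (at x within half_space)"

lemma hder_eq:
  assumes "x \<in> half_space" "(f has_derivative f') (at x within half_space)"
  shows "hder f x = f'"
  using half_space_derivative_unique[OF assms(1) _ assms(2)] assms(2) frechet_derivative_works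
  by (metis differentiable_def)

text \<open>By uniqueness the derivative of any local smooth extension restricts to the one within
  the half space. This makes the latter continuous up to the boundary.\<close>

lemma smooth_on_hder_local:
  assumes S: "rel_open S" and f: "smooth_on S f" and x: "x \<in> S"
  obtains V F where "open V" "x \<in> V" "\<And>k. ck_on k V F"
    "\<And>y. y \<in> S \<inter> V \<Longrightarrow> F y = f y \<and> hder f y = frechet_derivative F (at y) \<and> (f has_derivative hder f y) (at y within half_space)"
proof -
  obtain V F where V: "open V" "x \<in> V" "\<And>k. ck_on k V F" "\<And>y. y \<in> S \<Longrightarrow> y \<in> V \<Longrightarrow> F y = f y"
    using smooth_onE[OF f x] by metis
  have "F y = f y \<and> hder f y = frechet_derivative F (at y) \<and> (f has_derivative hder f y) (at y within half_space)"
    if y: "y \<in> S \<inter> V" for y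
  proof -
    have "(F has_derivative frechet_derivative F (at y)) (at y)"
      by (rule ck_has_derivative[OF V(3)]) (use y in auto)
    then have d: "(F has_derivative frechet_derivative F (at y)) (at y within S)" by (rule has_derivative_at_withinI)
    obtain e where e: "e > 0" "ball y e \<subseteq> V" using V(1) y open_contains_ball by (metis IntD2)
    have "(f has_derivative frechet_derivative F (at y)) (at y within S)"
      by (rule has_derivative_transform_within[OF d e(1)]) (use V(4) e y in \<open>auto simp: dist_commute subset_eq\<close>)
    then have D: "(f has_derivative frechet_derivative F (at y)) (at y within half_space)"
      using rel_open_at[OF S] y by auto
    have "y \<in> half_space" using S y openin_imp_subset by blast
    from hder_eq[OF this D] D V(4) y show ?thesis by auto
  qed
  with V that show thesis by blast
qed

lemma smooth_on_has_hder:
  assumes "rel_open S" "smooth_on S f" "x \<in> S"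
  shows "(f has_derivative hder f x) (at x within half_space)"
  using smooth_on_hder_local[OF assms] assms(3) by (metis IntI)

lemma smooth_on_continuous:
  assumes "smooth_on S f" shows "continuous_on S f"
  unfolding continuous_on_eq_continuous_within
proof
  fix x assume x: "x \<in> S"
  obtain V F where V: "open V" "x \<in> V" "\<And>k. ck_on k V F" "\<And>y. y \<in> S \<Longrightarrow> y \<in> V \<Longrightarrow> F y = f y"
    using smooth_onE[OF assms x] by metis
  have "continuous_on V F" using V(3)[of 0] by simp
  then have "continuous_on (S \<inter> V) f" using V(4) by (subst continuous_on_cong[OF refl, of _ f F]) (auto intro: continuous_on_subset)
  then have "continuous (at x within S \<inter> V) f" using x V by (simp add: continuous_on_eq_continuous_within)
  moreover have "at x within S \<inter> V = at x within S" by (rule at_within_nhd[of x V]) (use V in auto)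
  ultimately show "continuous (at x within S) f" by simp
qed

lemma smooth_on_hder_continuous:
  assumes S: "rel_open S" and f: "smooth_on S f"
  shows "continuous_on S (\<lambda>x. hder f x v)"
  unfolding continuous_on_eq_continuous_within
proof
  fix x assume x: "x \<in> S"
  obtain V F where V: "open V" "x \<in> V" "\<And>k. ck_on k V F"
    "\<And>y. y \<in> S \<inter> V \<Longrightarrow> F y = f y \<and> hder f y = frechet_derivative F (at y) \<and> (f has_derivative hder f y) (at y within half_space)"
    using smooth_on_hder_local[OF S f x] by metis
  have "continuous_on V (\<lambda>y. frechet_derivative F (at y) v)" using V(3)[of 1] by simp
  then have "continuous_on (S \<inter> V) (\<lambda>x. hder f x v)" using V(4)
    by (subst continuous_on_cong[OF refl, of _ _ "\<lambda>y. frechet_derivative F (at y) v"]) (auto intro: continuous_on_subset)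
  then have "continuous (at x within S \<inter> V) (\<lambda>x. hder f x v)" using x V by (simp add: continuous_on_eq_continuous_within)
  moreover have "at x within S \<inter> V = at x within S" by (rule at_within_nhd[of x V]) (use V in auto)
  ultimately show "continuous (at x within S) (\<lambda>x. hder f x v)" by simp
qed

lemma hder_cong:
  assumes S: "rel_open S" "x \<in> S" and eq: "\<And>y. y \<in> S \<Longrightarrow> f y = g y" and d: "(g has_derivative g') (at x within half_space)"
  shows "(f has_derivative g') (at x within half_space)"
proof -
  have "(g has_derivative g') (at x within S)" using d rel_open_at[OF S] by simp
  then have "(f has_derivative g') (at x within S)"
    by (rule has_derivative_transform_within[OF _ zero_less_one S(2)]) (use eq in auto)
  then show ?thesis using rel_open_at[OF S] by simp
qed

lemma inner_transpose_matrix: "(transpose A *v x) \<bullet> y = (x :: real^'n) \<bullet> (A *v y)"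
  by (simp add: dot_lmul_matrix)

lemma matrix_inv_pos_def:
  fixes A :: "real^'n::finite^'n"
  assumes "\<And>v. v \<noteq> 0 \<Longrightarrow> 0 < v \<bullet> (A *v v)"
  shows "A ** matrix_inv A = mat 1" "matrix_inv A ** A = mat 1" "det A \<noteq> 0"
proof -
  have "A *v x = 0 \<Longrightarrow> x = 0" for x using assms[of x] by (cases "x = 0") auto
  then have i: "invertible A" unfolding invertible_left_inverse matrix_left_invertible_ker by blast
  then show "det A \<noteq> 0" by (simp add: invertible_det_nz)
  from i have "\<exists>B. A ** B = mat 1 \<and> B ** A = mat 1" unfolding invertible_def by blast
  then have "A ** matrix_inv A = mat 1 \<and> matrix_inv A ** A = mat 1"
    unfolding matrix_inv_def by (rule someI_ex)
  then show "A ** matrix_inv A = mat 1" "matrix_inv A ** A = mat 1" by auto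
qed

lemma continuous_on_det:
  fixes A :: "'a::topological_space \<Rightarrow> real^'n::finite^'n"
  assumes "continuous_on S A" shows "continuous_on S (\<lambda>x. det (A x))"
  unfolding det_def by (intro continuous_intros assms)

lemma continuous_on_matrix_vector:
  fixes A :: "'a::topological_space \<Rightarrow> real^'n::finite^'m::finite"
  assumes "continuous_on S A" "continuous_on S v" shows "continuous_on S (\<lambda>x. A x *v v x)"
  unfolding matrix_vector_mult_def by (intro continuous_intros assms)

text \<open>Cramer's rule writes the solution as a quotient of determinants. Applied to the metric
  matrix and the differential it gives the continuity of gradients.\<close>

lemma continuous_on_linear_solve:
  fixes A :: "'a::topological_space \<Rightarrow> real^'n::finite^'n"
  assumes A: "continuous_on S A" and b: "continuous_on S b" and nz: "\<And>x. x \<in> S \<Longrightarrow> det (A x) \<noteq> 0"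
    and u: "\<And>x. x \<in> S \<Longrightarrow> A x *v u x = b x"
  shows "continuous_on S u"
proof -
  have B: "continuous_on S (\<lambda>x. (\<chi> i j. if j = k then b x $ i else A x $ i $ j) :: real^'n^'n)" for k
  proof (intro continuous_on_vec_lambda)
    fix i j show "continuous_on S (\<lambda>x. if j = k then b x $ i else A x $ i $ j)"
      using A b by (cases "j = k") (auto intro!: continuous_intros)
  qed
  have "continuous_on S (\<lambda>x. \<chi> k. det (\<chi> i j. if j = k then b x $ i else A x $ i $ j) / det (A x))"
    by (rule continuous_on_vec_lambda, intro continuous_on_divide continuous_on_det[OF B] continuous_on_det[OF A]) (use nz in auto)
  moreover have "u x = (\<chi> k. det (\<chi> i j. if j = k then b x $ i else A x $ i $ j) / det (A x))" if "x \<in> S" for x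
    using cramer[OF nz[OF that]] u[OF that] by blast
  ultimately show ?thesis by (subst continuous_on_cong[OF refl]) auto
qed

section \<open>Manifolds, coordinate changes and the metric\<close>

locale riem_mfd =
  fixes M :: "('p::{t2_space,second_countable_topology}, 'n::{finite,wellorder}) riem"
  assumes rm: "riemannian_manifold M"
begin

lemma chart: "c \<in> atlas M \<Longrightarrow> is_chart c"
  using rm by (simp add: riemannian_manifold_def smooth_atlas_def)

lemma chart_open: "c \<in> atlas M \<Longrightarrow> open (fst c)" using chart by (simp add: is_chart_def)

lemma cimage_rel_open: "c \<in> atlas M \<Longrightarrow> rel_open (cimage c)" using chart by (simp add: is_chart_def)

lemma cimage_half_space: "c \<in> atlas M \<Longrightarrow> cimage c \<subseteq> half_space" using cimage_rel_open openin_imp_subset by blast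

lemma chart_maps:
  assumes "c \<in> atlas M"
  shows "\<And>p. p \<in> fst c \<Longrightarrow> snd c p \<in> cimage c" "\<And>p. p \<in> fst c \<Longrightarrow> cinv c (snd c p) = p"
    "\<And>x. x \<in> cimage c \<Longrightarrow> cinv c x \<in> fst c" "\<And>x. x \<in> cimage c \<Longrightarrow> snd c (cinv c x) = x"
    "continuous_on (fst c) (snd c)" "continuous_on (cimage c) (cinv c)"
  using chart[OF assms] by (auto simp: is_chart_def homeomorphism_def)

lemma chart_exists: "\<exists>c\<in>atlas M. p \<in> fst c"
  using rm by (auto simp: riemannian_manifold_def smooth_atlas_def)

lemma chart_image_eq:
  assumes "c \<in> atlas M" "W \<subseteq> fst c" shows "snd c ` W = {x \<in> cimage c. cinv c x \<in> W}"
  using chart_maps[OF assms(1)] assms(2) by (force simp: image_iff)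

lemma chart_image_rel_open:
  assumes c: "c \<in> atlas M" and W: "open W" "W \<subseteq> fst c" shows "rel_open (snd c ` W)"
proof -
  have "openin (top_of_set (cimage c)) (cimage c \<inter> cinv c -` W)"
    by (rule continuous_openin_preimage[OF chart_maps(6)[OF c], of UNIV]) (use W in auto)
  moreover have "snd c ` W = cimage c \<inter> cinv c -` W" using chart_image_eq[OF c W(2)] by auto
  ultimately show ?thesis using openin_trans cimage_rel_open[OF c] by metis
qed

lemma transition_domain_rel_open:
  "c \<in> atlas M \<Longrightarrow> c' \<in> atlas M \<Longrightarrow> rel_open (transition_domain c c')"
  unfolding transition_domain_def by (rule chart_image_rel_open) (auto intro: chart_open)

lemma transition_smooth:
  "c \<in> atlas M \<Longrightarrow> c' \<in> atlas M \<Longrightarrow> smooth_on (transition_domain c c') (transition c c')"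
  using rm by (simp add: riemannian_manifold_def smooth_atlas_def)

lemma snd_in_half_space: "c \<in> atlas M \<Longrightarrow> p \<in> fst c \<Longrightarrow> snd c p \<in> half_space"
  using chart_maps(1) cimage_half_space by blast

lemma transition_snd: "c \<in> atlas M \<Longrightarrow> p \<in> fst c \<Longrightarrow> transition c c' (snd c p) = snd c' p"
  unfolding transition_def by (simp add: chart_maps)

lemma jacobian_hder:
  assumes "c \<in> atlas M" "c' \<in> atlas M" "p \<in> fst c" "p \<in> fst c'"
  shows "jacobian c c' p = matrix (hder (transition c c') (snd c p))"
proof -
  have "snd c p \<in> transition_domain c c'" using assms by (auto simp: transition_domain_def)
  then show ?thesis unfolding jacobian_def
    by (simp add: rel_open_at[OF transition_domain_rel_open[OF assms(1,2)]])
qed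

lemma transition_has_derivative:
  assumes "c \<in> atlas M" "c' \<in> atlas M" "p \<in> fst c" "p \<in> fst c'"
  shows "(transition c c' has_derivative (\<lambda>v. jacobian c c' p *v v)) (at (snd c p) within half_space)"
proof -
  have "snd c p \<in> transition_domain c c'" using assms by (auto simp: transition_domain_def)
  then have d: "(transition c c' has_derivative hder (transition c c') (snd c p)) (at (snd c p) within half_space)"
    by (rule smooth_on_has_hder[OF transition_domain_rel_open[OF assms(1,2)] transition_smooth[OF assms(1,2)]])
  have "matrix (hder (transition c c') (snd c p)) *v v = hder (transition c c') (snd c p) v" for v
    by (rule matrix_works[OF has_derivative_linear[OF d, unfolded linear_matrix_vector_mul_eq[symmetric]]])
  then show ?thesis using d by (simp add: jacobian_hder[OF assms])
qed

lemma jacobianI: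
  assumes "c \<in> atlas M" "c' \<in> atlas M" "p \<in> fst c" "p \<in> fst c'"
    and "(transition c c' has_derivative (\<lambda>v. A *v v)) (at (snd c p) within half_space)"
  shows "jacobian c c' p = A"
proof -
  have "(\<lambda>v. jacobian c c' p *v v) = (\<lambda>v. A *v v)"
    by (rule half_space_derivative_unique[OF _ transition_has_derivative[OF assms(1-4)] assms(5)])
      (use assms snd_in_half_space in auto)
  then show ?thesis by (metis matrix_eq)
qed

text \<open>The source of all transformation laws. The inner derivative is taken within the
  transition domain, whose image stays in the half space, so the chain rule for derivatives within
  sets holds at boundary points too.\<close>

lemma chain_through_chart:
  assumes c: "c \<in> atlas M" "c' \<in> atlas M" "p \<in> fst c" "p \<in> fst c'"
    and d: "((f \<circ> cinv c') has_derivative f') (at (snd c' p) within half_space)"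
  shows "((f \<circ> cinv c) has_derivative (\<lambda>v. f' (jacobian c c' p *v v))) (at (snd c p) within half_space)"
proof -
  let ?S = "transition_domain c c'"
  have x: "snd c p \<in> ?S" using c by (auto simp: transition_domain_def)
  note at = rel_open_at[OF transition_domain_rel_open[OF c(1,2)] x]
  have sub: "transition c c' ` ?S \<subseteq> half_space"
  proof
    fix y assume "y \<in> transition c c' ` ?S"
    then obtain q where "q \<in> fst c" "q \<in> fst c'" "y = transition c c' (snd c q)" by (auto simp: transition_domain_def)
    then show "y \<in> half_space" using snd_in_half_space[OF c(2)] transition_snd[OF c(1)] by metis
  qed
  have 1: "(transition c c' has_derivative (\<lambda>v. jacobian c c' p *v v)) (at (snd c p) within ?S)"
    using transition_has_derivative[OF c(1-4)] by (simp add: at)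
  have 2: "((f \<circ> cinv c') has_derivative f') (at (transition c c' (snd c p)) within transition c c' ` ?S)"
    using has_derivative_subset[OF d sub] by (simp add: transition_snd c)
  have "((\<lambda>x. (f \<circ> cinv c') (transition c c' x)) has_derivative (\<lambda>v. f' (jacobian c c' p *v v))) (at (snd c p) within half_space)"
    using has_derivative_in_compose[OF 1 2] by (simp add: at)
  then show ?thesis
    by (rule hder_cong[OF transition_domain_rel_open[OF c(1,2)] x, rotated])
      (use c in \<open>auto simp: transition_domain_def transition_def chart_maps\<close>)
qed

lemma jacobian_chain:
  assumes "c \<in> atlas M" "c' \<in> atlas M" "c'' \<in> atlas M" "p \<in> fst c" "p \<in> fst c'" "p \<in> fst c''"
  shows "jacobian c c'' p = jacobian c' c'' p ** jacobian c c' p"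
proof (rule jacobianI)
  have "((snd c'' \<circ> cinv c') has_derivative (\<lambda>v. jacobian c' c'' p *v v)) (at (snd c' p) within half_space)"
    using transition_has_derivative[OF assms(2,3,5,6)] by (simp add: transition_def)
  from chain_through_chart[OF assms(1,2,4,5) this]
  show "(transition c c'' has_derivative (\<lambda>v. (jacobian c' c'' p ** jacobian c c' p) *v v)) (at (snd c p) within half_space)"
    by (simp add: transition_def matrix_vector_mul_assoc)
qed (use assms in auto)

lemma jacobian_self:
  assumes "c \<in> atlas M" "p \<in> fst c" shows "jacobian c c p = mat 1"
proof (rule jacobianI)
  show "(transition c c has_derivative (\<lambda>v. mat 1 *v v)) (at (snd c p) within half_space)"
  proof (rule hder_cong[OF cimage_rel_open[OF assms(1)]])
    show "snd c p \<in> cimage c" by (rule chart_maps(1)[OF assms])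
    show "transition c c y = y" if "y \<in> cimage c" for y using chart_maps(4)[OF assms(1) that] by (simp add: transition_def)
    have "(*v) (mat 1) = (\<lambda>v::real^'n::_. v)" by (rule ext) simp
    then show "((\<lambda>x. x) has_derivative (*v) (mat 1)) (at (snd c p) within half_space)" by (simp only: has_derivative_ident)
  qed
qed (use assms in auto)

lemma jacobian_inverse:
  assumes "c \<in> atlas M" "c' \<in> atlas M" "p \<in> fst c" "p \<in> fst c'"
  shows "jacobian c' c p ** jacobian c c' p = mat 1"
  using jacobian_chain[of c c' c p] jacobian_self assms by simp

lemma metric: "riemannian_metric M"
  using rm unfolding riemannian_manifold_def by (elim conjE)

lemma gmat_sym: "c \<in> atlas M \<Longrightarrow> p \<in> fst c \<Longrightarrow> transpose (gmat M c p) = gmat M c p"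
  using metric unfolding riemannian_metric_def by blast

lemma gmat_pos: "c \<in> atlas M \<Longrightarrow> p \<in> fst c \<Longrightarrow> v \<noteq> 0 \<Longrightarrow> 0 < v \<bullet> (gmat M c p *v v)"
  using metric unfolding riemannian_metric_def by blast

lemma gmat_change: "c \<in> atlas M \<Longrightarrow> c' \<in> atlas M \<Longrightarrow> p \<in> fst c \<Longrightarrow> p \<in> fst c' \<Longrightarrow>
    gmat M c p = transpose (jacobian c c' p) ** gmat M c' p ** jacobian c c' p"
  using metric unfolding riemannian_metric_def by blast

lemma gmat_smooth: "c \<in> atlas M \<Longrightarrow> smooth_on (cimage c) (gmat M c \<circ> cinv c)"
  using metric unfolding riemannian_metric_def by blast

lemma gmat_sym_inner: "c \<in> atlas M \<Longrightarrow> p \<in> fst c \<Longrightarrow> u \<bullet> (gmat M c p *v v) = (gmat M c p *v u) \<bullet> v"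
  using inner_transpose_matrix[of "gmat M c p" u v] gmat_sym by simp

lemma gmat_change_inner:
  assumes "c \<in> atlas M" "c' \<in> atlas M" "p \<in> fst c" "p \<in> fst c'"
  shows "u \<bullet> (gmat M c p *v v) = (jacobian c c' p *v u) \<bullet> (gmat M c' p *v (jacobian c c' p *v v))"
proof -
  have "u \<bullet> (gmat M c p *v v) = u \<bullet> (transpose (jacobian c c' p) *v (gmat M c' p *v (jacobian c c' p *v v)))"
    unfolding gmat_change[OF assms] by (simp only: matrix_vector_mul_assoc matrix_mul_assoc)
  also have "\<dots> = (jacobian c c' p *v u) \<bullet> (gmat M c' p *v (jacobian c c' p *v v))"
    using inner_transpose_matrix[of "jacobian c c' p" "gmat M c' p *v (jacobian c c' p *v v)" u] by (simp only: inner_commute)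
  finally show ?thesis .
qed

lemma gmat_continuous: "c \<in> atlas M \<Longrightarrow> continuous_on (cimage c) (\<lambda>x. gmat M c (cinv c x))"
  using smooth_on_continuous[OF gmat_smooth] by (simp add: o_def)

lemma continuous_on_chart:
  assumes c: "c \<in> atlas M" and "continuous_on (cimage c) (\<lambda>x. f (cinv c x))"
  shows "continuous_on (fst c) f"
proof -
  have "continuous_on (fst c) (\<lambda>p. f (cinv c (snd c p)))"
    by (rule continuous_on_compose2[OF assms(2) chart_maps(5)[OF c]]) (use chart_maps[OF c] in auto)
  then show ?thesis by (rule continuous_on_eq) (simp add: chart_maps[OF c])
qed

lemma gmat_inv:
  assumes "c \<in> atlas M" "p \<in> fst c"
  shows "gmat M c p ** matrix_inv (gmat M c p) = mat 1" "matrix_inv (gmat M c p) ** gmat M c p = mat 1" "det (gmat M c p) \<noteq> 0"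
  using matrix_inv_pos_def[of "gmat M c p"] gmat_pos[OF assms] by auto

lemma vector_fieldD: "vector_field M X \<Longrightarrow> c \<in> atlas M \<Longrightarrow> c' \<in> atlas M \<Longrightarrow> p \<in> fst c \<Longrightarrow> p \<in> fst c' \<Longrightarrow>
    X c' p = jacobian c c' p *v X c p"
  unfolding vector_field_def by blast

text \<open>The definition uses an unspecified chart at \<open>p\<close>; the Jacobians in the laws
  for fields and for the metric cancel, so any chart may take its place.\<close>

lemma vinner_chart:
  assumes X: "vector_field M X" and Y: "vector_field M Y" and c: "c \<in> atlas M" "p \<in> fst c"
  shows "vinner M X Y p = X c p \<bullet> (gmat M c p *v Y c p)"
proof -
  define c0 where "c0 = chart_at M p"
  have c0: "c0 \<in> atlas M" "p \<in> fst c0"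
    using someI_ex[of "\<lambda>c. c \<in> atlas M \<and> p \<in> fst c"] chart_exists[of p] unfolding c0_def chart_at_def by blast+
  have "X c p = jacobian c0 c p *v X c0 p" "Y c p = jacobian c0 c p *v Y c0 p"
    using vector_fieldD[OF X c0(1) c(1) c0(2) c(2)] vector_fieldD[OF Y c0(1) c(1) c0(2) c(2)] .
  then show ?thesis unfolding vinner_def Let_def c0_def[symmetric]
    using gmat_change_inner[OF c0(1) c(1) c0(2) c(2)] by metis
qed

section \<open>Differentials and gradients\<close>

definition msmooth :: "('p \<Rightarrow> real) \<Rightarrow> bool" where
  "msmooth \<phi> \<longleftrightarrow> (\<forall>c\<in>atlas M. smooth_on (cimage c) (\<phi> \<circ> cinv c))"

text \<open>The components of the differential. They are computed without the metric, so the rules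
  of calculus are proved for them and then transported to gradients by the inverse metric.\<close>

definition dcoord :: "('p \<Rightarrow> real) \<Rightarrow> ('p, 'n) chart \<Rightarrow> 'p \<Rightarrow> real^'n::_" where
  "dcoord \<phi> c p = (\<chi> j. hder (\<phi> \<circ> cinv c) (snd c p) (axis j 1))"

lemma msmooth_hder:
  assumes "msmooth \<phi>" "c \<in> atlas M" "p \<in> fst c"
  shows "((\<phi> \<circ> cinv c) has_derivative hder (\<phi> \<circ> cinv c) (snd c p)) (at (snd c p) within half_space)"
  using assms(1) smooth_on_has_hder[OF cimage_rel_open[OF assms(2)] _ chart_maps(1)[OF assms(2,3)]] assms(2)
  unfolding msmooth_def by blast

lemma linear_functional_coords:
  fixes f :: "real^'n::_ \<Rightarrow> real"
  assumes "linear f" shows "f v = (\<chi> j. f (axis j 1)) \<bullet> v"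
proof -
  have "f v = f (\<Sum>j\<in>UNIV. (v $ j) *\<^sub>R axis j 1)"
    using basis_expansion[of v] by (simp add: scalar_mult_eq_scaleR)
  also have "\<dots> = (\<Sum>j\<in>UNIV. v $ j * f (axis j 1))" using assms by (simp add: linear_sum linear_cmul)
  finally show ?thesis by (simp add: inner_vec_def mult.commute)
qed

lemma msmooth_derivative:
  assumes "msmooth \<phi>" "c \<in> atlas M" "p \<in> fst c"
  shows "((\<phi> \<circ> cinv c) has_derivative (\<lambda>v. dcoord \<phi> c p \<bullet> v)) (at (snd c p) within half_space)"
proof -
  have "hder (\<phi> \<circ> cinv c) (snd c p) = (\<lambda>v. dcoord \<phi> c p \<bullet> v)"
    unfolding dcoord_def
    by (rule ext, rule linear_functional_coords) (rule has_derivative_linear[OF msmooth_hder[OF assms]])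
  then show ?thesis using msmooth_hder[OF assms] by simp
qed

lemma dcoordI:
  assumes "c \<in> atlas M" "p \<in> fst c" "((\<phi> \<circ> cinv c) has_derivative (\<lambda>v. d \<bullet> v)) (at (snd c p) within half_space)"
  shows "dcoord \<phi> c p = d"
  unfolding dcoord_def using hder_eq[OF snd_in_half_space[OF assms(1,2)] assms(3)]
  by (simp add: vec_eq_iff inner_axis)

lemma grad_dcoord:
  assumes "c \<in> atlas M" "p \<in> fst c"
  shows "grad M \<phi> c p = matrix_inv (gmat M c p) *v dcoord \<phi> c p"
  unfolding grad_def dcoord_def using rel_open_at[OF cimage_rel_open[OF assms(1)]] chart_maps(1)[OF assms] by simp

lemma gmat_grad:
  assumes "c \<in> atlas M" "p \<in> fst c"
  shows "gmat M c p *v grad M \<phi> c p = dcoord \<phi> c p"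
  by (simp add: grad_dcoord[OF assms] matrix_vector_mul_assoc gmat_inv[OF assms])

lemma dcoord_change:
  assumes \<phi>: "msmooth \<phi>" and c: "c \<in> atlas M" "c' \<in> atlas M" "p \<in> fst c" "p \<in> fst c'"
  shows "dcoord \<phi> c p = transpose (jacobian c c' p) *v dcoord \<phi> c' p"
proof (rule dcoordI[OF c(1,3)])
  show "((\<phi> \<circ> cinv c) has_derivative (\<lambda>v. (transpose (jacobian c c' p) *v dcoord \<phi> c' p) \<bullet> v)) (at (snd c p) within half_space)"
    unfolding inner_transpose_matrix by (rule chain_through_chart[OF c msmooth_derivative[OF \<phi> c(2,4)]])
qed

lemma grad_vector_field:
  assumes \<phi>: "msmooth \<phi>" shows "vector_field M (grad M \<phi>)"
  unfolding vector_field_def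
proof (intro ballI)
  fix c c' p assume c: "c \<in> atlas M" "c' \<in> atlas M" and "p \<in> fst c \<inter> fst c'"
  then have p: "p \<in> fst c" "p \<in> fst c'" by auto
  let ?J = "jacobian c c' p" and ?K = "jacobian c' c p"
  have KJ: "?K ** ?J = mat 1" "?J ** ?K = mat 1" using jacobian_inverse c p by auto
  have tKJ: "transpose ?K ** transpose ?J = mat 1"
    using KJ(2) by (simp flip: matrix_transpose_mul)
  \<comment> \<open>The metric changes by the Jacobian on both sides, the differential by its
    transpose alone. One factor \<open>transpose ?J\<close> is common to both sides and is cancelled
    next.\<close>
  have "transpose ?J *v (gmat M c' p *v (?J *v grad M \<phi> c p)) = transpose ?J *v dcoord \<phi> c' p"
    using gmat_grad[OF c(1) p(1)] dcoord_change[OF \<phi> c p] gmat_change[OF c p]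
    by (simp add: matrix_vector_mul_assoc matrix_mul_assoc)
  then have "(transpose ?K ** transpose ?J) *v (gmat M c' p *v (?J *v grad M \<phi> c p)) = (transpose ?K ** transpose ?J) *v dcoord \<phi> c' p"
    by (simp only: matrix_vector_mul_assoc[symmetric])
  then have "gmat M c' p *v (?J *v grad M \<phi> c p) = dcoord \<phi> c' p" by (simp add: tKJ)
  then have "matrix_inv (gmat M c' p) *v (gmat M c' p *v (?J *v grad M \<phi> c p)) = grad M \<phi> c' p"
    using grad_dcoord[OF c(2) p(2)] by simp
  then show "grad M \<phi> c' p = ?J *v grad M \<phi> c p"
    by (simp add: matrix_vector_mul_assoc matrix_mul_assoc gmat_inv[OF c(2) p(2)])
qed

lemma dcoord_continuous:
  assumes \<phi>: "msmooth \<phi>" and c: "c \<in> atlas M" shows "continuous_on (fst c) (dcoord \<phi> c)"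
proof (rule continuous_on_chart[OF c])
  have "continuous_on (cimage c) (\<lambda>x. hder (\<phi> \<circ> cinv c) x (axis j 1))" for j
    by (rule smooth_on_hder_continuous[OF cimage_rel_open[OF c]]) (use \<phi> c in \<open>auto simp: msmooth_def\<close>)
  then have "continuous_on (cimage c) (\<lambda>x. \<chi> j. hder (\<phi> \<circ> cinv c) x (axis j 1))"
    by (intro continuous_on_vec_lambda)
  then show "continuous_on (cimage c) (\<lambda>x. dcoord \<phi> c (cinv c x))"
    by (rule continuous_on_eq) (simp add: dcoord_def chart_maps[OF c])
qed

lemma grad_continuous:
  assumes \<phi>: "msmooth \<phi>" and c: "c \<in> atlas M" shows "continuous_on (fst c) (grad M \<phi> c)"
  by (rule continuous_on_linear_solve[OF continuous_on_chart[OF c gmat_continuous[OF c]] dcoord_continuous[OF \<phi> c]])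
    (use gmat_inv(3)[OF c] gmat_grad[OF c] in auto)

lemma grad_measurable_vfield:
  assumes "msmooth \<phi>" shows "measurable_vfield M (grad M \<phi>)"
  unfolding measurable_vfield_def set_borel_measurable_def
  using grad_vector_field[OF assms] grad_continuous[OF assms] chart_open
  by (auto intro!: borel_measurable_continuous_on_indicator)

lemma msmooth_continuous:
  assumes "msmooth \<phi>" shows "continuous_on UNIV \<phi>"
proof -
  have "continuous_on (fst c) \<phi>" if "c \<in> atlas M" for c
    by (rule continuous_on_chart[OF that]) (use smooth_on_continuous assms that in \<open>auto simp: msmooth_def o_def\<close>)
  then have "continuous_on (\<Union>c\<in>atlas M. fst c) \<phi>"
    by (intro continuous_on_open_UN) (auto intro: chart_open)
  moreover have "(\<Union>c\<in>atlas M. fst c) = UNIV" using chart_exists by auto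
  ultimately show ?thesis by simp
qed

lemma msmooth_add: "msmooth \<phi> \<Longrightarrow> msmooth \<psi> \<Longrightarrow> msmooth (\<lambda>p. \<phi> p + \<psi> p)"
  and msmooth_mult: "msmooth \<phi> \<Longrightarrow> msmooth \<psi> \<Longrightarrow> msmooth (\<lambda>p. \<phi> p * \<psi> p)"
  and msmooth_const: "msmooth (\<lambda>p. a)"
  and msmooth_comp: "msmooth \<phi> \<Longrightarrow> (\<And>k. ck_on k UNIV F) \<Longrightarrow> msmooth (\<lambda>p. F (\<phi> p))"
  unfolding msmooth_def o_def by (auto intro: smooth_on_add smooth_on_mult smooth_on_const smooth_on_comp)

lemma grad_lincomb:
  assumes c: "c \<in> atlas M" "p \<in> fst c" and d: "dcoord \<phi> c p = a *\<^sub>R dcoord \<psi>1 c p + b *\<^sub>R dcoord \<psi>2 c p"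
  shows "grad M \<phi> c p = a *\<^sub>R grad M \<psi>1 c p + b *\<^sub>R grad M \<psi>2 c p"
  unfolding grad_dcoord[OF c] d by (simp add: matrix_vector_right_distrib matrix_vector_mult_scaleR)

lemma grad_add:
  assumes "msmooth \<phi>" "msmooth \<psi>" and c: "c \<in> atlas M" "p \<in> fst c"
  shows "grad M (\<lambda>p. \<phi> p + \<psi> p) c p = grad M \<phi> c p + grad M \<psi> c p"
proof -
  have "dcoord (\<lambda>p. \<phi> p + \<psi> p) c p = 1 *\<^sub>R dcoord \<phi> c p + 1 *\<^sub>R dcoord \<psi> c p"
    by (rule dcoordI[OF c]) (use has_derivative_add[OF msmooth_derivative[OF assms(1) c] msmooth_derivative[OF assms(2) c]]
        in \<open>simp add: o_def inner_add_left\<close>)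
  from grad_lincomb[OF c this] show ?thesis by simp
qed

lemma grad_mult_comp:
  assumes "msmooth \<phi>" "msmooth w" and c: "c \<in> atlas M" "p \<in> fst c" and F: "(F has_real_derivative F') (at (w p))"
  shows "grad M (\<lambda>p. \<phi> p * F (w p)) c p = F (w p) *\<^sub>R grad M \<phi> c p + (\<phi> p * F') *\<^sub>R grad M w c p"
proof (rule grad_lincomb[OF c], rule dcoordI[OF c])
  have "(F has_real_derivative F') (at ((w \<circ> cinv c) (snd c p)))" using F by (simp add: chart_maps c)
  from DERIV_compose_FDERIV[OF this msmooth_derivative[OF assms(2) c]]
  have 1: "((\<lambda>x. F ((w \<circ> cinv c) x)) has_derivative (\<lambda>v. (dcoord w c p \<bullet> v) * F')) (at (snd c p) within half_space)" .
  show "((\<lambda>p. \<phi> p * F (w p)) \<circ> cinv c has_derivative (\<bullet>) (F (w p) *\<^sub>R dcoord \<phi> c p + (\<phi> p * F') *\<^sub>R dcoord w c p))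
     (at (snd c p) within half_space)"
  proof -
    have "(\<bullet>) (F (w p) *\<^sub>R dcoord \<phi> c p + (\<phi> p * F') *\<^sub>R dcoord w c p)
        = (\<lambda>v. \<phi> p * ((dcoord w c p \<bullet> v) * F') + (dcoord \<phi> c p \<bullet> v) * F (w p))"
      by (rule ext) (simp add: inner_add_left algebra_simps)
    then show ?thesis
      using has_derivative_mult[OF msmooth_derivative[OF assms(1) c] 1]
      by (simp add: o_def chart_maps c)
  qed
qed

lemma grad_comp:
  assumes "msmooth w" and c: "c \<in> atlas M" "p \<in> fst c" and F: "(F has_real_derivative F') (at (w p))"
  shows "grad M (\<lambda>p. F (w p)) c p = F' *\<^sub>R grad M w c p"
proof -
  have "dcoord (\<lambda>p. 1) c p = 0" by (rule dcoordI[OF c]) (simp add: o_def)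
  then have "grad M (\<lambda>p. 1) c p = 0" by (simp add: grad_dcoord[OF c])
  then show ?thesis using grad_mult_comp[OF msmooth_const assms(1) c F, of 1] by simp
qed

lemma grad_zero:
  assumes "c \<in> atlas M" "p \<in> fst c" "open W" "p \<in> W" "\<And>q. q \<in> W \<Longrightarrow> \<phi> q = 0"
  shows "grad M \<phi> c p = 0"
proof -
  have "dcoord \<phi> c p = 0"
  proof (rule dcoordI[OF assms(1,2)])
    have "((\<phi> \<circ> cinv c) has_derivative (\<lambda>v. 0)) (at (snd c p) within half_space)"
      by (rule hder_cong[OF chart_image_rel_open[OF assms(1), of "W \<inter> fst c"], of _ _ "\<lambda>_. 0"])
        (use assms chart_open[OF assms(1)] in \<open>auto simp: chart_maps[OF assms(1)]\<close>)
    moreover have "(\<bullet>) 0 = (\<lambda>v::real^'n::_. 0)" by (rule ext) simp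
    ultimately show "((\<phi> \<circ> cinv c) has_derivative (\<bullet>) 0) (at (snd c p) within half_space)" by simp
  qed
  then show ?thesis by (simp add: grad_dcoord[OF assms(1,2)])
qed

end

section \<open>The Riemannian volume\<close>

text \<open>For nonnegative functions the two sides are absolutely integrable simultaneously. So
  either both integrals are finite, and the classical theorem applies, or both are infinite.\<close>

lemma nn_integral_change_of_variables:
  fixes g :: "real^'n::{finite,wellorder} \<Rightarrow> real^'n::_" and f :: "real^'n::_ \<Rightarrow> real"
  assumes S: "S \<in> sets borel"
    and der: "\<And>x. x \<in> S \<Longrightarrow> (g has_derivative g' x) (at x within S)"
    and inj: "inj_on g S" and nonneg: "\<And>y. y \<in> g ` S \<Longrightarrow> 0 \<le> f y"
    and u: "(\<lambda>x. if x \<in> S then \<bar>det (matrix (g' x))\<bar> * f (g x) else 0) \<in> borel_measurable borel" (is "?u \<in> _")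
    and v: "(\<lambda>y. if y \<in> g ` S then f y else 0) \<in> borel_measurable borel" (is "?v \<in> _")
  shows "(\<integral>\<^sup>+x. ennreal (if x \<in> S then \<bar>det (matrix (g' x))\<bar> * f (g x) else 0) \<partial>lborel)
    = (\<integral>\<^sup>+y. ennreal (if y \<in> g ` S then f y else 0) \<partial>lborel)"
proof -
  let ?D = "\<lambda>x. \<bar>det (matrix (g' x))\<bar> * f (g x)"
  have L: "S \<in> sets lebesgue" using S by simp
  \<comment> \<open>The scalar function is read as one with values in \<open>real^1\<close>, the
    form in which the theorem on absolute integrals takes it.\<close>
  have key: "(?D absolutely_integrable_on S \<and> integral S ?D = b) \<longleftrightarrow> (f absolutely_integrable_on (g ` S) \<and> integral (g ` S) f = b)" for b
    using has_absolute_integral_change_of_variables[OF L der inj, of "\<lambda>y. vec (f y) :: real^1" "vec b"]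
    by (simp add: absolutely_integrable_on_1_iff integral_on_1_eq vec_eq_iff)
  have D0: "0 \<le> ?D x" if "x \<in> S" for x using nonneg that by simp
  have eq: "(\<integral>\<^sup>+x. ennreal (?u x) \<partial>lborel) = ennreal b \<and> (\<integral>\<^sup>+y. ennreal (?v y) \<partial>lborel) = ennreal b"
    if "?D absolutely_integrable_on S" "integral S ?D = b" for b
  proof
    have "(?D has_integral b) S" using that by (auto simp: absolutely_integrable_on_def has_integral_iff)
    then have "(?u has_integral b) UNIV" by (simp add: has_integral_restrict_UNIV)
    then show "(\<integral>\<^sup>+x. ennreal (?u x) \<partial>lborel) = ennreal b"
      by (rule nn_integral_has_integral_lborel[OF u, rotated]) (use D0 in auto)
    have "(f has_integral b) (g ` S)" using that key[of b] by (auto simp: absolutely_integrable_on_def has_integral_iff)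
    then have "(?v has_integral b) UNIV" by (simp add: has_integral_restrict_UNIV)
    then show "(\<integral>\<^sup>+x. ennreal (?v x) \<partial>lborel) = ennreal b"
      by (rule nn_integral_has_integral_lborel[OF v, rotated]) (use nonneg in auto)
  qed
  show ?thesis
  proof (cases "(\<integral>\<^sup>+x. ennreal (?u x) \<partial>lborel) < \<infinity> \<or> (\<integral>\<^sup>+y. ennreal (?v y) \<partial>lborel) < \<infinity>")
    case False
    have top: "a = b" if "\<not> (a < \<infinity> \<or> b < \<infinity>)" for a b :: ennreal
      using that by (cases a; cases b) auto
    from top[OF False] show ?thesis .
  next
    case True
    then have "?D absolutely_integrable_on S"
    proof
      assume "(\<integral>\<^sup>+x. ennreal (?u x) \<partial>lborel) < \<infinity>"
      then have "?u integrable_on UNIV" by (intro nn_integral_integrable_on u) (use D0 in auto)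
      then show ?thesis by (intro nonnegative_absolutely_integrable_1 D0) (simp add: integrable_restrict_UNIV)
    next
      assume "(\<integral>\<^sup>+y. ennreal (?v y) \<partial>lborel) < \<infinity>"
      then have "?v integrable_on UNIV" by (intro nn_integral_integrable_on v) (use nonneg in auto)
      then have "f absolutely_integrable_on g ` S"
        by (intro nonnegative_absolutely_integrable_1 nonneg) (auto simp: integrable_restrict_UNIV)
      then show ?thesis using key[of "integral (g ` S) f"] by simp
    qed
    then show ?thesis using eq by simp
  qed
qed

lemma det_pos_def:
  fixes A :: "real^'n::finite^'n"
  assumes A: "\<And>v. v \<noteq> 0 \<Longrightarrow> 0 < v \<bullet> (A *v v)" shows "0 < det A"
proof -
  \<comment> \<open>The determinant does not vanish on the segment from the identity to \<open>A\<close>.\<close>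
  define B where "B t = (1 - t) *\<^sub>R mat 1 + t *\<^sub>R A" for t :: real
  have nz: "det (B t) \<noteq> 0" if t: "t \<in> {0..1}" for t
  proof (rule matrix_inv_pos_def(3))
    fix v :: "real^'n" assume "v \<noteq> 0"
    have "v \<bullet> (B t *v v) = (1 - t) * (v \<bullet> v) + t * (v \<bullet> (A *v v))"
      unfolding B_def by (simp add: matrix_vector_mult_add_rdistrib scaleR_matrix_vector_assoc[symmetric] inner_add_right)
    moreover have "0 < v \<bullet> v" "0 < v \<bullet> (A *v v)" using \<open>v \<noteq> 0\<close> A by auto
    ultimately show "0 < v \<bullet> (B t *v v)" using t
      by (cases "t = 0") (auto intro!: add_nonneg_pos)
  qed
  have cont: "continuous_on {0..1} (\<lambda>t. det (B t))" unfolding B_def by (intro continuous_on_det continuous_intros)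
  have "det (B 0) = 1" "det (B 1) = det A" by (auto simp: B_def)
  show ?thesis
  proof (rule ccontr)
    assume "\<not> 0 < det A"
    then have "\<exists>t\<ge>0. t \<le> 1 \<and> det (B t) = 0"
      using IVT2'[of "\<lambda>t. det (B t)" 1 0 0, OF _ _ _ cont] \<open>det (B 0) = 1\<close> \<open>det (B 1) = det A\<close> by auto
    then show False using nz by auto
  qed
qed

lemma rel_open_borel: "rel_open S \<Longrightarrow> S \<in> sets borel"
  unfolding openin_open by (elim exE conjE) (simp add: sets.Int[OF borel_closed[OF half_space_closed] borel_open])

context riem_mfd
begin

definition rho :: "('p, 'n) chart \<Rightarrow> real^'n::_ \<Rightarrow> real" where
  "rho c x = sqrt (det (gmat M c (cinv c x)))"

lemma rho_pos: "c \<in> atlas M \<Longrightarrow> x \<in> cimage c \<Longrightarrow> 0 < rho c x"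
  unfolding rho_def using det_pos_def[of "gmat M c (cinv c x)"] gmat_pos chart_maps by simp

lemma rho_continuous: "c \<in> atlas M \<Longrightarrow> continuous_on (cimage c) (rho c)"
  unfolding rho_def by (intro continuous_on_real_sqrt continuous_on_det gmat_continuous)

lemma rho_nonneg: "c \<in> atlas M \<Longrightarrow> x \<in> cimage c \<Longrightarrow> 0 \<le> rho c x"
  using rho_pos by (simp add: less_imp_le)

lemma cimage_borel [measurable]: "c \<in> atlas M \<Longrightarrow> cimage c \<in> sets borel"
  using rel_open_borel cimage_rel_open by blast

lemma rho_measurable:
  assumes c: "c \<in> atlas M" shows "(\<lambda>x. indicator (cimage c) x * rho c x) \<in> borel_measurable borel"
  using borel_measurable_continuous_on_indicator[OF cimage_borel[OF c] rho_continuous[OF c]] by simp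

lemma rho_measurable_ennreal:
  assumes c: "c \<in> atlas M" shows "(\<lambda>x. indicator (cimage c) x * ennreal (rho c x)) \<in> borel_measurable borel"
proof -
  have "(\<lambda>x. ennreal (indicator (cimage c) x * rho c x)) \<in> borel_measurable borel"
    using rho_measurable[OF c] by measurable
  moreover have "ennreal (indicator (cimage c) x * rho c x) = indicator (cimage c) x * ennreal (rho c x)" for x
    by (simp add: indicator_def)
  ultimately show ?thesis by simp
qed

lemma cinv_measurable:
  assumes c: "c \<in> atlas M" shows "(\<lambda>x. if x \<in> cimage c then cinv c x else undefined) \<in> borel_measurable borel"
  by (rule borel_measurable_continuous_on_if[OF cimage_borel[OF c] chart_maps(6)[OF c]]) simp

lemma rho_change:
  assumes "c \<in> atlas M" "c' \<in> atlas M" "p \<in> fst c" "p \<in> fst c'"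
  shows "rho c (snd c p) = \<bar>det (jacobian c c' p)\<bar> * rho c' (snd c' p)"
proof -
  have "det (gmat M c p) = (det (jacobian c c' p))\<^sup>2 * det (gmat M c' p)"
    using gmat_change[OF assms] by (simp add: det_mul power2_eq_square)
  then show ?thesis by (simp add: rho_def chart_maps assms real_sqrt_mult)
qed

lemma chart_image_borel:
  assumes c: "c \<in> atlas M" and B: "B \<in> sets borel" "B \<subseteq> fst c" shows "snd c ` B \<in> sets borel"
proof -
  have "snd c ` B = cimage c \<inter> ((\<lambda>x. if x \<in> cimage c then cinv c x else undefined) -` B \<inter> space borel)"
    using chart_image_eq[OF c B(2)] by auto
  then show ?thesis using measurable_sets[OF cinv_measurable[OF c] B(1)] cimage_borel[OF c] by auto
qed

text \<open>The density is cut off outside the chart image, so the default \<open>undefined\<close>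
  of the extended inverse chart carries no mass.\<close>

definition chart_vol :: "('p, 'n) chart \<Rightarrow> 'p measure" where
  "chart_vol c = distr (density lborel (\<lambda>x. indicator (cimage c) x * ennreal (rho c x))) borel
     (\<lambda>x. if x \<in> cimage c then cinv c x else undefined)"

lemma sets_chart_vol [simp]: "sets (chart_vol c) = sets borel" "space (chart_vol c) = UNIV"
  by (simp_all add: chart_vol_def)

lemma chart_vol_nn:
  assumes c: "c \<in> atlas M" and f: "f \<in> borel_measurable borel"
  shows "(\<integral>\<^sup>+p. f p \<partial>chart_vol c) = (\<integral>\<^sup>+x. indicator (cimage c) x * ennreal (rho c x) * f (cinv c x) \<partial>lborel)"
proof -
  note m = cinv_measurable[OF c] rho_measurable_ennreal[OF c]
  have "(\<integral>\<^sup>+p. f p \<partial>chart_vol c) = (\<integral>\<^sup>+x. indicator (cimage c) x * ennreal (rho c x) * f (if x \<in> cimage c then cinv c x else undefined) \<partial>lborel)"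
  proof -
    have "(\<integral>\<^sup>+p. f p \<partial>chart_vol c) = (\<integral>\<^sup>+x. f (if x \<in> cimage c then cinv c x else undefined) \<partial>density lborel (\<lambda>x. indicator (cimage c) x * ennreal (rho c x)))"
      unfolding chart_vol_def by (rule nn_integral_distr) (use m(1) f in simp_all)
    also have "\<dots> = (\<integral>\<^sup>+x. indicator (cimage c) x * ennreal (rho c x) * f (if x \<in> cimage c then cinv c x else undefined) \<partial>lborel)"
      by (rule nn_integral_density) (use m(2) measurable_compose[OF m(1) f] in simp_all)
    finally show ?thesis .
  qed
  also have "\<dots> = (\<integral>\<^sup>+x. indicator (cimage c) x * ennreal (rho c x) * f (cinv c x) \<partial>lborel)"
    by (intro nn_integral_cong) (auto simp: indicator_def)
  finally show ?thesis .
qed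

lemma chart_vol_emeasure:
  assumes c: "c \<in> atlas M" and B: "B \<in> sets borel"
  shows "emeasure (chart_vol c) B = (\<integral>\<^sup>+x. indicator (cimage c) x * ennreal (rho c x) * indicator B (cinv c x) \<partial>lborel)"
  using chart_vol_nn[OF c, of "indicator B"] B by (simp add: nn_integral_indicator)

lemma chart_vol_image:
  assumes c: "c \<in> atlas M" and B: "B \<in> sets borel" "B \<subseteq> fst c"
  shows "emeasure (chart_vol c) B = (\<integral>\<^sup>+x\<in>snd c ` B. ennreal (sqrt (det (gmat M c (cinv c x)))) \<partial>lborel)"
  unfolding chart_vol_emeasure[OF c B(1)] rho_def[symmetric] chart_image_eq[OF c B(2)]
  by (intro nn_integral_cong) (auto simp: indicator_def)

text \<open>The law of the metric gives \<open>rho c = \<bar>det J\<bar> * rho c'\<close>, which is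
  exactly the factor in the change of variables under the transition map.\<close>

lemma chart_vol_agree:
  assumes c: "c \<in> atlas M" "c' \<in> atlas M" and B: "B \<in> sets borel" "B \<subseteq> fst c" "B \<subseteq> fst c'"
  shows "emeasure (chart_vol c) B = emeasure (chart_vol c') B"
proof -
  let ?S = "snd c ` B" and ?g = "transition c c'"
  let ?g' = "\<lambda>x v. jacobian c c' (cinv c x) *v v"
  have gS: "?g ` ?S = snd c' ` B" unfolding image_image
    by (rule image_cong[OF refl]) (use B(2) transition_snd[OF c(1)] in blast)
  have Sb: "?S \<in> sets borel" "snd c' ` B \<in> sets borel" using chart_image_borel c B by auto
  have sub: "?S \<subseteq> half_space" using B snd_in_half_space[OF c(1)] by auto
  have J: "\<bar>det (matrix (?g' x))\<bar> * rho c' (?g x) = rho c x" if x: "x \<in> ?S" for x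
  proof -
    obtain p where p: "p \<in> B" "x = snd c p" using x by blast
    then have pp: "p \<in> fst c" "p \<in> fst c'" using B by auto
    show ?thesis using rho_change[OF c pp] chart_maps(2)[OF c(1) pp(1)] transition_snd[OF c(1) pp(1)] p
      by simp
  qed
  have ind: "(\<lambda>x. if x \<in> snd d ` B then rho d x else 0) \<in> borel_measurable borel"
    if d: "d \<in> atlas M" "B \<subseteq> fst d" for d
  proof -
    have [measurable]: "snd d ` B \<in> sets borel" using chart_image_borel[OF d(1) B(1) d(2)] .
    have "snd d ` B \<subseteq> cimage d" using chart_maps(1)[OF d(1)] d(2) by auto
    then have "(\<lambda>x. if x \<in> snd d ` B then rho d x else 0) = (\<lambda>x. indicator (snd d ` B) x * (indicator (cimage d) x * rho d x))"
      by (auto simp: fun_eq_iff indicator_def)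
    then show ?thesis using rho_measurable[OF d(1)] by simp
  qed
  have ueq: "(\<lambda>x. if x \<in> ?S then \<bar>det (matrix (?g' x))\<bar> * rho c' (?g x) else 0) = (\<lambda>x. if x \<in> ?S then rho c x else 0)"
    using J by auto
  have "(\<integral>\<^sup>+x. ennreal (if x \<in> ?S then \<bar>det (matrix (?g' x))\<bar> * rho c' (?g x) else 0) \<partial>lborel)
    = (\<integral>\<^sup>+y. ennreal (if y \<in> ?g ` ?S then rho c' y else 0) \<partial>lborel)"
  proof (rule nn_integral_change_of_variables[OF Sb(1)])
    fix x assume "x \<in> ?S"
    then obtain p where p: "p \<in> B" "x = snd c p" by blast
    then have pp: "p \<in> fst c" "p \<in> fst c'" using B by auto
    show "(?g has_derivative ?g' x) (at x within ?S)"
      using has_derivative_subset[OF transition_has_derivative[OF c pp] sub] chart_maps(2)[OF c(1) pp(1)] p by simp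
  next
    show "inj_on ?g ?S"
    proof (rule inj_onI)
      fix x y assume "x \<in> ?S" "y \<in> ?S" and e: "?g x = ?g y"
      then obtain p r where p: "p \<in> B" "x = snd c p" "r \<in> B" "y = snd c r" by blast
      then have "p \<in> fst c" "p \<in> fst c'" "r \<in> fst c" "r \<in> fst c'" using B by auto
      then have "snd c' p = snd c' r" using e p transition_snd[OF c(1)] by metis
      then have "p = r" using chart_maps(2)[OF c(2)] \<open>p \<in> fst c'\<close> \<open>r \<in> fst c'\<close> by metis
      then show "x = y" using p by simp
    qed
  next
    fix y assume "y \<in> ?g ` ?S"
    then show "0 \<le> rho c' y" unfolding gS using rho_nonneg[OF c(2)] chart_maps(1)[OF c(2)] B(3) by auto
  qed (unfold ueq gS, use ind[OF c(1) B(2)] ind[OF c(2) B(3)] in auto)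
  then have "(\<integral>\<^sup>+x. ennreal (if x \<in> ?S then rho c x else 0) \<partial>lborel) = (\<integral>\<^sup>+y. ennreal (if y \<in> snd c' ` B then rho c' y else 0) \<partial>lborel)"
    unfolding gS using arg_cong[OF ueq, of "\<lambda>h. \<integral>\<^sup>+x. ennreal (h x) \<partial>lborel"] by simp
  moreover have "emeasure (chart_vol d) B = (\<integral>\<^sup>+x. ennreal (if x \<in> snd d ` B then rho d x else 0) \<partial>lborel)"
    if "d \<in> atlas M" "B \<subseteq> fst d" for d
    unfolding chart_vol_image[OF that(1) B(1) that(2)] rho_def
    by (intro nn_integral_cong) (auto simp: indicator_def)
  ultimately show ?thesis using c B by simp
qed

lemma countable_subatlas: "\<exists>f::nat \<Rightarrow> ('p, 'n) chart. range f \<subseteq> atlas M \<and> (\<forall>p. \<exists>n. p \<in> fst (f n))"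
proof -
  obtain \<F> where F: "\<F> \<subseteq> fst ` atlas M" "countable \<F>" "\<Union>\<F> = \<Union>(fst ` atlas M)"
    using Lindelof[of "fst ` atlas M"] chart_open by blast
  obtain C where C: "C \<subseteq> atlas M" "countable C" "\<F> = fst ` C"
    using F(1,2) countable_subset_image[of \<F> fst "atlas M"] by blast
  have cov: "\<exists>c\<in>C. p \<in> fst c" for p using chart_exists[of p] F(3) C(3) by blast
  then have "C \<noteq> {}" by blast
  then have "range (from_nat_into C) = C" using C(2) by (rule range_from_nat_into)
  then show ?thesis using C(1) cov by (intro exI[of _ "from_nat_into C"]) (metis imageE)
qed

text \<open>A countable covering by charts. Taking the first chart of the sequence that contains a
  point is a Borel choice, and it splits the manifold into countably many disjoint cells, each
  inside one chart.\<close>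

definition ch :: "nat \<Rightarrow> ('p, 'n) chart" where
  "ch = (SOME f. range f \<subseteq> atlas M \<and> (\<forall>p. \<exists>n. p \<in> fst (f n)))"

definition idx :: "'p \<Rightarrow> nat" where "idx p = (LEAST n. p \<in> fst (ch n))"

lemma ch_atlas: "ch n \<in> atlas M" and ch_cover: "\<exists>n. p \<in> fst (ch n)"
  using someI_ex[OF countable_subatlas] unfolding ch_def[symmetric] by auto

lemma idx: "p \<in> fst (ch (idx p))"
  unfolding idx_def using ch_cover by (rule LeastI_ex)

lemma idx_measurable [measurable]: "idx \<in> measurable borel (count_space UNIV)"
  unfolding idx_def
proof (rule measurable_Least)
  have [measurable]: "fst (ch n) \<in> sets borel" for n using chart_open[OF ch_atlas] by simp
  show "(\<lambda>p. p \<in> fst (ch n)) \<in> measurable borel (count_space UNIV)" for n by measurable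
qed

definition cell :: "nat \<Rightarrow> 'p set" where "cell n = {p. idx p = n}"

lemma cell: "cell n \<in> sets borel" "cell n \<subseteq> fst (ch n)" "(\<Union>n. cell n) = UNIV" "disjoint_family cell"
proof -
  have "cell n = idx -` {n} \<inter> space borel" by (auto simp: cell_def)
  then show "cell n \<in> sets borel" by (metis idx_measurable measurable_sets sets_count_space Pow_UNIV UNIV_I)
qed (use idx in \<open>auto simp: cell_def disjoint_family_on_def\<close>)

lemma suminf_swap: "(\<Sum>i. \<Sum>n. f i n) = (\<Sum>n. \<Sum>i. (f i n :: ennreal))" for f :: "nat \<Rightarrow> nat \<Rightarrow> ennreal"
proof -
  have "(\<integral>\<^sup>+n. (\<Sum>i. f i n) \<partial>count_space UNIV) = (\<Sum>i. \<integral>\<^sup>+n. f i n \<partial>count_space UNIV)"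
    by (rule nn_integral_suminf) simp
  then show ?thesis by (simp add: nn_integral_count_space_nat)
qed

text \<open>The local volumes are glued by measuring each cell in its own chart; agreement on
  overlaps makes the result correct in all charts.\<close>

definition mvol :: "'p measure" where
  "mvol = measure_of UNIV (sets borel) (\<lambda>B. \<Sum>n. emeasure (chart_vol (ch n)) (B \<inter> cell n))"

lemma sets_mvol [simp]: "sets mvol = sets borel" "space mvol = UNIV"
  unfolding mvol_def using sets.sigma_sets_eq[of borel] by auto

lemma emeasure_cells:
  assumes "sets \<mu> = sets borel" "B \<in> sets borel"
  shows "emeasure \<mu> B = (\<Sum>n. emeasure \<mu> (B \<inter> cell n))"
proof -
  have "(\<Sum>n. emeasure \<mu> (B \<inter> cell n)) = emeasure \<mu> (\<Union>n. B \<inter> cell n)"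
  proof (rule suminf_emeasure)
    show "range (\<lambda>n. B \<inter> cell n) \<subseteq> sets \<mu>" using assms cell(1) by auto
    show "disjoint_family (\<lambda>n. B \<inter> cell n)" using cell(4) unfolding disjoint_family_on_def by blast
  qed
  also have "(\<Union>n. B \<inter> cell n) = B" using cell(3) by auto
  finally show ?thesis by simp
qed

lemma mvol_emeasure:
  assumes B: "B \<in> sets borel"
  shows "emeasure mvol B = (\<Sum>n. emeasure (chart_vol (ch n)) (B \<inter> cell n))"
proof (rule emeasure_measure_of[OF mvol_def])
  show "countably_additive (sets mvol) (\<lambda>B. \<Sum>n. emeasure (chart_vol (ch n)) (B \<inter> cell n))"
  proof (rule countably_additiveI)
    fix A :: "nat \<Rightarrow> 'p set" assume A: "range A \<subseteq> sets mvol" "disjoint_family A" "(\<Union>i. A i) \<in> sets mvol"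
    have "(\<Sum>i. emeasure (chart_vol (ch n)) (A i \<inter> cell n)) = emeasure (chart_vol (ch n)) (\<Union>i. A i \<inter> cell n)" for n
      by (rule suminf_emeasure) (use A cell(1,4) in \<open>auto simp: disjoint_family_on_def\<close>)
    then show "(\<Sum>i. \<Sum>n. emeasure (chart_vol (ch n)) (A i \<inter> cell n)) = (\<Sum>n. emeasure (chart_vol (ch n)) ((\<Union>i. A i) \<inter> cell n))"
      by (subst suminf_swap) simp
  qed
qed (use B in \<open>auto simp: positive_def\<close>)

lemma mvol_chart:
  assumes c: "c \<in> atlas M" and B: "B \<in> sets borel" "B \<subseteq> fst c"
  shows "emeasure mvol B = emeasure (chart_vol c) B"
proof -
  have "emeasure (chart_vol (ch n)) (B \<inter> cell n) = emeasure (chart_vol c) (B \<inter> cell n)" for n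
    by (rule chart_vol_agree[OF ch_atlas c]) (use B cell(1,2)[of n] in auto)
  then show ?thesis unfolding mvol_emeasure[OF B(1)] using emeasure_cells[of "chart_vol c" B] B by simp
qed

text \<open>Existence is the glued measure. Uniqueness holds because a Borel set is the disjoint
  union of its parts in the cells, on each of which some chart prescribes the measure.\<close>

lemma riem_volume_eq: "riem_volume M = mvol"
  unfolding riem_volume_def
proof (rule the_equality)
  show "sets mvol = sets borel \<and> (\<forall>c\<in>atlas M. \<forall>B\<in>sets borel. B \<subseteq> fst c \<longrightarrow>
    emeasure mvol B = (\<integral>\<^sup>+x\<in>snd c ` B. ennreal (sqrt (det (gmat M c (cinv c x)))) \<partial>lborel))"
    using mvol_chart chart_vol_image by auto
  fix \<mu> :: "'p measure"
  assume \<mu>: "sets \<mu> = sets borel \<and> (\<forall>c\<in>atlas M. \<forall>B\<in>sets borel. B \<subseteq> fst c \<longrightarrow>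
    emeasure \<mu> B = (\<integral>\<^sup>+x\<in>snd c ` B. ennreal (sqrt (det (gmat M c (cinv c x)))) \<partial>lborel))"
  show "\<mu> = mvol"
  proof (rule measure_eqI)
    fix B assume "B \<in> sets \<mu>"
    then have B: "B \<in> sets borel" using \<mu> by simp
    have "emeasure \<mu> (B \<inter> cell n) = emeasure mvol (B \<inter> cell n)" for n
    proof -
      have Bn: "B \<inter> cell n \<in> sets borel" "B \<inter> cell n \<subseteq> fst (ch n)" using B cell(1,2)[of n] by auto
      have "emeasure \<mu> (B \<inter> cell n) = (\<integral>\<^sup>+x\<in>snd (ch n) ` (B \<inter> cell n). ennreal (sqrt (det (gmat M (ch n) (cinv (ch n) x)))) \<partial>lborel)"
        using \<mu>[THEN conjunct2, rule_format, OF ch_atlas Bn] .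
      then show ?thesis using mvol_chart[OF ch_atlas Bn] chart_vol_image[OF ch_atlas Bn] by simp
    qed
    then show "emeasure \<mu> B = emeasure mvol B"
      using emeasure_cells[OF _ B, of \<mu>] emeasure_cells[OF _ B, of mvol] \<mu> by simp
  qed (use \<mu> in simp)
qed

abbreviation vol :: "'p measure" where "vol \<equiv> riem_volume M"

lemma sets_vol [simp, measurable_cong]: "sets vol = sets borel" and space_vol [simp]: "space vol = UNIV"
  by (simp_all add: riem_volume_eq)

lemma vol_density: assumes c: "c \<in> atlas M" shows "density vol (indicator (fst c)) = chart_vol c"
proof (rule measure_eqI)
  fix B assume "B \<in> sets (density vol (indicator (fst c)))"
  then have B: "B \<in> sets borel" by simp
  have f: "fst c \<in> sets borel" using chart_open[OF c] by simp
  have "emeasure (density vol (indicator (fst c))) B = (\<integral>\<^sup>+p. indicator (fst c) p * indicator B p \<partial>vol)"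
    by (rule emeasure_density) (use B f in auto)
  also have "\<dots> = (\<integral>\<^sup>+p. indicator (fst c \<inter> B) p \<partial>vol)"
    by (simp only: indicator_inter_arith)
  also have "\<dots> = emeasure vol (fst c \<inter> B)" using B f by (intro nn_integral_indicator) auto
  also have "\<dots> = emeasure (chart_vol c) (fst c \<inter> B)"
    unfolding riem_volume_eq by (rule mvol_chart[OF c]) (use B f in auto)
  also have "\<dots> = emeasure (chart_vol c) B"
    using B f chart_maps(3)[OF c] by (subst (1 2) chart_vol_emeasure[OF c]) (auto intro!: nn_integral_cong simp: indicator_def)
  finally show "emeasure (density vol (indicator (fst c))) B = emeasure (chart_vol c) B" .
qed simp

lemma vol_nn:
  assumes c: "c \<in> atlas M" and f: "f \<in> borel_measurable borel"
  shows "(\<integral>\<^sup>+p. indicator (fst c) p * f p \<partial>vol) = (\<integral>\<^sup>+x. indicator (cimage c) x * ennreal (rho c x) * f (cinv c x) \<partial>lborel)"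
proof -
  have "fst c \<in> sets borel" using chart_open[OF c] by simp
  then have "(\<integral>\<^sup>+p. indicator (fst c) p * f p \<partial>vol) = (\<integral>\<^sup>+p. f p \<partial>density vol (indicator (fst c)))"
    using f by (subst nn_integral_density) auto
  then show ?thesis unfolding vol_density[OF c] chart_vol_nn[OF c f] .
qed

lemma chart_ball:
  obtains c e where "c \<in> atlas M" "p \<in> fst c" "e > 0" "cball (snd c p) e \<inter> half_space \<subseteq> cimage c"
proof -
  obtain c where c: "c \<in> atlas M" "p \<in> fst c" using chart_exists by blast
  have "snd c p \<in> cimage c" using chart_maps c by blast
  then obtain e where "e > 0" "cball (snd c p) e \<inter> half_space \<subseteq> cimage c"
    using cimage_rel_open[OF c(1)] unfolding openin_contains_cball by blast
  with c that show thesis by blast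
qed

lemma chart_preimage_open:
  assumes "c \<in> atlas M" "open V" shows "open (fst c \<inter> snd c -` V)"
  using continuous_open_preimage[OF chart_maps(5)[OF assms(1)] chart_open[OF assms(1)] assms(2)] .

lemma rho_bounds:
  assumes c: "c \<in> atlas M" and K: "compact K" "K \<subseteq> cimage c"
  obtains a b where "0 < a" "0 < b" "\<And>x. x \<in> K \<Longrightarrow> a \<le> rho c x \<and> rho c x \<le> b"
proof (cases "K = {}")
  case True then show thesis using that[of 1 1] by simp
next
  case False
  have cont: "continuous_on K (rho c)" using rho_continuous[OF c] K(2) continuous_on_subset by blast
  obtain x y where "x \<in> K" "y \<in> K" "\<And>z. z \<in> K \<Longrightarrow> rho c x \<le> rho c z" "\<And>z. z \<in> K \<Longrightarrow> rho c z \<le> rho c y"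
    using continuous_attains_inf[OF K(1) False cont] continuous_attains_sup[OF K(1) False cont] by blast
  then show thesis using that[of "rho c x" "rho c y"] rho_pos[OF c] K(2) by blast
qed

lemma vol_locally_finite: "\<exists>W. open W \<and> p \<in> W \<and> emeasure vol W < \<infinity>"
proof -
  obtain c e where c: "c \<in> atlas M" "p \<in> fst c" and e: "e > 0" "cball (snd c p) e \<inter> half_space \<subseteq> cimage c"
    by (rule chart_ball)
  let ?K = "cball (snd c p) e \<inter> half_space"
  have K: "compact ?K" using half_space_closed by (intro compact_Int_closed) auto
  obtain a b where b: "\<And>x. x \<in> ?K \<Longrightarrow> rho c x \<le> b" using rho_bounds[OF c(1) K e(2)] by metis
  let ?W = "fst c \<inter> snd c -` ball (snd c p) e"
  have W: "open ?W" by (rule chart_preimage_open[OF c(1)]) simp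
  have "emeasure vol ?W = (\<integral>\<^sup>+p. indicator (fst c) p * indicator ?W p \<partial>vol)"
  proof -
    have "emeasure vol ?W = (\<integral>\<^sup>+p. indicator ?W p \<partial>vol)" using W by (intro nn_integral_indicator[symmetric]) simp
    also have "\<dots> = (\<integral>\<^sup>+p. indicator (fst c) p * indicator ?W p \<partial>vol)"
      by (intro nn_integral_cong) (simp add: indicator_def)
    finally show ?thesis .
  qed
  also have "\<dots> = (\<integral>\<^sup>+x. indicator (cimage c) x * ennreal (rho c x) * indicator ?W (cinv c x) \<partial>lborel)"
    by (rule vol_nn[OF c(1)]) (rule borel_measurable_indicator[OF borel_open[OF W]])
  also have "\<dots> \<le> (\<integral>\<^sup>+x. ennreal b * indicator ?K x \<partial>lborel)"
  proof (rule nn_integral_mono)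
    fix x
    show "indicator (cimage c) x * ennreal (rho c x) * indicator ?W (cinv c x) \<le> ennreal b * indicator ?K x"
    proof (cases "x \<in> cimage c \<and> cinv c x \<in> ?W")
      case True
      then have "x \<in> ?K" using chart_maps(4)[OF c(1)] cimage_half_space[OF c(1)] by auto
      then show ?thesis using b by (auto simp: indicator_def intro!: ennreal_leI)
    qed (auto simp: indicator_def)
  qed
  also have "\<dots> = ennreal b * emeasure lborel ?K" using K by (intro nn_integral_cmult_indicator) (auto simp: borel_compact)
  also have "\<dots> < \<infinity>" using emeasure_compact_finite[OF K] by (simp add: ennreal_mult_less_top)
  finally show ?thesis using W c e by (intro exI[of _ ?W]) auto
qed

lemma vol_compact_finite: assumes "compact K" shows "emeasure vol K < \<infinity>"
proof -
  have "\<forall>p. \<exists>W. open W \<and> p \<in> W \<and> emeasure vol W < \<infinity>" using vol_locally_finite by blast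
  then obtain W where W: "\<And>p. open (W p)" "\<And>p. p \<in> W p" "\<And>p. emeasure vol (W p) < \<infinity>" by metis
  obtain F where F: "F \<subseteq> K" "finite F" "K \<subseteq> (\<Union>p\<in>F. W p)"
    using compactE_image[OF assms, of K W] W by blast
  have "emeasure vol K \<le> emeasure vol (\<Union>p\<in>F. W p)" using F W by (intro emeasure_mono) auto
  also have "\<dots> \<le> (\<Sum>p\<in>F. emeasure vol (W p))" using F W by (intro emeasure_subadditive_finite) auto
  also have "\<dots> < \<infinity>" using F W by (simp add: ennreal_sum_less_top)
  finally show ?thesis .
qed

lemma mfd_interior_open: "open (mfd_interior M)"
proof -
  have "mfd_interior M = (\<Union>c\<in>atlas M. fst c \<inter> snd c -` interior half_space)" by (auto simp: mfd_interior_def)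
  moreover have "open (\<Union>c\<in>atlas M. fst c \<inter> snd c -` interior half_space)"
    by (intro open_UN ballI chart_preimage_open open_interior)
  ultimately show ?thesis by (rule ssubst)
qed

text \<open>In every chart around it, a point outside the interior lies on the bounding hyperplane
  of the half space, a Lebesgue null set.\<close>

lemma vol_AE_interior: "AE p in vol. p \<in> mfd_interior M"
proof -
  let ?N = "- mfd_interior M"
  have N: "?N \<in> sets borel" using mfd_interior_open by auto
  have "emeasure vol (?N \<inter> cell n) = 0" for n
  proof -
    have NB: "(?N \<inter> cell n) \<in> sets borel" using N cell(1)[of n] by auto
    have "emeasure vol (?N \<inter> cell n) = (\<integral>\<^sup>+x. indicator (cimage (ch n)) x * ennreal (rho (ch n) x) * indicator (?N \<inter> cell n) (cinv (ch n) x) \<partial>lborel)"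
      unfolding riem_volume_eq mvol_chart[OF ch_atlas NB le_infI2[OF cell(2)]] by (rule chart_vol_emeasure[OF ch_atlas NB])
    also have "\<dots> = (\<integral>\<^sup>+x. 0 \<partial>(lborel :: (real^'n::_) measure))"
    proof (rule nn_integral_cong_AE)
      have "{x :: real^'n::_. x $ (LEAST i. True) = 0} \<in> null_sets lebesgue"
        using negligible_standard_hyperplane_cart[of "LEAST i. True"] by (simp add: negligible_iff_null_sets)
      moreover have "closed {x :: real^'n::_. x $ (LEAST i. True) = 0}" by (intro closed_Collect_eq continuous_intros)
      ultimately have "{x :: real^'n::_. x $ (LEAST i. True) = 0} \<in> null_sets lborel"
        by (auto simp: null_sets_def emeasure_completion)
      then have "AE x in lborel. (x :: real^'n::_) $ (LEAST i. True) \<noteq> 0"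
        using AE_not_in by fastforce
      then show "AE x in lborel. indicator (cimage (ch n)) x * ennreal (rho (ch n) x) * indicator (?N \<inter> cell n) (cinv (ch n) x) = (0::ennreal)"
      proof eventually_elim
        case (elim x)
        have "cinv (ch n) x \<in> mfd_interior M" if x: "x \<in> cimage (ch n)"
        proof -
          have "x \<in> half_space" using x cimage_half_space[OF ch_atlas] by blast
          then have "x \<in> interior half_space" using elim unfolding interior_half_space by (auto simp: half_space_def)
          then show ?thesis unfolding mfd_interior_def
            using chart_maps(3,4)[OF ch_atlas x] ch_atlas[of n] by auto
        qed
        then show ?case by (auto simp: indicator_def)
      qed
    qed
    finally show ?thesis by simp
  qed
  then have "emeasure vol ?N = 0" using emeasure_cells[OF sets_vol N] by simp
  then have "?N \<in> null_sets vol" using N by (auto simp: null_sets_def)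
  from AE_not_in[OF this] show ?thesis by auto
qed

end

section \<open>Test functions\<close>

lemma compact_closed_subset:
  fixes K :: "'a::topological_space set"
  assumes "compact K" "closed S" "S \<subseteq> K" shows "compact S"
  using compact_Int_closed[OF assms(1,2)] Int_absorb1[OF assms(3)] by simp

context riem_mfd
begin

text \<open>\<open>chart_at M\<close> is an arbitrary choice of charts, hence possibly not measurable; \<open>kappa\<close> is
  a measurable one.\<close>

definition kappa :: "'p \<Rightarrow> ('p, 'n) chart" where "kappa p = ch (idx p)"

lemma kappa: "kappa p \<in> atlas M" "p \<in> fst (kappa p)"
  unfolding kappa_def by (rule ch_atlas, rule idx)

lemma kappa_measurable:
  assumes "\<And>c. c \<in> atlas M \<Longrightarrow> (\<lambda>p. indicator (fst c) p *\<^sub>R f c p) \<in> borel_measurable borel"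
  shows "(\<lambda>p. f (kappa p) p :: 'b::real_normed_vector) \<in> borel_measurable borel"
proof -
  have "(\<lambda>p. indicator (fst (ch (idx p))) p *\<^sub>R f (ch (idx p)) p) \<in> borel_measurable borel"
    by (rule measurable_compose_countable[OF _ idx_measurable, of "\<lambda>n p. indicator (fst (ch n)) p *\<^sub>R f (ch n) p"])
      (rule assms[OF ch_atlas])
  moreover have "(\<lambda>p. indicator (fst (ch (idx p))) p *\<^sub>R f (ch (idx p)) p) = (\<lambda>p. f (kappa p) p)"
    using idx by (auto simp: kappa_def fun_eq_iff)
  ultimately show ?thesis by simp
qed

text \<open>A measurable trivialization of the tangent bundle: fields become functions into one
  Euclidean space, to which the abstract theory applies with \<open>qf\<close>.\<close>

definition compo :: "('p, 'n) vfield \<Rightarrow> 'p \<Rightarrow> real^'n::_" where "compo X p = X (kappa p) p"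

definition qf :: "'p \<Rightarrow> real^'n::_ \<Rightarrow> real^'n::_ \<Rightarrow> real" where
  "qf p u v = u \<bullet> (gmat M (kappa p) p *v v)"

lemma vinner_qf: "vector_field M X \<Longrightarrow> vector_field M Y \<Longrightarrow> vinner M X Y p = qf p (compo X p) (compo Y p)"
  unfolding qf_def compo_def by (rule vinner_chart[OF _ _ kappa])

lemma vnorm_qf: "vector_field M X \<Longrightarrow> (vnorm M X p)\<^sup>2 = qf p (compo X p) (compo X p)"
proof -
  assume X: "vector_field M X"
  have "0 \<le> qf p (compo X p) (compo X p)"
    using gmat_pos[OF kappa, of "compo X p" p] unfolding qf_def by (cases "compo X p = 0") (auto simp: less_imp_le)
  then show ?thesis unfolding vnorm_def vinner_qf[OF X X] by simp
qed

lemma compo_measurable: "measurable_vfield M X \<Longrightarrow> compo X \<in> borel_measurable borel"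
  unfolding compo_def measurable_vfield_def set_borel_measurable_def by (rule kappa_measurable) blast

lemma gmat_kappa_measurable: "(\<lambda>p. gmat M (kappa p) p) \<in> borel_measurable borel"
proof (rule kappa_measurable)
  fix c assume c: "c \<in> atlas M"
  show "(\<lambda>p. indicator (fst c) p *\<^sub>R gmat M c p) \<in> borel_measurable borel"
    by (rule borel_measurable_continuous_on_indicator[OF borel_open[OF chart_open[OF c]] continuous_on_chart[OF c gmat_continuous[OF c]]])
qed

lemma qf_measurable:
  assumes U: "U \<in> borel_measurable borel" and V: "V \<in> borel_measurable borel"
  shows "(\<lambda>p. qf p (U p) (V p)) \<in> borel_measurable borel"
proof -
  have nth: "(\<lambda>p. W p $ i) \<in> borel_measurable borel" if "W \<in> borel_measurable borel" for W :: "'p \<Rightarrow> real^'n::_" and i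
    using measurable_compose[OF that borel_measurable_nth] .
  have g: "(\<lambda>p. gmat M (kappa p) p $ i $ j) \<in> borel_measurable borel" for i j
  proof -
    have "(\<lambda>A :: real^'n::_^'n::_. A $ i $ j) \<in> borel_measurable borel"
      by (intro borel_measurable_continuous_onI continuous_intros)
    from measurable_compose[OF gmat_kappa_measurable this] show ?thesis .
  qed
  show ?thesis
    unfolding qf_def inner_vec_def matrix_vector_mult_def
    using nth[OF U] nth[OF V] g by (simp add: borel_measurable_sum borel_measurable_times)
qed

lemma bilinear_qf: "bilinear (qf p)"
  unfolding bilinear_def qf_def linear_iff
  by (simp add: inner_add_left inner_add_right matrix_vector_right_distrib matrix_vector_mult_scaleR)

sublocale Q: ip_field vol qf
proof
  show "bilinear (qf p)" for p by (rule bilinear_qf)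
  show "qf p u v = qf p v u" for p u v
    unfolding qf_def using gmat_sym_inner[OF kappa, of u p v] by (simp add: inner_commute)
  show "0 < qf p u u" if "u \<noteq> 0" for p u unfolding qf_def by (rule gmat_pos[OF kappa that])
  show "(\<lambda>p. qf p (U p) (V p)) \<in> borel_measurable vol" if "U \<in> borel_measurable vol" "V \<in> borel_measurable vol" for U V
    using qf_measurable[of U V] that by (simp add: measurable_cong_sets[OF sets_vol refl])
qed

text \<open>The value 0 outside the chart domain is a mere default: the transformation law compares
  two charts at common points of their domains, and measurability is asked on each domain.\<close>

definition of_compo :: "('p \<Rightarrow> real^'n::_) \<Rightarrow> ('p, 'n) vfield" where
  "of_compo U c p = (if p \<in> fst c then jacobian (kappa p) c p *v U p else 0)"

lemma compo_of_compo: "compo (of_compo U) = U"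
  unfolding compo_def of_compo_def using kappa jacobian_self[OF kappa] by (auto simp: fun_eq_iff)

lemma of_compo_vector_field: "vector_field M (of_compo U)"
  unfolding vector_field_def
proof (intro ballI)
  fix c c' p assume c: "c \<in> atlas M" "c' \<in> atlas M" and "p \<in> fst c \<inter> fst c'"
  then have p: "p \<in> fst c" "p \<in> fst c'" by auto
  have "jacobian (kappa p) c' p = jacobian c c' p ** jacobian (kappa p) c p"
    by (rule jacobian_chain[OF kappa(1) c kappa(2) p])
  then show "of_compo U c' p = jacobian c c' p *v of_compo U c p"
    using p unfolding of_compo_def by (simp add: matrix_vector_mul_assoc)
qed

lemma jacobian_continuous:
  assumes c: "c \<in> atlas M" "c' \<in> atlas M"
  shows "continuous_on (fst c \<inter> fst c') (jacobian c c')"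
proof -
  have td: "snd c p \<in> transition_domain c c'" if "p \<in> fst c \<inter> fst c'" for p using that by (auto simp: transition_domain_def)
  have "continuous_on (fst c \<inter> fst c') (\<lambda>p. hder (transition c c') (snd c p) v)" for v
    by (rule continuous_on_compose2[OF smooth_on_hder_continuous[OF transition_domain_rel_open[OF c] transition_smooth[OF c]]
        continuous_on_subset[OF chart_maps(5)[OF c(1)]]]) (use td in auto)
  then have "continuous_on (fst c \<inter> fst c') (\<lambda>p. matrix (hder (transition c c') (snd c p)))"
    unfolding matrix_def by (intro continuous_on_vec_lambda continuous_on_component)
  then show ?thesis by (rule continuous_on_eq) (simp add: jacobian_hder[OF c])
qed

lemma of_compo_measurable:
  assumes U: "U \<in> borel_measurable borel" shows "measurable_vfield M (of_compo U)"
  unfolding measurable_vfield_def set_borel_measurable_def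
proof (intro conjI ballI of_compo_vector_field)
  fix c assume c: "c \<in> atlas M"
  have J: "(\<lambda>p. indicator (fst d \<inter> fst c) p *\<^sub>R jacobian d c p) \<in> borel_measurable borel" if d: "d \<in> atlas M" for d
    by (rule borel_measurable_continuous_on_indicator[OF _ jacobian_continuous[OF d c]])
      (intro borel_open open_Int chart_open c d)
  have "(\<lambda>p. indicator (fst c) p *\<^sub>R jacobian (kappa p) c p) \<in> borel_measurable borel"
  proof (rule kappa_measurable[where f = "\<lambda>d p. indicator (fst c) p *\<^sub>R jacobian d c p"])
    fix d assume d: "d \<in> atlas M"
    have "(\<lambda>p. indicator (fst d) p *\<^sub>R indicator (fst c) p *\<^sub>R jacobian d c p) = (\<lambda>p. indicator (fst d \<inter> fst c) p *\<^sub>R jacobian d c p)"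
      by (auto simp: indicator_def fun_eq_iff)
    then show "(\<lambda>p. indicator (fst d) p *\<^sub>R indicator (fst c) p *\<^sub>R jacobian d c p) \<in> borel_measurable borel" using J[OF d] by simp
  qed
  then have "(\<lambda>p. (indicator (fst c) p *\<^sub>R jacobian (kappa p) c p, U p)) \<in> borel_measurable borel"
    using U by (rule borel_measurable_Pair)
  moreover have "continuous_on UNIV (\<lambda>z :: (real^'n::_^'n::_) \<times> (real^'n::_). fst z *v snd z)"
    by (intro continuous_on_matrix_vector continuous_intros)
  ultimately have "(\<lambda>p. (indicator (fst c) p *\<^sub>R jacobian (kappa p) c p) *v U p) \<in> borel_measurable borel"
    using measurable_compose[OF _ borel_measurable_continuous_onI] by fastforce
  moreover have "(\<lambda>p. (indicator (fst c) p *\<^sub>R jacobian (kappa p) c p) *v U p) = (\<lambda>p. indicator (fst c) p *\<^sub>R of_compo U c p)"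
    by (auto simp: fun_eq_iff of_compo_def scaleR_matrix_vector_assoc[symmetric] indicator_def)
  ultimately show "(\<lambda>p. indicator (fst c) p *\<^sub>R of_compo U c p) \<in> borel_measurable borel" by simp
qed

section \<open>Test functions as a Dirichlet form\<close>

abbreviation tests :: "('p \<Rightarrow> real) set" where "tests \<equiv> test_functions M"

abbreviation csupp :: "('p \<Rightarrow> real) \<Rightarrow> 'p set" where "csupp \<phi> \<equiv> closure {p. \<phi> p \<noteq> 0}"

lemma tests_iff: "\<phi> \<in> tests \<longleftrightarrow> msmooth \<phi> \<and> compact (csupp \<phi>) \<and> csupp \<phi> \<subseteq> mfd_interior M"
  unfolding test_functions_def msmooth_def by simp

lemma testsD: "\<phi> \<in> tests \<Longrightarrow> msmooth \<phi>" "\<phi> \<in> tests \<Longrightarrow> compact (csupp \<phi>)" "\<phi> \<in> tests \<Longrightarrow> csupp \<phi> \<subseteq> mfd_interior M"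
  by (simp_all add: tests_iff)

lemma tests_subsupport:
  assumes "msmooth \<psi>" "\<phi> \<in> tests" "\<And>p. \<phi> p = 0 \<Longrightarrow> \<psi> p = 0"
  shows "\<psi> \<in> tests"
proof -
  have "csupp \<psi> \<subseteq> csupp \<phi>" using assms(3) by (intro closure_mono) auto
  then have "compact (csupp \<psi>)" using compact_closed_subset[OF testsD(2)[OF assms(2)] closed_closure] by blast
  then show ?thesis using \<open>csupp \<psi> \<subseteq> csupp \<phi>\<close> testsD(3)[OF assms(2)] assms(1) by (auto simp: tests_iff)
qed

lemma tests_add: assumes "\<phi> \<in> tests" "\<psi> \<in> tests" shows "(\<lambda>p. \<phi> p + \<psi> p) \<in> tests"
proof -
  have "csupp (\<lambda>p. \<phi> p + \<psi> p) \<subseteq> closure ({p. \<phi> p \<noteq> 0} \<union> {p. \<psi> p \<noteq> 0})" by (intro closure_mono) auto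
  then have sub: "csupp (\<lambda>p. \<phi> p + \<psi> p) \<subseteq> csupp \<phi> \<union> csupp \<psi>" by simp
  have "compact (csupp (\<lambda>p. \<phi> p + \<psi> p))"
    by (rule compact_closed_subset[OF compact_Un[OF testsD(2)[OF assms(1)] testsD(2)[OF assms(2)]] closed_closure sub])
  then show ?thesis using sub testsD(3)[OF assms(1)] testsD(3)[OF assms(2)] msmooth_add[OF testsD(1) testsD(1), OF assms]
    by (auto simp: tests_iff)
qed

lemma tests_mult: "\<phi> \<in> tests \<Longrightarrow> msmooth \<psi> \<Longrightarrow> (\<lambda>p. \<phi> p * \<psi> p) \<in> tests"
  by (rule tests_subsupport[OF msmooth_mult[OF testsD(1)]]) auto

lemma tests_scale: "\<phi> \<in> tests \<Longrightarrow> (\<lambda>p. a * \<phi> p) \<in> tests"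
  by (rule tests_subsupport[OF msmooth_mult[OF msmooth_const testsD(1)]]) auto

lemma integrable_compact_support:
  assumes K: "compact K" and f: "f \<in> borel_measurable borel" and b: "\<And>p. \<bar>f p\<bar> \<le> B" and 0: "\<And>p. p \<notin> K \<Longrightarrow> f p = 0"
  shows "integrable vol (f :: 'p \<Rightarrow> real)"
proof (rule Bochner_Integration.integrable_bound)
  have "integrable vol (indicator K :: 'p \<Rightarrow> real)"
    using vol_compact_finite[OF K] borel_compact[OF K] by (intro integrable_real_indicator) auto
  then show "integrable vol (\<lambda>p. B * indicator K p)" by simp
  show "AE p in vol. norm (f p) \<le> norm (B * indicator K p)"
    using b 0 by (auto simp: indicator_def intro!: order_trans[OF b])
qed (use f in simp)

lemma continuous_compact_support_bounded:
  assumes f: "continuous_on UNIV (f :: 'p \<Rightarrow> real)" and K: "compact K" and 0: "\<And>p. p \<notin> K \<Longrightarrow> f p = 0"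
  shows "\<exists>B. \<forall>p. \<bar>f p\<bar> \<le> B"
proof -
  have "compact (f ` K)" using K continuous_on_subset[OF f] by (intro compact_continuous_image) auto
  then obtain B where "\<And>y. y \<in> f ` K \<Longrightarrow> norm y \<le> B" using compact_imp_bounded bounded_iff by metis
  then have "\<bar>f p\<bar> \<le> max B 0" for p using 0[of p] by (cases "p \<in> K") (force simp: le_max_iff_disj)+
  then show ?thesis by blast
qed

lemma tests_bounded: assumes "\<phi> \<in> tests" shows "\<exists>B. \<forall>p. \<bar>\<phi> p\<bar> \<le> B"
  using continuous_compact_support_bounded[OF msmooth_continuous[OF testsD(1)[OF assms]] testsD(2)[OF assms]]
    closure_subset[of "{p. \<phi> p \<noteq> 0}"] by blast

lemma tests_measurable: "\<phi> \<in> tests \<Longrightarrow> \<phi> \<in> borel_measurable borel"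
  using msmooth_continuous[OF testsD(1)] by (rule borel_measurable_continuous_onI)

lemma tests_sq_integrable: assumes "\<phi> \<in> tests" shows "integrable vol (\<lambda>p. (\<phi> p)\<^sup>2)"
proof -
  obtain B where B: "\<And>p. \<bar>\<phi> p\<bar> \<le> B" using tests_bounded[OF assms] by blast
  show ?thesis
  proof (rule integrable_compact_support[OF testsD(2)[OF assms], of _ "B\<^sup>2"])
    show "\<bar>(\<phi> p)\<^sup>2\<bar> \<le> B\<^sup>2" for p using power_mono[OF B[of p], of 2] by simp
    show "(\<phi> p)\<^sup>2 = 0" if "p \<notin> csupp \<phi>" for p using that closure_subset[of "{p. \<phi> p \<noteq> 0}"] by auto
  qed (use tests_measurable[OF assms] in measurable)
qed

abbreviation Dt :: "('p \<Rightarrow> real) \<Rightarrow> 'p \<Rightarrow> real^'n::_" where "Dt \<phi> \<equiv> compo (grad M \<phi>)"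

text \<open>The selected components of the gradient may jump from cell to cell, but its length is
  the same in all charts, and in a single chart it is continuous.\<close>

lemma grad_norm_continuous:
  assumes \<phi>: "msmooth \<phi>" shows "continuous_on UNIV (\<lambda>p. qf p (Dt \<phi> p) (Dt \<phi> p))"
proof -
  have "continuous_on (fst c) (\<lambda>p. qf p (Dt \<phi> p) (Dt \<phi> p))" if c: "c \<in> atlas M" for c
  proof (rule continuous_on_eq)
    show "continuous_on (fst c) (\<lambda>p. grad M \<phi> c p \<bullet> (gmat M c p *v grad M \<phi> c p))"
      by (intro continuous_on_inner continuous_on_matrix_vector grad_continuous[OF \<phi> c] continuous_on_chart[OF c gmat_continuous[OF c]])
    show "grad M \<phi> c p \<bullet> (gmat M c p *v grad M \<phi> c p) = qf p (Dt \<phi> p) (Dt \<phi> p)" if "p \<in> fst c" for p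
      using vinner_chart[OF grad_vector_field[OF \<phi>] grad_vector_field[OF \<phi>] c that]
        vinner_qf[OF grad_vector_field[OF \<phi>] grad_vector_field[OF \<phi>], of p] by simp
  qed
  then have "continuous_on (\<Union>c\<in>atlas M. fst c) (\<lambda>p. qf p (Dt \<phi> p) (Dt \<phi> p))"
    by (intro continuous_on_open_UN) (auto intro: chart_open)
  moreover have "(\<Union>c\<in>atlas M. fst c) = UNIV" using chart_exists by auto
  ultimately show ?thesis by simp
qed

lemma Dt_zero: assumes "p \<notin> csupp \<phi>" shows "Dt \<phi> p = 0"
  unfolding compo_def
  by (rule grad_zero[OF kappa, of "- csupp \<phi>"]) (use assms closure_subset[of "{p. \<phi> p \<noteq> 0}"] in auto)

lemma Dt_L2: assumes \<phi>: "\<phi> \<in> tests" shows "Dt \<phi> \<in> Q.L2"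
proof -
  note s = testsD(1)[OF \<phi>]
  have m: "Dt \<phi> \<in> borel_measurable borel" by (rule compo_measurable[OF grad_measurable_vfield[OF s]])
  have z: "qf p (Dt \<phi> p) (Dt \<phi> p) = 0" if "p \<notin> csupp \<phi>" for p using Dt_zero[OF that] by (simp add: qf_def)
  obtain B where B: "\<And>p. \<bar>qf p (Dt \<phi> p) (Dt \<phi> p)\<bar> \<le> B"
    using continuous_compact_support_bounded[OF grad_norm_continuous[OF s] testsD(2)[OF \<phi>] z] by blast
  have "integrable vol (\<lambda>p. qf p (Dt \<phi> p) (Dt \<phi> p))"
    by (rule integrable_compact_support[OF testsD(2)[OF \<phi>] qf_measurable[OF m m] B z])
  then show ?thesis using m by (simp add: Q.L2_def measurable_cong_sets[OF sets_vol refl])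
qed

sublocale E: dirichlet_form vol qf tests Dt
proof
  fix \<phi> \<psi> w :: "'p \<Rightarrow> real" and F F' :: "real \<Rightarrow> real" and a :: real
  assume \<phi>: "\<phi> \<in> tests"
  note s = testsD(1)[OF \<phi>]
  have id: "ck_on k UNIV (\<lambda>s::real. a * s)" for k by (intro ck_mult ck_const ck_id) auto
  show "(\<lambda>p. a * \<phi> p) \<in> tests" by (rule tests_scale[OF \<phi>])
  show "Dt (\<lambda>p. a * \<phi> p) = (\<lambda>p. a *\<^sub>R Dt \<phi> p)"
    unfolding compo_def using grad_comp[OF s kappa, of "\<lambda>s. a * s" a] by (auto simp: fun_eq_iff intro!: derivative_eq_intros)
  show "\<phi> \<in> borel_measurable vol" using tests_measurable[OF \<phi>] by simp
  show "integrable vol (\<lambda>p. (\<phi> p)\<^sup>2)" by (rule tests_sq_integrable[OF \<phi>])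
  show "\<exists>B. \<forall>p. \<bar>\<phi> p\<bar> \<le> B" by (rule tests_bounded[OF \<phi>])
  show "Dt \<phi> \<in> Q.L2" by (rule Dt_L2[OF \<phi>])
  { assume \<psi>: "\<psi> \<in> tests"
    show "(\<lambda>p. \<phi> p + \<psi> p) \<in> tests" by (rule tests_add[OF \<phi> \<psi>])
    show "Dt (\<lambda>p. \<phi> p + \<psi> p) = (\<lambda>p. Dt \<phi> p + Dt \<psi> p)"
      unfolding compo_def using grad_add[OF s testsD(1)[OF \<psi>] kappa] by auto }
  { assume F: "\<And>k. ck_on k UNIV F" "\<And>s. (F has_real_derivative F' s) (at s)"
    { assume "F 0 = 0"
      then show "(\<lambda>p. F (\<phi> p)) \<in> tests" by (intro tests_subsupport[OF msmooth_comp[OF s F(1)] \<phi>]) simp }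
    show "Dt (\<lambda>p. F (\<phi> p)) = (\<lambda>p. F' (\<phi> p) *\<^sub>R Dt \<phi> p)"
      unfolding compo_def using grad_comp[OF s kappa F(2)] by auto
    assume w: "w \<in> tests"
    show "(\<lambda>p. \<phi> p * F (w p)) \<in> tests" by (rule tests_mult[OF \<phi> msmooth_comp[OF testsD(1)[OF w] F(1)]])
    show "Dt (\<lambda>p. \<phi> p * F (w p)) = (\<lambda>p. F (w p) *\<^sub>R Dt \<phi> p + (\<phi> p * F' (w p)) *\<^sub>R Dt w p)"
      unfolding compo_def using grad_mult_comp[OF s testsD(1)[OF w] kappa F(2)] by auto }
qed

text \<open>A product of factors \<open>exp (- 1 / (m * t))\<close>, one for each face, where
  \<open>t\<close> is the signed distance to the face. It vanishes off the open box, stays below 1,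
  and tends to the indicator of the box as \<open>m\<close> grows.\<close>

definition bump :: "real^'n::_ \<Rightarrow> real^'n::_ \<Rightarrow> real \<Rightarrow> real^'n::_ \<Rightarrow> real" where
  "bump a b m x = (\<Prod>i\<in>UNIV. flat 0 (m * (x $ i - a $ i)) * flat 0 (m * (b $ i - x $ i)))"

lemma flat_0: "0 \<le> flat 0 t" "flat 0 t \<le> 1" "flat 0 t \<noteq> 0 \<longleftrightarrow> t > 0" by (auto simp: flat_def)

lemma bump_bounds: "0 \<le> bump a b m x" "bump a b m x \<le> 1"
  unfolding bump_def using flat_0 by (auto intro!: prod_nonneg prod_le_1 mult_le_one)

lemma bump_nonzero: "m > 0 \<Longrightarrow> bump a b m x \<noteq> 0 \<longleftrightarrow> x \<in> box a b"
  unfolding bump_def using flat_0(3) by (auto simp: mem_box_cart zero_less_mult_iff)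

lemma bump_tendsto: "(\<lambda>k. bump a b (real (Suc k)) x) \<longlonglongrightarrow> indicator (box a b) x"
proof (cases "x \<in> box a b")
  case False
  then have "bump a b (real (Suc k)) x = 0" for k using bump_nonzero[of "real (Suc k)" a b x] by auto
  then show ?thesis using False by simp
next
  case True
  have lim: "(\<lambda>k. flat 0 (real (Suc k) * t)) \<longlonglongrightarrow> 1" if "t > 0" for t
  proof -
    have "(\<lambda>k. exp (- (inverse (real (Suc k)) * inverse t))) \<longlonglongrightarrow> exp (- (0 * inverse t))"
      by (intro tendsto_intros LIMSEQ_inverse_real_of_nat)
    then show ?thesis using that by (simp add: flat_def zero_less_mult_iff)
  qed
  have "(\<lambda>k. bump a b (real (Suc k)) x) \<longlonglongrightarrow> (\<Prod>i\<in>(UNIV::'n set). 1 * 1)"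
    unfolding bump_def by (intro tendsto_prod tendsto_mult lim) (use True in \<open>auto simp: mem_box_cart\<close>)
  then show ?thesis using True by simp
qed

definition mbump :: "('p, 'n) chart \<Rightarrow> real^'n::_ \<Rightarrow> real^'n::_ \<Rightarrow> real \<Rightarrow> 'p \<Rightarrow> real" where
  "mbump c a b m p = (if p \<in> fst c then bump a b m (snd c p) else 0)"

lemma bump_smooth:
  assumes T: "smooth_on S T" shows "smooth_on S (\<lambda>x. bump a b m (T x))"
  unfolding bump_def
proof (intro smooth_on_prod finite smooth_on_mult)
  fix i
  have t: "smooth_on S (\<lambda>x. T x $ i)" by (rule smooth_on_bounded_linear[OF bounded_linear_vec_nth T])
  have "smooth_on S (\<lambda>x. m * (T x $ i + (- (a $ i))))" "smooth_on S (\<lambda>x. m * (b $ i + (-1) * T x $ i))"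
    by (intro smooth_on_mult smooth_on_add smooth_on_const t)+
  then have "smooth_on S (\<lambda>x. m * (T x $ i - a $ i))" "smooth_on S (\<lambda>x. m * (b $ i - T x $ i))" by simp_all
  then show "smooth_on S (\<lambda>x. flat 0 (m * (T x $ i - a $ i)))" "smooth_on S (\<lambda>x. flat 0 (m * (b $ i - T x $ i)))"
    using smooth_on_comp[of "flat 0", OF ck_flat] by auto
qed

text \<open>Smoothness in another chart is checked on two open sets that cover it: on the overlap of
  the charts the function is the bump composed with a transition map, and off the compact preimage
  of the closed box, which is closed in a Hausdorff space, it is zero.\<close>

lemma mbump_test:
  assumes c: "c \<in> atlas M" and ab: "cbox a b \<subseteq> cimage c \<inter> interior half_space" and m: "m > 0"
  shows "mbump c a b m \<in> tests" and "compact (cinv c ` cbox a b)" "cinv c ` cbox a b \<subseteq> mfd_interior M"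
    "\<And>p. p \<notin> cinv c ` cbox a b \<Longrightarrow> mbump c a b m p = 0"
proof -
  let ?K = "cinv c ` cbox a b"
  show K: "compact ?K"
    by (intro compact_continuous_image compact_cbox continuous_on_subset[OF chart_maps(6)[OF c]]) (use ab in auto)
  then have Kc: "closed ?K" by (rule compact_imp_closed)
  show z: "mbump c a b m p = 0" if "p \<notin> ?K" for p
  proof (rule ccontr)
    assume "mbump c a b m p \<noteq> 0"
    then have p: "p \<in> fst c" "snd c p \<in> box a b" using bump_nonzero[OF m] by (auto simp: mbump_def split: if_splits)
    then have "snd c p \<in> cbox a b" using box_subset_cbox by blast
    then show False using that chart_maps(2)[OF c p(1)] by (metis imageI)
  qed
  show Ki: "?K \<subseteq> mfd_interior M"
  proof
    fix p assume "p \<in> ?K"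
    then obtain x where x: "x \<in> cbox a b" "p = cinv c x" by blast
    then have "x \<in> cimage c" "x \<in> interior half_space" using ab by auto
    then have "p \<in> fst c \<and> snd c p \<in> interior half_space" using chart_maps(3,4)[OF c, of x] x(2) by simp
    then show "p \<in> mfd_interior M" unfolding mfd_interior_def using c by blast
  qed
  have sub: "csupp (mbump c a b m) \<subseteq> ?K" using z by (intro closure_minimal Kc) auto
  have comp: "compact (csupp (mbump c a b m))" by (rule compact_closed_subset[OF K closed_closure sub])
  have "smooth_on (cimage c') (mbump c a b m \<circ> cinv c')" if c': "c' \<in> atlas M" for c'
  proof (rule smooth_on_local)
    fix x assume x: "x \<in> cimage c'"
    show "\<exists>U. open U \<and> x \<in> U \<and> smooth_on (cimage c' \<inter> U) (mbump c a b m \<circ> cinv c')"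
    proof (cases "cinv c' x \<in> fst c")
      case True
      let ?t = "transition_domain c' c"
      obtain U where U: "open U" "?t = half_space \<inter> U"
        using transition_domain_rel_open[OF c' c] by (auto simp: openin_open)
      have tsub: "?t \<subseteq> cimage c'" using chart_maps(1)[OF c'] by (auto simp: transition_domain_def)
      have xt: "x \<in> ?t" unfolding transition_domain_def using True chart_maps(3,4)[OF c' x] by (metis IntI imageI)
      have eq: "cimage c' \<inter> U = ?t" using U(2) tsub cimage_half_space[OF c'] by auto
      have "smooth_on ?t (mbump c a b m \<circ> cinv c')"
      proof (rule smooth_on_cong[OF _ bump_smooth[OF transition_smooth[OF c' c]]])
        fix y assume "y \<in> ?t"
        then obtain p where p: "p \<in> fst c'" "p \<in> fst c" "y = snd c' p" by (auto simp: transition_domain_def)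
        then show "bump a b m (transition c' c y) = (mbump c a b m \<circ> cinv c') y"
          using transition_snd[OF c' p(1), of c] chart_maps(2)[OF c' p(1)] by (simp add: mbump_def)
      qed
      then show ?thesis using U xt eq by (intro exI[of _ U]) auto
    next
      case False
      have nK: "cinv c' x \<notin> ?K" using False chart_maps(3)[OF c] ab by auto
      have "rel_open (snd c' ` (- ?K \<inter> fst c'))"
        by (rule chart_image_rel_open[OF c']) (use Kc chart_open[OF c'] in auto)
      then obtain U where U: "open U" "snd c' ` (- ?K \<inter> fst c') = half_space \<inter> U" by (auto simp: openin_open)
      have xU: "x \<in> U"
      proof -
        have "x \<in> snd c' ` (- ?K \<inter> fst c')" using nK chart_maps(3,4)[OF c' x] by (metis ComplI IntI imageI)
        then show ?thesis using U(2) by blast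
      qed
      have "smooth_on (cimage c' \<inter> U) (mbump c a b m \<circ> cinv c')"
      proof (rule smooth_on_cong[OF _ smooth_on_const[of _ 0]])
        fix y assume "y \<in> cimage c' \<inter> U"
        then have "y \<in> snd c' ` (- ?K \<inter> fst c')" using U(2) cimage_half_space[OF c'] by blast
        then obtain p where "p \<notin> ?K" "p \<in> fst c'" "y = snd c' p" by blast
        then show "0 = (mbump c a b m \<circ> cinv c') y" using z chart_maps(2)[OF c'] by simp
      qed
      then show ?thesis using U xU by blast
    qed
  qed
  then show "mbump c a b m \<in> tests" unfolding tests_iff msmooth_def using comp sub Ki by blast
qed

end

lemma open_box_nhd:
  fixes S :: "'a::euclidean_space set"
  assumes "open S" "x \<in> S" shows "\<exists>a b. x \<in> box a b \<and> cbox a b \<subseteq> S"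
proof -
  obtain e where e: "e > 0" "cball x e \<subseteq> S" using assms open_contains_cball by blast
  obtain a b where ab: "x \<in> box a b" "box a b \<subseteq> ball x e" using rational_boxes[OF e(1), of x] by blast
  have "cbox a b = closure (box a b)" using ab(1) by (subst closure_box) auto
  also have "\<dots> \<subseteq> cball x e" using closure_mono[OF ab(2)] e(1) by simp
  finally show ?thesis using ab(1) e(2) by blast
qed

lemma measure_eq_on_boxes:
  fixes P N :: "'a::euclidean_space measure"
  assumes "sets P = sets borel" "sets N = sets borel" "\<And>a b. emeasure P (box a b) = emeasure N (box a b)"
    and "emeasure P UNIV < \<infinity>"
  shows "P = N"
proof (rule measure_eqI_generator_eq)
  let ?E = "range (\<lambda>(a, b). box a b :: 'a set)"
  show "Int_stable ?E" by (auto simp: Int_stable_def box_Int_box)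
  show "?E \<subseteq> Pow UNIV" by simp
  show "sets P = sigma_sets UNIV ?E" "sets N = sigma_sets UNIV ?E" using assms(1,2) by (simp_all add: borel_eq_box)
  let ?A = "\<lambda>n::nat. box (- (real n *\<^sub>R One)) (real n *\<^sub>R One) :: 'a set"
  show "range ?A \<subseteq> ?E" by auto
  show "(\<Union>i. ?A i) = UNIV" by (rule UN_box_eq_UNIV)
  show "emeasure P (?A i) \<noteq> \<infinity>" for i
    using emeasure_mono[of "?A i" UNIV P] assms(1,4) by (auto simp: less_top[symmetric] top_unique)
qed (use assms(3) in auto)

context riem_mfd
begin

section \<open>The fundamental lemma of the calculus of variations\<close>

definition boxpre :: "('p, 'n) chart \<Rightarrow> real^'n::_ \<Rightarrow> real^'n::_ \<Rightarrow> 'p set" where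
  "boxpre c a b = fst c \<inter> snd c -` box a b"

lemma boxpre_open: "c \<in> atlas M \<Longrightarrow> open (boxpre c a b)"
  unfolding boxpre_def by (rule chart_preimage_open) auto

text \<open>The bumps converge to the indicator of the box and live on a compact subset of the
  interior, where \<open>h\<close> is integrable; dominated convergence transfers the vanishing
  integrals.\<close>

lemma integral_boxpre_zero:
  assumes h: "h \<in> L1_loc M" and z: "\<And>\<phi>. \<phi> \<in> tests \<Longrightarrow> (\<integral>p. \<phi> p * h p \<partial>vol) = 0"
    and c: "c \<in> atlas M" and ab: "cbox a b \<subseteq> cimage c \<inter> interior half_space"
  shows "integrable vol (\<lambda>p. indicator (boxpre c a b) p * h p)" "(\<integral>p. indicator (boxpre c a b) p * h p \<partial>vol) = 0"
proof -
  let ?K = "cinv c ` cbox a b"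
  note bt = mbump_test[OF c ab]
  have hm[measurable]: "h \<in> borel_measurable borel" using h by (simp add: L1_loc_def)
  have "set_integrable vol ?K h" using h bt(2,3)[of 1] unfolding L1_loc_def by auto
  then have iK: "integrable vol (\<lambda>p. indicator ?K p * h p)" by (simp add: set_integrable_def)
  have W[measurable]: "boxpre c a b \<in> sets borel" using boxpre_open[OF c] by simp
  have WK: "boxpre c a b \<subseteq> ?K"
  proof
    fix p assume "p \<in> boxpre c a b"
    then have p: "p \<in> fst c" "snd c p \<in> cbox a b" using box_subset_cbox by (auto simp: boxpre_def)
    then show "p \<in> ?K" using chart_maps(2)[OF c p(1)] by (metis imageI)
  qed
  show "integrable vol (\<lambda>p. indicator (boxpre c a b) p * h p)"
    by (rule Bochner_Integration.integrable_bound[OF iK]) (use WK in \<open>auto simp: indicator_def\<close>)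
  have "(\<lambda>k. \<integral>p. mbump c a b (real (Suc k)) p * h p \<partial>vol) \<longlonglongrightarrow> (\<integral>p. indicator (boxpre c a b) p * h p \<partial>vol)"
  proof (rule integral_dominated_convergence[where w = "\<lambda>p. norm (indicator ?K p * h p)"])
    have mb: "mbump c a b (real (Suc k)) \<in> borel_measurable borel" for k by (rule tests_measurable[OF bt(1)]) simp
    then show "(\<lambda>p. mbump c a b (real (Suc k)) p * h p) \<in> borel_measurable vol" for k
      using hm by (simp add: borel_measurable_times)
    show "(\<lambda>p. indicator (boxpre c a b) p * h p) \<in> borel_measurable vol" by measurable
    show "integrable vol (\<lambda>p. norm (indicator ?K p * h p))" using iK by (rule integrable_norm)
    show "AE p in vol. (\<lambda>k. mbump c a b (real (Suc k)) p * h p) \<longlonglongrightarrow> indicator (boxpre c a b) p * h p"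
    proof (rule AE_I2, rule tendsto_mult[OF _ tendsto_const])
      fix p
      show "(\<lambda>k. mbump c a b (real (Suc k)) p) \<longlonglongrightarrow> indicator (boxpre c a b) p"
        using bump_tendsto[of a b "snd c p"] by (cases "p \<in> fst c") (auto simp: mbump_def boxpre_def indicator_def)
    qed
    show "AE p in vol. norm (mbump c a b (real (Suc k)) p * h p) \<le> norm (indicator ?K p * h p)" for k
    proof (rule AE_I2)
      fix p
      have "\<bar>mbump c a b (real (Suc k)) p\<bar> \<le> indicator ?K p"
        using bt(4)[of "real (Suc k)" p] bump_bounds[of a b "real (Suc k)" "snd c p"] by (auto simp: mbump_def indicator_def)
      then show "norm (mbump c a b (real (Suc k)) p * h p) \<le> norm (indicator ?K p * h p)"
        by (simp add: abs_mult mult_right_mono)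
    qed
  qed
  moreover have "(\<integral>p. mbump c a b (real (Suc k)) p * h p \<partial>vol) = 0" for k by (rule z[OF bt(1)]) simp
  ultimately show "(\<integral>p. indicator (boxpre c a b) p * h p \<partial>vol) = 0" by (simp add: LIMSEQ_const_iff)
qed

text \<open>The positive and the negative part of \<open>h\<close> are densities of two measures on the coordinate
  domain which agree on all boxes.\<close>

lemma zero_on_boxpre:
  assumes h: "h \<in> L1_loc M" and z: "\<And>\<phi>. \<phi> \<in> tests \<Longrightarrow> (\<integral>p. \<phi> p * h p \<partial>vol) = 0"
    and c: "c \<in> atlas M" and ab: "cbox a b \<subseteq> cimage c \<inter> interior half_space"
  shows "AE p in vol. p \<in> boxpre c a b \<longrightarrow> h p = 0"
proof -
  let ?W = "boxpre c a b"
  have hm[measurable]: "h \<in> borel_measurable borel" using h by (simp add: L1_loc_def)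
  have W[measurable]: "?W \<in> sets borel" using boxpre_open[OF c] by simp
  \<comment> \<open>The coordinate map, made total by the value 0; the densities below vanish
    outside \<open>?W\<close>, so this value receives no mass.\<close>
  define s where "s p = (if p \<in> ?W then snd c p else 0)" for p
  have sm[measurable]: "s \<in> borel_measurable borel"
    unfolding s_def by (rule borel_measurable_continuous_on_if[OF W continuous_on_subset[OF chart_maps(5)[OF c]]]) (auto simp: boxpre_def)
  have main: "emeasure (distr (density vol (\<lambda>p. ennreal (indicator ?W p * f p))) borel s) (box a' b')
      = ennreal (\<integral>p. indicator (boxpre c a' b' \<inter> ?W) p * f p \<partial>vol)"
    if f[measurable]: "f \<in> borel_measurable borel" and f0: "\<And>p. 0 \<le> f p" and i: "integrable vol (\<lambda>p. indicator (boxpre c a' b' \<inter> ?W) p * f p)"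
    for f a' b'
  proof -
    have B: "boxpre c a' b' \<in> sets borel" using boxpre_open[OF c] by simp
    have "emeasure (distr (density vol (\<lambda>p. ennreal (indicator ?W p * f p))) borel s) (box a' b')
      = (\<integral>\<^sup>+p. ennreal (indicator ?W p * f p) * indicator (s -` box a' b') p \<partial>vol)"
      using measurable_sets[OF sm, of "box a' b'"] by (subst emeasure_distr) (auto simp: emeasure_density)
    also have "\<dots> = (\<integral>\<^sup>+p. ennreal (indicator (boxpre c a' b' \<inter> ?W) p * f p) \<partial>vol)"
      by (intro nn_integral_cong) (auto simp: indicator_def s_def boxpre_def)
    also have "\<dots> = ennreal (\<integral>p. indicator (boxpre c a' b' \<inter> ?W) p * f p \<partial>vol)"
      by (rule nn_integral_eq_integral[OF i]) (use f0 in simp)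
    finally show ?thesis .
  qed
  define P where "P = density vol (\<lambda>p. ennreal (indicator ?W p * max (h p) 0))"
  define N where "N = density vol (\<lambda>p. ennreal (indicator ?W p * max (- h p) 0))"
  have eqbox: "emeasure (distr P borel s) (box a' b') = emeasure (distr N borel s) (box a' b')" for a' b'
  proof -
    \<comment> \<open>An arbitrary box meets the given one in a box again, and that box still lies
      in the interior part of the chart image.\<close>
    obtain a2 b2 where ab2: "box a' b' \<inter> box a b = box a2 b2" "cbox a' b' \<inter> cbox a b = cbox a2 b2"
      using box_Int_box[of a' b' a b] Int_interval[of a' b' a b] by (metis (no_types, lifting))
    have sub: "cbox a2 b2 \<subseteq> cimage c \<inter> interior half_space" using ab ab2(2) by blast
    have e: "boxpre c a' b' \<inter> ?W = boxpre c a2 b2" using ab2(1) by (auto simp: boxpre_def)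
    note iz = integral_boxpre_zero[OF h z c sub]
    have [measurable]: "boxpre c a2 b2 \<in> sets borel" using boxpre_open[OF c] by simp
    have i1: "integrable vol (\<lambda>p. indicator (boxpre c a2 b2) p * max (h p) 0)"
      by (rule Bochner_Integration.integrable_bound[OF iz(1)]) (auto simp: indicator_def)
    have i2: "integrable vol (\<lambda>p. indicator (boxpre c a2 b2) p * max (- h p) 0)"
      by (rule Bochner_Integration.integrable_bound[OF iz(1)]) (auto simp: indicator_def)
    have "(\<integral>p. indicator (boxpre c a2 b2) p * max (h p) 0 \<partial>vol) - (\<integral>p. indicator (boxpre c a2 b2) p * max (- h p) 0 \<partial>vol)
        = (\<integral>p. indicator (boxpre c a2 b2) p * max (h p) 0 - indicator (boxpre c a2 b2) p * max (- h p) 0 \<partial>vol)"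
      using i1 i2 by simp
    also have "\<dots> = (\<integral>p. indicator (boxpre c a2 b2) p * h p \<partial>vol)"
      by (intro Bochner_Integration.integral_cong) (auto simp: indicator_def max_def)
    finally have "(\<integral>p. indicator (boxpre c a2 b2) p * max (h p) 0 \<partial>vol) = (\<integral>p. indicator (boxpre c a2 b2) p * max (- h p) 0 \<partial>vol)"
      using iz(2) by simp
    then show ?thesis unfolding P_def N_def using main[of "\<lambda>p. max (h p) 0" a' b'] main[of "\<lambda>p. max (- h p) 0" a' b'] i1 i2 e
      by simp
  qed
  have "emeasure (distr P borel s) UNIV < \<infinity>"
  proof -
    have i1: "integrable vol (\<lambda>p. indicator ?W p * max (h p) 0)"
      by (rule Bochner_Integration.integrable_bound[OF integral_boxpre_zero(1)[OF h z c ab]]) (auto simp: indicator_def)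
    have "emeasure (distr P borel s) UNIV = (\<integral>\<^sup>+p. ennreal (indicator ?W p * max (h p) 0) \<partial>vol)"
      unfolding P_def by (subst emeasure_distr) (auto simp: emeasure_density)
    also have "\<dots> = ennreal (\<integral>p. indicator ?W p * max (h p) 0 \<partial>vol)" by (rule nn_integral_eq_integral[OF i1]) simp
    finally show ?thesis by simp
  qed
  then have PN: "distr P borel s = distr N borel s" by (intro measure_eq_on_boxes eqbox) auto
  \<comment> \<open>The coordinate map is injective on \<open>?W\<close>, so equality of the image
    measures comes back to the Borel subsets of \<open>?W\<close>.\<close>
  have eqB: "emeasure P B = emeasure N B" if B: "B \<in> sets borel" "B \<subseteq> ?W" for B
  proof -
    have Bc: "B \<subseteq> fst c" using B(2) by (auto simp: boxpre_def)
    have S: "snd c ` B \<in> sets borel" by (rule chart_image_borel[OF c B(1) Bc])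
    have sB: "(s -` (snd c ` B)) \<inter> ?W = B"
    proof
      show "s -` (snd c ` B) \<inter> ?W \<subseteq> B"
      proof
        fix p assume p: "p \<in> s -` (snd c ` B) \<inter> ?W"
        then obtain r where r: "r \<in> B" "snd c p = snd c r" by (auto simp: s_def)
        then have "p = r" using chart_maps(2)[OF c] Bc p unfolding boxpre_def by (metis IntD1 IntD2 subsetD)
        then show "p \<in> B" using r by simp
      qed
      show "B \<subseteq> s -` (snd c ` B) \<inter> ?W" using B(2) by (auto simp: s_def)
    qed
    have "emeasure (density vol (\<lambda>p. ennreal (indicator ?W p * f p))) B
        = emeasure (distr (density vol (\<lambda>p. ennreal (indicator ?W p * f p))) borel s) (snd c ` B)"
      if [measurable]: "f \<in> borel_measurable borel" for f
    proof -
      have "emeasure (distr (density vol (\<lambda>p. ennreal (indicator ?W p * f p))) borel s) (snd c ` B)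
        = (\<integral>\<^sup>+p. ennreal (indicator ?W p * f p) * indicator (s -` (snd c ` B)) p \<partial>vol)"
        using measurable_sets[OF sm S] S by (subst emeasure_distr) (auto simp: emeasure_density)
      also have "\<dots> = (\<integral>\<^sup>+p. ennreal (indicator ?W p * f p) * indicator B p \<partial>vol)"
        using sB by (intro nn_integral_cong) (auto simp: indicator_def)
      also have "\<dots> = emeasure (density vol (\<lambda>p. ennreal (indicator ?W p * f p))) B"
        using B by (subst emeasure_density) auto
      finally show ?thesis by simp
    qed
    from this[of "\<lambda>p. max (h p) 0"] this[of "\<lambda>p. max (- h p) 0"] show ?thesis
      unfolding P_def[symmetric] N_def[symmetric] PN by simp
  qed
  \<comment> \<open>On the set where \<open>f\<close> is positive the density of the negative part
    vanishes, so the equality of the two measures makes the positive part vanish almost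
    everywhere.\<close>
  have one_sided: "AE p in vol. p \<in> ?W \<longrightarrow> f p \<le> 0"
    if f[measurable]: "f \<in> borel_measurable borel"
      and eq: "\<And>B. B \<in> sets borel \<Longrightarrow> B \<subseteq> ?W \<Longrightarrow> emeasure (density vol (\<lambda>p. ennreal (indicator ?W p * max (f p) 0))) B
        = emeasure (density vol (\<lambda>p. ennreal (indicator ?W p * max (- f p) 0))) B" for f
  proof -
    let ?B = "{p \<in> ?W. f p > 0}"
    have B: "?B \<in> sets borel" by measurable
    have "(\<integral>\<^sup>+p. ennreal (indicator ?W p * max (f p) 0) * indicator ?B p \<partial>vol)
        = emeasure (density vol (\<lambda>p. ennreal (indicator ?W p * max (f p) 0))) ?B"
      using B by (subst emeasure_density) auto
    also have "\<dots> = emeasure (density vol (\<lambda>p. ennreal (indicator ?W p * max (- f p) 0))) ?B"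
      by (rule eq) (use B in auto)
    also have "\<dots> = (\<integral>\<^sup>+p. ennreal (indicator ?W p * max (- f p) 0) * indicator ?B p \<partial>vol)"
      using B by (subst emeasure_density) auto
    also have "\<dots> = (\<integral>\<^sup>+p. 0 \<partial>vol)" by (intro nn_integral_cong) (auto simp: indicator_def max_def)
    finally have "(\<integral>\<^sup>+p. ennreal (indicator ?W p * max (f p) 0) * indicator ?B p \<partial>vol) = 0" by simp
    then have "AE p in vol. ennreal (indicator ?W p * max (f p) 0) * indicator ?B p = 0"
      using B by (subst (asm) nn_integral_0_iff_AE) auto
    then show ?thesis by eventually_elim (auto simp: indicator_def max_def split: if_splits)
  qed
  have "AE p in vol. p \<in> ?W \<longrightarrow> h p \<le> 0"
    by (rule one_sided) (use eqB in \<open>auto simp: P_def N_def\<close>)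
  moreover have "AE p in vol. p \<in> ?W \<longrightarrow> - h p \<le> 0"
    by (rule one_sided) (use eqB in \<open>auto simp: P_def N_def\<close>)
  ultimately show ?thesis by eventually_elim auto
qed

text \<open>Countably many coordinate boxes cover the interior, by the Lindelof property, and the
  boundary is a null set.\<close>

theorem fundamental_lemma:
  assumes h: "h \<in> L1_loc M" and z: "\<And>\<phi>. \<phi> \<in> tests \<Longrightarrow> (\<integral>p. \<phi> p * h p \<partial>vol) = 0"
  shows "AE p in vol. h p = 0"
proof -
  define \<F> where "\<F> = {boxpre c a b | c a b. c \<in> atlas M \<and> cbox a b \<subseteq> cimage c \<inter> interior half_space}"
  have "open S" if "S \<in> \<F>" for S using that boxpre_open unfolding \<F>_def by auto
  then obtain \<F>' where F: "\<F>' \<subseteq> \<F>" "countable \<F>'" "\<Union>\<F>' = \<Union>\<F>"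
    using Lindelof[of \<F>] by metis
  have cover: "p \<in> \<Union>\<F>" if p: "p \<in> mfd_interior M" for p
  proof -
    obtain c where c: "c \<in> atlas M" "p \<in> fst c" "snd c p \<in> interior half_space"
      using p unfolding mfd_interior_def by blast
    obtain T where T: "open T" "cimage c = half_space \<inter> T" using cimage_rel_open[OF c(1)] by (auto simp: openin_open)
    have "cimage c \<inter> interior half_space = T \<inter> interior half_space" using T(2) interior_subset[of half_space] by blast
    then have "open (cimage c \<inter> interior half_space)" using T(1) by auto
    from open_box_nhd[OF this, of "snd c p"] obtain a b where
      "snd c p \<in> box a b" "cbox a b \<subseteq> cimage c \<inter> interior half_space"
      using c chart_maps(1) by blast
    then show ?thesis unfolding \<F>_def boxpre_def using c by blast
  qed
  have "AE p in vol. \<forall>W\<in>\<F>'. p \<in> W \<longrightarrow> h p = 0"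
    using F(1) zero_on_boxpre[OF h z] unfolding AE_ball_countable[OF F(2)] \<F>_def by blast
  then show ?thesis using vol_AE_interior
    by eventually_elim (use cover F(3) in blast)
qed

lemma vol_nonzero: "emeasure vol UNIV \<noteq> 0"
proof
  assume 0: "emeasure vol UNIV = 0"
  obtain c e and p :: 'p where c: "c \<in> atlas M" "p \<in> fst c" and e: "e > 0" "cball (snd c p) e \<inter> half_space \<subseteq> cimage c"
    using chart_ball[of undefined] by metis
  have "emeasure vol (fst c) \<le> emeasure vol UNIV" by (rule emeasure_mono) simp_all
  then have "(\<integral>\<^sup>+p. indicator (fst c) p * 1 \<partial>vol) = 0" using 0 chart_open[OF c(1)] by simp
  then have "(\<integral>\<^sup>+x. indicator (cimage c) x * ennreal (rho c x) * 1 \<partial>lborel) = 0" by (subst (asm) vol_nn[OF c(1)]) simp_all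
  then have "AE x in lborel. indicator (cimage c) x * ennreal (rho c x) = 0"
    using rho_measurable_ennreal[OF c(1)] by (subst (asm) nn_integral_0_iff_AE) auto
  then have "AE x in lborel. x \<notin> cimage c"
    by eventually_elim (use rho_pos[OF c(1)] in \<open>force simp: indicator_def\<close>)
  let ?S = "ball (snd c p) e \<inter> interior half_space"
  have "AE x in lborel. x \<notin> ?S"
    using \<open>AE x in lborel. x \<notin> cimage c\<close>
    by eventually_elim (use e(2) interior_subset[of half_space] ball_subset_cball[of "snd c p" e] in blast)
  then have "?S \<in> null_sets lborel" by (subst AE_iff_null_sets[of ?S]) auto
  then have "negligible ?S" using null_sets_completionI by (auto simp: negligible_iff_null_sets)
  moreover have "?S \<noteq> {}"
  proof -
    let ?k = "LEAST i::'n. True"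
    \<comment> \<open>The centre may be a boundary point; a shift along the normal coordinate leads
      into the interior while staying in the ball.\<close>
    let ?y = "snd c p + (e/2) *\<^sub>R axis ?k 1"
    have "0 \<le> snd c p $ ?k" using snd_in_half_space[OF c] by (simp add: half_space_def)
    then have "?y \<in> interior half_space" using e(1) unfolding interior_half_space by (simp add: axis_def)
    moreover have "?y \<in> ball (snd c p) e" using e(1) by (simp add: dist_norm norm_axis_1)
    ultimately show ?thesis by blast
  qed
  ultimately show False using open_not_negligible[of ?S] by auto
qed

lemma one_L1_loc: "(\<lambda>_. 1) \<in> L1_loc M"
  unfolding L1_loc_def set_integrable_def
proof (intro CollectI conjI allI impI)
  fix K :: "'p set" assume "compact K \<and> K \<subseteq> mfd_interior M"
  then have "integrable vol (indicator K :: 'p \<Rightarrow> real)"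
    using vol_compact_finite borel_compact by (intro integrable_real_indicator) auto
  then show "integrable vol (\<lambda>x. indicator K x *\<^sub>R (1::real))" by simp
qed simp

text \<open>Otherwise every test function would vanish almost everywhere, and the fundamental lemma,
  applied to the constant 1, would give a manifold of volume zero.\<close>

lemma test_nonzero: "\<exists>\<phi>\<in>tests. E.S.N2 \<phi> \<noteq> 0"
proof (rule ccontr)
  assume n: "\<not> ?thesis"
  have "AE p in vol. (1::real) = 0"
  proof (rule fundamental_lemma[OF one_L1_loc])
    fix \<phi> assume \<phi>: "\<phi> \<in> tests"
    then have "E.S.N2 \<phi> = 0" using n by blast
    then have "AE p in vol. \<phi> p * \<phi> p = 0"
      using integral_nonneg_eq_0_iff_AE[OF E.S.L2_integrable[OF E.T_L2[OF \<phi>] E.T_L2[OF \<phi>]]] by (simp add: E.S.ip_def)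
    then have "AE p in vol. \<phi> p * 1 = 0" by eventually_elim simp
    then show "(\<integral>p. \<phi> p * 1 \<partial>vol) = 0" by (rule integral_eq_zero_AE)
  qed
  then have "AE p in vol. p \<notin> UNIV" by simp
  then have "UNIV \<in> null_sets vol" by (subst AE_iff_null_sets) auto
  then show False using vol_nonzero by (simp add: null_sets_def)
qed

end

section \<open>The Poincare inequality on convex sets\<close>

lemma nn_integral_lborel_swap:
  fixes k :: "'a::euclidean_space \<Rightarrow> 'b::euclidean_space \<Rightarrow> ennreal"
  assumes "case_prod k \<in> borel_measurable (borel \<Otimes>\<^sub>M borel)"
  shows "(\<integral>\<^sup>+x. \<integral>\<^sup>+y. k x y \<partial>lborel \<partial>lborel) = (\<integral>\<^sup>+y. \<integral>\<^sup>+x. k x y \<partial>lborel \<partial>lborel)"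
proof -
  have "case_prod k \<in> borel_measurable (lborel \<Otimes>\<^sub>M lborel)"
    using assms by (simp add: measurable_cong_sets[OF sets_pair_measure_cong[OF sets_lborel sets_lborel] refl])
  from lborel_pair.Fubini'[OF this] show ?thesis by simp
qed

text \<open>The substitution contributes the factor \<open>t ^ (- DIM('a))\<close>, which is at most
  \<open>2 ^ DIM('a)\<close>.\<close>

lemma nn_integral_affine_le:
  fixes G :: "'a::euclidean_space \<Rightarrow> ennreal"
  assumes [measurable]: "G \<in> borel_measurable borel" and t: "1/2 \<le> t"
  shows "(\<integral>\<^sup>+y. G (a + t *\<^sub>R y) \<partial>lborel) \<le> ennreal (2 ^ DIM('a)) * (\<integral>\<^sup>+y. G y \<partial>lborel)"
proof -
  let ?I = "\<integral>\<^sup>+y. G (a + t *\<^sub>R y) \<partial>lborel"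
  have "(\<integral>\<^sup>+y. G y \<partial>lborel) = (\<integral>\<^sup>+y. G y \<partial>density (distr lborel borel (\<lambda>x. a + t *\<^sub>R x)) (\<lambda>_. ennreal (\<bar>t\<bar> ^ DIM('a))))"
    using lborel_affine[of t a] t by simp
  also have "\<dots> = (\<integral>\<^sup>+y. ennreal (t ^ DIM('a)) * G (a + t *\<^sub>R y) \<partial>lborel)"
    using t by (subst nn_integral_density) (auto simp: nn_integral_distr)
  also have "\<dots> = ennreal (t ^ DIM('a)) * ?I" by (rule nn_integral_cmult) measurable
  finally have "ennreal (2 ^ DIM('a)) * (\<integral>\<^sup>+y. G y \<partial>lborel) = ennreal (2 ^ DIM('a)) * ennreal (t ^ DIM('a)) * ?I"
    by (simp add: mult.assoc)
  also have "ennreal (2 ^ DIM('a)) * ennreal (t ^ DIM('a)) = ennreal ((2 * t) ^ DIM('a))"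
    using t by (simp add: ennreal_mult[symmetric] power_mult_distrib)
  finally have e: "ennreal (2 ^ DIM('a)) * (\<integral>\<^sup>+y. G y \<partial>lborel) = ennreal ((2 * t) ^ DIM('a)) * ?I" .
  have "1 \<le> (2 * t) ^ DIM('a)" using t by (intro one_le_power) simp
  then have "1 * ?I \<le> ennreal ((2 * t) ^ DIM('a)) * ?I"
    by (intro mult_right_mono) (auto simp flip: ennreal_1 intro: ennreal_leI)
  then show ?thesis using e by simp
qed

text \<open>The increment \<open>m\<close> is the integral of the derivative \<open>g'\<close> along
  the segment. Integrating \<open>2 m g' - m^2 \<le> g'^2\<close> over the unit interval gives the
  bound on \<open>m^2\<close> directly.\<close>

lemma sq_diff_le_segment_integral:
  fixes f :: "'a::euclidean_space \<Rightarrow> real" and d :: "'a \<Rightarrow> 'a"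
  assumes P: "convex P" and xy: "x \<in> P" "y \<in> P"
    and der: "\<And>z. z \<in> P \<Longrightarrow> (f has_derivative (\<lambda>v. d z \<bullet> v)) (at z within P)"
    and cont: "continuous_on P d"
  shows "ennreal ((f y - f x)\<^sup>2) \<le> (\<integral>\<^sup>+t. ennreal (indicator {0..1} t * ((norm (y - x))\<^sup>2 * (norm (d (x + t *\<^sub>R (y - x))))\<^sup>2)) \<partial>lborel)"
proof -
  define \<gamma> where "\<gamma> t = x + t *\<^sub>R (y - x)" for t :: real
  have \<gamma>P: "\<gamma> t \<in> P" if "t \<in> {0..1}" for t
  proof -
    have "\<gamma> t = (1 - t) *\<^sub>R x + t *\<^sub>R y" by (simp add: \<gamma>_def algebra_simps)
    then show ?thesis using convexD_alt[OF P xy, of t] that by simp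
  qed
  have cd: "continuous_on {0..1} (\<lambda>t. d (\<gamma> t))"
    by (rule continuous_on_compose2[OF cont]) (use \<gamma>P in \<open>auto simp: \<gamma>_def intro!: continuous_intros\<close>)
  define g' where "g' t = d (\<gamma> t) \<bullet> (y - x)" for t
  define m where "m = f y - f x"
  define F where "F t = (norm (y - x))\<^sup>2 * (norm (d (\<gamma> t)))\<^sup>2" for t
  have "((\<lambda>t. f (\<gamma> t)) has_vector_derivative g' t) (at t within {0..1})" if t: "t \<in> {0..1}" for t
  proof -
    have 1: "(\<gamma> has_derivative (\<lambda>s. s *\<^sub>R (y - x))) (at t within {0..1})"
      unfolding \<gamma>_def by (auto intro!: derivative_eq_intros)
    have 2: "(f has_derivative (\<lambda>v. d (\<gamma> t) \<bullet> v)) (at (\<gamma> t) within \<gamma> ` {0..1})"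
      by (rule has_derivative_subset[OF der]) (use \<gamma>P t in auto)
    show ?thesis using has_derivative_in_compose[OF 1 2] by (simp add: has_vector_derivative_def g'_def)
  qed
  then have "(g' has_integral (f (\<gamma> 1) - f (\<gamma> 0))) {0..1}" by (intro fundamental_theorem_of_calculus) auto
  then have I1: "(g' has_integral m) {0..1}" by (simp add: m_def \<gamma>_def)
  have "((\<lambda>t. 2 * m * g' t - m\<^sup>2) has_integral (2 * m * m - m\<^sup>2)) {0..1}"
    using has_integral_diff[OF has_integral_mult_right[OF I1, of "2 * m"] has_integral_const_real[of "m\<^sup>2" 0 1]] by simp
  then have I2: "((\<lambda>t. 2 * m * g' t - m\<^sup>2) has_integral m\<^sup>2) {0..1}" by (simp add: power2_eq_square)
  have cF: "continuous_on {0..1} F" unfolding F_def by (intro continuous_intros cd)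
  then obtain J where J: "(F has_integral J) {0..1}" using integrable_continuous_real by blast
  have "m\<^sup>2 \<le> J"
  proof (rule has_integral_le[OF I2 J])
    fix t
    have "2 * m * g' t - m\<^sup>2 \<le> (g' t)\<^sup>2" using zero_le_power2[of "g' t - m"] by (simp add: power2_diff algebra_simps)
    also have "\<dots> \<le> F t" using power_mono[OF Cauchy_Schwarz_ineq2[of "d (\<gamma> t)" "y - x"], of 2]
      by (simp add: g'_def F_def power_mult_distrib mult.commute)
    finally show "2 * m * g' t - m\<^sup>2 \<le> F t" .
  qed
  have FI: "(\<lambda>t. indicator {0..1} t * F t) = (\<lambda>t. if t \<in> {0..1} then F t else 0)" by (auto simp: indicator_def)
  have "((\<lambda>t. indicator {0..1} t * F t) has_integral J) UNIV"
    unfolding FI has_integral_restrict_UNIV by (rule J)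
  then have "(\<integral>\<^sup>+t. ennreal (indicator {0..1} t * F t) \<partial>lborel) = ennreal J"
    by (rule nn_integral_has_integral_lborel[rotated 2])
      (use borel_measurable_continuous_on_indicator[OF _ cF] in \<open>auto simp: F_def\<close>)
  then show ?thesis using \<open>m\<^sup>2 \<le> J\<close> unfolding m_def F_def \<gamma>_def by (simp add: ennreal_leI)
qed

text \<open>By Tonelli it suffices to bound the integral over \<open>x\<close> and \<open>y\<close> at a fixed point
  \<open>(1 - t) x + t y\<close> of the segments; one of \<open>t\<close> and \<open>1 - t\<close> is at least \<open>1/2\<close>, and the variable with
  this coefficient is substituted.\<close>

lemma convex_double_integral:
  fixes f :: "'a::euclidean_space \<Rightarrow> real" and d :: "'a \<Rightarrow> 'a"
  assumes P: "convex P" "P \<in> sets borel"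
    and der: "\<And>z. z \<in> P \<Longrightarrow> (f has_derivative (\<lambda>v. d z \<bullet> v)) (at z within P)"
    and cont: "continuous_on P d" and diam: "\<And>x y. x \<in> P \<Longrightarrow> y \<in> P \<Longrightarrow> norm (y - x) \<le> \<delta>"
  shows "(\<integral>\<^sup>+x. \<integral>\<^sup>+y. indicator P x * indicator P y * ennreal ((f y - f x)\<^sup>2) \<partial>lborel \<partial>lborel)
     \<le> ennreal (\<delta>\<^sup>2) * (ennreal (2 ^ DIM('a)) * emeasure lborel P * (\<integral>\<^sup>+z. indicator P z * ennreal ((norm (d z))\<^sup>2) \<partial>lborel))"
proof -
  define G where "G z = indicator P z * ennreal ((norm (d z))\<^sup>2)" for z
  have [measurable]: "P \<in> sets borel" by (rule P)
  have Gm[measurable]: "G \<in> borel_measurable borel"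
  proof -
    have "(\<lambda>z. indicator P z *\<^sub>R (norm (d z))\<^sup>2) \<in> borel_measurable borel"
      by (rule borel_measurable_continuous_on_indicator[OF P(2)]) (intro continuous_intros cont)
    then have "(\<lambda>z. ennreal (indicator P z *\<^sub>R (norm (d z))\<^sup>2)) \<in> borel_measurable borel" by measurable
    moreover have "(\<lambda>z. ennreal (indicator P z *\<^sub>R (norm (d z))\<^sup>2)) = G" by (auto simp: G_def indicator_def)
    ultimately show ?thesis by (rule back_subst)
  qed
  let ?IG = "\<integral>\<^sup>+z. G z \<partial>lborel"
  define k where "k x y t = indicator P x * indicator P y * (indicator {0..1::real} t * (ennreal (\<delta>\<^sup>2) * G (x + t *\<^sub>R (y - x))))" for x y t
  have le: "indicator P x * indicator P y * ennreal ((f y - f x)\<^sup>2) \<le> (\<integral>\<^sup>+t. k x y t \<partial>lborel)" for x y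
  proof (cases "x \<in> P \<and> y \<in> P")
    case True
    have "ennreal ((f y - f x)\<^sup>2) \<le> (\<integral>\<^sup>+t. ennreal (indicator {0..1} t * ((norm (y - x))\<^sup>2 * (norm (d (x + t *\<^sub>R (y - x))))\<^sup>2)) \<partial>lborel)"
      by (rule sq_diff_le_segment_integral[OF P(1) _ _ der cont]) (use True in auto)
    also have "\<dots> \<le> (\<integral>\<^sup>+t. k x y t \<partial>lborel)"
    proof (rule nn_integral_mono)
      fix t :: real
      show "ennreal (indicator {0..1} t * ((norm (y - x))\<^sup>2 * (norm (d (x + t *\<^sub>R (y - x))))\<^sup>2)) \<le> k x y t"
      proof (cases "t \<in> {0..1}")
        case t: True
        have "x + t *\<^sub>R (y - x) = (1 - t) *\<^sub>R x + t *\<^sub>R y" by (simp add: algebra_simps)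
        then have "x + t *\<^sub>R (y - x) \<in> P" using convexD_alt[OF P(1), of x y t] True t by simp
        moreover have "(norm (y - x))\<^sup>2 \<le> \<delta>\<^sup>2" using diam[of x y] True by (intro power_mono) auto
        ultimately show ?thesis using True t unfolding k_def G_def
          by (auto simp: ennreal_mult[symmetric] intro!: ennreal_leI mult_right_mono)
      qed (simp add: k_def)
    qed
    finally show ?thesis using True by simp
  qed auto
  have "(\<integral>\<^sup>+x. \<integral>\<^sup>+y. indicator P x * indicator P y * ennreal ((f y - f x)\<^sup>2) \<partial>lborel \<partial>lborel)
      \<le> (\<integral>\<^sup>+x. \<integral>\<^sup>+y. \<integral>\<^sup>+t. k x y t \<partial>lborel \<partial>lborel \<partial>lborel)"
    by (intro nn_integral_mono le)
  also have "\<dots> = (\<integral>\<^sup>+x. \<integral>\<^sup>+t. \<integral>\<^sup>+y. k x y t \<partial>lborel \<partial>lborel \<partial>lborel)"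
    by (intro nn_integral_cong nn_integral_lborel_swap) (unfold k_def, measurable)
  also have "\<dots> = (\<integral>\<^sup>+t. \<integral>\<^sup>+x. \<integral>\<^sup>+y. k x y t \<partial>lborel \<partial>lborel \<partial>lborel)"
    by (intro nn_integral_lborel_swap) (unfold k_def, measurable)
  also have "\<dots> \<le> (\<integral>\<^sup>+t. indicator {0..1::real} t * (ennreal (\<delta>\<^sup>2) * (ennreal (2 ^ DIM('a)) * emeasure lborel P * ?IG)) \<partial>lborel)"
  proof (rule nn_integral_mono)
    fix t :: real
    show "(\<integral>\<^sup>+x. \<integral>\<^sup>+y. k x y t \<partial>lborel \<partial>lborel) \<le> indicator {0..1::real} t * (ennreal (\<delta>\<^sup>2) * (ennreal (2 ^ DIM('a)) * emeasure lborel P * ?IG))"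
    proof (cases "t \<in> {0..1}")
      case t: True
      define l where "l x y = indicator P x * indicator P y * G (x + t *\<^sub>R (y - x))" for x y
      have lm: "case_prod l \<in> borel_measurable (borel \<Otimes>\<^sub>M borel)" unfolding l_def by measurable
      have kl: "k x y t = ennreal (\<delta>\<^sup>2) * l x y" for x y using t by (simp add: k_def l_def mult_ac)
      have "(\<integral>\<^sup>+x. \<integral>\<^sup>+y. k x y t \<partial>lborel \<partial>lborel) = (\<integral>\<^sup>+x. ennreal (\<delta>\<^sup>2) * (\<integral>\<^sup>+y. l x y \<partial>lborel) \<partial>lborel)"
        unfolding kl by (intro nn_integral_cong nn_integral_cmult) (unfold l_def, measurable)
      also have "\<dots> = ennreal (\<delta>\<^sup>2) * (\<integral>\<^sup>+x. \<integral>\<^sup>+y. l x y \<partial>lborel \<partial>lborel)"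
        by (intro nn_integral_cmult) (unfold l_def, measurable)
      also have "(\<integral>\<^sup>+x. \<integral>\<^sup>+y. l x y \<partial>lborel \<partial>lborel) \<le> ennreal (2 ^ DIM('a)) * emeasure lborel P * ?IG"
      proof (cases "t \<ge> 1/2")
        case True
        have "(\<integral>\<^sup>+x. \<integral>\<^sup>+y. l x y \<partial>lborel \<partial>lborel) \<le> (\<integral>\<^sup>+x. (ennreal (2 ^ DIM('a)) * ?IG) * indicator P x \<partial>lborel)"
        proof (rule nn_integral_mono)
          fix x
          have "(\<integral>\<^sup>+y. l x y \<partial>lborel) \<le> (\<integral>\<^sup>+y. indicator P x * G ((x - t *\<^sub>R x) + t *\<^sub>R y) \<partial>lborel)"
            by (intro nn_integral_mono) (auto simp: l_def indicator_def algebra_simps)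
          also have "\<dots> = indicator P x * (\<integral>\<^sup>+y. G ((x - t *\<^sub>R x) + t *\<^sub>R y) \<partial>lborel)"
            by (rule nn_integral_cmult) measurable
          also have "\<dots> \<le> indicator P x * (ennreal (2 ^ DIM('a)) * ?IG)"
            by (intro mult_left_mono nn_integral_affine_le Gm True) simp
          finally show "(\<integral>\<^sup>+y. l x y \<partial>lborel) \<le> (ennreal (2 ^ DIM('a)) * ?IG) * indicator P x" by (simp add: mult.commute)
        qed
        also have "\<dots> = (ennreal (2 ^ DIM('a)) * ?IG) * emeasure lborel P" by (rule nn_integral_cmult_indicator) simp
        finally show ?thesis by (simp add: mult_ac)
      next
        case False
        have "(\<integral>\<^sup>+x. \<integral>\<^sup>+y. l x y \<partial>lborel \<partial>lborel) = (\<integral>\<^sup>+y. \<integral>\<^sup>+x. l x y \<partial>lborel \<partial>lborel)" by (rule nn_integral_lborel_swap[OF lm])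
        also have "\<dots> \<le> (\<integral>\<^sup>+y. (ennreal (2 ^ DIM('a)) * ?IG) * indicator P y \<partial>lborel)"
        proof (rule nn_integral_mono)
          fix y
          have "(\<integral>\<^sup>+x. l x y \<partial>lborel) \<le> (\<integral>\<^sup>+x. indicator P y * G (t *\<^sub>R y + (1 - t) *\<^sub>R x) \<partial>lborel)"
            by (intro nn_integral_mono) (auto simp: l_def indicator_def algebra_simps)
          also have "\<dots> = indicator P y * (\<integral>\<^sup>+x. G (t *\<^sub>R y + (1 - t) *\<^sub>R x) \<partial>lborel)"
            by (rule nn_integral_cmult) measurable
          also have "\<dots> \<le> indicator P y * (ennreal (2 ^ DIM('a)) * ?IG)"
            by (intro mult_left_mono nn_integral_affine_le Gm) (use False in auto)
          finally show "(\<integral>\<^sup>+x. l x y \<partial>lborel) \<le> (ennreal (2 ^ DIM('a)) * ?IG) * indicator P y" by (simp add: mult.commute)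
        qed
        also have "\<dots> = (ennreal (2 ^ DIM('a)) * ?IG) * emeasure lborel P" by (rule nn_integral_cmult_indicator) simp
        finally show ?thesis by (simp add: mult_ac)
      qed
      finally show ?thesis using t by (simp add: mult_left_mono)
    qed (simp add: k_def)
  qed
  also have "\<dots> = ennreal (\<delta>\<^sup>2) * (ennreal (2 ^ DIM('a)) * emeasure lborel P * ?IG)"
    by (subst nn_integral_multc) auto
  finally show ?thesis unfolding G_def .
qed

text \<open>Expanding the square shows that the double integral is twice the total mass times the
  variance; its nonnegativity is the last claim.\<close>

lemma double_integral_variance:
  fixes f :: "'a \<Rightarrow> real"
  assumes fin: "finite_measure \<nu>" and f[measurable]: "f \<in> borel_measurable \<nu>" and b: "\<And>x. x \<in> space \<nu> \<Longrightarrow> \<bar>f x\<bar> \<le> B"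
  shows "(\<integral>\<^sup>+x. \<integral>\<^sup>+y. ennreal ((f y - f x)\<^sup>2) \<partial>\<nu> \<partial>\<nu>) = ennreal (2 * measure \<nu> (space \<nu>) * (\<integral>x. (f x)\<^sup>2 \<partial>\<nu>) - 2 * (\<integral>x. f x \<partial>\<nu>)\<^sup>2)"
    and "integrable \<nu> (\<lambda>x. (f x)\<^sup>2)" and "integrable \<nu> f"
    and "(\<integral>x. f x \<partial>\<nu>)\<^sup>2 \<le> measure \<nu> (space \<nu>) * (\<integral>x. (f x)\<^sup>2 \<partial>\<nu>)"
proof -
  interpret finite_measure \<nu> by fact
  let ?V = "measure \<nu> (space \<nu>)" and ?A = "\<integral>x. (f x)\<^sup>2 \<partial>\<nu>" and ?I = "\<integral>x. f x \<partial>\<nu>"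
  show i1: "integrable \<nu> f" by (rule integrable_const_bound[of _ B]) (use b in auto)
  show i2: "integrable \<nu> (\<lambda>x. (f x)\<^sup>2)"
    by (rule integrable_const_bound[of _ "B\<^sup>2"]) (use b power_mono[OF b, of _ 2] in auto)
  have inner: "(\<integral>y. (f y - a)\<^sup>2 \<partial>\<nu>) = ?A - 2 * a * ?I + a\<^sup>2 * ?V" "integrable \<nu> (\<lambda>y. (f y - a)\<^sup>2)" for a
  proof -
    have e: "(f y - a)\<^sup>2 = (f y)\<^sup>2 - 2 * a * f y + a\<^sup>2" for y by (simp add: power2_diff algebra_simps)
    show "(\<integral>y. (f y - a)\<^sup>2 \<partial>\<nu>) = ?A - 2 * a * ?I + a\<^sup>2 * ?V" "integrable \<nu> (\<lambda>y. (f y - a)\<^sup>2)"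
      unfolding e using i1 i2 by auto
  qed
  have oe: "?A - 2 * f x * ?I + (f x)\<^sup>2 * ?V = (?A + ?V * (f x)\<^sup>2) - (2 * ?I) * f x" for x by (simp add: algebra_simps)
  have o1: "integrable \<nu> (\<lambda>x. ?A + ?V * (f x)\<^sup>2)" "integrable \<nu> (\<lambda>x. (2 * ?I) * f x)"
    by (intro Bochner_Integration.integrable_add integrable_mult_right i1 i2 integrable_const)+
  have outer: "integrable \<nu> (\<lambda>x. ?A - 2 * f x * ?I + (f x)\<^sup>2 * ?V)"
    unfolding oe by (rule Bochner_Integration.integrable_diff[OF o1])
  have "(\<integral>x. (?A + ?V * (f x)\<^sup>2) - (2 * ?I) * f x \<partial>\<nu>) = (\<integral>x. ?A + ?V * (f x)\<^sup>2 \<partial>\<nu>) - (2 * ?I) * ?I"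
    by (subst Bochner_Integration.integral_diff[OF o1]) simp
  also have "(\<integral>x. ?A + ?V * (f x)\<^sup>2 \<partial>\<nu>) = ?V * ?A + ?V * ?A"
    by (subst Bochner_Integration.integral_add) (use i2 in auto)
  finally have outer2: "(\<integral>x. ?A - 2 * f x * ?I + (f x)\<^sup>2 * ?V \<partial>\<nu>) = 2 * ?V * ?A - 2 * ?I\<^sup>2"
    unfolding oe by (simp add: power2_eq_square)
  have nn: "0 \<le> ?A - 2 * f x * ?I + (f x)\<^sup>2 * ?V" for x
  proof -
    have "0 \<le> (\<integral>y. (f y - f x)\<^sup>2 \<partial>\<nu>)" by (rule Bochner_Integration.integral_nonneg) simp
    then show ?thesis by (simp only: inner(1)[of "f x"])
  qed
  have "(\<integral>\<^sup>+x. \<integral>\<^sup>+y. ennreal ((f y - f x)\<^sup>2) \<partial>\<nu> \<partial>\<nu>) = (\<integral>\<^sup>+x. ennreal (?A - 2 * f x * ?I + (f x)\<^sup>2 * ?V) \<partial>\<nu>)"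
    by (intro nn_integral_cong) (simp only: nn_integral_eq_integral[OF inner(2)] inner(1) AE_I2 zero_le_power2)
  also have "\<dots> = ennreal (2 * ?V * ?A - 2 * ?I\<^sup>2)"
    by (subst nn_integral_eq_integral[OF outer]) (simp_all only: outer2 AE_I2 nn)
  finally show "(\<integral>\<^sup>+x. \<integral>\<^sup>+y. ennreal ((f y - f x)\<^sup>2) \<partial>\<nu> \<partial>\<nu>) = ennreal (2 * ?V * ?A - 2 * ?I\<^sup>2)" .
  have "0 \<le> (\<integral>x. ?A - 2 * f x * ?I + (f x)\<^sup>2 * ?V \<partial>\<nu>)" by (rule Bochner_Integration.integral_nonneg) (use nn in auto)
  then show "?I\<^sup>2 \<le> ?V * ?A" unfolding outer2 by simp
qed

text \<open>The squared mean is kept on the right: on a grid cell it becomes one of finitely many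
  linear coordinates, up to which the gradient controls the function.\<close>

theorem poincare_convex:
  fixes f :: "'a::euclidean_space \<Rightarrow> real" and d :: "'a \<Rightarrow> 'a"
  assumes P: "convex P" "P \<in> sets borel" "bounded P"
    and der: "\<And>z. z \<in> P \<Longrightarrow> (f has_derivative (\<lambda>v. d z \<bullet> v)) (at z within P)"
    and cont: "continuous_on P d" and diam: "\<And>x y. x \<in> P \<Longrightarrow> y \<in> P \<Longrightarrow> norm (y - x) \<le> \<delta>"
    and fb: "\<And>x. x \<in> P \<Longrightarrow> \<bar>f x\<bar> \<le> B" and db: "\<And>x. x \<in> P \<Longrightarrow> norm (d x) \<le> B"
  shows "(\<integral>x. indicator P x * (f x)\<^sup>2 \<partial>lborel) \<le> (\<integral>x. indicator P x * f x \<partial>lborel)\<^sup>2 / measure lborel P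
      + 2 ^ DIM('a) * \<delta>\<^sup>2 * (\<integral>x. indicator P x * (norm (d x))\<^sup>2 \<partial>lborel)"
    and "(\<integral>x. indicator P x * f x \<partial>lborel)\<^sup>2 \<le> measure lborel P * (\<integral>x. indicator P x * (f x)\<^sup>2 \<partial>lborel)"
    and "integrable lborel (\<lambda>x. indicator P x * f x)"
    and "integrable lborel (\<lambda>x. indicator P x * (f x)\<^sup>2)"
    and "integrable lborel (\<lambda>x. indicator P x * (norm (d x))\<^sup>2)"
proof -
  have [measurable]: "P \<in> sets borel" by (rule P)
  have Pfin: "emeasure lborel P < \<infinity>" using P(3) by (rule emeasure_bounded_finite)
  define \<nu> where "\<nu> = restrict_space lborel P"
  have sp: "space \<nu> = P" by (simp add: \<nu>_def space_restrict_space)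
  have fin: "finite_measure \<nu>"
    by standard (use Pfin in \<open>simp add: \<nu>_def emeasure_restrict_space space_restrict_space less_top\<close>)
  have V: "measure \<nu> (space \<nu>) = measure lborel P" unfolding sp by (simp add: \<nu>_def measure_restrict_space)
  have cf: "continuous_on P f" using der by (auto simp: continuous_on_eq_continuous_within intro: has_derivative_continuous)
  have fm: "f \<in> borel_measurable \<nu>"
    using borel_measurable_continuous_on_restrict[OF cf] by (simp add: \<nu>_def cong: measurable_cong_sets sets_restrict_space_cong)
  have int: "(\<integral>x. h x \<partial>\<nu>) = (\<integral>x. indicator P x * h x \<partial>lborel)" for h :: "'a \<Rightarrow> real"
    unfolding \<nu>_def by (subst integral_restrict_space) auto
  have intble: "integrable \<nu> h \<longleftrightarrow> integrable lborel (\<lambda>x. indicator P x * h x)" for h :: "'a \<Rightarrow> real"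
    unfolding \<nu>_def by (subst integrable_restrict_space) auto
  have fb': "\<bar>f x\<bar> \<le> B" if "x \<in> space \<nu>" for x using fb that by (simp add: sp)
  note dv = double_integral_variance[OF fin fm fb', unfolded V int intble]
  show i1: "integrable lborel (\<lambda>x. indicator P x * f x)" and i2: "integrable lborel (\<lambda>x. indicator P x * (f x)\<^sup>2)"
    and cs: "(\<integral>x. indicator P x * f x \<partial>lborel)\<^sup>2 \<le> measure lborel P * (\<integral>x. indicator P x * (f x)\<^sup>2 \<partial>lborel)"
    using dv(2,3,4) by auto
  have dm: "(\<lambda>x. indicator P x * (norm (d x))\<^sup>2) \<in> borel_measurable borel"
  proof -
    have "continuous_on P (\<lambda>x. (norm (d x))\<^sup>2)" by (intro continuous_intros cont)
    then show ?thesis using borel_measurable_continuous_on_indicator[OF P(2)] by fastforce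
  qed
  show i3: "integrable lborel (\<lambda>x. indicator P x * (norm (d x))\<^sup>2)"
  proof (rule Bochner_Integration.integrable_bound)
    show "integrable lborel (\<lambda>x. B\<^sup>2 * indicator P x)"
      using Pfin by (intro integrable_mult_right integrable_real_indicator) auto
    show "AE x in lborel. norm (indicator P x * (norm (d x))\<^sup>2) \<le> norm (B\<^sup>2 * indicator P x)"
      using power_mono[OF db, of _ 2] by (auto simp: indicator_def)
  qed (use dm in simp)
  let ?V = "measure lborel P" and ?A = "\<integral>x. indicator P x * (f x)\<^sup>2 \<partial>lborel" and ?I = "\<integral>x. indicator P x * f x \<partial>lborel"
    and ?G = "\<integral>x. indicator P x * (norm (d x))\<^sup>2 \<partial>lborel"
  have G0: "0 \<le> ?G" by (rule Bochner_Integration.integral_nonneg) simp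
  have GG: "(\<integral>\<^sup>+z. indicator P z * ennreal ((norm (d z))\<^sup>2) \<partial>lborel) = ennreal ?G"
  proof -
    have "(\<integral>\<^sup>+z. indicator P z * ennreal ((norm (d z))\<^sup>2) \<partial>lborel) = (\<integral>\<^sup>+z. ennreal (indicator P z * (norm (d z))\<^sup>2) \<partial>lborel)"
      by (intro nn_integral_cong) (auto simp: indicator_def)
    then show ?thesis using nn_integral_eq_integral[OF i3] by simp
  qed
  have "ennreal (2 * ?V * ?A - 2 * ?I\<^sup>2) = (\<integral>\<^sup>+x. \<integral>\<^sup>+y. ennreal ((f y - f x)\<^sup>2) \<partial>\<nu> \<partial>\<nu>)" using dv(1) by simp
  also have "\<dots> = (\<integral>\<^sup>+x. \<integral>\<^sup>+y. indicator P x * indicator P y * ennreal ((f y - f x)\<^sup>2) \<partial>lborel \<partial>lborel)"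
  proof -
    have nnr: "(\<integral>\<^sup>+x. h x \<partial>\<nu>) = (\<integral>\<^sup>+x. h x * indicator P x \<partial>lborel)" for h :: "'a \<Rightarrow> ennreal"
      unfolding \<nu>_def by (subst nn_integral_restrict_space) auto
    show ?thesis unfolding nnr
      by (intro nn_integral_cong) (auto simp: indicator_def mult_ac intro!: nn_integral_cong)
  qed
  also have "\<dots> \<le> ennreal (\<delta>\<^sup>2) * (ennreal (2 ^ DIM('a)) * emeasure lborel P * ennreal ?G)"
    using convex_double_integral[OF P(1,2) der cont diam] unfolding GG .
  also have "\<dots> = ennreal (\<delta>\<^sup>2 * (2 ^ DIM('a) * ?V * ?G))"
    using Pfin G0 by (simp add: emeasure_eq_ennreal_measure ennreal_mult)
  finally have "2 * ?V * ?A - 2 * ?I\<^sup>2 \<le> \<delta>\<^sup>2 * (2 ^ DIM('a) * ?V * ?G)"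
    using G0 by (simp add: ennreal_le_iff)
  moreover have nn: "0 \<le> \<delta>\<^sup>2 * (2 ^ DIM('a) * ?V * ?G)" using G0 by simp
  \<comment> \<open>Halving both sides would give a constant smaller by the factor 2; the cruder one
    is kept.\<close>
  ultimately have main: "?V * ?A \<le> ?I\<^sup>2 + \<delta>\<^sup>2 * (2 ^ DIM('a) * ?V * ?G)" by linarith
  show "?A \<le> ?I\<^sup>2 / ?V + 2 ^ DIM('a) * \<delta>\<^sup>2 * ?G"
  \<comment> \<open>Grid cells may be null sets. The quotient is then 0 by convention, and the left
    side vanishes as well.\<close>
  proof (cases "?V = 0")
    case True
    then have "emeasure lborel P = 0" using Pfin by (simp add: emeasure_eq_ennreal_measure)
    then have "P \<in> null_sets lborel" by (auto simp: null_sets_def)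
    from AE_not_in[OF this] have "AE x in lborel. indicator P x * (f x)\<^sup>2 = 0" by eventually_elim simp
    then have "?A = 0" by (rule integral_eq_zero_AE)
    then show ?thesis using G0 by (simp add: True)
  next
    case False
    then have "?V > 0" using measure_nonneg[of lborel P] by linarith
    then show ?thesis using main by (simp add: field_simps)
  qed
qed

section \<open>Rellich compactness\<close>

lemma floor_bounded: "\<bar>x :: real\<bar> \<le> of_int N \<Longrightarrow> \<lfloor>x\<rfloor> \<in> {- (N + 1)..N + 1}"
proof -
  assume "\<bar>x\<bar> \<le> of_int N"
  then have "of_int (- N) \<le> x" "x < of_int (N + 1)" by auto
  then have "- N \<le> \<lfloor>x\<rfloor>" "\<lfloor>x\<rfloor> < N + 1" by (simp_all only: le_floor_iff floor_less_iff)
  then show ?thesis by simp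
qed

definition grid :: "real \<Rightarrow> real^'n::finite \<Rightarrow> 'n \<Rightarrow> int" where
  "grid \<epsilon> x i = \<lfloor>x $ i / \<epsilon>\<rfloor>"

text \<open>Half-open cubes make the cells disjoint; cut with a convex \<open>K\<close>, such as a
  half ball at the boundary, they remain convex, as the Poincare inequality demands.\<close>

definition grid_cell :: "real \<Rightarrow> (real^'n::finite) set \<Rightarrow> ('n \<Rightarrow> int) \<Rightarrow> (real^'n) set" where
  "grid_cell \<epsilon> K j = {x \<in> K. grid \<epsilon> x = j}"

lemma grid_cell_eq:
  fixes K :: "(real^'n::finite) set"
  assumes "\<epsilon> > 0"
  shows "grid_cell \<epsilon> K j = K \<inter> (\<Inter>i. (\<lambda>x. x $ i) -` {of_int (j i) * \<epsilon>..<(of_int (j i) + 1) * \<epsilon>})"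
proof -
  have "grid \<epsilon> x = j \<longleftrightarrow> (\<forall>i. of_int (j i) * \<epsilon> \<le> x $ i \<and> x $ i < (of_int (j i) + 1) * \<epsilon>)" for x :: "real^'n"
    using assms by (auto simp: fun_eq_iff grid_def floor_eq_iff field_simps)
  then show ?thesis by (auto simp: grid_cell_def)
qed

lemma grid_cell_convex: "\<epsilon> > 0 \<Longrightarrow> convex K \<Longrightarrow> convex (grid_cell \<epsilon> K j)" for K :: "(real^'n::finite) set"
  unfolding grid_cell_eq
  by (intro convex_Int convex_INT convex_linear_vimage) (auto simp: bounded_linear_vec_nth bounded_linear.linear)

lemma grid_cell_borel:
  fixes K :: "(real^'n::finite) set"
  assumes "\<epsilon> > 0" "K \<in> sets borel" shows "grid_cell \<epsilon> K j \<in> sets borel"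
  unfolding grid_cell_eq[OF assms(1)]
proof (intro sets.Int assms(2) sets.finite_INT)
  fix i :: 'n
  have "(\<lambda>x::real^'n. x $ i) -` {of_int (j i) * \<epsilon>..<(of_int (j i) + 1) * \<epsilon>} \<inter> space borel \<in> sets borel"
    by (rule measurable_sets[OF borel_measurable_nth]) simp
  then show "(\<lambda>x::real^'n. x $ i) -` {of_int (j i) * \<epsilon>..<(of_int (j i) + 1) * \<epsilon>} \<in> sets borel" by simp
qed auto

lemma grid_cell_diam:
  fixes K :: "(real^'n::finite) set"
  assumes "\<epsilon> > 0" "x \<in> grid_cell \<epsilon> K j" "y \<in> grid_cell \<epsilon> K j"
  shows "norm (y - x) \<le> real CARD('n) * \<epsilon>"
proof -
  have "\<bar>(y - x) $ i\<bar> \<le> \<epsilon>" for i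
  proof -
    have "of_int (j i) * \<epsilon> \<le> z $ i \<and> z $ i < of_int (j i) * \<epsilon> + \<epsilon>" if "z \<in> grid_cell \<epsilon> K j" for z
      using that unfolding grid_cell_eq[OF assms(1)] by (auto simp: distrib_right)
    from this[OF assms(2)] this[OF assms(3)] show ?thesis unfolding vector_minus_component by linarith
  qed
  then have "(\<Sum>i\<in>UNIV. \<bar>(y - x) $ i\<bar>) \<le> (\<Sum>i\<in>(UNIV::'n set). \<epsilon>)" by (intro sum_mono) auto
  then show ?thesis using norm_le_l1_cart[of "y - x"] by simp
qed

lemma grid_finite:
  fixes K :: "(real^'n::finite) set"
  assumes "bounded K" shows "finite (grid \<epsilon> ` K)"
proof -
  obtain R where R: "\<And>x. x \<in> K \<Longrightarrow> norm x \<le> R" using assms bounded_iff by blast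
  define N where "N = \<lceil>R / \<bar>\<epsilon>\<bar>\<rceil> + 1"
  have "grid \<epsilon> ` K \<subseteq> PiE UNIV (\<lambda>_. {-N..N})"
  proof
    fix g assume "g \<in> grid \<epsilon> ` K"
    then obtain x where x: "x \<in> K" "g = grid \<epsilon> x" by blast
    have "g i \<in> {-N..N}" for i
    proof -
      have "\<bar>x $ i / \<epsilon>\<bar> \<le> R / \<bar>\<epsilon>\<bar>"
        unfolding abs_divide using component_le_norm_cart[of x i] R[OF x(1)] by (intro divide_right_mono) auto
      then have "\<bar>x $ i / \<epsilon>\<bar> \<le> of_int \<lceil>R / \<bar>\<epsilon>\<bar>\<rceil>" using le_of_int_ceiling order_trans by blast
      then show ?thesis unfolding x(2) grid_def N_def by (rule floor_bounded)
    qed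
    then show "g \<in> PiE UNIV (\<lambda>_. {-N..N})" by auto
  qed
  then show ?thesis by (rule finite_subset) (auto intro: finite_PiE)
qed

lemma grid_cell_indicator:
  fixes K :: "(real^'n::finite) set" and f :: "real^'n \<Rightarrow> real"
  assumes "bounded K" shows "indicator K x * f x = (\<Sum>j\<in>grid \<epsilon> ` K. indicator (grid_cell \<epsilon> K j) x * f x)"
proof (cases "x \<in> K")
  case True
  have "(\<Sum>j\<in>grid \<epsilon> ` K. indicator (grid_cell \<epsilon> K j) x * f x) = (\<Sum>j\<in>grid \<epsilon> ` K. if j = grid \<epsilon> x then f x else 0)"
    using True by (intro sum.cong) (auto simp: grid_cell_def indicator_def)
  also have "\<dots> = f x" using True grid_finite[OF assms] by simp
  finally show ?thesis using True by simp
qed (auto simp: grid_cell_def indicator_def)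

text \<open>Rounding all values to multiples of \<tau> leaves finitely many patterns, and one of
  them occurs for infinitely many indices. Equal rounding means a distance of at most
  \<tau>.\<close>

lemma infinite_pigeonhole_close:
  fixes av :: "'j \<Rightarrow> nat \<Rightarrow> real"
  assumes "finite J" "infinite A" "\<And>j k. j \<in> J \<Longrightarrow> \<bar>av j k\<bar> \<le> \<Lambda>" "\<tau> > 0"
  shows "\<exists>A'\<subseteq>A. infinite A' \<and> (\<forall>m\<in>A'. \<forall>n\<in>A'. \<forall>j\<in>J. \<bar>av j m - av j n\<bar> \<le> \<tau>)"
proof -
  define g where "g k = restrict (\<lambda>j. \<lfloor>av j k / \<tau>\<rfloor>) J" for k
  define N where "N = \<lceil>\<Lambda> / \<tau>\<rceil> + 1"
  have "g ` A \<subseteq> PiE J (\<lambda>_. {-N..N})"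
  proof
    fix h assume "h \<in> g ` A"
    then obtain k where k: "h = g k" by blast
    have "\<lfloor>av j k / \<tau>\<rfloor> \<in> {-N..N}" if "j \<in> J" for j
    proof -
      have "\<bar>av j k / \<tau>\<bar> \<le> \<Lambda> / \<tau>" unfolding abs_divide using assms(3)[OF that, of k] assms(4) by (simp add: divide_right_mono)
      then have "\<bar>av j k / \<tau>\<bar> \<le> of_int \<lceil>\<Lambda> / \<tau>\<rceil>" using le_of_int_ceiling order_trans by blast
      then show ?thesis unfolding N_def by (rule floor_bounded)
    qed
    then show "h \<in> PiE J (\<lambda>_. {-N..N})" unfolding k g_def by auto
  qed
  then have "finite (g ` A)" by (rule finite_subset) (use assms(1) in \<open>auto intro: finite_PiE\<close>)
  then obtain a where a: "a \<in> A" "infinite {k \<in> A. g k = g a}" using pigeonhole_infinite[OF assms(2)] by blast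
  have "\<bar>av j m - av j n\<bar> \<le> \<tau>" if "g m = g a" "g n = g a" "j \<in> J" for m n j
  proof -
    have "\<lfloor>av j m / \<tau>\<rfloor> = \<lfloor>av j n / \<tau>\<rfloor>"
    proof -
      have "g m j = g n j" using that(1,2) by simp
      then show ?thesis using that(3) by (simp add: g_def)
    qed
    then have "\<bar>av j m / \<tau> - av j n / \<tau>\<bar> \<le> 1" by linarith
    then have "\<bar>(av j m - av j n) / \<tau>\<bar> \<le> 1" by (simp add: diff_divide_distrib)
    then show ?thesis using assms(4) by (simp add: abs_divide)
  qed
  then show ?thesis using a by (intro exI[of _ "{k \<in> A. g k = g a}"]) auto
qed

context riem_mfd
begin

text \<open>Both sides are quadratic in \<open>u\<close>, so compactness of \<open>K\<close> times
  the unit sphere suffices. With \<open>u\<close> the gradient, the left side is the Euclidean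
  length of the differential, which enters the Poincare inequality, and the right side its
  Riemannian length.\<close>

lemma metric_bound:
  assumes c: "c \<in> atlas M" and K: "compact K" "K \<subseteq> cimage c"
  shows "\<exists>C>0. \<forall>x\<in>K. \<forall>u. (norm (gmat M c (cinv c x) *v u))\<^sup>2 \<le> C * (u \<bullet> (gmat M c (cinv c x) *v u))"
proof (cases "K = {}")
  case True then show ?thesis by (intro exI[of _ 1]) auto
next
  case False
  let ?g = "\<lambda>x. gmat M c (cinv c x)" and ?S = "sphere (0 :: real^'n::_) 1"
  have cpt: "compact (K \<times> ?S)" using K(1) by (intro compact_Times) auto
  have ne: "K \<times> ?S \<noteq> {}" using False by auto
  have cg: "continuous_on (K \<times> ?S) (\<lambda>z. ?g (fst z))"
    by (rule continuous_on_compose2[OF gmat_continuous[OF c]]) (use K(2) in \<open>auto intro!: continuous_intros\<close>)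
  have c1: "continuous_on (K \<times> ?S) (\<lambda>z. ?g (fst z) *v snd z)"
    by (intro continuous_on_matrix_vector cg continuous_intros)
  have c2: "continuous_on (K \<times> ?S) (\<lambda>z. snd z \<bullet> (?g (fst z) *v snd z))" by (intro continuous_intros c1)
  have c3: "continuous_on (K \<times> ?S) (\<lambda>z. norm (?g (fst z) *v snd z))" by (intro continuous_intros c1)
  obtain z where z: "z \<in> K \<times> ?S" "\<And>y. y \<in> K \<times> ?S \<Longrightarrow> snd z \<bullet> (?g (fst z) *v snd z) \<le> snd y \<bullet> (?g (fst y) *v snd y)"
    using continuous_attains_inf[OF cpt ne c2] by blast
  obtain w where w: "w \<in> K \<times> ?S" "\<And>y. y \<in> K \<times> ?S \<Longrightarrow> norm (?g (fst y) *v snd y) \<le> norm (?g (fst w) *v snd w)"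
    using continuous_attains_sup[OF cpt ne c3] by blast
  \<comment> \<open>The least value of the quadratic form on unit vectors, compared with the largest
    norm \<beta> of the image; the 1 added to \<open>\<beta>^2\<close> below makes the constant
    positive.\<close>
  define \<alpha> where "\<alpha> = snd z \<bullet> (?g (fst z) *v snd z)"
  define \<beta> where "\<beta> = norm (?g (fst w) *v snd w)"
  have "fst z \<in> cimage c" "snd z \<noteq> 0" using z(1) K(2) by auto
  then have \<alpha>: "\<alpha> > 0" unfolding \<alpha>_def using gmat_pos[OF c chart_maps(3)[OF c]] by blast
  show ?thesis
  proof (intro exI[of _ "(\<beta>\<^sup>2 + 1) / \<alpha>"] conjI ballI allI)
    show "0 < (\<beta>\<^sup>2 + 1) / \<alpha>" using \<alpha> by (simp add: add_nonneg_pos)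
    fix x and u :: "real^'n::_" assume x: "x \<in> K"
    show "(norm (?g x *v u))\<^sup>2 \<le> (\<beta>\<^sup>2 + 1) / \<alpha> * (u \<bullet> (?g x *v u))"
    proof (cases "u = 0")
      case False
      define v where "v = (1 / norm u) *\<^sub>R u"
      have v: "(x, v) \<in> K \<times> ?S" using False x by (simp add: v_def)
      have uv: "u = norm u *\<^sub>R v" using False by (simp add: v_def)
      have "norm (?g x *v v) \<le> \<beta>" using w(2)[OF v] by (simp add: \<beta>_def)
      then have 1: "(norm (?g x *v v))\<^sup>2 \<le> \<beta>\<^sup>2" by (intro power_mono) auto
      have 2: "\<alpha> \<le> v \<bullet> (?g x *v v)" using z(2)[OF v] by (simp add: \<alpha>_def)
      have "(norm (?g x *v v))\<^sup>2 \<le> (\<beta>\<^sup>2 + 1) / \<alpha> * \<alpha>" using 1 \<alpha> by simp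
      also have "\<dots> \<le> (\<beta>\<^sup>2 + 1) / \<alpha> * (v \<bullet> (?g x *v v))" using 2 \<alpha> by (intro mult_left_mono) auto
      finally have 3: "(norm (?g x *v v))\<^sup>2 \<le> (\<beta>\<^sup>2 + 1) / \<alpha> * (v \<bullet> (?g x *v v))" .
      have "(norm u)\<^sup>2 * (norm (?g x *v v))\<^sup>2 \<le> (norm u)\<^sup>2 * ((\<beta>\<^sup>2 + 1) / \<alpha> * (v \<bullet> (?g x *v v)))"
        by (rule mult_left_mono[OF 3]) simp
      moreover have "?g x *v u = norm u *\<^sub>R (?g x *v v)" by (subst uv) (simp add: matrix_vector_mult_scaleR)
      moreover have "u \<bullet> (?g x *v u) = (norm u)\<^sup>2 * (v \<bullet> (?g x *v v))"
        by (subst (1 2) uv) (simp add: matrix_vector_mult_scaleR power2_eq_square)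
      ultimately show ?thesis by (simp add: power_mult_distrib mult_ac)
    qed simp
  qed
qed

lemma chart_integral_le:
  assumes c: "c \<in> atlas M" and K: "compact K" "K \<subseteq> cimage c" and a: "0 < a" "\<And>x. x \<in> K \<Longrightarrow> a \<le> rho c x"
    and F: "integrable vol F" "F \<in> borel_measurable borel" "\<And>p. 0 \<le> F p"
  shows "(\<integral>x. indicator K x * F (cinv c x) \<partial>lborel) \<le> (\<integral>p. F p \<partial>vol) / a"
proof (rule integral_real_bounded)
  have "ennreal a * (\<integral>\<^sup>+x. ennreal (indicator K x * F (cinv c x)) \<partial>lborel) = (\<integral>\<^sup>+x. ennreal a * ennreal (indicator K x * F (cinv c x)) \<partial>lborel)"
  proof (rule nn_integral_cmult[symmetric])
    have "(\<lambda>x. F (if x \<in> cimage c then cinv c x else undefined)) \<in> borel_measurable borel"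
      by (rule measurable_compose[OF cinv_measurable[OF c] F(2)])
    then have "(\<lambda>x. indicator K x * F (if x \<in> cimage c then cinv c x else undefined)) \<in> borel_measurable borel"
      using borel_compact[OF K(1)] by measurable
    also have "(\<lambda>x. indicator K x * F (if x \<in> cimage c then cinv c x else undefined)) = (\<lambda>x. indicator K x * F (cinv c x))"
      using K(2) by (auto simp: indicator_def fun_eq_iff)
    finally show "(\<lambda>x. ennreal (indicator K x * F (cinv c x))) \<in> borel_measurable lborel" by measurable
  qed
  also have "\<dots> \<le> (\<integral>\<^sup>+x. indicator (cimage c) x * ennreal (rho c x) * ennreal (F (cinv c x)) \<partial>lborel)"
    by (rule nn_integral_mono) (use a K(2) F(3) in \<open>auto simp: indicator_def intro!: mult_right_mono ennreal_leI\<close>)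
  also have "\<dots> = (\<integral>\<^sup>+p. indicator (fst c) p * ennreal (F p) \<partial>vol)"
    by (rule vol_nn[OF c, symmetric]) (use F(2) in measurable)
  also have "\<dots> \<le> (\<integral>\<^sup>+p. ennreal (F p) \<partial>vol)" by (rule nn_integral_mono) (simp add: indicator_def)
  also have "\<dots> = ennreal (\<integral>p. F p \<partial>vol)" by (rule nn_integral_eq_integral[OF F(1)]) (simp add: F(3))
  finally have "ennreal (1/a) * (ennreal a * (\<integral>\<^sup>+x. ennreal (indicator K x * F (cinv c x)) \<partial>lborel)) \<le> ennreal (1/a) * ennreal (\<integral>p. F p \<partial>vol)"
    by (rule mult_left_mono) simp
  then show "(\<integral>\<^sup>+x. ennreal (indicator K x * F (cinv c x)) \<partial>lborel) \<le> ennreal ((\<integral>p. F p \<partial>vol) / a)"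
    using a(1) F(3) by (simp add: mult.assoc[symmetric] ennreal_mult[symmetric])
  show "0 \<le> (\<integral>p. F p \<partial>vol) / a" using a(1) F(3) by simp
qed

text \<open>Finitely many averages over the cells of a grid control the local norm up to a small
  multiple of the energy: the Poincare constant of a cell is proportional to the square of its size.
  The neighbourhood comes before \<eta>, so refining the grid does not shrink it.\<close>

lemma local_averages:
  "\<exists>W. open W \<and> p \<in> W \<and> (\<forall>\<eta>>0. \<exists>J av C. finite (J :: ('n \<Rightarrow> int) set) \<and>
     (\<forall>\<phi>\<in>tests. \<forall>\<psi>\<in>tests. \<forall>j\<in>J. av j (\<lambda>p. \<phi> p - \<psi> p) = av j \<phi> - (av j \<psi> :: real)) \<and>
     (\<forall>\<phi>\<in>tests. \<forall>j\<in>J. (av j \<phi>)\<^sup>2 \<le> C * E.S.N2 \<phi>) \<and>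
     (\<forall>\<phi>\<in>tests. (\<integral>p. indicator W p * (\<phi> p)\<^sup>2 \<partial>vol) \<le> (\<Sum>j\<in>J. (av j \<phi>)\<^sup>2) + \<eta> * Q.N2 (Dt \<phi>)))"
proof -
  obtain c e where c: "c \<in> atlas M" "p \<in> fst c" and e: "e > 0" "cball (snd c p) e \<inter> half_space \<subseteq> cimage c"
    by (rule chart_ball)
  define K where "K = cball (snd c p) e \<inter> half_space"
  have Kc: "compact K" unfolding K_def using half_space_closed by (intro compact_Int_closed) auto
  have Kcv: "convex K" unfolding K_def by (intro convex_Int half_space_convex convex_cball)
  have Ks: "K \<subseteq> cimage c" using e(2) by (simp add: K_def)
  have Kh: "K \<subseteq> half_space" by (simp add: K_def)
  have Kb: "K \<in> sets borel" by (rule borel_compact[OF Kc])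
  have Kbd: "bounded K" by (rule compact_imp_bounded[OF Kc])
  obtain a b where ab: "0 < a" "0 < b" "\<And>x. x \<in> K \<Longrightarrow> a \<le> rho c x \<and> rho c x \<le> b"
    using rho_bounds[OF c(1) Kc Ks] by metis
  obtain C where C: "C > 0" "\<And>x u. x \<in> K \<Longrightarrow> (norm (gmat M c (cinv c x) *v u))\<^sup>2 \<le> C * (u \<bullet> (gmat M c (cinv c x) *v u))"
    using metric_bound[OF c(1) Kc Ks] by blast
  \<comment> \<open>The open ball is the neighbourhood; the closed half ball \<open>K\<close> around
    it is compact and convex, providing uniform bounds on the metric and cells that meet the
    boundary without harm.\<close>
  define W where "W = fst c \<inter> snd c -` ball (snd c p) e"
  have W: "open W" "p \<in> W" unfolding W_def using chart_preimage_open[OF c(1)] c e(1) by auto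
  define f where "f \<phi> x = \<phi> (cinv c x)" for \<phi> :: "'p \<Rightarrow> real" and x
  define d where "d \<phi> x = dcoord \<phi> c (cinv c x)" for \<phi> x
  have cf: "continuous_on K (f \<phi>)" if "\<phi> \<in> tests" for \<phi>
    unfolding f_def by (rule continuous_on_compose2[OF msmooth_continuous[OF testsD(1)[OF that]] continuous_on_subset[OF chart_maps(6)[OF c(1)] Ks]]) simp
  have cd: "continuous_on K (d \<phi>)" if "\<phi> \<in> tests" for \<phi>
    unfolding d_def
    by (rule continuous_on_compose2[OF dcoord_continuous[OF testsD(1)[OF that] c(1)] continuous_on_subset[OF chart_maps(6)[OF c(1)] Ks]])
      (use chart_maps(3)[OF c(1)] Ks in auto)
  have der: "(f \<phi> has_derivative (\<lambda>v. d \<phi> x \<bullet> v)) (at x within half_space)" if "\<phi> \<in> tests" "x \<in> K" for \<phi> x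
    using msmooth_derivative[OF testsD(1)[OF that(1)] c(1) chart_maps(3)[OF c(1)], of x] chart_maps(4)[OF c(1), of x] that(2) Ks
    by (auto simp: f_def[abs_def] d_def o_def)
  have bnd: "\<exists>B. \<forall>x\<in>K. \<bar>f \<phi> x\<bar> \<le> B \<and> norm (d \<phi> x) \<le> B" if \<phi>: "\<phi> \<in> tests" for \<phi>
  proof -
    obtain B1 where B1: "\<And>x. x \<in> K \<Longrightarrow> norm (f \<phi> x) \<le> B1"
      using compact_imp_bounded[OF compact_continuous_image[OF cf[OF \<phi>] Kc]] unfolding bounded_iff by auto
    obtain B2 where B2: "\<And>x. x \<in> K \<Longrightarrow> norm (d \<phi> x) \<le> B2"
      using compact_imp_bounded[OF compact_continuous_image[OF cd[OF \<phi>] Kc]] unfolding bounded_iff by auto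
    show ?thesis using B1 B2 by (intro exI[of _ "max B1 B2"]) (force simp: le_max_iff_disj)
  qed
  have dq: "(norm (d \<phi> x))\<^sup>2 \<le> C * qf (cinv c x) (Dt \<phi> (cinv c x)) (Dt \<phi> (cinv c x))" if "\<phi> \<in> tests" "x \<in> K" for \<phi> x
  proof -
    note s = testsD(1)[OF that(1)]
    have pc: "cinv c x \<in> fst c" using chart_maps(3)[OF c(1)] that(2) Ks by blast
    have "d \<phi> x = gmat M c (cinv c x) *v grad M \<phi> c (cinv c x)" unfolding d_def by (rule gmat_grad[OF c(1) pc, symmetric])
    then have "(norm (d \<phi> x))\<^sup>2 \<le> C * (grad M \<phi> c (cinv c x) \<bullet> (gmat M c (cinv c x) *v grad M \<phi> c (cinv c x)))"
      using C(2)[OF that(2)] by simp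
    then show ?thesis
      using vinner_chart[OF grad_vector_field[OF s] grad_vector_field[OF s] c(1) pc]
        vinner_qf[OF grad_vector_field[OF s] grad_vector_field[OF s], of "cinv c x"] by simp
  qed
  have KS: "(\<integral>x. indicator K x * (f \<phi> x)\<^sup>2 \<partial>lborel) \<le> E.S.N2 \<phi> / a" if "\<phi> \<in> tests" for \<phi>
    using chart_integral_le[OF c(1) Kc Ks ab(1), of "\<lambda>p. (\<phi> p)\<^sup>2"] ab(3) tests_sq_integrable[OF that] tests_measurable[OF that]
    by (simp add: f_def E.S.ip_def power2_eq_square)
  have KD: "(\<integral>x. indicator K x * (norm (d \<phi> x))\<^sup>2 \<partial>lborel) \<le> C * Q.N2 (Dt \<phi>) / a"
    if \<phi>: "\<phi> \<in> tests" and i: "integrable lborel (\<lambda>x. indicator K x * (norm (d \<phi> x))\<^sup>2)" for \<phi>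
  proof -
    let ?F = "\<lambda>p. C * qf p (Dt \<phi> p) (Dt \<phi> p)"
    have m: "Dt \<phi> \<in> borel_measurable borel" by (rule compo_measurable[OF grad_measurable_vfield[OF testsD(1)[OF \<phi>]]])
    have Fm: "?F \<in> borel_measurable borel" using qf_measurable[OF m m] by simp
    have F0: "0 \<le> ?F p" for p using C(1) Q.nonneg by simp
    have Fi: "integrable vol ?F" using Q.L2_integrable[OF Dt_L2[OF \<phi>] Dt_L2[OF \<phi>]] by simp
    have "continuous_on K (\<lambda>x. qf (cinv c x) (Dt \<phi> (cinv c x)) (Dt \<phi> (cinv c x)))"
      by (rule continuous_on_compose2[OF grad_norm_continuous[OF testsD(1)[OF \<phi>]] continuous_on_subset[OF chart_maps(6)[OF c(1)] Ks]]) simp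
    then have cF: "continuous_on K (\<lambda>x. ?F (cinv c x))" by (intro continuous_intros)
    have "set_integrable lborel K (\<lambda>x. ?F (cinv c x))" by (rule borel_integrable_compact[OF Kc cF, folded set_integrable_def])
    then have i2: "integrable lborel (\<lambda>x. indicator K x * ?F (cinv c x))" by (simp add: set_integrable_def)
    have "(\<integral>x. indicator K x * (norm (d \<phi> x))\<^sup>2 \<partial>lborel) \<le> (\<integral>x. indicator K x * ?F (cinv c x) \<partial>lborel)"
      by (rule integral_mono[OF i i2]) (use dq[OF \<phi>] in \<open>auto simp: indicator_def\<close>)
    also have "\<dots> \<le> (\<integral>p. ?F p \<partial>vol) / a"
      by (rule chart_integral_le[OF c(1) Kc Ks ab(1) _ Fi Fm F0]) (use ab(3) in blast)
    finally show ?thesis by (simp add: Q.ip_def)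
  qed
  have WK: "(\<integral>q. indicator W q * (\<phi> q)\<^sup>2 \<partial>vol) \<le> b * (\<integral>x. indicator K x * (f \<phi> x)\<^sup>2 \<partial>lborel)"
    if \<phi>: "\<phi> \<in> tests" and i: "integrable lborel (\<lambda>x. indicator K x * (f \<phi> x)\<^sup>2)" for \<phi>
  proof (rule integral_real_bounded)
    have m: "(\<lambda>q. ennreal (indicator W q * (\<phi> q)\<^sup>2)) \<in> borel_measurable borel"
    proof -
      have [measurable]: "W \<in> sets borel" "\<phi> \<in> borel_measurable borel" using W(1) tests_measurable[OF \<phi>] by auto
      show ?thesis by measurable
    qed
    have "(\<integral>\<^sup>+q. ennreal (indicator W q * (\<phi> q)\<^sup>2) \<partial>vol) = (\<integral>\<^sup>+q. indicator (fst c) q * ennreal (indicator W q * (\<phi> q)\<^sup>2) \<partial>vol)"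
      by (intro nn_integral_cong) (auto simp: indicator_def W_def)
    also have "\<dots> = (\<integral>\<^sup>+x. indicator (cimage c) x * ennreal (rho c x) * ennreal (indicator W (cinv c x) * (\<phi> (cinv c x))\<^sup>2) \<partial>lborel)"
      by (rule vol_nn[OF c(1) m])
    also have "\<dots> \<le> (\<integral>\<^sup>+x. ennreal (b * (indicator K x * (f \<phi> x)\<^sup>2)) \<partial>lborel)"
    proof (rule nn_integral_mono)
      fix x
      show "indicator (cimage c) x * ennreal (rho c x) * ennreal (indicator W (cinv c x) * (\<phi> (cinv c x))\<^sup>2) \<le> ennreal (b * (indicator K x * (f \<phi> x)\<^sup>2))"
      proof (cases "x \<in> cimage c \<and> cinv c x \<in> W")
        case True
        then have x: "x \<in> K" using chart_maps(4)[OF c(1)] cimage_half_space[OF c(1)] by (auto simp: W_def K_def)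
        have "ennreal (rho c x) * ennreal ((f \<phi> x)\<^sup>2) = ennreal (rho c x * (f \<phi> x)\<^sup>2)"
          using rho_nonneg[OF c(1)] True by (simp add: ennreal_mult)
        also have "\<dots> \<le> ennreal (b * (f \<phi> x)\<^sup>2)" using ab(3)[OF x] by (intro ennreal_leI mult_right_mono) auto
        finally show ?thesis using True x by (simp add: f_def)
      qed (auto simp: indicator_def)
    qed
    also have "\<dots> = ennreal (\<integral>x. b * (indicator K x * (f \<phi> x)\<^sup>2) \<partial>lborel)"
      by (rule nn_integral_eq_integral) (use i ab(2) in auto)
    finally show "(\<integral>\<^sup>+q. ennreal (indicator W q * (\<phi> q)\<^sup>2) \<partial>vol) \<le> ennreal (b * (\<integral>x. indicator K x * (f \<phi> x)\<^sup>2 \<partial>lborel))"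
      by simp
    show "0 \<le> b * (\<integral>x. indicator K x * (f \<phi> x)\<^sup>2 \<partial>lborel)" using ab(2) by simp
  qed
  show ?thesis
  proof (intro exI[of _ W] conjI W allI impI)
    fix \<eta> :: real assume \<eta>: "\<eta> > 0"
    let ?n = "real CARD('n)"
    \<comment> \<open>All constants of the estimate collected: density bounds \<open>b\<close> and
      \<open>a\<close>, the Poincare factor, the diameter of a cube and the comparison of norms. The
      grid size is then fixed by \<open>D0 * \<epsilon>^2 = \<eta>\<close>.\<close>
    define D0 where "D0 = b * 2 ^ CARD('n) * ?n\<^sup>2 * C / a"
    have D0: "D0 > 0" using ab C by (simp add: D0_def)
    define \<epsilon> where "\<epsilon> = sqrt (\<eta> / D0)"
    have \<epsilon>: "\<epsilon> > 0" "D0 * \<epsilon>\<^sup>2 = \<eta>" using D0 \<eta> by (auto simp: \<epsilon>_def)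
    define J where "J = grid \<epsilon> ` K"
    let ?P = "grid_cell \<epsilon> K"
    have J: "finite J" unfolding J_def by (rule grid_finite[OF Kbd])
    \<comment> \<open>Normalized so that the square is \<open>b\<close> times the mean term of the
      Poincare inequality. On a null cell the quotient, and with it the functional, is 0.\<close>
    define av where "av j \<phi> = sqrt (b / measure lborel (?P j)) * (\<integral>x. indicator (?P j) x * f \<phi> x \<partial>lborel)" for j \<phi>
    have PK: "?P j \<subseteq> K" for j by (auto simp: grid_cell_def)
    have poin: "(\<integral>x. indicator (?P j) x * (f \<phi> x)\<^sup>2 \<partial>lborel) \<le> (\<integral>x. indicator (?P j) x * f \<phi> x \<partial>lborel)\<^sup>2 / measure lborel (?P j)
        + 2 ^ CARD('n) * (?n * \<epsilon>)\<^sup>2 * (\<integral>x. indicator (?P j) x * (norm (d \<phi> x))\<^sup>2 \<partial>lborel)"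
      "(\<integral>x. indicator (?P j) x * f \<phi> x \<partial>lborel)\<^sup>2 \<le> measure lborel (?P j) * (\<integral>x. indicator (?P j) x * (f \<phi> x)\<^sup>2 \<partial>lborel)"
      "integrable lborel (\<lambda>x. indicator (?P j) x * f \<phi> x)"
      "integrable lborel (\<lambda>x. indicator (?P j) x * (f \<phi> x)\<^sup>2)"
      "integrable lborel (\<lambda>x. indicator (?P j) x * (norm (d \<phi> x))\<^sup>2)" if \<phi>: "\<phi> \<in> tests" for \<phi> j
    proof -
      obtain B where B: "\<And>x. x \<in> K \<Longrightarrow> \<bar>f \<phi> x\<bar> \<le> B" "\<And>x. x \<in> K \<Longrightarrow> norm (d \<phi> x) \<le> B" using bnd[OF \<phi>] by blast
      have dP: "(f \<phi> has_derivative (\<lambda>v. d \<phi> z \<bullet> v)) (at z within ?P j)" if "z \<in> ?P j" for z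
        by (rule has_derivative_subset[OF der[OF \<phi>]]) (use that PK Kh in auto)
      note pc = poincare_convex[OF grid_cell_convex[OF \<epsilon>(1) Kcv, of j] grid_cell_borel[OF \<epsilon>(1) Kb] bounded_subset[OF Kbd PK] dP
          continuous_on_subset[OF cd[OF \<phi>] PK] grid_cell_diam[OF \<epsilon>(1)] B(1)[OF subsetD[OF PK]] B(2)[OF subsetD[OF PK]]]
      show "(\<integral>x. indicator (?P j) x * (f \<phi> x)\<^sup>2 \<partial>lborel) \<le> (\<integral>x. indicator (?P j) x * f \<phi> x \<partial>lborel)\<^sup>2 / measure lborel (?P j)
          + 2 ^ CARD('n) * (?n * \<epsilon>)\<^sup>2 * (\<integral>x. indicator (?P j) x * (norm (d \<phi> x))\<^sup>2 \<partial>lborel)"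
        using pc(1) by simp
      show "(\<integral>x. indicator (?P j) x * f \<phi> x \<partial>lborel)\<^sup>2 \<le> measure lborel (?P j) * (\<integral>x. indicator (?P j) x * (f \<phi> x)\<^sup>2 \<partial>lborel)"
        by (rule pc(2))
      show "integrable lborel (\<lambda>x. indicator (?P j) x * f \<phi> x)" by (rule pc(3))
      show "integrable lborel (\<lambda>x. indicator (?P j) x * (f \<phi> x)\<^sup>2)" by (rule pc(4))
      show "integrable lborel (\<lambda>x. indicator (?P j) x * (norm (d \<phi> x))\<^sup>2)" by (rule pc(5))
    qed
    have dec: "integrable lborel (\<lambda>x. indicator K x * g x) \<and> (\<integral>x. indicator K x * g x \<partial>lborel) = (\<Sum>j\<in>J. \<integral>x. indicator (?P j) x * g x \<partial>lborel)"
      if "\<And>j. integrable lborel (\<lambda>x. indicator (?P j) x * g x)" for g :: "real^'n::_ \<Rightarrow> real"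
      unfolding grid_cell_indicator[OF Kbd, of _ g \<epsilon>] J_def[symmetric] using that by (simp add: Bochner_Integration.integral_sum)
    have l2: "(av j \<phi>)\<^sup>2 = b * ((\<integral>x. indicator (?P j) x * f \<phi> x \<partial>lborel)\<^sup>2 / measure lborel (?P j))" for j \<phi>
      unfolding av_def power_mult_distrib using ab(2) by (simp add: real_sqrt_pow2)
    show "\<exists>J av C. finite (J :: ('n \<Rightarrow> int) set) \<and>
     (\<forall>\<phi>\<in>tests. \<forall>\<psi>\<in>tests. \<forall>j\<in>J. av j (\<lambda>p. \<phi> p - \<psi> p) = av j \<phi> - (av j \<psi> :: real)) \<and>
     (\<forall>\<phi>\<in>tests. \<forall>j\<in>J. (av j \<phi>)\<^sup>2 \<le> C * E.S.N2 \<phi>) \<and>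
     (\<forall>\<phi>\<in>tests. (\<integral>p. indicator W p * (\<phi> p)\<^sup>2 \<partial>vol) \<le> (\<Sum>j\<in>J. (av j \<phi>)\<^sup>2) + \<eta> * Q.N2 (Dt \<phi>))"
    proof (intro exI[of _ J] exI[of _ av] exI[of _ "b / a"] conjI ballI J)
      fix \<phi> \<psi> j assume \<phi>: "\<phi> \<in> tests" and \<psi>: "\<psi> \<in> tests"
      have "(\<integral>x. indicator (?P j) x * f (\<lambda>p. \<phi> p - \<psi> p) x \<partial>lborel) = (\<integral>x. indicator (?P j) x * f \<phi> x - indicator (?P j) x * f \<psi> x \<partial>lborel)"
        by (intro Bochner_Integration.integral_cong) (auto simp: f_def algebra_simps)
      also have "\<dots> = (\<integral>x. indicator (?P j) x * f \<phi> x \<partial>lborel) - (\<integral>x. indicator (?P j) x * f \<psi> x \<partial>lborel)"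
        by (rule Bochner_Integration.integral_diff[OF poin(3)[OF \<phi>] poin(3)[OF \<psi>]])
      finally show "av j (\<lambda>p. \<phi> p - \<psi> p) = av j \<phi> - av j \<psi>" unfolding av_def by (simp add: right_diff_distrib)
    next
      fix \<phi> j assume \<phi>: "\<phi> \<in> tests" and "j \<in> J"
      have "(\<integral>x. indicator (?P j) x * f \<phi> x \<partial>lborel)\<^sup>2 / measure lborel (?P j) \<le> (\<integral>x. indicator (?P j) x * (f \<phi> x)\<^sup>2 \<partial>lborel)"
        using poin(2)[OF \<phi>, of j] measure_nonneg[of lborel "?P j"]
        by (cases "measure lborel (?P j) = 0") (auto simp: divide_le_eq mult.commute)
      also have "\<dots> \<le> (\<integral>x. indicator K x * (f \<phi> x)\<^sup>2 \<partial>lborel)"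
        using dec[OF poin(4)[OF \<phi>]] poin(4)[OF \<phi>] PK[of j] by (intro integral_mono) (auto simp: indicator_def)
      also have "\<dots> \<le> E.S.N2 \<phi> / a" by (rule KS[OF \<phi>])
      finally have "b * ((\<integral>x. indicator (?P j) x * f \<phi> x \<partial>lborel)\<^sup>2 / measure lborel (?P j)) \<le> b * (E.S.N2 \<phi> / a)"
        using ab(2) by (intro mult_left_mono) auto
      then show "(av j \<phi>)\<^sup>2 \<le> b / a * E.S.N2 \<phi>" unfolding l2 by simp
    next
      fix \<phi> assume \<phi>: "\<phi> \<in> tests"
      let ?k = "2 ^ CARD('n) * (?n * \<epsilon>)\<^sup>2"
      have "(\<integral>p. indicator W p * (\<phi> p)\<^sup>2 \<partial>vol) \<le> b * (\<integral>x. indicator K x * (f \<phi> x)\<^sup>2 \<partial>lborel)"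
        using WK[OF \<phi>] dec[OF poin(4)[OF \<phi>]] by blast
      also have "\<dots> = b * (\<Sum>j\<in>J. \<integral>x. indicator (?P j) x * (f \<phi> x)\<^sup>2 \<partial>lborel)" using dec[OF poin(4)[OF \<phi>]] by simp
      also have "\<dots> \<le> b * (\<Sum>j\<in>J. (\<integral>x. indicator (?P j) x * f \<phi> x \<partial>lborel)\<^sup>2 / measure lborel (?P j)
          + ?k * (\<integral>x. indicator (?P j) x * (norm (d \<phi> x))\<^sup>2 \<partial>lborel))"
        using ab(2) poin(1)[OF \<phi>] by (intro mult_left_mono sum_mono) auto
      also have "\<dots> = (\<Sum>j\<in>J. (av j \<phi>)\<^sup>2) + b * ?k * (\<Sum>j\<in>J. \<integral>x. indicator (?P j) x * (norm (d \<phi> x))\<^sup>2 \<partial>lborel)"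
        unfolding l2 by (simp add: sum.distrib sum_distrib_left algebra_simps)
      also have "(\<Sum>j\<in>J. \<integral>x. indicator (?P j) x * (norm (d \<phi> x))\<^sup>2 \<partial>lborel) = (\<integral>x. indicator K x * (norm (d \<phi> x))\<^sup>2 \<partial>lborel)"
        using dec[OF poin(5)[OF \<phi>]] by simp
      also have "(\<Sum>j\<in>J. (av j \<phi>)\<^sup>2) + b * ?k * (\<integral>x. indicator K x * (norm (d \<phi> x))\<^sup>2 \<partial>lborel)
          \<le> (\<Sum>j\<in>J. (av j \<phi>)\<^sup>2) + b * ?k * (C * Q.N2 (Dt \<phi>) / a)"
        using KD[OF \<phi>] dec[OF poin(5)[OF \<phi>]] ab(2) by (intro add_left_mono mult_left_mono) auto
      also have "b * ?k * (C * Q.N2 (Dt \<phi>) / a) = (D0 * \<epsilon>\<^sup>2) * Q.N2 (Dt \<phi>)"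
        by (simp add: D0_def power_mult_distrib)
      finally show "(\<integral>p. indicator W p * (\<phi> p)\<^sup>2 \<partial>vol) \<le> (\<Sum>j\<in>J. (av j \<phi>)\<^sup>2) + \<eta> * Q.N2 (Dt \<phi>)"
        unfolding \<epsilon>(2) .
    qed
  qed
qed

text \<open>Total boundedness in terms of index sets: any infinite set of indices can be thinned to
  one on which all members are close. In this form finite unions follow by thinning twice, and a
  diagonal choice by thinning repeatedly.\<close>

definition precompact_on :: "'p set \<Rightarrow> bool" where
  "precompact_on W \<longleftrightarrow> (\<forall>\<eta>>0. \<forall>B (\<phi> :: nat \<Rightarrow> 'p \<Rightarrow> real) A. infinite A \<longrightarrow>
     (\<forall>k. \<phi> k \<in> tests \<and> E.S.N2 (\<phi> k) + Q.N2 (Dt (\<phi> k)) \<le> B) \<longrightarrow>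
     (\<exists>A'\<subseteq>A. infinite A' \<and> (\<forall>m\<in>A'. \<forall>n\<in>A'. (\<integral>p. indicator W p * (\<phi> m p - \<phi> n p)\<^sup>2 \<partial>vol) \<le> \<eta>)))"

lemma local_precompact: "\<exists>W. open W \<and> p \<in> W \<and> precompact_on W"
proof -
  obtain W where W: "open W" "p \<in> W" and est: "\<And>\<eta>. \<eta> > 0 \<Longrightarrow> \<exists>J av C. finite (J :: ('n \<Rightarrow> int) set) \<and>
     (\<forall>\<phi>\<in>tests. \<forall>\<psi>\<in>tests. \<forall>j\<in>J. av j (\<lambda>p. \<phi> p - \<psi> p) = av j \<phi> - (av j \<psi> :: real)) \<and>
     (\<forall>\<phi>\<in>tests. \<forall>j\<in>J. (av j \<phi>)\<^sup>2 \<le> C * E.S.N2 \<phi>) \<and>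
     (\<forall>\<phi>\<in>tests. (\<integral>p. indicator W p * (\<phi> p)\<^sup>2 \<partial>vol) \<le> (\<Sum>j\<in>J. (av j \<phi>)\<^sup>2) + \<eta> * Q.N2 (Dt \<phi>))"
    using local_averages[of p] by blast
  have "precompact_on W"
    unfolding precompact_on_def
  proof (intro allI impI)
    fix \<eta> B :: real and \<phi> :: "nat \<Rightarrow> 'p \<Rightarrow> real" and A :: "nat set"
    assume \<eta>: "\<eta> > 0" and A: "infinite A" and "\<forall>k. \<phi> k \<in> tests \<and> E.S.N2 (\<phi> k) + Q.N2 (Dt (\<phi> k)) \<le> B"
    then have \<phi>: "\<And>k. \<phi> k \<in> tests" and bd: "\<And>k. E.S.N2 (\<phi> k) + Q.N2 (Dt (\<phi> k)) \<le> B" by auto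
    have SB: "E.S.N2 (\<phi> k) \<le> B" and DB: "Q.N2 (Dt (\<phi> k)) \<le> B" for k
      using bd[of k] E.S.N2_nonneg[of "\<phi> k"] Q.N2_nonneg[of "Dt (\<phi> k)"] by linarith+
    have B0: "0 \<le> B" using SB[of 0] E.S.N2_nonneg[of "\<phi> 0"] by linarith
    \<comment> \<open>The energy of a difference is at most \<open>4 * B\<close>, so its share of
      the estimate is at most \<open>\<eta> / 2\<close>.\<close>
    define \<eta>' where "\<eta>' = \<eta> / (8 * (B + 1))"
    have \<eta>': "\<eta>' > 0" using \<eta> B0 by (simp add: \<eta>'_def)
    obtain J :: "('n \<Rightarrow> int) set" and av :: "('n \<Rightarrow> int) \<Rightarrow> ('p \<Rightarrow> real) \<Rightarrow> real" and C where
      "finite J \<and> (\<forall>\<phi>\<in>tests. \<forall>\<psi>\<in>tests. \<forall>j\<in>J. av j (\<lambda>p. \<phi> p - \<psi> p) = av j \<phi> - av j \<psi>) \<and>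
       (\<forall>\<phi>\<in>tests. \<forall>j\<in>J. (av j \<phi>)\<^sup>2 \<le> C * E.S.N2 \<phi>) \<and>
       (\<forall>\<phi>\<in>tests. (\<integral>p. indicator W p * (\<phi> p)\<^sup>2 \<partial>vol) \<le> (\<Sum>j\<in>J. (av j \<phi>)\<^sup>2) + \<eta>' * Q.N2 (Dt \<phi>))"
      using est[OF \<eta>'] by (elim exE)
    then have J: "finite J" and lin: "\<And>\<phi> \<psi> j. \<phi> \<in> tests \<Longrightarrow> \<psi> \<in> tests \<Longrightarrow> j \<in> J \<Longrightarrow> av j (\<lambda>p. \<phi> p - \<psi> p) = av j \<phi> - av j \<psi>"
      and avb: "\<And>\<phi> j. \<phi> \<in> tests \<Longrightarrow> j \<in> J \<Longrightarrow> (av j \<phi>)\<^sup>2 \<le> C * E.S.N2 \<phi>"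
      and main: "\<And>\<phi>. \<phi> \<in> tests \<Longrightarrow> (\<integral>p. indicator W p * (\<phi> p)\<^sup>2 \<partial>vol) \<le> (\<Sum>j\<in>J. (av j \<phi>)\<^sup>2) + \<eta>' * Q.N2 (Dt \<phi>)"
      by simp_all
    \<comment> \<open>Makes the sum of \<open>card J\<close> squares at most
      \<open>\<eta> / 2\<close>; the 1 covers an empty \<open>J\<close>.\<close>
    define \<tau> where "\<tau> = sqrt (\<eta> / (2 * (real (card J) + 1)))"
    have \<tau>: "\<tau> > 0" "\<tau>\<^sup>2 = \<eta> / (2 * (real (card J) + 1))" using \<eta> by (auto simp: \<tau>_def add_nonneg_pos)
    have "\<bar>av j (\<phi> k)\<bar> \<le> sqrt (\<bar>C\<bar> * B)" if "j \<in> J" for j k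
    proof (rule real_le_rsqrt)
      have "\<bar>av j (\<phi> k)\<bar>\<^sup>2 \<le> C * E.S.N2 (\<phi> k)" using avb[OF \<phi> that] by simp
      also have "\<dots> \<le> \<bar>C\<bar> * B" using SB[of k] E.S.N2_nonneg[of "\<phi> k"] by (intro mult_mono) auto
      finally show "\<bar>av j (\<phi> k)\<bar>\<^sup>2 \<le> \<bar>C\<bar> * B" .
    qed
    from infinite_pigeonhole_close[where av = "\<lambda>j k. av j (\<phi> k)", OF J A this \<tau>(1)]
    obtain A' where A': "A' \<subseteq> A" "infinite A'" "\<And>m n j. m \<in> A' \<Longrightarrow> n \<in> A' \<Longrightarrow> j \<in> J \<Longrightarrow> \<bar>av j (\<phi> m) - av j (\<phi> n)\<bar> \<le> \<tau>" by blast
    have "(\<integral>p. indicator W p * (\<phi> m p - \<phi> n p)\<^sup>2 \<partial>vol) \<le> \<eta>" if mn: "m \<in> A'" "n \<in> A'" for m n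
    proof -
      let ?\<psi> = "\<lambda>p. \<phi> m p - \<phi> n p"
      have \<psi>: "?\<psi> \<in> tests" by (rule E.T_diff[OF \<phi> \<phi>])
      have "(\<Sum>j\<in>J. (av j ?\<psi>)\<^sup>2) \<le> (\<Sum>j\<in>J. \<tau>\<^sup>2)"
      proof (rule sum_mono)
        fix j assume j: "j \<in> J"
        have "\<bar>av j ?\<psi>\<bar> \<le> \<tau>" using lin[OF \<phi> \<phi> j] A'(3)[OF mn j] by simp
        then show "(av j ?\<psi>)\<^sup>2 \<le> \<tau>\<^sup>2" using power_mono[of "\<bar>av j ?\<psi>\<bar>" \<tau> 2] by simp
      qed
      also have "\<dots> = real (card J) * (\<eta> / (2 * (real (card J) + 1)))" using \<tau>(2) by simp
      also have "\<dots> \<le> \<eta> / 2" using \<eta> by (simp add: field_simps)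
      finally have 1: "(\<Sum>j\<in>J. (av j ?\<psi>)\<^sup>2) \<le> \<eta> / 2" .
      have "Q.N2 (Dt ?\<psi>) \<le> 4 * B"
        using Q.parallelogram[OF Dt_L2[OF \<phi>] Dt_L2[OF \<phi>], of m n] Q.N2_nonneg[of "\<lambda>p. Dt (\<phi> m) p + Dt (\<phi> n) p"] DB[of m] DB[of n]
        unfolding E.D_diff[OF \<phi> \<phi>] by linarith
      then have "\<eta>' * Q.N2 (Dt ?\<psi>) \<le> \<eta>' * (4 * (B + 1))" using \<eta>' by (intro mult_left_mono) auto
      also have "\<dots> = \<eta> / 2"
      proof -
        have "\<eta> / (8 * c) * (4 * c) = \<eta> / 2" if "c > 0" for c using that by (simp add: field_simps)
        from this[of "B + 1"] show ?thesis using B0 by (simp add: \<eta>'_def)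
      qed
      finally have 2: "\<eta>' * Q.N2 (Dt ?\<psi>) \<le> \<eta> / 2" .
      show ?thesis using main[OF \<psi>] 1 2 by linarith
    qed
    then show "\<exists>A'\<subseteq>A. infinite A' \<and> (\<forall>m\<in>A'. \<forall>n\<in>A'. (\<integral>p. indicator W p * (\<phi> m p - \<phi> n p)\<^sup>2 \<partial>vol) \<le> \<eta>)"
      using A'(1,2) by blast
  qed
  then show ?thesis using W by blast
qed

lemma precompact_Un:
  assumes "precompact_on V" "precompact_on W" "open V" "open W" shows "precompact_on (V \<union> W)"
  unfolding precompact_on_def
proof (intro allI impI)
  fix \<eta> B :: real and \<phi> :: "nat \<Rightarrow> 'p \<Rightarrow> real" and A :: "nat set"
  assume \<eta>: "\<eta> > 0" and A: "infinite A" and \<phi>: "\<forall>k. \<phi> k \<in> tests \<and> E.S.N2 (\<phi> k) + Q.N2 (Dt (\<phi> k)) \<le> B"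
  obtain A1 where A1: "A1 \<subseteq> A" "infinite A1" "\<And>m n. m \<in> A1 \<Longrightarrow> n \<in> A1 \<Longrightarrow> (\<integral>p. indicator V p * (\<phi> m p - \<phi> n p)\<^sup>2 \<partial>vol) \<le> \<eta> / 2"
    using assms(1)[unfolded precompact_on_def, rule_format, of "\<eta> / 2" A \<phi> B] \<eta> A \<phi> by auto
  obtain A2 where A2: "A2 \<subseteq> A1" "infinite A2" "\<And>m n. m \<in> A2 \<Longrightarrow> n \<in> A2 \<Longrightarrow> (\<integral>p. indicator W p * (\<phi> m p - \<phi> n p)\<^sup>2 \<partial>vol) \<le> \<eta> / 2"
    using assms(2)[unfolded precompact_on_def, rule_format, of "\<eta> / 2" A1 \<phi> B] \<eta> A1 \<phi> by auto
  have "(\<integral>p. indicator (V \<union> W) p * (\<phi> m p - \<phi> n p)\<^sup>2 \<partial>vol) \<le> \<eta>" if mn: "m \<in> A2" "n \<in> A2" for m n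
  proof -
    have i: "integrable vol (\<lambda>p. (\<phi> m p - \<phi> n p)\<^sup>2)" using tests_sq_integrable[OF E.T_diff] \<phi> by blast
    have iU: "integrable vol (\<lambda>p. indicator U p * (\<phi> m p - \<phi> n p)\<^sup>2)" if "open U" for U
      using integrable_real_mult_indicator[OF _ i, of U] that by (simp add: mult.commute)
    have "(\<integral>p. indicator (V \<union> W) p * (\<phi> m p - \<phi> n p)\<^sup>2 \<partial>vol)
      \<le> (\<integral>p. indicator V p * (\<phi> m p - \<phi> n p)\<^sup>2 + indicator W p * (\<phi> m p - \<phi> n p)\<^sup>2 \<partial>vol)"
      by (rule integral_mono[OF iU[OF open_Un[OF assms(3,4)]] Bochner_Integration.integrable_add[OF iU[OF assms(3)] iU[OF assms(4)]]])
        (auto simp: indicator_def)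
    also have "\<dots> = (\<integral>p. indicator V p * (\<phi> m p - \<phi> n p)\<^sup>2 \<partial>vol) + (\<integral>p. indicator W p * (\<phi> m p - \<phi> n p)\<^sup>2 \<partial>vol)"
      using iU assms(3,4) by simp
    also have "\<dots> \<le> \<eta> / 2 + \<eta> / 2" using A1(3)[of m n] A2 mn by (intro add_mono) auto
    finally show ?thesis by simp
  qed
  then show "\<exists>A'\<subseteq>A. infinite A' \<and> (\<forall>m\<in>A'. \<forall>n\<in>A'. (\<integral>p. indicator (V \<union> W) p * (\<phi> m p - \<phi> n p)\<^sup>2 \<partial>vol) \<le> \<eta>)"
    using A1 A2 by (intro exI[of _ A2]) auto
qed

lemma precompact_UNIV:
  assumes "compact (UNIV :: 'p set)" shows "precompact_on UNIV"
proof -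
  have "\<forall>p. \<exists>W. open W \<and> p \<in> W \<and> precompact_on W" using local_precompact by blast
  then obtain W where W: "\<And>p. open (W p)" "\<And>p. p \<in> W p" "\<And>p. precompact_on (W p)" by metis
  obtain F where F: "finite F" "UNIV \<subseteq> (\<Union>p\<in>F. W p)"
    by (rule compactE_image[OF assms, of UNIV W]) (use W in auto)
  have "precompact_on (\<Union>p\<in>F. W p)"
    using F(1)
  proof (induction F rule: finite_induct)
    case empty
    show ?case unfolding precompact_on_def by auto
  next
    case (insert p F)
    have "open (\<Union>p\<in>F. W p)" using W(1) by auto
    with insert show ?case using precompact_Un[OF W(3)[of p] insert.IH W(1)] by simp
  qed
  then show ?thesis using F(2) by (simp add: top.extremum_unique)
qed

text \<open>Nested infinite index sets of tolerance \<open>1 / (k + 1)\<close>, with an element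
  picked from each in increasing order, form the diagonal subsequence.\<close>

lemma rellich_compact:
  assumes "compact (UNIV :: 'p set)" shows E.rellich
  unfolding E.rellich_def
proof (intro allI impI)
  fix \<phi> :: "nat \<Rightarrow> 'p \<Rightarrow> real" and B :: real
  assume \<phi>: "\<forall>k. \<phi> k \<in> tests \<and> E.S.N2 (\<phi> k) + Q.N2 (Dt (\<phi> k)) \<le> B"
  let ?o = "\<lambda>m n. E.S.N2 (\<lambda>p. \<phi> m p - \<phi> n p)"
  have refine: "\<exists>A'\<subseteq>A. infinite A' \<and> (\<forall>m\<in>A'. \<forall>n\<in>A'. ?o m n \<le> \<eta>)" if "\<eta> > 0" "infinite A" for \<eta> A
    using precompact_UNIV[OF assms, unfolded precompact_on_def, rule_format, OF that(1,2), of \<phi> B] \<phi>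
    by (simp add: E.S.ip_def power2_eq_square)
  define P where "P k z = (case z of (A, n) \<Rightarrow> infinite A \<and> n \<in> A \<and> (\<forall>m\<in>A. \<forall>l\<in>A. ?o m l \<le> 1 / real (Suc k)))"
    for k :: nat and z :: "nat set \<times> nat"
  define R where "R z z' = (case z of (A, n) \<Rightarrow> case z' of (A', n') \<Rightarrow> A' \<subseteq> A \<and> n < n')" for z z' :: "nat set \<times> nat"
  have "\<exists>s. \<forall>k. P k (s k) \<and> R (s k) (s (Suc k))"
  proof (rule dependent_nat_choice)
    obtain A where A: "infinite A" "\<forall>m\<in>A. \<forall>l\<in>A. ?o m l \<le> 1" using refine[of 1 UNIV] by auto
    then obtain n where "n \<in> A" using infinite_imp_nonempty by blast
    then show "\<exists>z. P 0 z" using A by (intro exI[of _ "(A, n)"]) (simp add: P_def)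
    fix z and k :: nat assume z: "P k z"
    obtain A n where An: "z = (A, n)" by (cases z)
    obtain A' where A': "A' \<subseteq> A" "infinite A'" "\<forall>m\<in>A'. \<forall>l\<in>A'. ?o m l \<le> 1 / real (Suc (Suc k))"
      using refine[of "1 / real (Suc (Suc k))" A] z An by (auto simp: P_def)
    obtain n' where "n' \<in> A'" "n < n'" using A'(2) infinite_nat_iff_unbounded by blast
    then show "\<exists>z'. P (Suc k) z' \<and> R z z'" using A' An by (intro exI[of _ "(A', n')"]) (simp add: P_def R_def)
  qed
  then obtain s where s: "\<And>k. P k (s k)" "\<And>k. R (s k) (s (Suc k))" by blast
  define r where "r k = snd (s k)" for k
  have "r k < r (Suc k)" for k using s(2)[of k] by (auto simp: R_def r_def split: prod.splits)
  then have r: "strict_mono r" by (simp add: strict_mono_Suc_iff)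
  have "fst (s (Suc k)) \<subseteq> fst (s k)" for k using s(2)[of k] by (cases "s k"; cases "s (Suc k)") (simp add: R_def)
  then have anti: "fst (s m) \<subseteq> fst (s k)" if "k \<le> m" for k m
    using lift_Suc_antimono_le[of "\<lambda>k. fst (s k)"] that by blast
  have mem: "r m \<in> fst (s k)" if "k \<le> m" for k m
    using s(1)[of m] anti[OF that] by (auto simp: P_def r_def split: prod.splits)
  have "\<exists>n0. \<forall>m\<ge>n0. \<forall>n\<ge>n0. ?o (r m) (r n) \<le> e" if e: "e > 0" for e
  proof -
    obtain k where k: "inverse (real (Suc k)) < e" using reals_Archimedean[OF e] by blast
    have "?o (r m) (r n) \<le> e" if "m \<ge> k" "n \<ge> k" for m n
    proof -
      have "?o (r m) (r n) \<le> 1 / real (Suc k)"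
        using s(1)[of k] mem[OF that(1)] mem[OF that(2)] by (auto simp: P_def split: prod.splits)
      then show ?thesis using k by (simp add: inverse_eq_divide)
    qed
    then show ?thesis by blast
  qed
  then show "\<exists>r::nat\<Rightarrow>nat. strict_mono r \<and> (\<forall>e>0. \<exists>n0. \<forall>m\<ge>n0. \<forall>n\<ge>n0. ?o (r m) (r n) \<le> e)" using r by blast
qed

section \<open>Comparison of the fundamental tone with vector fields\<close>

lemma measurable_vol [simp]: "borel_measurable vol = borel_measurable borel"
  by (rule measurable_cong_sets[OF sets_vol refl])

lemma vnorm_integral: "vector_field M X \<Longrightarrow> (\<integral>p. (vnorm M X p)\<^sup>2 \<partial>vol) = Q.N2 (compo X)"
  unfolding Q.ip_def by (simp add: vnorm_qf)

lemma compo_diff: "compo (\<lambda>c q. X c q - Y c q) = (\<lambda>p. compo X p - compo Y p)"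
  by (simp add: compo_def fun_eq_iff)

lemma vector_field_diff:
  assumes "vector_field M X" "vector_field M Y" shows "vector_field M (\<lambda>c q. X c q - Y c q)"
  unfolding vector_field_def
proof (intro ballI)
  fix c c' p assume c: "c \<in> atlas M" "c' \<in> atlas M" and "p \<in> fst c \<inter> fst c'"
  then have p: "p \<in> fst c" "p \<in> fst c'" by auto
  show "X c' p - Y c' p = jacobian c c' p *v (X c p - Y c p)"
    unfolding vector_fieldD[OF assms(1) c p] vector_fieldD[OF assms(2) c p] by (rule matrix_vector_mult_diff_distrib[symmetric])
qed

lemma sobolev_distance:
  fixes \<phi> :: "nat \<Rightarrow> 'p \<Rightarrow> real"
  assumes "vector_field M V" "\<And>k. \<phi> k \<in> tests"
  shows "(\<lambda>k. (\<integral>p. (f p - \<phi> k p)\<^sup>2 \<partial>vol) + (\<integral>p. (vnorm M (\<lambda>c q. V c q - grad M (\<phi> k) c q) p)\<^sup>2 \<partial>vol))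
     = (\<lambda>k. E.S.N2 (\<lambda>p. \<phi> k p - f p) + Q.N2 (\<lambda>p. Dt (\<phi> k) p - compo V p))"
proof
  fix k :: nat
  have "(\<integral>p. (vnorm M (\<lambda>c q. V c q - grad M (\<phi> k) c q) p)\<^sup>2 \<partial>vol) = Q.N2 (\<lambda>p. compo V p - Dt (\<phi> k) p)"
    using vnorm_integral[OF vector_field_diff[OF assms(1) grad_vector_field[OF testsD(1)[OF assms(2)]]]] by (simp add: compo_diff)
  also have "\<dots> = Q.N2 (\<lambda>p. Dt (\<phi> k) p - compo V p)"
    unfolding Q.ip_def by (intro Bochner_Integration.integral_cong) (auto simp: Q.q_simps)
  finally show "(\<integral>p. (f p - \<phi> k p)\<^sup>2 \<partial>vol) + (\<integral>p. (vnorm M (\<lambda>c q. V c q - grad M (\<phi> k) c q) p)\<^sup>2 \<partial>vol)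
     = E.S.N2 (\<lambda>p. \<phi> k p - f p) + Q.N2 (\<lambda>p. Dt (\<phi> k) p - compo V p)"
    unfolding E.S.ip_def by (simp add: power2_eq_square algebra_simps)
qed

lemma sobolev0D:
  assumes "sobolev0 M f V"
  shows "\<exists>\<phi>. E.hconv \<phi> f (compo V)" and "vector_field M V"
proof -
  obtain \<phi> where f: "f \<in> borel_measurable borel" "integrable vol (\<lambda>p. (f p)\<^sup>2)" and V: "measurable_vfield M V" "integrable vol (\<lambda>p. (vnorm M V p)\<^sup>2)"
    and \<phi>: "\<And>k. \<phi> k \<in> tests" and lim: "(\<lambda>k. (\<integral>p. (f p - \<phi> k p)\<^sup>2 \<partial>vol) + (\<integral>p. (vnorm M (\<lambda>c q. V c q - grad M (\<phi> k) c q) p)\<^sup>2 \<partial>vol)) \<longlonglongrightarrow> 0"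
    using assms unfolding sobolev0_def by blast
  show vf: "vector_field M V" using V(1) by (simp add: measurable_vfield_def)
  have 1: "f \<in> E.S.L2" using f by (simp add: E.S.L2_def power2_eq_square)
  have 2: "compo V \<in> Q.L2" using V(2) compo_measurable[OF V(1)] by (simp add: Q.L2_def vnorm_qf[OF vf])
  have lim': "(\<lambda>k. E.S.N2 (\<lambda>p. \<phi> k p - f p) + Q.N2 (\<lambda>p. Dt (\<phi> k) p - compo V p)) \<longlonglongrightarrow> 0"
    using lim sobolev_distance[where \<phi> = \<phi> and f = f, OF vf \<phi>] by (rule back_subst)
  have 3: "(\<lambda>k. E.S.N2 (\<lambda>p. \<phi> k p - f p)) \<longlonglongrightarrow> 0"
    by (rule tendsto_sandwich[OF _ _ tendsto_const lim']) (auto simp: E.S.N2_nonneg Q.N2_nonneg)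
  have 4: "(\<lambda>k. Q.N2 (\<lambda>p. Dt (\<phi> k) p - compo V p)) \<longlonglongrightarrow> 0"
    by (rule tendsto_sandwich[OF _ _ tendsto_const lim']) (auto simp: E.S.N2_nonneg Q.N2_nonneg)
  show "\<exists>\<phi>. E.hconv \<phi> f (compo V)" unfolding E.hconv_def using 1 2 3 4 \<phi> by blast
qed

lemma sobolev0I:
  assumes h: "E.hconv \<phi> f U" shows "sobolev0 M f (of_compo U)"
proof -
  note h' = E.hconvD[OF h]
  have U: "U \<in> borel_measurable borel" using h'(3) by (simp add: Q.L2_def)
  have "(\<lambda>k. E.S.N2 (\<lambda>p. \<phi> k p - f p) + Q.N2 (\<lambda>p. Dt (\<phi> k) p - compo (of_compo U) p)) \<longlonglongrightarrow> 0"
    using tendsto_add[OF h'(6,7)] by (simp add: compo_of_compo)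
  then have "(\<lambda>k. (\<integral>p. (f p - \<phi> k p)\<^sup>2 \<partial>vol) + (\<integral>p. (vnorm M (\<lambda>c q. of_compo U c q - grad M (\<phi> k) c q) p)\<^sup>2 \<partial>vol)) \<longlonglongrightarrow> 0"
    using sobolev_distance[where \<phi> = \<phi> and f = f, OF of_compo_vector_field h'(1), symmetric] by (rule back_subst)
  then show ?thesis
    unfolding sobolev0_def using h'(1,2,3) of_compo_measurable[OF U]
    by (auto simp: E.S.L2_def Q.L2_def power2_eq_square vnorm_qf[OF of_compo_vector_field, unfolded power2_eq_square] compo_of_compo)
qed

lemma test_mult_L1_loc:
  assumes \<phi>: "\<phi> \<in> tests" and h: "h \<in> L1_loc M" shows "integrable vol (\<lambda>p. \<phi> p * h p)"
proof -
  obtain B where B: "\<And>p. \<bar>\<phi> p\<bar> \<le> B" using tests_bounded[OF \<phi>] by blast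
  have hm[measurable]: "h \<in> borel_measurable borel" using h by (simp add: L1_loc_def)
  have [measurable]: "\<phi> \<in> borel_measurable borel" by (rule tests_measurable[OF \<phi>])
  have "set_integrable vol (csupp \<phi>) h" using h testsD(2,3)[OF \<phi>] by (auto simp: L1_loc_def)
  then have i: "integrable vol (\<lambda>p. B * \<bar>indicator (csupp \<phi>) p * h p\<bar>)" by (auto simp: set_integrable_def)
  show ?thesis
  proof (rule Bochner_Integration.integrable_bound[OF i])
    show "(\<lambda>p. \<phi> p * h p) \<in> borel_measurable vol" by simp
    show "AE p in vol. norm (\<phi> p * h p) \<le> norm (B * \<bar>indicator (csupp \<phi>) p * h p\<bar>)"
    proof (rule AE_I2)
      fix p
      have "0 \<le> B" using B[of p] by linarith
      have "\<bar>\<phi> p\<bar> \<le> B * indicator (csupp \<phi>) p"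
        using B[of p] closure_subset[of "{p. \<phi> p \<noteq> 0}"] by (auto simp: indicator_def)
      then have "\<bar>\<phi> p\<bar> * \<bar>h p\<bar> \<le> B * indicator (csupp \<phi>) p * \<bar>h p\<bar>" by (intro mult_right_mono) auto
      then show "norm (\<phi> p * h p) \<le> norm (B * \<bar>indicator (csupp \<phi>) p * h p\<bar>)"
        using \<open>0 \<le> B\<close> by (simp add: abs_mult mult.assoc)
    qed
  qed
qed

lemma integrable_L1_loc:
  assumes "h \<in> borel_measurable borel" "integrable vol h" shows "h \<in> L1_loc M"
  unfolding L1_loc_def
proof (intro CollectI conjI allI impI)
  fix K :: "'p set" assume "compact K \<and> K \<subseteq> mfd_interior M"
  then have "compact K" by blast
  then have "K \<in> sets vol" unfolding sets_vol by (rule borel_compact)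
  from integrable_mult_indicator[OF this assms(2)] show "set_integrable vol K h" by (simp add: set_integrable_def)
qed (rule assms(1))

text \<open>\<open>Div\<close> is a choice among weak divergences. Uniqueness up to null sets is
  what allows the divergence of a constructed field to be replaced by the function it was built
  with.\<close>

lemma weak_div_unique:
  assumes 1: "has_weak_div M X h1" and 2: "has_weak_div M X h2" shows "AE p in vol. h1 p = h2 p"
proof -
  have L: "h1 \<in> L1_loc M" "h2 \<in> L1_loc M" using 1 2 by (auto simp: has_weak_div_def)
  have "AE p in vol. h1 p - h2 p = 0"
  proof (rule fundamental_lemma)
    show "(\<lambda>p. h1 p - h2 p) \<in> L1_loc M"
      using L unfolding L1_loc_def set_integrable_def by (auto simp: right_diff_distrib)
    fix \<phi> assume \<phi>: "\<phi> \<in> tests"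
    have "(\<integral>p. \<phi> p * (h1 p - h2 p) \<partial>vol) = (\<integral>p. \<phi> p * h1 p \<partial>vol) - (\<integral>p. \<phi> p * h2 p \<partial>vol)"
      using test_mult_L1_loc[OF \<phi>] L by (simp add: right_diff_distrib)
    also have "\<dots> = 0" using 1 2 \<phi> by (simp add: has_weak_div_def)
    finally show "(\<integral>p. \<phi> p * (h1 p - h2 p) \<partial>vol) = 0" .
  qed
  then show ?thesis by eventually_elim simp
qed

lemma Div_weak_div: "X \<in> W11 M \<Longrightarrow> has_weak_div M X (Div M X)"
  unfolding W11_def Div_def using someI_ex[of "has_weak_div M X"] by blast

lemma lower_bound:
  assumes X: "has_weak_div M X h" and r: "AE p in vol. r \<le> h p - (vnorm M X p)\<^sup>2" and \<phi>: "\<phi> \<in> tests"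
  shows "r * E.S.N2 \<phi> \<le> Q.N2 (Dt \<phi>)"
proof -
  have XL: "measurable_vfield M X" and h: "h \<in> L1_loc M" using X by (auto simp: has_weak_div_def L1_loc_vfield_def)
  then have vf: "vector_field M X" by (simp add: measurable_vfield_def)
  note s = testsD(1)[OF \<phi>]
  define x where "x p = qf p (compo X p) (compo X p)" for p
  have xm[measurable]: "x \<in> borel_measurable borel" unfolding x_def by (intro qf_measurable compo_measurable XL)
  have x0: "0 \<le> x p" for p unfolding x_def by (rule Q.nonneg)
  have rx: "AE p in vol. r \<le> h p - x p" using r by (simp add: vnorm_qf[OF vf] x_def)
  have hm[measurable]: "h \<in> borel_measurable borel" using h by (simp add: L1_loc_def)
  have \<phi>m[measurable]: "\<phi> \<in> borel_measurable borel" by (rule tests_measurable[OF \<phi>])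
  let ?\<psi> = "\<lambda>p. \<phi> p * \<phi> p"
  have \<psi>: "?\<psi> \<in> tests" by (rule tests_mult[OF \<phi> s])
  have D\<psi>: "Dt ?\<psi> p = (2 * \<phi> p) *\<^sub>R Dt \<phi> p" for p
  proof -
    have "Dt ?\<psi> = (\<lambda>p. \<phi> p *\<^sub>R Dt \<phi> p + (\<phi> p * 1) *\<^sub>R Dt \<phi> p)"
      by (rule E.D_mult_comp[OF \<phi> \<phi> ck_id[OF open_UNIV]]) simp
    then show ?thesis by (simp only: mult_2 scaleR_add_left mult_1_right)
  qed
  have ih: "integrable vol (\<lambda>p. ?\<psi> p * h p)" by (rule test_mult_L1_loc[OF \<psi> h])
  have isq: "integrable vol ?\<psi>" using tests_sq_integrable[OF \<phi>] by (simp add: power2_eq_square)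
  \<comment> \<open>\<open>X\<close> is only locally integrable, so its squared length might not be.
    The lower bound on the divergence supplies this: the squared length is at most
    \<open>h - r\<close>, and \<open>h\<close> is integrable against test functions.\<close>
  have ix: "integrable vol (\<lambda>p. ?\<psi> p * x p)"
  proof (rule Bochner_Integration.integrable_bound)
    show "integrable vol (\<lambda>p. ?\<psi> p * h p - r * ?\<psi> p)" using ih isq by auto
    show "AE p in vol. norm (?\<psi> p * x p) \<le> norm (?\<psi> p * h p - r * ?\<psi> p)"
      using rx
    proof eventually_elim
      case (elim p)
      then have "x p \<le> h p - r" by simp
      then have "?\<psi> p * x p \<le> ?\<psi> p * (h p - r)" by (intro mult_left_mono) auto
      moreover have "0 \<le> ?\<psi> p * x p" using x0 by simp
      ultimately show ?case by (simp add: algebra_simps)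
    qed
  qed simp
  let ?g = "\<lambda>p. qf p (Dt \<phi> p) (Dt \<phi> p)" and ?m = "\<lambda>p. qf p (Dt ?\<psi> p) (compo X p)"
  have ig: "integrable vol ?g" by (rule Q.L2_integrable[OF Dt_L2[OF \<phi>] Dt_L2[OF \<phi>]])
  have mm: "?m p = 2 * qf p (Dt \<phi> p) (\<phi> p *\<^sub>R compo X p)" for p unfolding D\<psi> by (simp add: Q.q_simps)
  have px: "qf p (\<phi> p *\<^sub>R compo X p) (\<phi> p *\<^sub>R compo X p) = ?\<psi> p * x p" for p by (simp add: Q.q_simps x_def)
  have ym: "\<bar>?m p\<bar> \<le> ?g p + ?\<psi> p * x p" for p
    using Q.young[of p "Dt \<phi> p" "\<phi> p *\<^sub>R compo X p"] unfolding mm px by simp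
  have im: "integrable vol ?m"
  proof (rule Bochner_Integration.integrable_bound)
    show "integrable vol (\<lambda>p. ?g p + ?\<psi> p * x p)" using ig ix by simp
    show "?m \<in> borel_measurable vol"
      unfolding measurable_vol by (intro qf_measurable compo_measurable XL grad_measurable_vfield testsD(1)[OF \<psi>])
    show "AE p in vol. norm (?m p) \<le> norm (?g p + ?\<psi> p * x p)"
      by (intro AE_I2) (use ym in \<open>simp add: order_trans[OF ym abs_ge_self]\<close>)
  qed
  have "(\<integral>p. ?\<psi> p * h p \<partial>vol) = - (\<integral>p. vinner M (grad M ?\<psi>) X p \<partial>vol)" using X \<psi> by (simp add: has_weak_div_def)
  also have "(\<integral>p. vinner M (grad M ?\<psi>) X p \<partial>vol) = (\<integral>p. ?m p \<partial>vol)"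
    using vinner_qf[OF grad_vector_field[OF testsD(1)[OF \<psi>]] vf] by simp
  finally have wd: "(\<integral>p. ?\<psi> p * h p \<partial>vol) = - (\<integral>p. ?m p \<partial>vol)" .
  have "r * (\<integral>p. ?\<psi> p \<partial>vol) = (\<integral>p. r * ?\<psi> p \<partial>vol)" by simp
  also have "\<dots> \<le> (\<integral>p. ?\<psi> p * h p - ?\<psi> p * x p \<partial>vol)"
  proof (rule integral_mono_AE)
    show "AE p in vol. r * ?\<psi> p \<le> ?\<psi> p * h p - ?\<psi> p * x p"
      using rx
    proof eventually_elim
      case (elim p)
      have "?\<psi> p * r \<le> ?\<psi> p * (h p - x p)" by (rule mult_left_mono[OF elim]) simp
      then show ?case by (simp add: algebra_simps)
    qed
  qed (use isq ih ix in auto)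
  also have "\<dots> = - (\<integral>p. ?m p \<partial>vol) - (\<integral>p. ?\<psi> p * x p \<partial>vol)" using ih ix wd by simp
  also have "\<dots> = (\<integral>p. - ?m p - ?\<psi> p * x p \<partial>vol)" using im ix by simp
  also have "\<dots> \<le> (\<integral>p. ?g p \<partial>vol)"
  proof (rule integral_mono)
    fix p show "- ?m p - ?\<psi> p * x p \<le> ?g p" using ym[of p] by linarith
  qed (use im ix ig in auto)
  finally show ?thesis by (simp add: E.S.ip_def Q.ip_def)
qed

lemma AE_essinf: "AE p in vol. essinf vol f \<le> ereal (f p)"
proof -
  have "AE p in vol. - ereal (f p) \<le> esssup vol (\<lambda>x. - ereal (f x))" by (rule esssup_AE)
  then show ?thesis unfolding essinf_def by eventually_elim (metis ereal_minus_le_minus ereal_uminus_uminus)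
qed

lemma lower_bound_essinf:
  assumes X: "X \<in> W11 M" and r: "ereal r < essinf vol (\<lambda>p. Div M X p - (vnorm M X p)\<^sup>2)" and \<phi>: "\<phi> \<in> tests"
  shows "r * E.S.N2 \<phi> \<le> Q.N2 (Dt \<phi>)"
proof (rule lower_bound[OF Div_weak_div[OF X] _ \<phi>])
  show "AE p in vol. r \<le> Div M X p - (vnorm M X p)\<^sup>2"
    using AE_essinf[of "\<lambda>p. Div M X p - (vnorm M X p)\<^sup>2"]
  proof eventually_elim
    case (elim p)
    from order_trans[OF less_imp_le[OF r] elim] show ?case by simp
  qed
qed

lemma tone_ge:
  assumes r: "\<And>\<phi>. \<phi> \<in> tests \<Longrightarrow> r * E.S.N2 \<phi> \<le> Q.N2 (Dt \<phi>)"
  shows "ereal r \<le> fundamental_tone M"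
  unfolding fundamental_tone_def
proof (rule Inf_greatest)
  fix z assume "z \<in> {ereal ((\<integral>p. (vnorm M V p)\<^sup>2 \<partial>vol) / (\<integral>p. (f p)\<^sup>2 \<partial>vol)) | f V.
       sobolev0 M f V \<and> \<not> (AE p in vol. f p = 0)}"
  then obtain f V where z: "z = ereal ((\<integral>p. (vnorm M V p)\<^sup>2 \<partial>vol) / (\<integral>p. (f p)\<^sup>2 \<partial>vol))"
    and s: "sobolev0 M f V" and nz: "\<not> (AE p in vol. f p = 0)" by blast
  obtain \<phi> where h: "E.hconv \<phi> f (compo V)" using sobolev0D(1)[OF s] by blast
  note h' = E.hconvD[OF h]
  have "r * E.S.N2 f \<le> Q.N2 (compo V)"
    by (rule LIMSEQ_le[OF tendsto_mult_left[OF h'(8)] h'(9)]) (use r h'(1) in auto)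
  moreover have "E.S.N2 f > 0"
  proof -
    have "E.S.N2 f \<noteq> 0"
    proof
      assume "E.S.N2 f = 0"
      then have "AE p in vol. f p * f p = 0"
        using integral_nonneg_eq_0_iff_AE[OF E.S.L2_integrable[OF h'(2) h'(2)]] by (simp add: E.S.ip_def)
      then have "AE p in vol. f p = 0" by eventually_elim simp
      then show False using nz by simp
    qed
    then show ?thesis using E.S.N2_nonneg[of f] by linarith
  qed
  ultimately have "r \<le> Q.N2 (compo V) / E.S.N2 f" by (simp add: field_simps)
  then show "ereal r \<le> z" unfolding z vnorm_integral[OF sobolev0D(2)[OF s]] by (simp add: E.S.ip_def power2_eq_square)
qed

text \<open>Finite volume turns square integrability into integrability, by
  \<open>sqrt a \<le> 1 + a\<close>, which places the field in the class for which weak divergences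
  are defined.\<close>

lemma weak_divI:
  assumes U: "U \<in> Q.L2" and fin: "finite_measure vol" and h: "h \<in> borel_measurable borel" "integrable vol h"
    and eq: "\<And>\<phi>. \<phi> \<in> tests \<Longrightarrow> (\<integral>p. \<phi> p * h p \<partial>vol) = - Q.ip (Dt \<phi>) U"
  shows "has_weak_div M (of_compo U) h"
proof -
  interpret finite_measure vol by fact
  have Um: "U \<in> borel_measurable borel" using U by (simp add: Q.L2_def)
  have vn: "vnorm M (of_compo U) p = sqrt (qf p (U p) (U p))" for p
    unfolding vnorm_def vinner_qf[OF of_compo_vector_field of_compo_vector_field] compo_of_compo ..
  have vm: "vnorm M (of_compo U) \<in> borel_measurable borel"
    unfolding vn[abs_def] using qf_measurable[OF Um Um] by measurable
  have "integrable vol (vnorm M (of_compo U))"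
  proof (rule Bochner_Integration.integrable_bound)
    show "integrable vol (\<lambda>p. 1 + qf p (U p) (U p))" using Q.L2_integrable[OF U U] by simp
    have "sqrt a \<le> 1 + a" if "a \<ge> 0" for a
      using that by (intro real_le_lsqrt) (auto simp: power2_eq_square algebra_simps)
    then show "AE p in vol. norm (vnorm M (of_compo U) p) \<le> norm (1 + qf p (U p) (U p))"
      unfolding vn using Q.nonneg by (intro AE_I2) (simp add: abs_of_nonneg)
  qed (use vm in simp)
  then have "of_compo U \<in> L1_loc_vfield M"
    unfolding L1_loc_vfield_def using of_compo_measurable[OF Um] integrable_L1_loc[OF vm] by simp
  moreover have "(\<integral>p. vinner M (grad M \<phi>) (of_compo U) p \<partial>vol) = Q.ip (Dt \<phi>) U" if "\<phi> \<in> tests" for \<phi>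
    unfolding Q.ip_def using vinner_qf[OF grad_vector_field[OF testsD(1)[OF that]] of_compo_vector_field] by (simp add: compo_of_compo)
  ultimately show ?thesis unfolding has_weak_div_def using integrable_L1_loc[OF h] eq by simp
qed

lemma essinf_ge:
  assumes "f \<in> borel_measurable borel" "AE p in vol. r \<le> f p" shows "ereal r \<le> essinf vol f"
proof -
  have "esssup vol (\<lambda>x. - ereal (f x)) \<le> - ereal r"
    by (rule esssup_I) (use assms in auto)
  then show ?thesis unfolding essinf_def by (metis ereal_minus_le_minus ereal_uminus_uminus)
qed

lemma Div_essinf_ge:
  assumes wd: "has_weak_div M (of_compo U) h" and r: "AE p in vol. r \<le> h p - qf p (U p) (U p)"
  shows "of_compo U \<in> W11 M" and "ereal r \<le> essinf vol (\<lambda>p. Div M (of_compo U) p - (vnorm M (of_compo U) p)\<^sup>2)"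
proof -
  show W: "of_compo U \<in> W11 M" using wd unfolding W11_def has_weak_div_def by blast
  note D = Div_weak_div[OF W]
  have "AE p in vol. Div M (of_compo U) p = h p" by (rule weak_div_unique[OF D wd])
  then have ae: "AE p in vol. r \<le> Div M (of_compo U) p - (vnorm M (of_compo U) p)\<^sup>2"
    using r by eventually_elim (simp add: vnorm_qf[OF of_compo_vector_field] compo_of_compo)
  have "Div M (of_compo U) \<in> borel_measurable borel" "vnorm M (of_compo U) \<in> borel_measurable borel"
    using D by (auto simp: has_weak_div_def L1_loc_def L1_loc_vfield_def)
  then have m: "(\<lambda>p. Div M (of_compo U) p - (vnorm M (of_compo U) p)\<^sup>2) \<in> borel_measurable borel" by measurable
  show "ereal r \<le> essinf vol (\<lambda>p. Div M (of_compo U) p - (vnorm M (of_compo U) p)\<^sup>2)" by (rule essinf_ge[OF m ae])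
qed

abbreviation barta_sup :: ereal where
  "barta_sup \<equiv> SUP X\<in>W11 M. essinf vol (\<lambda>p. Div M X p - (vnorm M X p)\<^sup>2)"

theorem barta_le_tone: "barta_sup \<le> fundamental_tone M"
proof (rule SUP_least)
  fix X assume X: "X \<in> W11 M"
  show "essinf vol (\<lambda>p. Div M X p - (vnorm M X p)\<^sup>2) \<le> fundamental_tone M"
  proof (rule ccontr)
    assume "\<not> ?thesis"
    then have "fundamental_tone M < essinf vol (\<lambda>p. Div M X p - (vnorm M X p)\<^sup>2)" by simp
    \<comment> \<open>The essential infimum is an extended real that might be infinite; the integral
      estimate is applied to a real number below it.\<close>
    then obtain r where r: "fundamental_tone M < ereal r" "ereal r < essinf vol (\<lambda>p. Div M X p - (vnorm M X p)\<^sup>2)"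
      using ereal_dense2 by blast
    have "ereal r \<le> fundamental_tone M" by (rule tone_ge) (rule lower_bound_essinf[OF X r(2)])
    then show False using r(1) by simp
  qed
qed

lemma lam_ge:
  assumes "\<And>\<phi>. \<phi> \<in> tests \<Longrightarrow> r * E.S.N2 \<phi> \<le> Q.N2 (Dt \<phi>)" shows "r \<le> E.lam"
  unfolding E.lam_def
proof (rule cInf_greatest)
  show "{Q.N2 (Dt \<phi>) / E.S.N2 \<phi> |\<phi>. \<phi> \<in> tests \<and> E.S.N2 \<phi> \<noteq> 0} \<noteq> {}" using test_nonzero by blast
  fix z assume "z \<in> {Q.N2 (Dt \<phi>) / E.S.N2 \<phi> |\<phi>. \<phi> \<in> tests \<and> E.S.N2 \<phi> \<noteq> 0}"
  then obtain \<phi> where \<phi>: "z = Q.N2 (Dt \<phi>) / E.S.N2 \<phi>" "\<phi> \<in> tests" "E.S.N2 \<phi> \<noteq> 0" by blast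
  then have "E.S.N2 \<phi> > 0" using E.S.N2_nonneg[of \<phi>] by linarith
  then show "r \<le> z" unfolding \<phi>(1) using assms[OF \<phi>(2)] by (simp add: pos_le_divide_eq)
qed

text \<open>The same estimate against the infimum over test functions, the quantity that the least
  eigenvalue is identified with.\<close>

lemma barta_le_lam: "barta_sup \<le> ereal E.lam"
proof (rule SUP_least)
  fix X assume X: "X \<in> W11 M"
  show "essinf vol (\<lambda>p. Div M X p - (vnorm M X p)\<^sup>2) \<le> ereal E.lam"
  proof (rule ccontr)
    assume "\<not> ?thesis"
    then have "ereal E.lam < essinf vol (\<lambda>p. Div M X p - (vnorm M X p)\<^sup>2)" by simp
    then obtain r where r: "ereal E.lam < ereal r" "ereal r < essinf vol (\<lambda>p. Div M X p - (vnorm M X p)\<^sup>2)"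
      using ereal_dense2 by blast
    have "r \<le> E.lam" by (rule lam_ge) (rule lower_bound_essinf[OF X r(2)])
    then show False using r(1) by simp
  qed
qed

lemma compact_finite_measure: "compact (UNIV :: 'p set) \<Longrightarrow> finite_measure vol"
  using vol_compact_finite[of UNIV] by (intro finite_measureI) (simp add: less_top)

lemma lam_le_barta:
  assumes "compact (UNIV :: 'p set)" shows "ereal E.lam \<le> barta_sup"
proof (rule ccontr)
  assume "\<not> ?thesis"
  then have "barta_sup < ereal E.lam" by simp
  then obtain r where r: "barta_sup < ereal r" "ereal r < ereal E.lam" using ereal_dense2 by blast
  note fin = compact_finite_measure[OF assms]
  have "\<exists>U h. has_weak_div M (of_compo U) h \<and> (AE p in vol. r \<le> h p - qf p (U p) (U p))"
  \<comment> \<open>For \<open>r \<le> 0\<close> the zero field serves. On a compact manifold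
    without boundary constants are test functions, so the infimum is zero and only this case
    arises.\<close>
  proof (cases "r > 0")
    case True
    obtain \<phi>0 where \<phi>0: "\<phi>0 \<in> tests" using test_nonzero by blast
    obtain U h where U: "U \<in> Q.L2" "integrable vol h" "\<And>\<phi>. \<phi> \<in> tests \<Longrightarrow> (\<integral>p. \<phi> p * h p \<partial>vol) = - Q.ip (Dt \<phi>) U"
      "AE p in vol. r \<le> h p - qf p (U p) (U p)"
      using E.divergence_field_exists[OF fin True _ \<phi>0] r(2) by auto
    have "h \<in> borel_measurable borel" using borel_measurable_integrable[OF U(2)] by simp
    from weak_divI[OF U(1) fin this U(2,3)] U(4) show ?thesis by blast
  next
    case False
    have "has_weak_div M (of_compo (\<lambda>_. 0)) (\<lambda>_. 0)"
      by (rule weak_divI[OF _ fin]) (auto simp: Q.L2_def Q.ip_def Q.q_simps)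
    moreover have "AE p in vol. r \<le> 0 - qf p 0 0" using False by (simp add: Q.q_simps)
    ultimately show ?thesis by (intro exI[of _ "\<lambda>_. 0"] exI[of _ "\<lambda>_. 0"]) auto
  qed
  then obtain U h where U: "has_weak_div M (of_compo U) h" "AE p in vol. r \<le> h p - qf p (U p) (U p)" by blast
  have "ereal r \<le> barta_sup"
    by (rule SUP_upper2[where f = "\<lambda>X. essinf vol (\<lambda>p. Div M X p - (vnorm M X p)\<^sup>2)",
        OF Div_essinf_ge(1)[OF U] Div_essinf_ge(2)[OF U]])
  then show False using r(1) by simp
qed

text \<open>The minimizer provided by compactness is an eigenfunction for \<open>lam\<close>.
  Conversely the energy of an eigenfunction for \<open>l\<close> is \<open>l\<close> times its
  squared norm, so \<open>l\<close> cannot be smaller.\<close>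

lemma lambda1_lam:
  assumes "compact (UNIV :: 'p set)" shows "lambda1 M = E.lam"
  unfolding lambda1_def
proof (rule Least_equality)
  note fin = compact_finite_measure[OF assms]
  interpret finite_measure vol by (rule fin)
  obtain \<phi>0 where \<phi>0: "\<phi>0 \<in> tests" "E.S.N2 \<phi>0 \<noteq> 0" using test_nonzero by blast
  obtain \<phi> f U where h: "E.hconv \<phi> f U" and f: "E.S.N2 f = 1" and w: "\<And>\<psi>. \<psi> \<in> tests \<Longrightarrow> Q.ip U (Dt \<psi>) = E.lam * E.S.ip f \<psi>"
    using E.eigenfunction_exists[OF rellich_compact[OF assms] \<phi>0] by blast
  note h' = E.hconvD[OF h]
  have fm: "f \<in> borel_measurable borel" using h'(2) by (simp add: E.S.L2_def)
  have "(\<lambda>_. 1) \<in> E.S.L2" by (auto simp: E.S.L2_def)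
  then have fi: "integrable vol f" using E.S.L2_integrable[OF h'(2)] by fastforce
  have "has_weak_div M (of_compo U) (\<lambda>p. - E.lam * f p)"
  proof (rule weak_divI[OF h'(3) fin])
    fix \<psi> assume \<psi>: "\<psi> \<in> tests"
    have "(\<integral>p. \<psi> p * (- E.lam * f p) \<partial>vol) = (\<integral>p. (- E.lam) * (f p * \<psi> p) \<partial>vol)"
      by (intro Bochner_Integration.integral_cong) auto
    also have "\<dots> = - E.lam * E.S.ip f \<psi>" unfolding E.S.ip_def by (rule Bochner_Integration.integral_mult_right_zero)
    also have "\<dots> = - Q.ip (Dt \<psi>) U" using w[OF \<psi>] Q.ip_sym[of U] by simp
    finally show "(\<integral>p. \<psi> p * (- E.lam * f p) \<partial>vol) = - Q.ip (Dt \<psi>) U" .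
  qed (use fm fi in auto)
  moreover have "\<not> (AE p in vol. f p = 0)"
  proof
    assume "AE p in vol. f p = 0"
    then have "E.S.N2 f = 0" unfolding E.S.ip_def by (intro integral_eq_zero_AE) (auto elim!: eventually_mono)
    then show False using f by simp
  qed
  ultimately show "laplace_eigenvalue M E.lam" unfolding laplace_eigenvalue_def using sobolev0I[OF h] by blast
next
  fix l assume "laplace_eigenvalue M l"
  then obtain f V where s: "sobolev0 M f V" and nz: "\<not> (AE p in vol. f p = 0)" and wd: "has_weak_div M V (\<lambda>p. - l * f p)"
    unfolding laplace_eigenvalue_def by blast
  obtain \<phi> where h: "E.hconv \<phi> f (compo V)" using sobolev0D(1)[OF s] by blast
  note vf = sobolev0D(2)[OF s] and h' = E.hconvD[OF h]
  \<comment> \<open>The eigenfunction itself is not a test function, so its equation is tested with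
    approximations, and the limit is taken on both sides.\<close>
  have eq: "l * E.S.ip (\<phi> k) f = Q.ip (Dt (\<phi> k)) (compo V)" for k
  proof -
    have "(\<integral>p. \<phi> k p * (- l * f p) \<partial>vol) = - (\<integral>p. vinner M (grad M (\<phi> k)) V p \<partial>vol)"
      using wd h'(1)[of k] unfolding has_weak_div_def by blast
    moreover have "(\<integral>p. vinner M (grad M (\<phi> k)) V p \<partial>vol) = Q.ip (Dt (\<phi> k)) (compo V)"
      unfolding Q.ip_def by (rule Bochner_Integration.integral_cong[OF refl vinner_qf[OF grad_vector_field[OF testsD(1)[OF h'(1)]] vf]])
    moreover have "(\<integral>p. \<phi> k p * (- l * f p) \<partial>vol) = (\<integral>p. (- l) * (\<phi> k p * f p) \<partial>vol)"
      by (intro Bochner_Integration.integral_cong) auto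
    moreover have "\<dots> = - l * E.S.ip (\<phi> k) f" unfolding E.S.ip_def by (rule Bochner_Integration.integral_mult_right_zero)
    ultimately show ?thesis by linarith
  qed
  have 1: "(\<lambda>k. l * E.S.ip (\<phi> k) f) \<longlonglongrightarrow> l * E.S.N2 f"
    by (intro tendsto_mult_left E.S.ip_tendsto_left h')
  have 2: "(\<lambda>k. Q.ip (Dt (\<phi> k)) (compo V)) \<longlonglongrightarrow> Q.N2 (compo V)"
    by (intro Q.ip_tendsto_left h')
  have "l * E.S.N2 f = Q.N2 (compo V)" using LIMSEQ_unique[OF 1] 2 unfolding eq by simp
  then have "E.lam * E.S.N2 f \<le> l * E.S.N2 f" using E.lam_le_hconv[OF h] by simp
  moreover have "E.S.N2 f \<noteq> 0"
  proof
    assume "E.S.N2 f = 0"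
    then have "AE p in vol. f p * f p = 0"
      using integral_nonneg_eq_0_iff_AE[OF E.S.L2_integrable[OF h'(2) h'(2)]] by (simp add: E.S.ip_def)
    then have "AE p in vol. f p = 0" by eventually_elim simp
    then show False using nz by simp
  qed
  ultimately show "E.lam \<le> l" using E.S.N2_nonneg[of f] by (simp add: mult_le_cancel_right)
qed

theorem barta_eq_lambda1:
  assumes "compact (UNIV :: 'p set)" shows "ereal (lambda1 M) = barta_sup"
  unfolding lambda1_lam[OF assms] by (rule antisym[OF lam_le_barta[OF assms] barta_le_lam])

end

theorem theorem1p7:
  fixes M :: "('p::{t2_space,second_countable_topology}, 'n::{finite,wellorder}) riem"
  assumes "riemannian_manifold M"
  shows "fundamental_tone M \<ge>
           (SUP X\<in>W11 M. essinf (riem_volume M) (\<lambda>p. Div M X p - (vnorm M X p)\<^sup>2))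
       \<and> (compact (UNIV :: 'p set) \<longrightarrow>
           ereal (lambda1 M) =
             (SUP X\<in>W11 M. essinf (riem_volume M) (\<lambda>p. Div M X p - (vnorm M X p)\<^sup>2)))"
proof -
  interpret riem_mfd M by standard (rule assms)
  show ?thesis using barta_le_tone barta_eq_lambda1 by blast
qed

end
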